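(* Let $G$ be a locally compact, Hausdorff, étale, ample groupoid with $\sigma$-compact base space $G^0$. Then there is a canonical isomorphism $H_*(G)\cong \mathrm{Tor}_*^{\mathbb{Z}[G]}(\mathbb{Z}[G^0],\mathbb{Z}[G^0])$.
   Context: Groupoid notation: $G^0$ is the base (unit) space, $r,s:G\to G^0$ are range and source, $G^x=r^{-1}(x)$, $G_x=s^{-1}(x)$. A (locally compact Hausdorff) groupoid is étale if its open bisections form a basis of its topology (a bisection is a subset on which $r$ and $s$ are homeomorphisms onto their images), and ample if the compact open bisections form a basis. For a locally compact Hausdorff totally disconnected space $Y$ let $\mathbb{Z}[Y]=C_c(Y,\mathbb{Z})$; a local homeomorphism $f:Y\to Z$ induces $f_*:\mathbb{Z}[Y]\to\mathbb{Z}[Z]$, $f_*(a)(z)=\sum_{y\in f^{-1}(z)}a(y)$. $\mathbb{Z}[G]=C_c(G,\mathbb{Z})$ is a (generally non-unital) ring under pointwise addition and convolution; it has local units, i.e. any finitely many elements $f_1,\dots,f_n$ admit an idempotent $e$ with $ef_j=f_je=f_j$ for all $j$. Modules over $\mathbb{Z}[G]$ are assumed non-degenerate, i.e. $\mathbb{Z}[G]M=M$ for left modules (similarly for right ones). $\mathbb{Z}[G^0]$ is a left $\mathbb{Z}[G]$-module via $(f\cdot a)(x)=\sum_{g\in G^x}f(g)a(s(g))$ and a right $\mathbb{Z}[G]$-module via $(a\cdot f)(x)=\sum_{g\in G_x}a(r(g))f(g)$, for $f\in\mathbb{Z}[G]$, $a\in\mathbb{Z}[G^0]$, $x\in G^0$.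 $\mathrm{Tor}_n^{\mathbb{Z}[G]}(\mathbb{Z}[G^0],\mathbb{Z}[G^0])$ is the $n$-th homology of $\mathbb{Z}[G^0]\otimes_{\mathbb{Z}[G]}P_*$, where $\cdots\to P_1\to P_0\to\mathbb{Z}[G^0]\to0$ is a resolution of the left module $\mathbb{Z}[G^0]$ by projective (non-degenerate) left $\mathbb{Z}[G]$-modules. Groupoid homology: let $G^{(0)}=G^0$ and, for $n\ge 1$, $G^{(n)}=\{(g_1,\dots,g_n)\in G^n\mid s(g_i)=r(g_{i+1})\text{ for }1\le i<n\}$. The face maps $\epsilon^n_i:G^{(n)}\to G^{(n-1)}$, $0\le i\le n$, are, for $n\ge2$: $\epsilon^n_0(g_1,\dots,g_n)=(g_2,\dots,g_n)$, $\epsilon^n_i(g_1,\dots,g_n)=(g_1,\dots,g_ig_{i+1},\dots,g_n)$ for $0<i<n$, $\epsilon^n_n(g_1,\dots,g_n)=(g_1,\dots,g_{n-1})$; and $\epsilon^1_0=s$, $\epsilon^1_1=r$. $H_*(G)$ is the homology of $(\mathbb{Z}[G^{( * )}],\partial_* )$ with $\partial_n=\sum_{i=0}^n(-1)^i(\epsilon^n_i)_*$.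
   Formalization: Étale is taken to include that the range and source maps are open, hence local homeomorphisms; a basis of open bisections alone does not ensure this, and without it the induced maps on compactly supported functions, and so H_*(G), are undefined. *)

theory Defs
  imports "HOL-Analysis.Analysis" "HOL-Algebra.Free_Abelian_Groups" "HOL-Algebra.Module"
begin

section \<open>Ample groupoids\<close>

text \<open>
  The arrows are the points of \<open>gtop\<close>. Units are identified with their identity arrows, so the
  base space is a subspace of the space of arrows; \<open>gmul g h\<close> is meaningful when
  \<open>gsrc g = grng h\<close>.
\<close>

record 'a tgroupoid =
  gtop :: "'a topology"
  gsrc :: "'a \<Rightarrow> 'a"
  grng :: "'a \<Rightarrow> 'a"
  gmul :: "'a \<Rightarrow> 'a \<Rightarrow> 'a"
  ginv :: "'a \<Rightarrow> 'a"

definition arrows :: "'a tgroupoid \<Rightarrow> 'a set" where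
  "arrows G = topspace (gtop G)"

definition units :: "'a tgroupoid \<Rightarrow> 'a set" where
  "units G = gsrc G ` arrows G"

definition unit_top :: "'a tgroupoid \<Rightarrow> 'a topology" where
  "unit_top G = subtopology (gtop G) (units G)"

locale topological_groupoid =
  fixes G :: "'a tgroupoid"
  assumes src_closed: "g \<in> arrows G \<Longrightarrow> gsrc G g \<in> arrows G"
    and rng_closed: "g \<in> arrows G \<Longrightarrow> grng G g \<in> arrows G"
    and src_src: "g \<in> arrows G \<Longrightarrow> gsrc G (gsrc G g) = gsrc G g"
    and rng_src: "g \<in> arrows G \<Longrightarrow> grng G (gsrc G g) = gsrc G g"
    and src_rng: "g \<in> arrows G \<Longrightarrow> gsrc G (grng G g) = grng G g"
    and rng_rng: "g \<in> arrows G \<Longrightarrow> grng G (grng G g) = grng G g"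
    and mul_closed: "\<lbrakk>g \<in> arrows G; h \<in> arrows G; gsrc G g = grng G h\<rbrakk> \<Longrightarrow> gmul G g h \<in> arrows G"
    and src_mul: "\<lbrakk>g \<in> arrows G; h \<in> arrows G; gsrc G g = grng G h\<rbrakk> \<Longrightarrow> gsrc G (gmul G g h) = gsrc G h"
    and rng_mul: "\<lbrakk>g \<in> arrows G; h \<in> arrows G; gsrc G g = grng G h\<rbrakk> \<Longrightarrow> grng G (gmul G g h) = grng G g"
    and mul_assoc: "\<lbrakk>g \<in> arrows G; h \<in> arrows G; k \<in> arrows G; gsrc G g = grng G h; gsrc G h = grng G k\<rbrakk>
        \<Longrightarrow> gmul G (gmul G g h) k = gmul G g (gmul G h k)"
    and mul_src: "g \<in> arrows G \<Longrightarrow> gmul G g (gsrc G g) = g"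
    and mul_rng: "g \<in> arrows G \<Longrightarrow> gmul G (grng G g) g = g"
    and inv_closed: "g \<in> arrows G \<Longrightarrow> ginv G g \<in> arrows G"
    and src_inv: "g \<in> arrows G \<Longrightarrow> gsrc G (ginv G g) = grng G g"
    and rng_inv: "g \<in> arrows G \<Longrightarrow> grng G (ginv G g) = gsrc G g"
    and mul_inv: "g \<in> arrows G \<Longrightarrow> gmul G g (ginv G g) = grng G g"
    and inv_mul: "g \<in> arrows G \<Longrightarrow> gmul G (ginv G g) g = gsrc G g"
    and continuous_src: "continuous_map (gtop G) (unit_top G) (gsrc G)"
    and continuous_rng: "continuous_map (gtop G) (unit_top G) (grng G)"
    and continuous_mul: "continuous_map
        (subtopology (prod_topology (gtop G) (gtop G)) {(g, h). gsrc G g = grng G h})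
        (gtop G) (\<lambda>(g, h). gmul G g h)"
    and continuous_inv: "continuous_map (gtop G) (gtop G) (ginv G)"

definition bisection :: "'a tgroupoid \<Rightarrow> 'a set \<Rightarrow> bool" where
  "bisection G U \<longleftrightarrow> U \<subseteq> arrows G \<and>
     homeomorphic_map (subtopology (gtop G) U) (subtopology (unit_top G) (grng G ` U)) (grng G) \<and>
     homeomorphic_map (subtopology (gtop G) U) (subtopology (unit_top G) (gsrc G ` U)) (gsrc G)"

text \<open>
  Openness of range and source is part of being etale: a basis of open bisections alone does not
  make these maps local homeomorphisms. (Adjoin to a space \<open>X\<close> of units one isolated arrow of
  order two at a non-isolated point of \<open>X\<close>.)
\<close>

locale etale_groupoid = topological_groupoid +
  assumes locally_compact: "locally_compact_space (gtop G)"
    and Hausdorff: "Hausdorff_space (gtop G)"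
    and open_rng: "open_map (gtop G) (unit_top G) (grng G)"
    and open_src: "open_map (gtop G) (unit_top G) (gsrc G)"
    and bisection_basis: "\<lbrakk>openin (gtop G) W; g \<in> W\<rbrakk>
        \<Longrightarrow> \<exists>U. openin (gtop G) U \<and> bisection G U \<and> g \<in> U \<and> U \<subseteq> W"

locale ample_groupoid = etale_groupoid +
  assumes compact_bisection_basis: "\<lbrakk>openin (gtop G) W; g \<in> W\<rbrakk>
        \<Longrightarrow> \<exists>U. openin (gtop G) U \<and> compactin (gtop G) U \<and> bisection G U \<and> g \<in> U \<and> U \<subseteq> W"

definition sigma_compact_space :: "'a topology \<Rightarrow> bool" where
  "sigma_compact_space X \<longleftrightarrow> (\<exists>K :: nat \<Rightarrow> 'a set. (\<forall>n. compactin X (K n)) \<and> (\<Union>n. K n) = topspace X)"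


section \<open>Compactly supported integer-valued functions\<close>

text \<open>
  Functions are extended by zero outside the space, so that equality is equality on the space.
  The set where a locally constant function is nonzero is closed, hence equal to its support.
\<close>

definition cc_funs :: "'y topology \<Rightarrow> ('y \<Rightarrow> int) set" where
  "cc_funs Y = {a. continuous_map Y (discrete_topology UNIV) a \<and>
     (\<forall>y. y \<notin> topspace Y \<longrightarrow> a y = 0) \<and> compactin Y {y \<in> topspace Y. a y \<noteq> 0}}"

definition cc_group :: "'y topology \<Rightarrow> ('y \<Rightarrow> int) monoid" where
  "cc_group Y = \<lparr>carrier = cc_funs Y, monoid.mult = (\<lambda>a b y. a y + b y), one = (\<lambda>y. 0)\<rparr>"

text \<open>
  For a local homeomorphism the fibres are discrete, so only finitely many points of a fibre lie in
  the support. Restricting to the support keeps the index set finite (sums over infinite sets are 0).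
\<close>

definition pushforward :: "'y topology \<Rightarrow> ('y \<Rightarrow> 'z) \<Rightarrow> ('y \<Rightarrow> int) \<Rightarrow> 'z \<Rightarrow> int" where
  "pushforward Y f a z = (\<Sum>y | y \<in> topspace Y \<and> f y = z \<and> a y \<noteq> 0. a y)"

text \<open>
  In general the ring has no unit. The record field \<open>one\<close> is filled with the indicator of the base
  space, which is in the carrier (and is the unit) precisely when the base space is compact; no
  definition below uses it.
\<close>

definition conv_ring :: "'a tgroupoid \<Rightarrow> ('a \<Rightarrow> int) ring" where
  "conv_ring G = \<lparr>carrier = cc_funs (gtop G),
     monoid.mult = (\<lambda>f f' g.
       if g \<in> arrows G
       then \<Sum>h | h \<in> arrows G \<and> grng G h = grng G g \<and> f h \<noteq> 0. f h * f' (gmul G (ginv G h) g)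
       else 0),
     one = (\<lambda>g. if g \<in> units G then 1 else 0),
     ring.zero = (\<lambda>g. 0), add = (\<lambda>f f' g. f g + f' g)\<rparr>"


section \<open>Modules, projective resolutions and Tor\<close>

text \<open>
  The library locale for modules asks for a commutative unital ring, so only its record type is
  used; as there, the fields \<open>mult\<close> and \<open>one\<close> of a module record are ignored.
  Non-degeneracy: every element is a finite sum of products.
\<close>

locale left_module = abelian_group M
  for R :: "('r, 'x) ring_scheme" and M :: "('r, 'm, 'z) module_scheme" +
  assumes smult_closed: "\<lbrakk>r \<in> carrier R; m \<in> carrier M\<rbrakk> \<Longrightarrow> r \<odot>\<^bsub>M\<^esub> m \<in> carrier M"
    and smult_l_distr: "\<lbrakk>r \<in> carrier R; r' \<in> carrier R; m \<in> carrier M\<rbrakk>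
        \<Longrightarrow> (r \<oplus>\<^bsub>R\<^esub> r') \<odot>\<^bsub>M\<^esub> m = r \<odot>\<^bsub>M\<^esub> m \<oplus>\<^bsub>M\<^esub> r' \<odot>\<^bsub>M\<^esub> m"
    and smult_r_distr: "\<lbrakk>r \<in> carrier R; m \<in> carrier M; m' \<in> carrier M\<rbrakk>
        \<Longrightarrow> r \<odot>\<^bsub>M\<^esub> (m \<oplus>\<^bsub>M\<^esub> m') = r \<odot>\<^bsub>M\<^esub> m \<oplus>\<^bsub>M\<^esub> r \<odot>\<^bsub>M\<^esub> m'"
    and smult_assoc: "\<lbrakk>r \<in> carrier R; r' \<in> carrier R; m \<in> carrier M\<rbrakk>
        \<Longrightarrow> (r \<otimes>\<^bsub>R\<^esub> r') \<odot>\<^bsub>M\<^esub> m = r \<odot>\<^bsub>M\<^esub> (r' \<odot>\<^bsub>M\<^esub> m)"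
    and nondegenerate:
      "carrier M \<subseteq> generate (add_monoid M) {r \<odot>\<^bsub>M\<^esub> m | r m. r \<in> carrier R \<and> m \<in> carrier M}"

definition lmod_hom :: "('r, 'x) ring_scheme \<Rightarrow> ('r, 'm) module \<Rightarrow> ('r, 'n) module \<Rightarrow> ('m \<Rightarrow> 'n) set" where
  "lmod_hom R M N = {f. f \<in> carrier M \<rightarrow> carrier N \<and>
     (\<forall>x\<in>carrier M. \<forall>y\<in>carrier M. f (x \<oplus>\<^bsub>M\<^esub> y) = f x \<oplus>\<^bsub>N\<^esub> f y) \<and>
     (\<forall>r\<in>carrier R. \<forall>x\<in>carrier M. f (r \<odot>\<^bsub>M\<^esub> x) = r \<odot>\<^bsub>N\<^esub> f x)}"

text \<open>
  The lifting property has to be tested on fixed types. The types chosen lose nothing when \<open>R\<close> has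
  local units: if \<open>e p\<close> is an idempotent fixing \<open>p\<close>, the direct sum of the left ideals \<open>R (e p)\<close>
  over \<open>p \<in> carrier P\<close> lives in \<open>'p \<Rightarrow> 'r\<close>, is projective, and maps onto \<open>P\<close>. Lifting the identity
  of \<open>P\<close> makes \<open>P\<close> a direct summand of it, hence projective against modules of all types.
\<close>

definition projective_module :: "('r, 'x) ring_scheme \<Rightarrow> ('r, 'p) module \<Rightarrow> bool" where
  "projective_module R P \<longleftrightarrow> left_module R P \<and>
     (\<forall>(M :: ('r, 'p \<Rightarrow> 'r) module) (N :: ('r, 'p) module) q f.
        left_module R M \<and> left_module R N \<and>
        q \<in> lmod_hom R M N \<and> q ` carrier M = carrier N \<and> f \<in> lmod_hom R P N
        \<longrightarrow> (\<exists>l \<in> lmod_hom R P M. \<forall>p\<in>carrier P. q (l p) = f p))"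

text \<open>
  \<open>d n\<close> maps degree \<open>n\<close> to degree \<open>n - 1\<close>; its value at \<open>n = 0\<close> is never used.
\<close>

definition projective_resolution ::
  "('r, 'x) ring_scheme \<Rightarrow> ('r, 'm) module \<Rightarrow> (nat \<Rightarrow> ('r, 'p) module) \<Rightarrow>
   (nat \<Rightarrow> 'p \<Rightarrow> 'p) \<Rightarrow> ('p \<Rightarrow> 'm) \<Rightarrow> bool" where
  "projective_resolution R M P d \<epsilon> \<longleftrightarrow>
     (\<forall>n. projective_module R (P n)) \<and>
     \<epsilon> \<in> lmod_hom R (P 0) M \<and> \<epsilon> ` carrier (P 0) = carrier M \<and>
     (\<forall>n. d (Suc n) \<in> lmod_hom R (P (Suc n)) (P n)) \<and>
     d 1 ` carrier (P 1) = {p \<in> carrier (P 0). \<epsilon> p = \<zero>\<^bsub>M\<^esub>} \<and>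
     (\<forall>n. d (Suc (Suc n)) ` carrier (P (Suc (Suc n))) =
          {p \<in> carrier (P (Suc n)). d (Suc n) p = \<zero>\<^bsub>P n\<^esub>})"

text \<open>
  Balanced tensor product of a right module \<open>M\<close> and a left module \<open>P\<close>, as a quotient of the free
  abelian group on pairs. A right module is stored in the same kind of record, with
  \<open>r \<odot>\<^bsub>M\<^esub> m\<close> standing for \<open>m\<close> acted upon by \<open>r\<close> from the right.
\<close>

definition tensor_rels ::
  "('r, 'x) ring_scheme \<Rightarrow> ('r, 'm) module \<Rightarrow> ('r, 'p) module \<Rightarrow> ('m \<times> 'p \<Rightarrow>\<^sub>0 int) set" where
  "tensor_rels R M P =
     {frag_of (m \<oplus>\<^bsub>M\<^esub> m', p) - frag_of (m, p) - frag_of (m', p) | m m' p.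
        m \<in> carrier M \<and> m' \<in> carrier M \<and> p \<in> carrier P} \<union>
     {frag_of (m, p \<oplus>\<^bsub>P\<^esub> p') - frag_of (m, p) - frag_of (m, p') | m p p'.
        m \<in> carrier M \<and> p \<in> carrier P \<and> p' \<in> carrier P} \<union>
     {frag_of (r \<odot>\<^bsub>M\<^esub> m, p) - frag_of (m, r \<odot>\<^bsub>P\<^esub> p) | r m p.
        r \<in> carrier R \<and> m \<in> carrier M \<and> p \<in> carrier P}"

definition tensor_null ::
  "('r, 'x) ring_scheme \<Rightarrow> ('r, 'm) module \<Rightarrow> ('r, 'p) module \<Rightarrow> ('m \<times> 'p \<Rightarrow>\<^sub>0 int) set" where
  "tensor_null R M P = generate (free_Abelian_group (carrier M \<times> carrier P)) (tensor_rels R M P)"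

definition tensor ::
  "('r, 'x) ring_scheme \<Rightarrow> ('r, 'm) module \<Rightarrow> ('r, 'p) module \<Rightarrow> ('m \<times> 'p \<Rightarrow>\<^sub>0 int) set monoid" where
  "tensor R M P = free_Abelian_group (carrier M \<times> carrier P) Mod tensor_null R M P"

definition tensor_elt ::
  "('r, 'x) ring_scheme \<Rightarrow> ('r, 'm) module \<Rightarrow> ('r, 'p) module \<Rightarrow> 'm \<Rightarrow> 'p \<Rightarrow> ('m \<times> 'p \<Rightarrow>\<^sub>0 int) set" where
  "tensor_elt R M P m p =
     tensor_null R M P #>\<^bsub>free_Abelian_group (carrier M \<times> carrier P)\<^esub> frag_of (m, p)"

text \<open>
  The homomorphism from the tensor product to the abelian group \<open>A\<close> (written multiplicatively)
  induced by a balanced biadditive map \<open>\<beta>\<close>: all representatives of a coset have the same value.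
\<close>

definition tensor_lift ::
  "('b, 'w) monoid_scheme \<Rightarrow> ('m \<Rightarrow> 'p \<Rightarrow> 'b) \<Rightarrow> ('m \<times> 'p \<Rightarrow>\<^sub>0 int) set \<Rightarrow> 'b" where
  "tensor_lift A \<beta> X = the_elem ((\<lambda>c. finprod A
       (\<lambda>k. \<beta> (fst k) (snd k) [^]\<^bsub>A\<^esub> Poly_Mapping.lookup c k) (Poly_Mapping.keys c)) ` X)"

definition tensor_map ::
  "('r, 'x) ring_scheme \<Rightarrow> ('r, 'm) module \<Rightarrow> ('r, 'q) module \<Rightarrow> ('p \<Rightarrow> 'q) \<Rightarrow>
   ('m \<times> 'p \<Rightarrow>\<^sub>0 int) set \<Rightarrow> ('m \<times> 'q \<Rightarrow>\<^sub>0 int) set" where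
  "tensor_map R M Q f = tensor_lift (tensor R M Q) (\<lambda>m p. tensor_elt R M Q m (f p))"

definition cycles :: "(nat \<Rightarrow> 'c monoid) \<Rightarrow> (nat \<Rightarrow> 'c \<Rightarrow> 'c) \<Rightarrow> nat \<Rightarrow> 'c set" where
  "cycles C d n = (if n = 0 then carrier (C 0) else kernel (C n) (C (n - 1)) (d n))"

definition boundaries :: "(nat \<Rightarrow> 'c monoid) \<Rightarrow> (nat \<Rightarrow> 'c \<Rightarrow> 'c) \<Rightarrow> nat \<Rightarrow> 'c set" where
  "boundaries C d n = d (Suc n) ` carrier (C (Suc n))"

definition chain_homology :: "(nat \<Rightarrow> 'c monoid) \<Rightarrow> (nat \<Rightarrow> 'c \<Rightarrow> 'c) \<Rightarrow> nat \<Rightarrow> 'c set monoid" where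
  "chain_homology C d n = (C n)\<lparr>carrier := cycles C d n\<rparr> Mod boundaries C d n"

definition homology_class :: "(nat \<Rightarrow> 'c monoid) \<Rightarrow> (nat \<Rightarrow> 'c \<Rightarrow> 'c) \<Rightarrow> nat \<Rightarrow> 'c \<Rightarrow> 'c set" where
  "homology_class C d n z = boundaries C d n #>\<^bsub>C n\<^esub> z"

definition tensor_complex ::
  "('r, 'x) ring_scheme \<Rightarrow> ('r, 'm) module \<Rightarrow> (nat \<Rightarrow> ('r, 'p) module) \<Rightarrow>
   nat \<Rightarrow> ('m \<times> 'p \<Rightarrow>\<^sub>0 int) set monoid" where
  "tensor_complex R M P n = tensor R M (P n)"

definition tensor_boundary ::
  "('r, 'x) ring_scheme \<Rightarrow> ('r, 'm) module \<Rightarrow> (nat \<Rightarrow> ('r, 'p) module) \<Rightarrow> (nat \<Rightarrow> 'p \<Rightarrow> 'p) \<Rightarrow>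
   nat \<Rightarrow> ('m \<times> 'p \<Rightarrow>\<^sub>0 int) set \<Rightarrow> ('m \<times> 'p \<Rightarrow>\<^sub>0 int) set" where
  "tensor_boundary R M P d n = tensor_map R M (P (n - 1)) (d n)"

text \<open>
  Tor of the right module \<open>M\<close> and the left module resolved by \<open>(P, d)\<close>.
\<close>

definition Tor ::
  "('r, 'x) ring_scheme \<Rightarrow> ('r, 'm) module \<Rightarrow> (nat \<Rightarrow> ('r, 'p) module) \<Rightarrow> (nat \<Rightarrow> 'p \<Rightarrow> 'p) \<Rightarrow>
   nat \<Rightarrow> ('m \<times> 'p \<Rightarrow>\<^sub>0 int) set set monoid" where
  "Tor R M P d = chain_homology (tensor_complex R M P) (tensor_boundary R M P d)"


section \<open>The two module structures on the functions on the base space\<close>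

definition unit_left_module :: "'a tgroupoid \<Rightarrow> ('a \<Rightarrow> int, 'a \<Rightarrow> int) module" where
  "unit_left_module G = \<lparr>carrier = cc_funs (unit_top G),
     monoid.mult = undefined, one = undefined,
     ring.zero = (\<lambda>x. 0), add = (\<lambda>a b x. a x + b x),
     smult = (\<lambda>f a x. \<Sum>g | g \<in> arrows G \<and> grng G g = x \<and> f g \<noteq> 0. f g * a (gsrc G g))\<rparr>"

definition unit_right_module :: "'a tgroupoid \<Rightarrow> ('a \<Rightarrow> int, 'a \<Rightarrow> int) module" where
  "unit_right_module G = \<lparr>carrier = cc_funs (unit_top G),
     monoid.mult = undefined, one = undefined,
     ring.zero = (\<lambda>x. 0), add = (\<lambda>a b x. a x + b x),
     smult = (\<lambda>f a x. \<Sum>g | g \<in> arrows G \<and> gsrc G g = x \<and> f g \<noteq> 0. a (grng G g) * f g)\<rparr>"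


section \<open>Groupoid homology\<close>

text \<open>
  A composable \<open>n\<close>-tuple is an extensional function on \<open>{..<n}\<close>, indexed from 0. To have one type
  in all degrees, degree 0 consists of the 1-tuples of units, a homeomorphic copy of the base space.
\<close>

definition nerve_set :: "'a tgroupoid \<Rightarrow> nat \<Rightarrow> (nat \<Rightarrow> 'a) set" where
  "nerve_set G n =
     (if n = 0 then {g \<in> {..<1} \<rightarrow>\<^sub>E arrows G. g 0 \<in> units G}
      else {g \<in> {..<n} \<rightarrow>\<^sub>E arrows G. \<forall>i. Suc i < n \<longrightarrow> gsrc G (g i) = grng G (g (Suc i))})"

definition nerve :: "'a tgroupoid \<Rightarrow> nat \<Rightarrow> (nat \<Rightarrow> 'a) topology" where
  "nerve G n = subtopology (product_topology (\<lambda>_. gtop G) {..<max 1 n}) (nerve_set G n)"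

text \<open>
  The \<open>i\<close>-th face from degree \<open>n\<close> to degree \<open>n - 1\<close>, for \<open>n \<ge> 1\<close> and \<open>i \<le> n\<close>. For \<open>0 < i < n\<close> the
  entries \<open>g (i - 1)\<close> and \<open>g i\<close> are multiplied.
\<close>

definition face :: "'a tgroupoid \<Rightarrow> nat \<Rightarrow> nat \<Rightarrow> (nat \<Rightarrow> 'a) \<Rightarrow> nat \<Rightarrow> 'a" where
  "face G n i g =
     (if n = 1 then (\<lambda>j\<in>{..<1}. if i = 0 then gsrc G (g 0) else grng G (g 0))
      else if i = 0 then (\<lambda>j\<in>{..<n - 1}. g (Suc j))
      else if i = n then (\<lambda>j\<in>{..<n - 1}. g j)
      else (\<lambda>j\<in>{..<n - 1}. if Suc j < i then g j
                           else if Suc j = i then gmul G (g j) (g (Suc j))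
                           else g (Suc j)))"

definition nerve_chains :: "'a tgroupoid \<Rightarrow> nat \<Rightarrow> ((nat \<Rightarrow> 'a) \<Rightarrow> int) monoid" where
  "nerve_chains G n = cc_group (nerve G n)"

definition nerve_boundary ::
  "'a tgroupoid \<Rightarrow> nat \<Rightarrow> ((nat \<Rightarrow> 'a) \<Rightarrow> int) \<Rightarrow> (nat \<Rightarrow> 'a) \<Rightarrow> int" where
  "nerve_boundary G n a y = (\<Sum>i\<le>n. (-1) ^ i * pushforward (nerve G n) (face G n i) a y)"

definition groupoid_homology :: "'a tgroupoid \<Rightarrow> nat \<Rightarrow> ((nat \<Rightarrow> 'a) \<Rightarrow> int) set monoid" where
  "groupoid_homology G = chain_homology (nerve_chains G) (nerve_boundary G)"


section \<open>The canonical comparison\<close>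

text \<open>
  The bar resolution of the left module of functions on the base space has in degree \<open>n\<close> the functions
  on composable \<open>(n + 1)\<close>-tuples; the groupoid acts on the first entry. Its faces are those of the nerve
  in degree \<open>n + 1\<close> except the 0-th one, and it is augmented by the range map.
\<close>

definition bar_module :: "'a tgroupoid \<Rightarrow> nat \<Rightarrow> ('a \<Rightarrow> int, (nat \<Rightarrow> 'a) \<Rightarrow> int) module" where
  "bar_module G n = \<lparr>carrier = cc_funs (nerve G (Suc n)),
     monoid.mult = undefined, one = undefined,
     ring.zero = (\<lambda>y. 0), add = (\<lambda>a b y. a y + b y),
     smult = (\<lambda>f b y.
       if y \<in> nerve_set G (Suc n)
       then \<Sum>h | h \<in> arrows G \<and> grng G h = grng G (y 0) \<and> f h \<noteq> 0.
              f h * b (y(0 := gmul G (ginv G h) (y 0)))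
       else 0)\<rparr>"

definition bar_boundary ::
  "'a tgroupoid \<Rightarrow> nat \<Rightarrow> ((nat \<Rightarrow> 'a) \<Rightarrow> int) \<Rightarrow> (nat \<Rightarrow> 'a) \<Rightarrow> int" where
  "bar_boundary G n b y =
     (\<Sum>i\<le>n. (-1) ^ i * pushforward (nerve G (Suc n)) (face G (Suc n) (Suc i)) b y)"

definition bar_augmentation :: "'a tgroupoid \<Rightarrow> ((nat \<Rightarrow> 'a) \<Rightarrow> int) \<Rightarrow> 'a \<Rightarrow> int" where
  "bar_augmentation G = pushforward (nerve G 1) (\<lambda>g. grng G (g 0))"

definition bar_comparison ::
  "'a tgroupoid \<Rightarrow> (nat \<Rightarrow> ('a \<Rightarrow> int, 'p) module) \<Rightarrow> (nat \<Rightarrow> 'p \<Rightarrow> 'p) \<Rightarrow> ('p \<Rightarrow> 'a \<Rightarrow> int) \<Rightarrow>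
   (nat \<Rightarrow> 'p \<Rightarrow> (nat \<Rightarrow> 'a) \<Rightarrow> int) \<Rightarrow> bool" where
  "bar_comparison G P d \<epsilon> \<tau> \<longleftrightarrow>
     (\<forall>n. \<tau> n \<in> lmod_hom (conv_ring G) (P n) (bar_module G n)) \<and>
     (\<forall>p\<in>carrier (P 0). bar_augmentation G (\<tau> 0 p) = \<epsilon> p) \<and>
     (\<forall>n. \<forall>p\<in>carrier (P (Suc n)). bar_boundary G (Suc n) (\<tau> (Suc n) p) = \<tau> n (d (Suc n) p))"

text \<open>
  Tensoring the bar resolution with the functions on the base space gives the complex of the nerve:
  \<open>a \<otimes> b\<close> corresponds to the push-forward of \<open>(a \<circ> r) b\<close> along the map dropping the first entry
  (the 0-th face).
\<close>

definition bar_coinvariants ::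
  "'a tgroupoid \<Rightarrow> nat \<Rightarrow> ('a \<Rightarrow> int) \<Rightarrow> ((nat \<Rightarrow> 'a) \<Rightarrow> int) \<Rightarrow> (nat \<Rightarrow> 'a) \<Rightarrow> int" where
  "bar_coinvariants G n a b =
     pushforward (nerve G (Suc n)) (face G (Suc n) 0) (\<lambda>y. a (grng G (y 0)) * b y)"

definition tensor_to_nerve ::
  "'a tgroupoid \<Rightarrow> (nat \<Rightarrow> 'p \<Rightarrow> (nat \<Rightarrow> 'a) \<Rightarrow> int) \<Rightarrow> nat \<Rightarrow>
   (('a \<Rightarrow> int) \<times> 'p \<Rightarrow>\<^sub>0 int) set \<Rightarrow> (nat \<Rightarrow> 'a) \<Rightarrow> int" where
  "tensor_to_nerve G \<tau> n = tensor_lift (nerve_chains G n) (\<lambda>a p. bar_coinvariants G n a (\<tau> n p))"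

text \<open>
  The maps \<open>\<Phi> n\<close> from groupoid homology to Tor computed by \<open>(P, d, \<epsilon>)\<close> are canonical if they are
  inverse to the maps on homology given by the comparison of the resolution with the bar resolution.
  A comparison is required to exist, so this determines \<open>\<Phi>\<close>; it must not matter which one is used.
\<close>

definition canonical_to_Tor ::
  "'a tgroupoid \<Rightarrow> (nat \<Rightarrow> ('a \<Rightarrow> int, 'p) module) \<Rightarrow> (nat \<Rightarrow> 'p \<Rightarrow> 'p) \<Rightarrow> ('p \<Rightarrow> 'a \<Rightarrow> int) \<Rightarrow>
   (nat \<Rightarrow> ((nat \<Rightarrow> 'a) \<Rightarrow> int) set \<Rightarrow> (('a \<Rightarrow> int) \<times> 'p \<Rightarrow>\<^sub>0 int) set set) \<Rightarrow> bool" where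
  "canonical_to_Tor G P d \<epsilon> \<Phi> \<longleftrightarrow>
     (\<exists>\<tau>. bar_comparison G P d \<epsilon> \<tau>) \<and>
     (\<forall>\<tau>. bar_comparison G P d \<epsilon> \<tau> \<longrightarrow>
       (\<forall>n. \<forall>X \<in> cycles (tensor_complex (conv_ring G) (unit_right_module G) P)
                       (tensor_boundary (conv_ring G) (unit_right_module G) P d) n.
          \<Phi> n (homology_class (nerve_chains G) (nerve_boundary G) n (tensor_to_nerve G \<tau> n X)) =
          homology_class (tensor_complex (conv_ring G) (unit_right_module G) P)
                         (tensor_boundary (conv_ring G) (unit_right_module G) P d) n X))"

end

theory Submission
  imports Defs
begin

text \<open>
  The bar modules \<open>B n = C_c(G^(n+1), Z)\<close> resolve the functions on the base space, and their
  coinvariants under the augmentation ideal form the nerve complex. They need not be projective,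
  but each of their elements lies in the image of a finite partial identity that factors through a
  free module: cutting the nerve into compact open bisections provides local dual bases.
  Projective modules have them too, and for an exact
  bounded below complex of modules with local dual bases the cycles again have local dual bases, so
  that the complex remains exact after dividing by the span of any right ideal. Applied to the
  mapping cone of a comparison map \<open>P \<rightarrow> B\<close> this shows that the map induced on coinvariants is an
  isomorphism in homology. Finally the tensor product of the functions on the base space with \<open>P\<close>
  is the quotient of \<open>P\<close> by the span of the augmentation ideal.
\<close>

text \<open>Finitely many chains have compact supports, and a compact part of the nerve can be cut
  into finitely many disjoint compact open pieces on which the range of the first entry is
  injective. A basis of a whole bar module would need such a partition of the entire nerve, while
  only the base space is assumed to be a countable union of compact sets.

  Maps can be lifted out of \<open>P\<close> but in general not out of the bar complex, so no
  homotopy inverse of the comparison is at hand. The cone replaces it: a bar cycle modulo the ideal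
  is a cone cycle modulo the ideal, and exactness supplies the required element of \<open>P\<close>.

  The ideal is the kernel of push-forward along the source map, and the right module of functions on
  the base space is the ring modulo this kernel. As the ring has no identity in general,
  \<open>1 \<otimes> p\<close> is replaced by \<open>1_K \<otimes> p\<close>, where \<open>K\<close>
  is a compact open set of units whose indicator fixes \<open>p\<close>. The contraction of the bar
  complex is additive but not linear, which is enough for exactness.\<close>

section \<open>Modules over rings with local units, and their homomorphisms\<close>

locale lmod = left_module R M for R :: "('r, 'x) ring_scheme" and M :: "('r, 'm) module"

definition regular_module :: "('r, 'x) ring_scheme \<Rightarrow> ('r, 'r) module" where
  "regular_module R = \<lparr>carrier = carrier R, monoid.mult = undefined, one = undefined,
     ring.zero = \<zero>\<^bsub>R\<^esub>, add = add R, smult = monoid.mult R\<rparr>"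

lemma regular_module_simps [simp]:
  "carrier (regular_module R) = carrier R" "\<zero>\<^bsub>regular_module R\<^esub> = \<zero>\<^bsub>R\<^esub>"
  "add (regular_module R) = add R" "smult (regular_module R) = monoid.mult R"
  by (simp_all add: regular_module_def)

text \<open>Without an identity, the ring axioms are carried by \<open>R\<close> as a left module
  over itself. One-sided units suffice, since they act only on left modules.\<close>

locale ring_with_local_units =
  fixes R :: "('r, 'x) ring_scheme"
  assumes regular_lmod: "lmod R (regular_module R)"
    and local_units: "\<lbrakk>finite F; F \<subseteq> carrier R\<rbrakk> \<Longrightarrow> \<exists>e\<in>carrier R. \<forall>f\<in>F. e \<otimes>\<^bsub>R\<^esub> f = f"
begin

lemma abelian_group_R: "abelian_group R"
proof -
  interpret abelian_group "regular_module R"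
    using regular_lmod by (simp add: lmod_def left_module_def)
  show ?thesis
    using a_closed zero_closed a_assoc a_comm l_zero add.l_inv_ex
    by (intro abelian_groupI) simp_all
qed

sublocale abelian_group R by (rule abelian_group_R)

lemma mult_closed: "\<lbrakk>x \<in> carrier R; y \<in> carrier R\<rbrakk> \<Longrightarrow> x \<otimes>\<^bsub>R\<^esub> y \<in> carrier R"
  using left_module.smult_closed[OF lmod.axioms, OF regular_lmod, of x y] by simp

end

lemma (in abelian_group) add_zero_cancel:
  assumes "x \<in> carrier G" "x \<oplus> x = x" shows "x = \<zero>"
  using assms by (metis add.r_cancel_one)

lemma (in lmod) smult_zero_right:
  assumes "r \<in> carrier R" shows "r \<odot>\<^bsub>M\<^esub> \<zero>\<^bsub>M\<^esub> = \<zero>\<^bsub>M\<^esub>"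
  using smult_r_distr[OF assms zero_closed zero_closed] smult_closed[OF assms zero_closed]
  by (metis add_zero_cancel l_zero zero_closed)

lemma (in lmod) smult_minus_right:
  assumes "r \<in> carrier R" "m \<in> carrier M" shows "r \<odot>\<^bsub>M\<^esub> (\<ominus>\<^bsub>M\<^esub> m) = \<ominus>\<^bsub>M\<^esub> (r \<odot>\<^bsub>M\<^esub> m)"
  by (metis a_inv_closed assms l_neg minus_equality smult_closed smult_r_distr smult_zero_right)

lemma (in lmod) smult_zero_left:
  assumes "abelian_group R" "m \<in> carrier M" shows "\<zero>\<^bsub>R\<^esub> \<odot>\<^bsub>M\<^esub> m = \<zero>\<^bsub>M\<^esub>"
proof -
  interpret R: abelian_group R by fact
  show ?thesis
    using smult_l_distr[OF R.zero_closed R.zero_closed assms(2)] assms(2)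
    by (metis R.l_zero R.zero_closed add_zero_cancel smult_closed)
qed

lemma lmod_homD:
  assumes "f \<in> lmod_hom R M N"
  shows "x \<in> carrier M \<Longrightarrow> f x \<in> carrier N"
    and "\<lbrakk>x \<in> carrier M; y \<in> carrier M\<rbrakk> \<Longrightarrow> f (x \<oplus>\<^bsub>M\<^esub> y) = f x \<oplus>\<^bsub>N\<^esub> f y"
    and "\<lbrakk>r \<in> carrier R; x \<in> carrier M\<rbrakk> \<Longrightarrow> f (r \<odot>\<^bsub>M\<^esub> x) = r \<odot>\<^bsub>N\<^esub> f x"
  using assms by (auto simp: lmod_hom_def)

lemma lmod_homI:
  assumes "\<And>x. x \<in> carrier M \<Longrightarrow> f x \<in> carrier N"
    and "\<And>x y. \<lbrakk>x \<in> carrier M; y \<in> carrier M\<rbrakk> \<Longrightarrow> f (x \<oplus>\<^bsub>M\<^esub> y) = f x \<oplus>\<^bsub>N\<^esub> f y"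
    and "\<And>r x. \<lbrakk>r \<in> carrier R; x \<in> carrier M\<rbrakk> \<Longrightarrow> f (r \<odot>\<^bsub>M\<^esub> x) = r \<odot>\<^bsub>N\<^esub> f x"
  shows "f \<in> lmod_hom R M N"
  using assms by (auto simp: lmod_hom_def)

lemma lmod_hom_zero:
  assumes "f \<in> lmod_hom R M N" "abelian_group M" "abelian_group N"
  shows "f \<zero>\<^bsub>M\<^esub> = \<zero>\<^bsub>N\<^esub>"
proof -
  interpret M: abelian_group M by fact
  interpret N: abelian_group N by fact
  show ?thesis using lmod_homD[OF assms(1)]
    by (metis M.l_zero M.zero_closed N.add_zero_cancel)
qed

lemma lmod_hom_minus:
  assumes "f \<in> lmod_hom R M N" "abelian_group M" "abelian_group N" "x \<in> carrier M"
  shows "f (\<ominus>\<^bsub>M\<^esub> x) = \<ominus>\<^bsub>N\<^esub> f x"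
proof -
  interpret M: abelian_group M by fact
  interpret N: abelian_group N by fact
  show ?thesis using lmod_homD[OF assms(1)] lmod_hom_zero[OF assms(1-3)] assms(4)
    by (metis M.a_inv_closed M.l_neg N.minus_equality)
qed

lemma lmod_hom_compose:
  assumes "f \<in> lmod_hom R M N" "g \<in> lmod_hom R N K"
  shows "(\<lambda>x. g (f x)) \<in> lmod_hom R M K"
  using assms by (auto simp: lmod_hom_def Pi_iff)

lemma lmod_hom_add:
  assumes "f \<in> lmod_hom R M N" "g \<in> lmod_hom R M N" "lmod R N"
  shows "(\<lambda>x. f x \<oplus>\<^bsub>N\<^esub> g x) \<in> lmod_hom R M N"
proof -
  interpret N: lmod R N by fact
  show ?thesis using lmod_homD[OF assms(1)] lmod_homD[OF assms(2)]
    by (intro lmod_homI) (simp_all add: N.a_ac N.smult_r_distr)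
qed

lemma lmod_hom_uminus:
  assumes "f \<in> lmod_hom R M N" "lmod R N"
  shows "(\<lambda>x. \<ominus>\<^bsub>N\<^esub> f x) \<in> lmod_hom R M N"
proof -
  interpret N: lmod R N by fact
  show ?thesis using lmod_homD[OF assms(1)]
    by (intro lmod_homI) (simp_all add: N.smult_minus_right N.minus_add)
qed

lemma lmod_hom_diff:
  assumes "f \<in> lmod_hom R M N" "g \<in> lmod_hom R M N" "lmod R N"
  shows "(\<lambda>x. f x \<ominus>\<^bsub>N\<^esub> g x) \<in> lmod_hom R M N"
  using lmod_hom_add[OF assms(1) lmod_hom_uminus[OF assms(2,3)] assms(3)] by (simp add: a_minus_def)

lemma (in abelian_group) finsum_superset:
  assumes "finite T" "S \<subseteq> T" "\<And>b. b \<in> T \<Longrightarrow> f b \<in> carrier G" "\<And>b. b \<in> T - S \<Longrightarrow> f b = \<zero>"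
  shows "finsum G f S = finsum G f T"
  using assms by (intro add.finprod_mono_neutral_cong_left) auto

section \<open>Local dual bases\<close>

text \<open>The value at \<open>y\<close> of the finite rank map with functionals
  \<open>fst c\<close> and vectors \<open>snd c\<close>. A list keeps multiplicities: applying a
  homomorphism to the vectors may identify pairs.\<close>

fun lincomb :: "('r, 'm) module \<Rightarrow> (('y \<Rightarrow> 'r) \<times> 'm) list \<Rightarrow> 'y \<Rightarrow> 'm" where
  "lincomb M [] y = \<zero>\<^bsub>M\<^esub>"
| "lincomb M (c # cs) y = fst c y \<odot>\<^bsub>M\<^esub> snd c \<oplus>\<^bsub>M\<^esub> lincomb M cs y"

lemma (in lmod) lincomb_closed:
  assumes "\<And>c. c \<in> set cs \<Longrightarrow> fst c y \<in> carrier R \<and> snd c \<in> carrier M"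
  shows "lincomb M cs y \<in> carrier M"
  using assms by (induction cs) (auto intro: smult_closed)

lemma (in lmod) hom_lincomb:
  assumes "h \<in> lmod_hom R M N" "abelian_group N"
    and "\<And>c. c \<in> set cs \<Longrightarrow> fst c y \<in> carrier R \<and> snd c \<in> carrier M"
  shows "h (lincomb M cs y) = lincomb N (map (apsnd h) cs) y"
  using assms(3)
proof (induction cs)
  case Nil
  then show ?case using lmod_hom_zero[OF assms(1) _ assms(2)] abelian_group_axioms by simp
next
  case (Cons c cs)
  then show ?case
    using lmod_homD[OF assms(1)] lincomb_closed[of cs y] by (simp add: smult_closed)
qed

lemma (in lmod) lincomb_hom:
  assumes "abelian_group R"
    and "\<And>c. c \<in> set cs \<Longrightarrow> fst c \<in> lmod_hom R A (regular_module R) \<and> snd c \<in> carrier M"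
  shows "lincomb M cs \<in> lmod_hom R A M"
  using assms(2)
proof (induction cs)
  case Nil
  then show ?case by (auto simp: lmod_hom_def smult_zero_right)
next
  case (Cons c cs)
  interpret R: abelian_group R by fact
  have "lincomb M cs \<in> lmod_hom R A M" using Cons by simp
  note h = lmod_homD[OF this]
  have "fst c \<in> lmod_hom R A (regular_module R)" and c: "snd c \<in> carrier M" using Cons by auto
  note g = lmod_homD[OF this(1), simplified]
  have "(\<lambda>y. fst c y \<odot>\<^bsub>M\<^esub> snd c) \<in> lmod_hom R A M"
    using g c by (intro lmod_homI) (simp_all add: smult_closed smult_l_distr smult_assoc)
  from lmod_hom_add[OF this \<open>lincomb M cs \<in> lmod_hom R A M\<close>]
  show ?case using lmod_axioms by simp
qed

text \<open>The functionals are defined on all of \<open>M\<close>, while the vectors lie in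
  \<open>Z\<close>. For \<open>Z\<close> the cycles of a complex, this asymmetry carries the
  induction on degrees; for \<open>Z = carrier M\<close> the notion is local projectivity, the
  finite form of the dual basis property.\<close>

definition locally_projective :: "('r, 'x) ring_scheme \<Rightarrow> ('r, 'm) module \<Rightarrow> 'm set \<Rightarrow> bool" where
  "locally_projective R M Z \<longleftrightarrow> (\<forall>Y. finite Y \<and> Y \<subseteq> Z \<longrightarrow>
     (\<exists>cs. (\<forall>c\<in>set cs. fst c \<in> lmod_hom R M (regular_module R) \<and> snd c \<in> Z) \<and>
           (\<forall>y\<in>Y. lincomb M cs y = y)))"

text \<open>Only a subgroup: for a right ideal \<open>J\<close> the set \<open>J M\<close> need not
  be stable under \<open>R\<close>, so \<open>M / J M\<close> is just an abelian group.\<close>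

definition ideal_span :: "'r set \<Rightarrow> ('r, 'm) module \<Rightarrow> 'm set" where
  "ideal_span J M = generate (add_monoid M) {j \<odot>\<^bsub>M\<^esub> m | j m. j \<in> J \<and> m \<in> carrier M}"

lemma ideal_span_gen: "\<lbrakk>j \<in> J; m \<in> carrier M\<rbrakk> \<Longrightarrow> j \<odot>\<^bsub>M\<^esub> m \<in> ideal_span J M"
  unfolding ideal_span_def by (rule generate.incl) blast

lemma (in lmod) ideal_span_subgroup:
  assumes "J \<subseteq> carrier R" shows "subgroup (ideal_span J M) (add_monoid M)"
  unfolding ideal_span_def using assms
  by (intro group.generate_is_subgroup[OF a_group]) (auto intro: smult_closed)

lemma (in lmod) ideal_spanD:
  assumes "J \<subseteq> carrier R"
  shows "x \<in> ideal_span J M \<Longrightarrow> x \<in> carrier M"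
    and "\<zero>\<^bsub>M\<^esub> \<in> ideal_span J M"
    and "\<lbrakk>x \<in> ideal_span J M; y \<in> ideal_span J M\<rbrakk> \<Longrightarrow> x \<oplus>\<^bsub>M\<^esub> y \<in> ideal_span J M"
    and "x \<in> ideal_span J M \<Longrightarrow> \<ominus>\<^bsub>M\<^esub> x \<in> ideal_span J M"
  using subgroup.subset[OF ideal_span_subgroup[OF assms]] subgroup.one_closed[OF ideal_span_subgroup[OF assms]]
    subgroup.m_closed[OF ideal_span_subgroup[OF assms]] subgroup.m_inv_closed[OF ideal_span_subgroup[OF assms]]
  by (auto simp: a_inv_def)

text \<open>The target subgroup is left open: it is \<open>J N\<close> for maps of modules and
  \<open>J\<close> itself for functionals.\<close>

lemma (in lmod) ideal_span_hom_into:
  assumes h: "h \<in> lmod_hom R M N" and N: "abelian_group N" and J: "J \<subseteq> carrier R"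
    and S: "subgroup S (add_monoid N)" and gen: "\<And>j m. \<lbrakk>j \<in> J; m \<in> carrier M\<rbrakk> \<Longrightarrow> h (j \<odot>\<^bsub>M\<^esub> m) \<in> S"
    and x: "x \<in> ideal_span J M"
  shows "h x \<in> S"
  using x unfolding ideal_span_def
proof (induction x rule: generate.induct)
  case one
  then show ?case using lmod_hom_zero[OF h abelian_group_axioms N] subgroup.one_closed[OF S] by simp
next
  case (incl x)
  then show ?case using gen by blast
next
  case (inv x)
  then obtain j m where jm: "j \<in> J" "m \<in> carrier M" "x = j \<odot>\<^bsub>M\<^esub> m" by blast
  then have "x \<in> carrier M" using J smult_closed by blast
  then have "h (\<ominus>\<^bsub>M\<^esub> x) = \<ominus>\<^bsub>N\<^esub> h x" by (rule lmod_hom_minus[OF h abelian_group_axioms N])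
  then show ?case using subgroup.m_inv_closed[OF S gen[OF jm(1,2)]] jm(3) by (simp add: a_inv_def)
next
  case (eng x y)
  have "x \<in> carrier M" "y \<in> carrier M"
    using eng(1,2) ideal_spanD(1)[OF J] unfolding ideal_span_def by blast+
  then show ?case using lmod_homD(2)[OF h] subgroup.m_closed[OF S eng(3,4)] by simp
qed

lemma (in lmod) ideal_span_hom:
  assumes h: "h \<in> lmod_hom R M N" and N: "lmod R N" and J: "J \<subseteq> carrier R"
    and x: "x \<in> ideal_span J M"
  shows "h x \<in> ideal_span J N"
proof (rule ideal_span_hom_into[OF h _ J _ _ x])
  interpret N: lmod R N by fact
  show "abelian_group N" ..
  show "subgroup (ideal_span J N) (add_monoid N)" by (rule N.ideal_span_subgroup[OF J])
  show "h (j \<odot>\<^bsub>M\<^esub> m) \<in> ideal_span J N" if "j \<in> J" "m \<in> carrier M" for j m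
    using that J lmod_homD[OF h] by (auto intro!: ideal_span_gen simp: subset_iff)
qed

lemma (in lmod) lincomb_ideal_span:
  assumes "J \<subseteq> carrier R"
    and "\<And>c. c \<in> set cs \<Longrightarrow> fst c y \<in> J \<and> snd c \<in> carrier M"
  shows "lincomb M cs y \<in> ideal_span J M"
  using assms(2) by (induction cs) (auto intro!: ideal_spanD(2,3)[OF assms(1)] ideal_span_gen)

section \<open>Exact complexes of locally projective modules\<close>

locale right_ideal = ring_with_local_units +
  fixes J
  assumes J_subgroup: "subgroup J (add_monoid (regular_module R))"
    and J_right: "\<lbrakk>j \<in> J; r \<in> carrier R\<rbrakk> \<Longrightarrow> j \<otimes>\<^bsub>R\<^esub> r \<in> J"
begin

lemma J_subset: "J \<subseteq> carrier R"
  using subgroup.subset[OF J_subgroup] by simp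

text \<open>\<open>\<phi> (j m) = j (\<phi> m)\<close>, and \<open>J\<close> absorbs factors on the
  right. So the coordinates of elements of \<open>J M\<close> lie in \<open>J\<close>.\<close>

lemma functional_ideal_span:
  assumes "lmod R M" "\<phi> \<in> lmod_hom R M (regular_module R)" "x \<in> ideal_span J M"
  shows "\<phi> x \<in> J"
proof (rule lmod.ideal_span_hom_into[OF assms(1,2) _ J_subset _ _ assms(3)])
  show "abelian_group (regular_module R)" 
    using regular_lmod by (simp add: lmod_def left_module_def)
  show "subgroup J (add_monoid (regular_module R))" by (rule J_subgroup)
  show "\<phi> (j \<odot>\<^bsub>M\<^esub> m) \<in> J" if "j \<in> J" "m \<in> carrier M" for j m
    using that J_subset lmod_homD[OF assms(2)] by (auto simp: J_right subset_iff)
qed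

end

text \<open>Exactness includes degree 0, where every chain is a boundary; this starts the induction
  on degrees.\<close>

locale exact_complex = ring_with_local_units +
  fixes C :: "nat \<Rightarrow> ('a, 'c) module" and d :: "nat \<Rightarrow> 'c \<Rightarrow> 'c"
  assumes C_module: "lmod R (C n)"
    and d_hom: "d (Suc n) \<in> lmod_hom R (C (Suc n)) (C n)"
    and exact_0: "d (Suc 0) ` carrier (C (Suc 0)) = carrier (C 0)"
    and exact_Suc: "d (Suc (Suc n)) ` carrier (C (Suc (Suc n))) =
      {x \<in> carrier (C (Suc n)). d (Suc n) x = \<zero>\<^bsub>C n\<^esub>}"
    and lproj: "locally_projective R (C n) (carrier (C n))"
begin

text \<open>
  If \<open>\<theta>\<close> fixes the given cycles and \<open>\<psi>\<close> fixes the boundaries of the coefficients of \<open>\<theta>\<close>, then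
  \<open>\<theta> - u d \<theta>\<close>, where \<open>u\<close> lifts \<open>\<psi>\<close> along \<open>d\<close>, fixes the cycles and has cycles as coefficients.
\<close>

lemma cycles_locally_projective:
  "locally_projective R (C n) (d (Suc n) ` carrier (C (Suc n)))"
proof (induction n)
  case 0
  then show ?case using lproj[of 0] exact_0 by simp
next
  case (Suc n)
  interpret D: lmod R "C n" by (rule C_module)
  interpret C: lmod R "C (Suc n)" by (rule C_module)
  let ?d = "d (Suc n)" and ?Z = "d (Suc (Suc n)) ` carrier (C (Suc (Suc n)))"
  note dh = lmod_homD[OF d_hom[of n]]
  show ?case
    unfolding locally_projective_def
  proof (intro allI impI, elim conjE)
    fix Y assume Y: "finite Y" "Y \<subseteq> ?Z"
    then have YC: "Y \<subseteq> carrier (C (Suc n))" and dY: "\<And>y. y \<in> Y \<Longrightarrow> ?d y = \<zero>\<^bsub>C n\<^esub>"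
      using exact_Suc[of n] by auto
    obtain cs where cs: "\<forall>c\<in>set cs. fst c \<in> lmod_hom R (C (Suc n)) (regular_module R) \<and> snd c \<in> carrier (C (Suc n))"
      and csY: "\<forall>y\<in>Y. lincomb (C (Suc n)) cs y = y"
      using lproj[of "Suc n"] Y(1) YC unfolding locally_projective_def by blast
    let ?Y' = "(\<lambda>c. ?d (snd c)) ` set cs"
    have "finite ?Y'" "?Y' \<subseteq> ?d ` carrier (C (Suc n))" using cs by auto
    then obtain es where es: "\<forall>c\<in>set es. fst c \<in> lmod_hom R (C n) (regular_module R) \<and> snd c \<in> ?d ` carrier (C (Suc n))"
      and esY: "\<forall>y\<in>?Y'. lincomb (C n) es y = y"
      using Suc.IH unfolding locally_projective_def by meson
    define l where "l w = (SOME v. v \<in> carrier (C (Suc n)) \<and> ?d v = w)" for w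
    have l: "l w \<in> carrier (C (Suc n)) \<and> ?d (l w) = w" if "w \<in> ?d ` carrier (C (Suc n))" for w
      unfolding l_def by (rule someI_ex) (use that in auto)
    define u where "u = lincomb (C (Suc n)) (map (apsnd l) es)"
    have u: "u \<in> lmod_hom R (C n) (C (Suc n))"
      unfolding u_def by (rule C.lincomb_hom) (use es l in \<open>auto simp: abelian_group_R\<close>)
    have du: "?d (u w) = lincomb (C n) es w" if "w \<in> carrier (C n)" for w
    proof -
      have "?d (u w) = lincomb (C n) (map (apsnd ?d) (map (apsnd l) es)) w"
        unfolding u_def by (rule C.hom_lincomb[OF d_hom D.abelian_group_axioms])
          (use es l that lmod_homD(1) in \<open>fastforce\<close>)
      also have "map (apsnd ?d) (map (apsnd l) es) = es"
        using es l by (auto intro!: map_idI simp: apsnd_def map_prod_def split: prod.splits)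
      finally show ?thesis .
    qed
    define h where "h z = z \<ominus>\<^bsub>C (Suc n)\<^esub> u (?d z)" for z
    have h: "h \<in> lmod_hom R (C (Suc n)) (C (Suc n))"
      unfolding h_def
      by (rule lmod_hom_diff[OF _ lmod_hom_compose[OF d_hom u] C_module]) (auto simp: lmod_hom_def)
    show "\<exists>cs. (\<forall>c\<in>set cs. fst c \<in> lmod_hom R (C (Suc n)) (regular_module R) \<and> snd c \<in> ?Z) \<and>
               (\<forall>y\<in>Y. lincomb (C (Suc n)) cs y = y)"
    proof (intro exI[of _ "map (apsnd h) cs"] conjI ballI)
      fix c assume "c \<in> set (map (apsnd h) cs)"
      then obtain b where b: "b \<in> set cs" "c = apsnd h b" by auto
      then have sb: "snd b \<in> carrier (C (Suc n))" and "fst c \<in> lmod_hom R (C (Suc n)) (regular_module R)"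
        using cs by auto
      then show "fst c \<in> lmod_hom R (C (Suc n)) (regular_module R)" by simp
      have "?d (u (?d (snd b))) = ?d (snd b)" using du dh(1) sb esY b(1) by auto
      moreover have "?d (h (snd b)) = ?d (snd b) \<ominus>\<^bsub>C n\<^esub> ?d (u (?d (snd b)))"
        unfolding h_def a_minus_def using sb dh lmod_homD(1)[OF u]
        by (simp add: lmod_hom_minus[OF d_hom C.abelian_group_axioms D.abelian_group_axioms])
      ultimately have "?d (h (snd b)) = \<zero>\<^bsub>C n\<^esub>"
        using dh(1) sb by (simp add: a_minus_def D.r_neg)
      then show "snd c \<in> ?Z" using exact_Suc[of n] b(2) lmod_homD(1)[OF h] sb by auto
    next
      fix y assume y: "y \<in> Y"
      have "lincomb (C (Suc n)) (map (apsnd h) cs) y = h (lincomb (C (Suc n)) cs y)"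
        by (rule C.hom_lincomb[OF h C.abelian_group_axioms, symmetric])
          (use cs y YC lmod_homD(1) in \<open>fastforce\<close>)
      also have "\<dots> = h y" using csY y by simp
      also have "\<dots> = y"
        unfolding h_def using y YC dY lmod_hom_zero[OF u D.abelian_group_axioms C.abelian_group_axioms]
        by (auto simp: a_minus_def)
      finally show "lincomb (C (Suc n)) (map (apsnd h) cs) y = y" .
    qed
  qed
qed

text \<open>The point is to find a preimage of \<open>d x\<close> inside \<open>J C\<close>. A local
  dual basis at \<open>d x\<close> with vectors among the boundaries has its coefficients in
  \<open>J\<close>, because \<open>d x\<close> lies in \<open>J C\<close>. Lifting its vectors along
  \<open>d\<close> yields \<open>w\<close> in \<open>J C\<close> with \<open>d w = d x\<close>, and
  \<open>x - w\<close> is a cycle, hence a boundary.\<close>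

lemma tensor_exact:
  assumes "right_ideal R J" and x: "x \<in> carrier (C (Suc n))" and dx: "d (Suc n) x \<in> ideal_span J (C n)"
  shows "\<exists>y\<in>carrier (C (Suc (Suc n))). \<exists>w\<in>ideal_span J (C (Suc n)). x = d (Suc (Suc n)) y \<oplus>\<^bsub>C (Suc n)\<^esub> w"
proof -
  interpret J: right_ideal R J by fact
  interpret D: lmod R "C n" by (rule C_module)
  interpret C: lmod R "C (Suc n)" by (rule C_module)
  let ?d = "d (Suc n)"
  note dh = lmod_homD[OF d_hom[of n]]
  have "finite {?d x}" "{?d x} \<subseteq> ?d ` carrier (C (Suc n))" using x by auto
  then obtain es where es: "\<forall>c\<in>set es. fst c \<in> lmod_hom R (C n) (regular_module R) \<and> snd c \<in> ?d ` carrier (C (Suc n))"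
      and "\<forall>y\<in>{?d x}. lincomb (C n) es y = y"
    using cycles_locally_projective[of n] unfolding locally_projective_def by meson
  then have es_x: "lincomb (C n) es (?d x) = ?d x" by simp
  define l where "l w = (SOME v. v \<in> carrier (C (Suc n)) \<and> ?d v = w)" for w
  have l: "l w \<in> carrier (C (Suc n)) \<and> ?d (l w) = w" if "w \<in> ?d ` carrier (C (Suc n))" for w
    unfolding l_def by (rule someI_ex) (use that in auto)
  define w where "w = lincomb (C (Suc n)) (map (apsnd l) es) (?d x)"
  have w: "w \<in> ideal_span J (C (Suc n))"
    unfolding w_def
  proof (rule C.lincomb_ideal_span[OF J.J_subset])
    fix c assume "c \<in> set (map (apsnd l) es)"
    then show "fst c (?d x) \<in> J \<and> snd c \<in> carrier (C (Suc n))"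
      using es l J.functional_ideal_span[OF C_module _ dx] by auto
  qed
  then have wC: "w \<in> carrier (C (Suc n))" by (rule C.ideal_spanD[OF J.J_subset])
  have "?d w = lincomb (C n) (map (apsnd ?d) (map (apsnd l) es)) (?d x)"
    unfolding w_def by (rule C.hom_lincomb[OF d_hom D.abelian_group_axioms])
          (use es l dh x lmod_homD(1) in \<open>fastforce\<close>)
  also have "map (apsnd ?d) (map (apsnd l) es) = es"
    using es l by (auto intro!: map_idI simp: apsnd_def map_prod_def split: prod.splits)
  finally have "?d w = ?d x" using es_x by simp
  then have "?d (x \<ominus>\<^bsub>C (Suc n)\<^esub> w) = \<zero>\<^bsub>C n\<^esub>"
    using x wC dh by (simp add: a_minus_def D.r_neg lmod_hom_minus[OF d_hom C.abelian_group_axioms D.abelian_group_axioms])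
  then have "x \<ominus>\<^bsub>C (Suc n)\<^esub> w \<in> d (Suc (Suc n)) ` carrier (C (Suc (Suc n)))"
    using exact_Suc[of n] x wC by auto
  then obtain y where "y \<in> carrier (C (Suc (Suc n)))" "x \<ominus>\<^bsub>C (Suc n)\<^esub> w = d (Suc (Suc n)) y" by auto
  moreover have "x = (x \<ominus>\<^bsub>C (Suc n)\<^esub> w) \<oplus>\<^bsub>C (Suc n)\<^esub> w"
    using x wC by (simp add: a_minus_def C.a_assoc C.l_neg)
  ultimately show ?thesis using w by metis
qed

end

section \<open>Projective modules\<close>

text \<open>The direct sum of copies of \<open>R\<close> indexed by \<open>I\<close>, in the
  function type on which \<open>projective_module\<close> tests lifting. Without an identity there
  are no unit vectors, so maps out of it are given by \<open>family_sum\<close>.\<close>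

definition free_module :: "('r, 'x) ring_scheme \<Rightarrow> 'i set \<Rightarrow> ('r, 'i \<Rightarrow> 'r) module" where
  "free_module R I = \<lparr>carrier = {u. (\<forall>b. u b \<in> carrier R) \<and> (\<forall>b. b \<notin> I \<longrightarrow> u b = \<zero>\<^bsub>R\<^esub>) \<and>
       finite {b. u b \<noteq> \<zero>\<^bsub>R\<^esub>}},
     monoid.mult = undefined, one = undefined, ring.zero = (\<lambda>b. \<zero>\<^bsub>R\<^esub>),
     add = (\<lambda>u v b. u b \<oplus>\<^bsub>R\<^esub> v b), smult = (\<lambda>r u b. r \<otimes>\<^bsub>R\<^esub> u b)\<rparr>"

lemma free_module_simps [simp]:
  "u \<in> carrier (free_module R I) \<longleftrightarrow> (\<forall>b. u b \<in> carrier R) \<and> (\<forall>b. b \<notin> I \<longrightarrow> u b = \<zero>\<^bsub>R\<^esub>) \<and>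
     finite {b. u b \<noteq> \<zero>\<^bsub>R\<^esub>}"
  "\<zero>\<^bsub>free_module R I\<^esub> = (\<lambda>b. \<zero>\<^bsub>R\<^esub>)"
  "add (free_module R I) = (\<lambda>u v b. u b \<oplus>\<^bsub>R\<^esub> v b)"
  "smult (free_module R I) = (\<lambda>r u b. r \<otimes>\<^bsub>R\<^esub> u b)"
  by (simp_all add: free_module_def)

definition family_sum :: "('r, 'x) ring_scheme \<Rightarrow> ('r, 'm) module \<Rightarrow> ('i \<Rightarrow> 'm) \<Rightarrow> ('i \<Rightarrow> 'r) \<Rightarrow> 'm" where
  "family_sum R M m u = finsum M (\<lambda>b. u b \<odot>\<^bsub>M\<^esub> m b) {b. u b \<noteq> \<zero>\<^bsub>R\<^esub>}"

lemma (in lmod) finsum_smult: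
  assumes "finite T" and r: "r \<in> carrier R" and "\<And>b. b \<in> T \<Longrightarrow> f b \<in> carrier M"
  shows "r \<odot>\<^bsub>M\<^esub> finsum M f T = finsum M (\<lambda>b. r \<odot>\<^bsub>M\<^esub> f b) T"
  using assms(1,3)
proof (induction T)
  case empty
  then show ?case using r by (simp add: smult_zero_right)
next
  case (insert b T)
  then have "finsum M f T \<in> carrier M" by (auto intro: finsum_closed)
  then show ?case using insert r by (simp add: Pi_iff smult_closed smult_r_distr)
qed

context ring_with_local_units
begin

lemma regular_simps:
  assumes "x \<in> carrier R" "y \<in> carrier R" "z \<in> carrier R"
  shows "(x \<oplus>\<^bsub>R\<^esub> y) \<otimes>\<^bsub>R\<^esub> z = x \<otimes>\<^bsub>R\<^esub> z \<oplus>\<^bsub>R\<^esub> y \<otimes>\<^bsub>R\<^esub> z"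
    and "z \<otimes>\<^bsub>R\<^esub> (x \<oplus>\<^bsub>R\<^esub> y) = z \<otimes>\<^bsub>R\<^esub> x \<oplus>\<^bsub>R\<^esub> z \<otimes>\<^bsub>R\<^esub> y"
    and "(x \<otimes>\<^bsub>R\<^esub> y) \<otimes>\<^bsub>R\<^esub> z = x \<otimes>\<^bsub>R\<^esub> (y \<otimes>\<^bsub>R\<^esub> z)"
    and "x \<otimes>\<^bsub>R\<^esub> \<zero>\<^bsub>R\<^esub> = \<zero>\<^bsub>R\<^esub>"
proof -
  interpret M: lmod R "regular_module R" by (rule regular_lmod)
  show "(x \<oplus>\<^bsub>R\<^esub> y) \<otimes>\<^bsub>R\<^esub> z = x \<otimes>\<^bsub>R\<^esub> z \<oplus>\<^bsub>R\<^esub> y \<otimes>\<^bsub>R\<^esub> z"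
    "z \<otimes>\<^bsub>R\<^esub> (x \<oplus>\<^bsub>R\<^esub> y) = z \<otimes>\<^bsub>R\<^esub> x \<oplus>\<^bsub>R\<^esub> z \<otimes>\<^bsub>R\<^esub> y"
    "(x \<otimes>\<^bsub>R\<^esub> y) \<otimes>\<^bsub>R\<^esub> z = x \<otimes>\<^bsub>R\<^esub> (y \<otimes>\<^bsub>R\<^esub> z)"
    "x \<otimes>\<^bsub>R\<^esub> \<zero>\<^bsub>R\<^esub> = \<zero>\<^bsub>R\<^esub>"
    using M.smult_l_distr[of x y z] M.smult_r_distr[of z x y] M.smult_assoc[of x y z]
      M.smult_zero_right[of x] assms by simp_all
qed

lemma free_module_support_add:
  assumes "u \<in> carrier (free_module R I)" "v \<in> carrier (free_module R I)"
  shows "finite {b. u b \<oplus>\<^bsub>R\<^esub> v b \<noteq> \<zero>\<^bsub>R\<^esub>}"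
proof (rule finite_subset)
  show "{b. u b \<oplus>\<^bsub>R\<^esub> v b \<noteq> \<zero>\<^bsub>R\<^esub>} \<subseteq> {b. u b \<noteq> \<zero>\<^bsub>R\<^esub>} \<union> {b. v b \<noteq> \<zero>\<^bsub>R\<^esub>}" by auto
qed (use assms in auto)

lemma free_module_support_smult:
  assumes "r \<in> carrier R" "u \<in> carrier (free_module R I)"
  shows "finite {b. r \<otimes>\<^bsub>R\<^esub> u b \<noteq> \<zero>\<^bsub>R\<^esub>}"
proof (rule finite_subset)
  show "{b. r \<otimes>\<^bsub>R\<^esub> u b \<noteq> \<zero>\<^bsub>R\<^esub>} \<subseteq> {b. u b \<noteq> \<zero>\<^bsub>R\<^esub>}" using assms by (auto simp: regular_simps(4))
qed (use assms in auto)

lemma free_module_lmod: "lmod R (free_module R I)"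
proof -
  have ag: "abelian_group (free_module R I)"
  proof (rule abelian_groupI)
    fix u assume u: "u \<in> carrier (free_module R I)"
    have "{b. \<ominus>\<^bsub>R\<^esub> u b \<noteq> \<zero>\<^bsub>R\<^esub>} \<subseteq> {b. u b \<noteq> \<zero>\<^bsub>R\<^esub>}" by auto
    then have "finite {b. \<ominus>\<^bsub>R\<^esub> u b \<noteq> \<zero>\<^bsub>R\<^esub>}" using u finite_subset by auto
    then show "\<exists>v\<in>carrier (free_module R I). v \<oplus>\<^bsub>free_module R I\<^esub> u = \<zero>\<^bsub>free_module R I\<^esub>"
      using u by (intro bexI[of _ "\<lambda>b. \<ominus>\<^bsub>R\<^esub> u b"]) (auto simp: l_neg)
  next
    fix u v assume "u \<in> carrier (free_module R I)" "v \<in> carrier (free_module R I)"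
    then show "u \<oplus>\<^bsub>free_module R I\<^esub> v \<in> carrier (free_module R I)"
      using free_module_support_add[of u I v] by auto
  qed (auto simp: a_ac)
  show ?thesis
  proof (rule lmod.intro, intro left_module.intro left_module_axioms.intro ag)
    fix r u assume ru: "r \<in> carrier R" "u \<in> carrier (free_module R I)"
    then show "r \<odot>\<^bsub>free_module R I\<^esub> u \<in> carrier (free_module R I)"
      using free_module_support_smult[OF ru] by (auto simp: mult_closed regular_simps)
  next
    show "carrier (free_module R I) \<subseteq> generate (add_monoid (free_module R I))
        {r \<odot>\<^bsub>free_module R I\<^esub> m |r m. r \<in> carrier R \<and> m \<in> carrier (free_module R I)}"
    proof
      fix u assume u: "u \<in> carrier (free_module R I)"
      have "finite (range u)"
      proof (rule finite_subset)
        show "range u \<subseteq> insert \<zero>\<^bsub>R\<^esub> (u ` {b. u b \<noteq> \<zero>\<^bsub>R\<^esub>})" by auto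
      qed (use u in auto)
      then obtain e where e: "e \<in> carrier R" "\<forall>f\<in>range u. e \<otimes>\<^bsub>R\<^esub> f = f"
        using local_units[of "range u"] u by auto
      then have "u = e \<odot>\<^bsub>free_module R I\<^esub> u" by simp
      then show "u \<in> generate (add_monoid (free_module R I))
        {r \<odot>\<^bsub>free_module R I\<^esub> m |r m. r \<in> carrier R \<and> m \<in> carrier (free_module R I)}"
        using e u by (intro generate.incl) blast
    qed
  qed (auto simp: fun_eq_iff regular_simps)
qed

lemma family_sum_superset:
  assumes M: "lmod R M" and m: "\<And>b. b \<in> T \<Longrightarrow> m b \<in> carrier M" and "finite T" "\<And>b. u b \<in> carrier R"
    and "{b. u b \<noteq> \<zero>\<^bsub>R\<^esub>} \<subseteq> T"
  shows "family_sum R M m u = finsum M (\<lambda>b. u b \<odot>\<^bsub>M\<^esub> m b) T"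
proof -
  interpret M: lmod R M by (rule M)
  show ?thesis unfolding family_sum_def
    using assms by (intro M.finsum_superset) (auto simp: M.smult_closed M.smult_zero_left[OF abelian_group_R])
qed

lemma finsum_lmod_hom:
  assumes h: "h \<in> lmod_hom R M N" and "abelian_group M" "abelian_group N"
    and "finite T" "\<And>b. b \<in> T \<Longrightarrow> f b \<in> carrier M"
  shows "h (finsum M f T) = finsum N (\<lambda>b. h (f b)) T"
proof -
  interpret M: abelian_group M by fact
  interpret N: abelian_group N by fact
  show ?thesis using assms(4,5)
    by (induction T) (use lmod_homD[OF h] in \<open>auto simp: lmod_hom_zero[OF h] Pi_iff assms(2,3)\<close>)
qed

lemma hom_family_sum:
  assumes h: "h \<in> lmod_hom R M N" and M: "lmod R M" and N: "abelian_group N"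
    and m: "\<And>b. b \<in> I \<Longrightarrow> m b \<in> carrier M" and u: "u \<in> carrier (free_module R I)"
  shows "h (family_sum R M m u) = family_sum R N (\<lambda>b. h (m b)) u"
proof -
  interpret M: lmod R M by (rule M)
  interpret N: abelian_group N by (rule N)
  have I: "b \<in> I" if "u b \<noteq> \<zero>\<^bsub>R\<^esub>" for b using u that by auto
  have "h (family_sum R M m u) = finsum N (\<lambda>b. h (u b \<odot>\<^bsub>M\<^esub> m b)) {b. u b \<noteq> \<zero>\<^bsub>R\<^esub>}"
    unfolding family_sum_def using u m I
    by (intro finsum_lmod_hom[OF h M.abelian_group_axioms N]) (auto intro!: M.smult_closed)
  also have "\<dots> = family_sum R N (\<lambda>b. h (m b)) u"
    unfolding family_sum_def
  proof (intro N.finsum_cong'[symmetric])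
    have um: "u b \<odot>\<^bsub>M\<^esub> m b \<in> carrier M" "m b \<in> carrier M" if "u b \<noteq> \<zero>\<^bsub>R\<^esub>" for b
      using u m I[OF that] by (auto intro: M.smult_closed)
    then show "(\<lambda>b. h (u b \<odot>\<^bsub>M\<^esub> m b)) \<in> {b. u b \<noteq> \<zero>\<^bsub>R\<^esub>} \<rightarrow> carrier N"
      using lmod_homD(1)[OF h] by blast
    show "u b \<odot>\<^bsub>N\<^esub> h (m b) = h (u b \<odot>\<^bsub>M\<^esub> m b)" if "b \<in> {b. u b \<noteq> \<zero>\<^bsub>R\<^esub>}" for b
      using lmod_homD(3)[OF h, of "u b" "m b"] um that u by simp
  qed simp
  finally show ?thesis .
qed

lemma family_sum_hom:
  assumes M: "lmod R M" and m: "\<And>b. b \<in> I \<Longrightarrow> m b \<in> carrier M"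
  shows "family_sum R M m \<in> lmod_hom R (free_module R I) M"
proof (rule lmod_homI)
  interpret M: lmod R M by (rule M)
  note z = M.smult_zero_left[OF abelian_group_R]
  {
    fix u assume u: "u \<in> carrier (free_module R I)"
    have I: "b \<in> I" if "u b \<noteq> \<zero>\<^bsub>R\<^esub>" for b using u that by auto
    show "family_sum R M m u \<in> carrier M"
      unfolding family_sum_def using u m I by (auto intro!: M.finsum_closed M.smult_closed)
    fix v assume v: "v \<in> carrier (free_module R I)"
    let ?T = "{b. u b \<noteq> \<zero>\<^bsub>R\<^esub>} \<union> {b. v b \<noteq> \<zero>\<^bsub>R\<^esub>}"
    have T: "finite ?T" "?T \<subseteq> I" using u v by auto
    have mT: "m b \<in> carrier M" if "b \<in> ?T" for b using m T that by blast
    have uv: "u b \<in> carrier R" "v b \<in> carrier R" for b using u v by auto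
    have uvT: "u b \<odot>\<^bsub>M\<^esub> m b \<in> carrier M" "v b \<odot>\<^bsub>M\<^esub> m b \<in> carrier M" if "b \<in> ?T" for b
      using mT[OF that] uv by (auto intro: M.smult_closed)
    have "family_sum R M m (u \<oplus>\<^bsub>free_module R I\<^esub> v) = finsum M (\<lambda>b. (u \<oplus>\<^bsub>free_module R I\<^esub> v) b \<odot>\<^bsub>M\<^esub> m b) ?T"
      by (rule family_sum_superset[OF M mT T(1)]) (use uv in auto)
    also have "\<dots> = finsum M (\<lambda>b. u b \<odot>\<^bsub>M\<^esub> m b \<oplus>\<^bsub>M\<^esub> v b \<odot>\<^bsub>M\<^esub> m b) ?T"
    proof (intro M.finsum_cong' refl)
      show "(\<lambda>b. u b \<odot>\<^bsub>M\<^esub> m b \<oplus>\<^bsub>M\<^esub> v b \<odot>\<^bsub>M\<^esub> m b) \<in> ?T \<rightarrow> carrier M"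
        using uvT by blast
      show "(u \<oplus>\<^bsub>free_module R I\<^esub> v) b \<odot>\<^bsub>M\<^esub> m b = u b \<odot>\<^bsub>M\<^esub> m b \<oplus>\<^bsub>M\<^esub> v b \<odot>\<^bsub>M\<^esub> m b"
        if "b \<in> ?T" for b using M.smult_l_distr[OF uv mT[OF that]] by simp
    qed
    also have "\<dots> = finsum M (\<lambda>b. u b \<odot>\<^bsub>M\<^esub> m b) ?T \<oplus>\<^bsub>M\<^esub> finsum M (\<lambda>b. v b \<odot>\<^bsub>M\<^esub> m b) ?T"
      by (rule M.finsum_addf) (use uvT in blast)+
    also have "\<dots> = family_sum R M m u \<oplus>\<^bsub>M\<^esub> family_sum R M m v"
    proof -
      have "family_sum R M m u = finsum M (\<lambda>b. u b \<odot>\<^bsub>M\<^esub> m b) ?T"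
        by (rule family_sum_superset[OF M mT T(1)]) (use uv in auto)
      moreover have "family_sum R M m v = finsum M (\<lambda>b. v b \<odot>\<^bsub>M\<^esub> m b) ?T"
        by (rule family_sum_superset[OF M mT T(1)]) (use uv in auto)
      ultimately show ?thesis by simp
    qed
    finally show "family_sum R M m (u \<oplus>\<^bsub>free_module R I\<^esub> v) = family_sum R M m u \<oplus>\<^bsub>M\<^esub> family_sum R M m v" .
  next
    fix r u assume r: "r \<in> carrier R" and u: "u \<in> carrier (free_module R I)"
    let ?T = "{b. u b \<noteq> \<zero>\<^bsub>R\<^esub>}"
    have T: "finite ?T" "?T \<subseteq> I" using u by auto
    have mT: "m b \<in> carrier M" if "b \<in> ?T" for b using m T that by blast
    have uR: "u b \<in> carrier R" for b using u by auto
    have uT: "u b \<odot>\<^bsub>M\<^esub> m b \<in> carrier M" if "b \<in> ?T" for b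
      using mT[OF that] uR by (auto intro: M.smult_closed)
    have "family_sum R M m (r \<odot>\<^bsub>free_module R I\<^esub> u) = finsum M (\<lambda>b. (r \<odot>\<^bsub>free_module R I\<^esub> u) b \<odot>\<^bsub>M\<^esub> m b) ?T"
      by (rule family_sum_superset[OF M mT T(1)]) (use uR r in \<open>auto simp: mult_closed regular_simps\<close>)
    also have "\<dots> = finsum M (\<lambda>b. r \<odot>\<^bsub>M\<^esub> (u b \<odot>\<^bsub>M\<^esub> m b)) ?T"
    proof (intro M.finsum_cong' refl)
      show "(\<lambda>b. r \<odot>\<^bsub>M\<^esub> (u b \<odot>\<^bsub>M\<^esub> m b)) \<in> ?T \<rightarrow> carrier M"
        using uT r by (auto intro: M.smult_closed)
      show "(r \<odot>\<^bsub>free_module R I\<^esub> u) b \<odot>\<^bsub>M\<^esub> m b = r \<odot>\<^bsub>M\<^esub> (u b \<odot>\<^bsub>M\<^esub> m b)"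
        if "b \<in> ?T" for b using M.smult_assoc[OF r uR mT[OF that]] by simp
    qed
    also have "\<dots> = r \<odot>\<^bsub>M\<^esub> finsum M (\<lambda>b. u b \<odot>\<^bsub>M\<^esub> m b) ?T"
      by (rule M.finsum_smult[OF T(1) r uT, symmetric])
    also have "\<dots> = r \<odot>\<^bsub>M\<^esub> family_sum R M m u" by (simp add: family_sum_def)
    finally show "family_sum R M m (r \<odot>\<^bsub>free_module R I\<^esub> u) = r \<odot>\<^bsub>M\<^esub> family_sum R M m u" .
  }
qed

lemma left_unit:
  assumes M: "lmod R M" and m: "m \<in> carrier M"
  shows "\<exists>e\<in>carrier R. e \<odot>\<^bsub>M\<^esub> m = m"
proof -
  interpret M: lmod R M by (rule M)
  have "m \<in> generate (add_monoid M) {r \<odot>\<^bsub>M\<^esub> m | r m. r \<in> carrier R \<and> m \<in> carrier M}"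
    using M.nondegenerate m by blast
  \<comment> \<open>The claim is strengthened to a finite set \<open>F\<close> of ring elements such
    that every left unit of \<open>F\<close> fixes \<open>m\<close>. Unlike single units, such sets
    can simply be united when elements are added.\<close>
  then have "\<exists>F. finite F \<and> F \<subseteq> carrier R \<and> m \<in> carrier M \<and> (\<forall>e\<in>carrier R. (\<forall>f\<in>F. e \<otimes>\<^bsub>R\<^esub> f = f) \<longrightarrow> e \<odot>\<^bsub>M\<^esub> m = m)"
  proof (induction m rule: generate.induct)
    case one
    then show ?case by (intro exI[of _ "{}"]) (auto simp: M.smult_zero_right)
  next
    case (incl h)
    then obtain r m where "r \<in> carrier R" "m \<in> carrier M" "h = r \<odot>\<^bsub>M\<^esub> m" by blast
    then show ?case by (intro exI[of _ "{r}"]) (auto simp: M.smult_assoc[symmetric] M.smult_closed)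
  next
    case (inv h)
    then obtain r m where "r \<in> carrier R" "m \<in> carrier M" "h = r \<odot>\<^bsub>M\<^esub> m" by blast
    then show ?case
      by (intro exI[of _ "{r}"])
        (auto simp: M.smult_assoc[symmetric] M.smult_closed M.smult_minus_right simp flip: a_inv_def)
  next
    case (eng h k)
    then obtain F F' where "finite F" "F \<subseteq> carrier R" "h \<in> carrier M"
        "\<forall>e\<in>carrier R. (\<forall>f\<in>F. e \<otimes>\<^bsub>R\<^esub> f = f) \<longrightarrow> e \<odot>\<^bsub>M\<^esub> h = h"
      and "finite F'" "F' \<subseteq> carrier R" "k \<in> carrier M"
        "\<forall>e\<in>carrier R. (\<forall>f\<in>F'. e \<otimes>\<^bsub>R\<^esub> f = f) \<longrightarrow> e \<odot>\<^bsub>M\<^esub> k = k" by blast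
    then show ?case by (intro exI[of _ "F \<union> F'"]) (auto simp: M.smult_r_distr)
  qed
  then obtain F where F: "finite F" "F \<subseteq> carrier R"
    "\<forall>e\<in>carrier R. (\<forall>f\<in>F. e \<otimes>\<^bsub>R\<^esub> f = f) \<longrightarrow> e \<odot>\<^bsub>M\<^esub> m = m" by blast
  obtain e where "e \<in> carrier R" "\<forall>f\<in>F. e \<otimes>\<^bsub>R\<^esub> f = f" using local_units[OF F(1,2)] by blast
  then show ?thesis using F(3) by blast
qed

text \<open>
  Non-degeneracy makes the evaluation map from the direct sum of copies of \<open>R\<close> indexed by \<open>P\<close> onto,
  so lifting the identity of \<open>P\<close> gives coordinate functionals.
\<close>

lemma projective_dual_basis:
  fixes P :: "('r, 'p) module"
  assumes "projective_module R P"
  obtains \<iota> where "\<iota> \<in> lmod_hom R P (free_module R (carrier P))"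
    "\<And>p. p \<in> carrier P \<Longrightarrow> family_sum R P (\<lambda>b. b) (\<iota> p) = p"
proof -
  have P: "left_module R P" using assms by (simp add: projective_module_def)
  then have P': "lmod R P" by (rule lmod.intro)
  interpret P: lmod R P by (rule P')
  let ?F = "free_module R (carrier P)"
  let ?q = "family_sum R P (\<lambda>b. b)"
  have q: "?q \<in> lmod_hom R ?F P" by (rule family_sum_hom[OF P']) simp
  have onto: "?q ` carrier ?F = carrier P"
  proof
    show "?q ` carrier ?F \<subseteq> carrier P" using lmod_homD(1)[OF q] by blast
    show "carrier P \<subseteq> ?q ` carrier ?F"
    proof
      fix p assume p: "p \<in> carrier P"
      obtain e where e: "e \<in> carrier R" "e \<odot>\<^bsub>P\<^esub> p = p" using left_unit[OF P' p] by blast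
      \<comment> \<open>A left unit of \<open>p\<close> in the place indexed by \<open>p\<close>
        itself stands in for the missing unit vector.\<close>
      let ?u = "\<lambda>b. if b = p then e else \<zero>\<^bsub>R\<^esub>"
      have "finite {b. ?u b \<noteq> \<zero>\<^bsub>R\<^esub>}" by (rule finite_subset[of _ "{p}"]) auto
      then have u: "?u \<in> carrier ?F" using p e by auto
      have "?q ?u = finsum P (\<lambda>b. ?u b \<odot>\<^bsub>P\<^esub> b) {p}"
        by (rule family_sum_superset[OF P']) (use p e in auto)
      also have "\<dots> = p" using p e by (simp add: P.finsum_insert)
      finally show "p \<in> ?q ` carrier ?F" using u by (metis image_eqI)
    qed
  qed
  have "left_module R ?F" by (rule lmod.axioms[OF free_module_lmod])
  moreover have "(\<lambda>p. p) \<in> lmod_hom R P P" by (auto simp: lmod_hom_def)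
  ultimately have "\<exists>l \<in> lmod_hom R P ?F. \<forall>p\<in>carrier P. ?q (l p) = p"
    using assms P q onto unfolding projective_module_def by blast
  then show thesis using that by blast
qed

text \<open>\<open>projective_module\<close> tests lifting against modules on two fixed types.
  Coordinates remove this restriction: an arbitrary preimage of \<open>f b\<close> is chosen for
  each \<open>b\<close>, and these are combined with the coordinates of \<open>p\<close>. It is
  enough that \<open>q\<close> covers the image of \<open>f\<close>.\<close>

lemma projective_lift:
  assumes P: "projective_module R P" and M: "lmod R M" and N: "abelian_group N"
    and f: "f \<in> lmod_hom R P N" and q: "q \<in> lmod_hom R M N"
    and sub: "f ` carrier P \<subseteq> q ` carrier M"
  shows "\<exists>l\<in>lmod_hom R P M. \<forall>p\<in>carrier P. q (l p) = f p"
proof -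
  obtain \<iota> where \<iota>: "\<iota> \<in> lmod_hom R P (free_module R (carrier P))"
    and \<iota>2: "\<And>p. p \<in> carrier P \<Longrightarrow> family_sum R P (\<lambda>b. b) (\<iota> p) = p"
    using projective_dual_basis[OF P] by blast
  have P': "lmod R P" using P by (simp add: projective_module_def lmod_def)
  interpret N: abelian_group N by (rule N)
  obtain m where m: "\<And>b. b \<in> carrier P \<Longrightarrow> m b \<in> carrier M \<and> q (m b) = f b"
  proof -
    have "\<forall>b\<in>carrier P. \<exists>x. x \<in> carrier M \<and> q x = f b"
    proof
      fix b assume "b \<in> carrier P"
      then have "f b \<in> q ` carrier M" using sub by blast
      then show "\<exists>x. x \<in> carrier M \<and> q x = f b" by auto
    qed
    then show thesis using that by (metis (no_types) bchoice)
  qed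
  let ?l = "\<lambda>p. family_sum R M m (\<iota> p)"
  have l: "?l \<in> lmod_hom R P M"
    by (rule lmod_hom_compose[OF \<iota> family_sum_hom[OF M]]) (use m in auto)
  have ql: "q (?l p) = f p" if p: "p \<in> carrier P" for p
  proof -
    have \<iota>p: "\<iota> p \<in> carrier (free_module R (carrier P))" by (rule lmod_homD(1)[OF \<iota> p])
    have "q (?l p) = family_sum R N (\<lambda>b. q (m b)) (\<iota> p)"
      by (rule hom_family_sum[OF q M N _ \<iota>p]) (use m in auto)
    also have "\<dots> = family_sum R N f (\<iota> p)"
    proof -
      have "\<And>b. b \<in> {b. \<iota> p b \<noteq> \<zero>\<^bsub>R\<^esub>} \<Longrightarrow> b \<in> carrier P" using \<iota>p by auto
      \<comment> \<open>\<open>N\<close> is just an abelian group here, so closure under multiples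
        comes from the linearity of \<open>f\<close>.\<close>
      moreover have "\<iota> p b \<odot>\<^bsub>N\<^esub> f b \<in> carrier N" if "b \<in> carrier P" for b
      proof -
        have "\<iota> p b \<odot>\<^bsub>N\<^esub> f b = f (\<iota> p b \<odot>\<^bsub>P\<^esub> b)" using lmod_homD(3)[OF f] \<iota>p that by auto
        moreover have "\<iota> p b \<odot>\<^bsub>P\<^esub> b \<in> carrier P"
          using left_module.smult_closed[OF lmod.axioms[OF P']] \<iota>p that by auto
        ultimately show ?thesis using lmod_homD(1)[OF f] by simp
      qed
      ultimately show ?thesis unfolding family_sum_def using m by (intro N.finsum_cong') auto
    qed
    also have "\<dots> = f (family_sum R P (\<lambda>b. b) (\<iota> p))"
      by (rule hom_family_sum[OF f P' N _ \<iota>p, symmetric]) auto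
    finally show ?thesis using \<iota>2[OF p] by simp
  qed
  show ?thesis by (rule bexI[where P = "\<lambda>l. \<forall>p\<in>carrier P. q (l p) = f p", OF _ l]) (simp add: ql)
qed

lemma projective_locally_projective:
  assumes P: "projective_module R P"
  shows "locally_projective R P (carrier P)"
  unfolding locally_projective_def
proof (intro allI impI, elim conjE)
  fix Y assume Y: "finite Y" "Y \<subseteq> carrier P"
  obtain \<iota> where \<iota>: "\<iota> \<in> lmod_hom R P (free_module R (carrier P))"
    and \<iota>2: "\<And>p. p \<in> carrier P \<Longrightarrow> family_sum R P (\<lambda>b. b) (\<iota> p) = p"
    using projective_dual_basis[OF P] by blast
  have P': "lmod R P" using P by (simp add: projective_module_def lmod_def)
  interpret P: lmod R P by (rule P')
  have \<iota>F: "\<And>y. y \<in> Y \<Longrightarrow> \<iota> y \<in> carrier (free_module R (carrier P))" using lmod_homD(1)[OF \<iota>] Y by blast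
  \<comment> \<open>Finitely many elements have finitely many nonzero coordinates altogether; only
    these indices enter the list.\<close>
  let ?S = "\<Union>y\<in>Y. {b. \<iota> y b \<noteq> \<zero>\<^bsub>R\<^esub>}"
  have "finite ?S"
  proof (rule finite_UN_I[OF Y(1)])
    show "finite {b. \<iota> y b \<noteq> \<zero>\<^bsub>R\<^esub>}" if "y \<in> Y" for y using \<iota>F[OF that] by simp
  qed
  then obtain bs where bs: "set bs = ?S" "distinct bs" using finite_distinct_list by blast
  have bsP: "set bs \<subseteq> carrier P"
  proof
    fix b assume "b \<in> set bs"
    then obtain y where "y \<in> Y" "\<iota> y b \<noteq> \<zero>\<^bsub>R\<^esub>" using bs(1) by blast
    then show "b \<in> carrier P" using \<iota>F[of y] by auto
  qed
  have "lincomb P (map (\<lambda>b. (\<lambda>p. \<iota> p b, b)) bs) y = y" if y: "y \<in> Y" for y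
  proof -
    have uR: "\<And>b. \<iota> y b \<in> carrier R" using \<iota>F[OF y] by auto
    have "lincomb P (map (\<lambda>b. (\<lambda>p. \<iota> p b, b)) bs) y = finsum P (\<lambda>b. \<iota> y b \<odot>\<^bsub>P\<^esub> b) (set bs)"
      using bs(2) bsP
    proof (induction bs)
      case (Cons b bs)
      then have "(\<lambda>b. \<iota> y b \<odot>\<^bsub>P\<^esub> b) \<in> set bs \<rightarrow> carrier P" "\<iota> y b \<odot>\<^bsub>P\<^esub> b \<in> carrier P"
        using uR by (auto intro!: P.smult_closed)
      then show ?case using Cons by simp
    qed simp
    also have "\<dots> = family_sum R P (\<lambda>b. b) (\<iota> y)"
      by (rule family_sum_superset[OF P' _ finite_set uR, symmetric]) (use bsP bs(1) y in blast)+
    finally show ?thesis using \<iota>2 y Y by auto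
  qed
  moreover have "(\<lambda>p. \<iota> p b) \<in> lmod_hom R P (regular_module R)" for b
  proof (rule lmod_homI)
    show "\<iota> x b \<in> carrier (regular_module R)" if "x \<in> carrier P" for x
      using lmod_homD(1)[OF \<iota> that] by simp
    show "\<iota> (x \<oplus>\<^bsub>P\<^esub> y) b = \<iota> x b \<oplus>\<^bsub>regular_module R\<^esub> \<iota> y b" if "x \<in> carrier P" "y \<in> carrier P" for x y
      using lmod_homD(2)[OF \<iota> that] by simp
    show "\<iota> (r \<odot>\<^bsub>P\<^esub> x) b = r \<odot>\<^bsub>regular_module R\<^esub> \<iota> x b" if "r \<in> carrier R" "x \<in> carrier P" for r x
      using lmod_homD(3)[OF \<iota> that] by simp
  qed
  ultimately show "\<exists>cs. (\<forall>c\<in>set cs. fst c \<in> lmod_hom R P (regular_module R) \<and> snd c \<in> carrier P) \<and>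
             (\<forall>y\<in>Y. lincomb P cs y = y)"
    using bsP by (intro exI[of _ "map (\<lambda>b. (\<lambda>p. \<iota> p b, b)) bs"]) (simp add: subset_iff)
qed

end

section \<open>Direct sums of two modules\<close>

definition prod_module :: "('r, 'm) module \<Rightarrow> ('r, 'n) module \<Rightarrow> ('r, 'm \<times> 'n) module" where
  "prod_module M N = \<lparr>carrier = carrier M \<times> carrier N, monoid.mult = undefined, one = undefined,
     ring.zero = (\<zero>\<^bsub>M\<^esub>, \<zero>\<^bsub>N\<^esub>), add = (\<lambda>x y. (fst x \<oplus>\<^bsub>M\<^esub> fst y, snd x \<oplus>\<^bsub>N\<^esub> snd y)),
     smult = (\<lambda>r x. (r \<odot>\<^bsub>M\<^esub> fst x, r \<odot>\<^bsub>N\<^esub> snd x))\<rparr>"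

lemma prod_module_simps [simp]:
  "carrier (prod_module M N) = carrier M \<times> carrier N"
  "\<zero>\<^bsub>prod_module M N\<^esub> = (\<zero>\<^bsub>M\<^esub>, \<zero>\<^bsub>N\<^esub>)"
  "add (prod_module M N) = (\<lambda>x y. (fst x \<oplus>\<^bsub>M\<^esub> fst y, snd x \<oplus>\<^bsub>N\<^esub> snd y))"
  "smult (prod_module M N) = (\<lambda>r x. (r \<odot>\<^bsub>M\<^esub> fst x, r \<odot>\<^bsub>N\<^esub> snd x))"
  by (simp_all add: prod_module_def)

text \<open>A zero module in the type of \<open>M\<close>, so that degree 0 of the mapping cone has
  the same type as the other degrees.\<close>

definition zero_module :: "('r, 'm) module \<Rightarrow> ('r, 'm) module" where
  "zero_module M = M\<lparr>carrier := {\<zero>\<^bsub>M\<^esub>}\<rparr>"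

lemma zero_module_simps [simp]:
  "carrier (zero_module M) = {\<zero>\<^bsub>M\<^esub>}" "\<zero>\<^bsub>zero_module M\<^esub> = \<zero>\<^bsub>M\<^esub>"
  "add (zero_module M) = add M" "smult (zero_module M) = smult M"
  by (simp_all add: zero_module_def)

text \<open>Non-degeneracy holds because each \<open>m\<close> is itself a product
  \<open>e m\<close>.\<close>

lemma lmodI_left_units:
  fixes R :: "('r, 'x) ring_scheme" and M :: "('r, 'm) module"
  assumes "abelian_group M"
    and "\<And>r m. \<lbrakk>r \<in> carrier R; m \<in> carrier M\<rbrakk> \<Longrightarrow> r \<odot>\<^bsub>M\<^esub> m \<in> carrier M"
    and "\<And>r r' m. \<lbrakk>r \<in> carrier R; r' \<in> carrier R; m \<in> carrier M\<rbrakk>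
        \<Longrightarrow> (r \<oplus>\<^bsub>R\<^esub> r') \<odot>\<^bsub>M\<^esub> m = r \<odot>\<^bsub>M\<^esub> m \<oplus>\<^bsub>M\<^esub> r' \<odot>\<^bsub>M\<^esub> m"
    and "\<And>r m m'. \<lbrakk>r \<in> carrier R; m \<in> carrier M; m' \<in> carrier M\<rbrakk>
        \<Longrightarrow> r \<odot>\<^bsub>M\<^esub> (m \<oplus>\<^bsub>M\<^esub> m') = r \<odot>\<^bsub>M\<^esub> m \<oplus>\<^bsub>M\<^esub> r \<odot>\<^bsub>M\<^esub> m'"
    and "\<And>r r' m. \<lbrakk>r \<in> carrier R; r' \<in> carrier R; m \<in> carrier M\<rbrakk>
        \<Longrightarrow> (r \<otimes>\<^bsub>R\<^esub> r') \<odot>\<^bsub>M\<^esub> m = r \<odot>\<^bsub>M\<^esub> (r' \<odot>\<^bsub>M\<^esub> m)"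
    and unit: "\<And>m. m \<in> carrier M \<Longrightarrow> \<exists>e\<in>carrier R. e \<odot>\<^bsub>M\<^esub> m = m"
  shows "lmod R M"
proof (rule lmod.intro, intro left_module.intro left_module_axioms.intro)
  show "carrier M \<subseteq> generate (add_monoid M) {r \<odot>\<^bsub>M\<^esub> m |r m. r \<in> carrier R \<and> m \<in> carrier M}"
  proof
    fix m assume m: "m \<in> carrier M"
    then obtain e where "e \<in> carrier R" "e \<odot>\<^bsub>M\<^esub> m = m" using unit by blast
    then show "m \<in> generate (add_monoid M) {r \<odot>\<^bsub>M\<^esub> m |r m. r \<in> carrier R \<and> m \<in> carrier M}"
      using m by (intro generate.incl) (metis (mono_tags, lifting) mem_Collect_eq)
  qed
qed (fact assms)+

context ring_with_local_units
begin

text \<open>One unit has to serve both components of a pair: take a left unit of the two ring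
  elements that fix \<open>m\<close> and \<open>n\<close>.\<close>

lemma common_left_unit:
  assumes M: "lmod R M" "m \<in> carrier M" and N: "lmod R N" "n \<in> carrier N"
  shows "\<exists>e\<in>carrier R. e \<odot>\<^bsub>M\<^esub> m = m \<and> e \<odot>\<^bsub>N\<^esub> n = n"
proof -
  interpret M: lmod R M by fact
  interpret N: lmod R N by fact
  obtain f where f: "f \<in> carrier R" "f \<odot>\<^bsub>M\<^esub> m = m" using left_unit[OF M] by blast
  obtain g where g: "g \<in> carrier R" "g \<odot>\<^bsub>N\<^esub> n = n" using left_unit[OF N] by blast
  obtain e where "e \<in> carrier R" "e \<otimes>\<^bsub>R\<^esub> f = f" "e \<otimes>\<^bsub>R\<^esub> g = g" 
    using local_units[of "{f, g}"] f g by auto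
  then have "e \<odot>\<^bsub>M\<^esub> m = m" "e \<odot>\<^bsub>N\<^esub> n = n" "e \<in> carrier R"
    using f g M.smult_assoc[of e f m] N.smult_assoc[of e g n] assms by simp_all
  then show ?thesis by blast
qed

lemma prod_module_lmod:
  assumes M: "lmod R M" and N: "lmod R N"
  shows "lmod R (prod_module M N)"
proof -
  interpret M: lmod R M by fact
  interpret N: lmod R N by fact
  have "abelian_group (prod_module M N)"
  proof (rule abelian_groupI)
    fix x assume "x \<in> carrier (prod_module M N)"
    then show "\<exists>y\<in>carrier (prod_module M N). y \<oplus>\<^bsub>prod_module M N\<^esub> x = \<zero>\<^bsub>prod_module M N\<^esub>"
      by (intro bexI[of _ "(\<ominus>\<^bsub>M\<^esub> fst x, \<ominus>\<^bsub>N\<^esub> snd x)"]) (auto simp: M.l_neg N.l_neg)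
  qed (auto simp: M.a_ac N.a_ac)
  moreover have "\<exists>e\<in>carrier R. e \<odot>\<^bsub>prod_module M N\<^esub> m = m" if "m \<in> carrier (prod_module M N)" for m
    using common_left_unit[OF M _ N, of "fst m" "snd m"] that by auto
  ultimately show ?thesis
    by (intro lmodI_left_units)
      (auto simp: M.smult_closed N.smult_closed M.smult_l_distr N.smult_l_distr
         M.smult_r_distr N.smult_r_distr M.smult_assoc N.smult_assoc)
qed

lemma zero_module_lmod:
  assumes M: "lmod R M"
  shows "lmod R (zero_module M)"
proof -
  interpret M: lmod R M by fact
  have "abelian_group (zero_module M)" by (rule abelian_groupI) auto
  moreover have "\<exists>e\<in>carrier R. e \<odot>\<^bsub>zero_module M\<^esub> m = m" if "m \<in> carrier (zero_module M)" for m
    using left_unit[OF M] that by auto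
  ultimately show ?thesis
    by (intro lmodI_left_units) (auto simp: M.smult_zero_right mult_closed)
qed

lemma lincomb_append:
  assumes "lmod R M" "\<And>c. c \<in> set (as @ bs) \<Longrightarrow> fst c y \<in> carrier R \<and> snd c \<in> carrier M"
  shows "lincomb M (as @ bs) y = lincomb M as y \<oplus>\<^bsub>M\<^esub> lincomb M bs y"
proof -
  interpret M: lmod R M by fact
  show ?thesis
    using assms(2)
  proof (induction as)
    case Nil then show ?case using M.lincomb_closed[of bs y] by simp
  next
    case (Cons a as) then show ?case
      using M.lincomb_closed[of as y] M.lincomb_closed[of bs y] by (simp add: M.smult_closed M.a_assoc)
  qed
qed

lemma zero_module_locally_projective: "locally_projective R (zero_module M) (carrier (zero_module M))"
  unfolding locally_projective_def by (intro allI impI exI[of _ "[]"]) auto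

lemma prod_module_locally_projective:
  fixes M :: "('r, 'm) module" and N :: "('r, 'n) module"
  assumes M: "lmod R M" and N: "lmod R N"
    and LM: "locally_projective R M (carrier M)" and LN: "locally_projective R N (carrier N)"
  shows "locally_projective R (prod_module M N) (carrier (prod_module M N))"
  unfolding locally_projective_def
proof (intro allI impI, elim conjE)
  interpret M: lmod R M by fact
  interpret N: lmod R N by fact
  let ?P = "prod_module M N"
  fix Y assume Y: "finite Y" "Y \<subseteq> carrier ?P"
  obtain as where as: "\<forall>c\<in>set as. fst c \<in> lmod_hom R M (regular_module R) \<and> snd c \<in> carrier M"
    and asY: "\<forall>y\<in>fst ` Y. lincomb M as y = y"
    using LM[unfolded locally_projective_def, rule_format, of "fst ` Y"] Y by (fastforce simp del: ball_simps)
  obtain bs where bs: "\<forall>c\<in>set bs. fst c \<in> lmod_hom R N (regular_module R) \<and> snd c \<in> carrier N"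
    and bsY: "\<forall>y\<in>snd ` Y. lincomb N bs y = y"
    using LN[unfolded locally_projective_def, rule_format, of "snd ` Y"] Y by (fastforce simp del: ball_simps)
  let ?as = "map (\<lambda>c. (\<lambda>x. fst c (fst x), (snd c, \<zero>\<^bsub>N\<^esub>))) as :: (('m \<times> 'n \<Rightarrow> 'r) \<times> 'm \<times> 'n) list"
  let ?bs = "map (\<lambda>c. (\<lambda>x. fst c (snd x), (\<zero>\<^bsub>M\<^esub>, snd c))) bs :: (('m \<times> 'n \<Rightarrow> 'r) \<times> 'm \<times> 'n) list"
  show "\<exists>cs. (\<forall>c\<in>set cs. fst c \<in> lmod_hom R ?P (regular_module R) \<and> snd c \<in> carrier ?P) \<and>
             (\<forall>y\<in>Y. lincomb ?P cs y = y)"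
  proof (intro exI[of _ "?as @ ?bs"] conjI ballI)
    fix c assume "c \<in> set (?as @ ?bs)"
    then consider a where "a \<in> set as" "c = (\<lambda>x. fst a (fst x), (snd a, \<zero>\<^bsub>N\<^esub>))"
      | a where "a \<in> set bs" "c = (\<lambda>x. fst a (snd x), (\<zero>\<^bsub>M\<^esub>, snd a))" by auto
    then have "fst c \<in> lmod_hom R ?P (regular_module R) \<and> snd c \<in> carrier ?P"
    proof cases
      case 1
      have "fst \<in> lmod_hom R ?P M" by (auto simp: lmod_hom_def)
      then have "(\<lambda>x. fst a (fst x)) \<in> lmod_hom R ?P (regular_module R)"
        using as 1(1) by (blast intro: lmod_hom_compose)
      then show ?thesis using as 1 by auto
    next
      case 2
      have "snd \<in> lmod_hom R ?P N" by (auto simp: lmod_hom_def)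
      then have "(\<lambda>x. fst a (snd x)) \<in> lmod_hom R ?P (regular_module R)"
        using bs 2(1) by (blast intro: lmod_hom_compose)
      then show ?thesis using bs 2 by auto
    qed
    then show "fst c \<in> lmod_hom R ?P (regular_module R)" "snd c \<in> carrier ?P" by simp_all
  next
    fix y assume y: "y \<in> Y"
    then have y': "fst y \<in> carrier M" "snd y \<in> carrier N" using Y by auto
    have as': "fst c (fst y) \<in> carrier R \<and> snd c \<in> carrier M" if "c \<in> set as" for c
      using as that lmod_homD(1)[of "fst c" R M "regular_module R", OF _ y'(1)] by auto
    have bs': "fst c (snd y) \<in> carrier R \<and> snd c \<in> carrier N" if "c \<in> set bs" for c
      using bs that lmod_homD(1)[of "fst c" R N "regular_module R", OF _ y'(2)] by auto
    have 1: "lincomb ?P ?as y = (lincomb M as (fst y), \<zero>\<^bsub>N\<^esub>)"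
      using as' by (induction as) (simp_all add: N.smult_zero_right)
    have 2: "lincomb ?P ?bs y = (\<zero>\<^bsub>M\<^esub>, lincomb N bs (snd y))"
      using bs' by (induction bs) (simp_all add: M.smult_zero_right)
    have "lincomb ?P (?as @ ?bs) y = lincomb ?P ?as y \<oplus>\<^bsub>?P\<^esub> lincomb ?P ?bs y"
    proof (rule lincomb_append[OF prod_module_lmod[OF M N]])
      show "fst c y \<in> carrier R \<and> snd c \<in> carrier ?P" if "c \<in> set (?as @ ?bs)" for c
        using that as' bs' by auto
    qed
    then show "lincomb ?P (?as @ ?bs) y = y" using 1 2 asY bsY y y' by simp
  qed
qed

end

text \<open>Projections and inclusions are homomorphisms, and homomorphisms map spans of
  \<open>J\<close> into spans of \<open>J\<close>.\<close>

lemma (in right_ideal) ideal_span_prod_iff: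
  assumes M: "lmod R M" and N: "lmod R N"
  shows "x \<in> ideal_span J (prod_module M N) \<longleftrightarrow> fst x \<in> ideal_span J M \<and> snd x \<in> ideal_span J N"
proof
  interpret M: lmod R M by fact
  interpret N: lmod R N by fact
  interpret P: lmod R "prod_module M N" by (rule prod_module_lmod[OF M N])
  {
    assume x: "x \<in> ideal_span J (prod_module M N)"
    have "fst \<in> lmod_hom R (prod_module M N) M" "snd \<in> lmod_hom R (prod_module M N) N"
      by (auto simp: lmod_hom_def)
    from P.ideal_span_hom[OF this(1) M J_subset x] P.ideal_span_hom[OF this(2) N J_subset x]
    show "fst x \<in> ideal_span J M \<and> snd x \<in> ideal_span J N" by simp
  next
    assume x: "fst x \<in> ideal_span J M \<and> snd x \<in> ideal_span J N"
    have "(\<lambda>a. (a, \<zero>\<^bsub>N\<^esub>)) \<in> lmod_hom R M (prod_module M N)" "(\<lambda>a. (\<zero>\<^bsub>M\<^esub>, a)) \<in> lmod_hom R N (prod_module M N)"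
      by (auto simp: lmod_hom_def N.smult_zero_right M.smult_zero_right)
    from M.ideal_span_hom[OF this(1) P.lmod_axioms J_subset] N.ideal_span_hom[OF this(2) P.lmod_axioms J_subset]
    have "(fst x, \<zero>\<^bsub>N\<^esub>) \<oplus>\<^bsub>prod_module M N\<^esub> (\<zero>\<^bsub>M\<^esub>, snd x) \<in> ideal_span J (prod_module M N)"
      using x P.ideal_spanD(3)[OF J_subset] by blast
    then show "x \<in> ideal_span J (prod_module M N)"
      using x M.ideal_spanD(1)[OF J_subset] N.ideal_spanD(1)[OF J_subset] by simp
  }
qed

section \<open>Comparison with a locally projective resolution\<close>

text \<open>The roles are not symmetric: homomorphisms are lifted out of the projective modules
  \<open>P n\<close> along \<open>\<delta>\<close> and \<open>\<eta>\<close>, whereas the modules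
  \<open>B n\<close> have only local dual bases.\<close>

locale resolution_pair = right_ideal R J
  for R :: "('r, 'x) ring_scheme" and J +
  fixes L :: "('r, 'l) module"
    and P :: "nat \<Rightarrow> ('r, 'p) module" and d :: "nat \<Rightarrow> 'p \<Rightarrow> 'p" and \<epsilon> :: "'p \<Rightarrow> 'l"
    and B :: "nat \<Rightarrow> ('r, 'b) module" and \<delta> :: "nat \<Rightarrow> 'b \<Rightarrow> 'b" and \<eta> :: "'b \<Rightarrow> 'l"
  assumes L: "abelian_group L"
    and P_resolution: "projective_resolution R L P d \<epsilon>"
    and B_lmod: "lmod R (B n)"
    and B_locally_projective: "locally_projective R (B n) (carrier (B n))"
    and \<delta>_hom: "\<delta> (Suc n) \<in> lmod_hom R (B (Suc n)) (B n)"
    and \<eta>_hom: "\<eta> \<in> lmod_hom R (B 0) L"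
    and \<eta>_onto: "\<eta> ` carrier (B 0) = carrier L"
    and B_exact_0: "\<delta> (Suc 0) ` carrier (B (Suc 0)) = {b \<in> carrier (B 0). \<eta> b = \<zero>\<^bsub>L\<^esub>}"
    and B_exact: "\<delta> (Suc (Suc n)) ` carrier (B (Suc (Suc n))) =
      {b \<in> carrier (B (Suc n)). \<delta> (Suc n) b = \<zero>\<^bsub>B n\<^esub>}"
begin

lemma P_projective: "projective_module R (P n)"
  and \<epsilon>_hom: "\<epsilon> \<in> lmod_hom R (P 0) L"
  and \<epsilon>_onto: "\<epsilon> ` carrier (P 0) = carrier L"
  and d_hom: "d (Suc n) \<in> lmod_hom R (P (Suc n)) (P n)"
  and P_exact_0: "d (Suc 0) ` carrier (P (Suc 0)) = {p \<in> carrier (P 0). \<epsilon> p = \<zero>\<^bsub>L\<^esub>}"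
  and P_exact: "d (Suc (Suc n)) ` carrier (P (Suc (Suc n))) =
      {p \<in> carrier (P (Suc n)). d (Suc n) p = \<zero>\<^bsub>P n\<^esub>}"
  using P_resolution by (auto simp: projective_resolution_def)

lemma P_lmod: "lmod R (P n)"
  using P_projective[of n] by (simp add: projective_module_def lmod_def)

sublocale L: abelian_group L by (rule L)

sublocale B: lmod R "B n" for n by (rule B_lmod)

sublocale P: lmod R "P n" for n by (rule P_lmod)

lemma dd: "p \<in> carrier (P (Suc (Suc n))) \<Longrightarrow> d (Suc n) (d (Suc (Suc n)) p) = \<zero>\<^bsub>P n\<^esub>"
  using P_exact[of n] by blast

lemma \<epsilon>d: "p \<in> carrier (P (Suc 0)) \<Longrightarrow> \<epsilon> (d (Suc 0) p) = \<zero>\<^bsub>L\<^esub>"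
  using P_exact_0 by blast

lemma \<delta>\<delta>: "b \<in> carrier (B (Suc (Suc n))) \<Longrightarrow> \<delta> (Suc n) (\<delta> (Suc (Suc n)) b) = \<zero>\<^bsub>B n\<^esub>"
  using B_exact[of n] by blast

lemma \<eta>\<delta>: "b \<in> carrier (B (Suc 0)) \<Longrightarrow> \<eta> (\<delta> (Suc 0) b) = \<zero>\<^bsub>L\<^esub>"
  using B_exact_0 by blast

lemmas d_in = lmod_homD[OF d_hom] and \<epsilon>_in = lmod_homD[OF \<epsilon>_hom]
  and \<delta>_in = lmod_homD[OF \<delta>_hom] and \<eta>_in = lmod_homD[OF \<eta>_hom]

section \<open>Comparison maps and their homotopies\<close>

definition comparison :: "(nat \<Rightarrow> 'p \<Rightarrow> 'b) \<Rightarrow> bool" where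
  "comparison \<tau> \<longleftrightarrow> (\<forall>n. \<tau> n \<in> lmod_hom R (P n) (B n)) \<and>
     (\<forall>p\<in>carrier (P 0). \<eta> (\<tau> 0 p) = \<epsilon> p) \<and>
     (\<forall>n. \<forall>p\<in>carrier (P (Suc n)). \<delta> (Suc n) (\<tau> (Suc n) p) = \<tau> n (d (Suc n) p))"

lemma lift_to_B:
  assumes f: "f \<in> lmod_hom R (P k) (B (Suc n))"
    and "\<And>p. p \<in> carrier (P k) \<Longrightarrow> \<delta> (Suc n) (f p) = \<zero>\<^bsub>B n\<^esub>"
  shows "\<exists>l\<in>lmod_hom R (P k) (B (Suc (Suc n))). \<forall>p\<in>carrier (P k). \<delta> (Suc (Suc n)) (l p) = f p"
proof (rule projective_lift[OF P_projective B_lmod _ f \<delta>_hom])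
  show "abelian_group (B (Suc n))" by (rule B.abelian_group_axioms)
  show "f ` carrier (P k) \<subseteq> \<delta> (Suc (Suc n)) ` carrier (B (Suc (Suc n)))"
    unfolding B_exact using assms(2) lmod_homD(1)[OF f] by blast
qed

lemma lift_to_B_0:
  assumes f: "f \<in> lmod_hom R (P k) (B 0)"
    and "\<And>p. p \<in> carrier (P k) \<Longrightarrow> \<eta> (f p) = \<zero>\<^bsub>L\<^esub>"
  shows "\<exists>l\<in>lmod_hom R (P k) (B (Suc 0)). \<forall>p\<in>carrier (P k). \<delta> (Suc 0) (l p) = f p"
proof (rule projective_lift[OF P_projective B_lmod _ f \<delta>_hom])
  show "abelian_group (B 0)" by (rule B.abelian_group_axioms)
  show "f ` carrier (P k) \<subseteq> \<delta> (Suc 0) ` carrier (B (Suc 0))"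
    unfolding B_exact_0 using assms(2) lmod_homD(1)[OF f] by blast
qed

lemma comparison_exists: "\<exists>\<tau>. comparison \<tau>"
proof -
  \<comment> \<open>\<open>A n t\<close> is what the next step has to know about \<open>t\<close>,
    namely that \<open>t d\<close> takes its values in the cycles and can therefore be lifted. In
    degree 0 this follows from compatibility with the augmentations; later it is part of the
    invariant.\<close>
  define A where "A n t \<longleftrightarrow> t \<in> lmod_hom R (P n) (B n) \<and>
    (case n of 0 \<Rightarrow> \<forall>p\<in>carrier (P 0). \<eta> (t p) = \<epsilon> p
     | Suc m \<Rightarrow> \<forall>p\<in>carrier (P (Suc (Suc m))). \<delta> (Suc m) (t (d (Suc (Suc m)) p)) = \<zero>\<^bsub>B m\<^esub>)" for n t
  have "\<exists>\<tau>. \<forall>n. A n (\<tau> n) \<and> (\<forall>p\<in>carrier (P (Suc n)). \<delta> (Suc n) (\<tau> (Suc n) p) = \<tau> n (d (Suc n) p))"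
  proof (rule dependent_nat_choice)
    have "\<exists>t\<in>lmod_hom R (P 0) (B 0). \<forall>p\<in>carrier (P 0). \<eta> (t p) = \<epsilon> p"
      by (rule projective_lift[OF P_projective B_lmod L \<epsilon>_hom \<eta>_hom]) (simp add: \<epsilon>_onto \<eta>_onto)
    then show "\<exists>t. A 0 t" unfolding A_def by auto
  next
    fix t n assume t: "A n t"
    then have th: "t \<in> lmod_hom R (P n) (B n)" by (simp add: A_def)
    have f: "(\<lambda>p. t (d (Suc n) p)) \<in> lmod_hom R (P (Suc n)) (B n)"
      by (rule lmod_hom_compose[OF d_hom th])
    have "\<exists>l\<in>lmod_hom R (P (Suc n)) (B (Suc n)). \<forall>p\<in>carrier (P (Suc n)). \<delta> (Suc n) (l p) = t (d (Suc n) p)"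
    proof (cases n)
      case 0
      have "\<eta> (t (d (Suc 0) p)) = \<zero>\<^bsub>L\<^esub>" if "p \<in> carrier (P (Suc 0))" for p
        using t that d_in(1)[of p 0] \<epsilon>d by (simp add: A_def 0)
      then show ?thesis using lift_to_B_0[of _ "Suc 0"] f unfolding 0 by blast
    next
      case (Suc m)
      have "\<delta> (Suc m) (t (d (Suc (Suc m)) p)) = \<zero>\<^bsub>B m\<^esub>" if "p \<in> carrier (P (Suc (Suc m)))" for p
        using t that by (simp add: A_def Suc)
      then show ?thesis using lift_to_B[of _ "Suc (Suc m)" m] f unfolding Suc by blast
    qed
    then obtain l where l: "l \<in> lmod_hom R (P (Suc n)) (B (Suc n))"
      and dl: "\<And>p. p \<in> carrier (P (Suc n)) \<Longrightarrow> \<delta> (Suc n) (l p) = t (d (Suc n) p)" by blast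
    have "\<delta> (Suc n) (l (d (Suc (Suc n)) p)) = \<zero>\<^bsub>B n\<^esub>" if "p \<in> carrier (P (Suc (Suc n)))" for p
      using that dl d_in(1) dd lmod_hom_zero[OF th P.abelian_group_axioms B.abelian_group_axioms] by simp
    then show "\<exists>l. A (Suc n) l \<and> (\<forall>p\<in>carrier (P (Suc n)). \<delta> (Suc n) (l p) = t (d (Suc n) p))"
      using l dl by (intro exI[of _ l]) (simp add: A_def)
  qed
  then obtain \<tau> where \<tau>: "\<forall>n. A n (\<tau> n) \<and> (\<forall>p\<in>carrier (P (Suc n)). \<delta> (Suc n) (\<tau> (Suc n) p) = \<tau> n (d (Suc n) p))" ..
  then have "A 0 (\<tau> 0)" by blast
  then show ?thesis using \<tau> unfolding comparison_def by (intro exI[of _ \<tau>]) (auto simp: A_def)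
qed

text \<open>The homotopy identity is written as \<open>\<tau> - \<tau>' - h d = \<delta> h\<close>,
  which is the equation solved by each lifting.\<close>

lemma comparison_homotopy:
  assumes \<tau>: "comparison \<tau>" and \<tau>': "comparison \<tau>'"
  shows "\<exists>h. (\<forall>n. h n \<in> lmod_hom R (P n) (B (Suc n))) \<and>
    (\<forall>p\<in>carrier (P 0). \<tau> 0 p \<ominus>\<^bsub>B 0\<^esub> \<tau>' 0 p = \<delta> (Suc 0) (h 0 p)) \<and>
    (\<forall>n. \<forall>p\<in>carrier (P (Suc n)). \<tau> (Suc n) p \<ominus>\<^bsub>B (Suc n)\<^esub> \<tau>' (Suc n) p \<ominus>\<^bsub>B (Suc n)\<^esub> h n (d (Suc n) p) =
      \<delta> (Suc (Suc n)) (h (Suc n) p))"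
proof -
  define D where "D n p = \<tau> n p \<ominus>\<^bsub>B n\<^esub> \<tau>' n p" for n p
  have \<tau>h: "\<tau> n \<in> lmod_hom R (P n) (B n)" "\<tau>' n \<in> lmod_hom R (P n) (B n)" for n
    using \<tau> \<tau>' by (auto simp: comparison_def)
  have D: "D n \<in> lmod_hom R (P n) (B n)" for n
    unfolding D_def by (rule lmod_hom_diff[OF \<tau>h B_lmod])
  note D_in = lmod_homD[OF D]
  note \<tau>_in = lmod_homD(1)[OF \<tau>h(1)] lmod_homD(1)[OF \<tau>h(2)]
  have \<delta>_diff: "\<delta> (Suc n) (x \<ominus>\<^bsub>B (Suc n)\<^esub> y) = \<delta> (Suc n) x \<ominus>\<^bsub>B n\<^esub> \<delta> (Suc n) y"
    if "x \<in> carrier (B (Suc n))" "y \<in> carrier (B (Suc n))" for x y n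
    using that by (simp add: a_minus_def \<delta>_in lmod_hom_minus[OF \<delta>_hom B.abelian_group_axioms B.abelian_group_axioms])
  have \<eta>D: "\<eta> (D 0 p) = \<zero>\<^bsub>L\<^esub>" if "p \<in> carrier (P 0)" for p
    using that \<tau>_in[of p 0] \<tau> \<tau>' \<epsilon>_in(1)[of p] lmod_hom_minus[OF \<eta>_hom B.abelian_group_axioms L.abelian_group_axioms]
    by (simp add: D_def a_minus_def \<eta>_in comparison_def L.r_neg)
  have \<delta>D: "\<delta> (Suc n) (D (Suc n) p) = D n (d (Suc n) p)" if "p \<in> carrier (P (Suc n))" for n p
    using that \<tau>_in[of p "Suc n"] \<tau> \<tau>' by (simp add: D_def \<delta>_diff comparison_def)
  \<comment> \<open>The second condition makes \<open>D (Suc n) - t d\<close> a cycle, as lifting in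
    the next degree requires. It propagates because \<open>d d = 0\<close>.\<close>
  define A where "A n t \<longleftrightarrow> t \<in> lmod_hom R (P n) (B (Suc n)) \<and>
    (\<forall>p\<in>carrier (P (Suc n)). \<delta> (Suc n) (t (d (Suc n) p)) = D n (d (Suc n) p)) \<and>
    (n = 0 \<longrightarrow> (\<forall>p\<in>carrier (P 0). \<delta> (Suc 0) (t p) = D 0 p))" for n t
  have "\<exists>h. \<forall>n. A n (h n) \<and> (\<forall>p\<in>carrier (P (Suc n)).
      \<delta> (Suc (Suc n)) (h (Suc n) p) = D (Suc n) p \<ominus>\<^bsub>B (Suc n)\<^esub> h n (d (Suc n) p))"
  proof (rule dependent_nat_choice)
    have "\<exists>l\<in>lmod_hom R (P 0) (B (Suc 0)). \<forall>p\<in>carrier (P 0). \<delta> (Suc 0) (l p) = D 0 p"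
      by (rule lift_to_B_0[OF D \<eta>D])
    then show "\<exists>t. A 0 t" unfolding A_def using d_in(1) by auto
  next
    fix t n assume t: "A n t"
    then have th: "t \<in> lmod_hom R (P n) (B (Suc n))" by (simp add: A_def)
    note t_in = lmod_homD[OF th]
    let ?f = "\<lambda>p. D (Suc n) p \<ominus>\<^bsub>B (Suc n)\<^esub> t (d (Suc n) p)"
    have f: "?f \<in> lmod_hom R (P (Suc n)) (B (Suc n))"
      by (rule lmod_hom_diff[OF D lmod_hom_compose[OF d_hom th] B_lmod])
    have "\<delta> (Suc n) (?f p) = \<zero>\<^bsub>B n\<^esub>" if p: "p \<in> carrier (P (Suc n))" for p
    proof -
      have "\<delta> (Suc n) (?f p) = D n (d (Suc n) p) \<ominus>\<^bsub>B n\<^esub> \<delta> (Suc n) (t (d (Suc n) p))"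
        using p by (simp add: \<delta>_diff D_in d_in t_in \<delta>D)
      also have "\<delta> (Suc n) (t (d (Suc n) p)) = D n (d (Suc n) p)" using t p by (simp add: A_def)
      finally show ?thesis using p by (simp add: a_minus_def B.r_neg D_in d_in)
    qed
    from lift_to_B[OF f this] obtain l where l: "l \<in> lmod_hom R (P (Suc n)) (B (Suc (Suc n)))"
      and dl: "\<forall>p\<in>carrier (P (Suc n)). \<delta> (Suc (Suc n)) (l p) = ?f p" by blast
    have "\<delta> (Suc (Suc n)) (l (d (Suc (Suc n)) p)) = D (Suc n) (d (Suc (Suc n)) p)"
      if p: "p \<in> carrier (P (Suc (Suc n)))" for p
      using dl p by (simp add: d_in dd lmod_hom_zero[OF th P.abelian_group_axioms B.abelian_group_axioms] D_in a_minus_def)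
    then show "\<exists>l. A (Suc n) l \<and> (\<forall>p\<in>carrier (P (Suc n)). \<delta> (Suc (Suc n)) (l p) = ?f p)"
      using l dl by (intro exI[of _ l]) (simp add: A_def)
  qed
  then obtain h where h: "\<forall>n. A n (h n) \<and> (\<forall>p\<in>carrier (P (Suc n)).
      \<delta> (Suc (Suc n)) (h (Suc n) p) = D (Suc n) p \<ominus>\<^bsub>B (Suc n)\<^esub> h n (d (Suc n) p))" ..
  then have "A 0 (h 0)" by blast
  then show ?thesis using h by (intro exI[of _ h]) (auto simp: A_def D_def)
qed

text \<open>
  The mapping cone of \<open>\<tau>\<close>, in the type of pairs; in degree 0 the first component is a zero module.
\<close>

definition cone :: "nat \<Rightarrow> ('r, 'p \<times> 'b) module" where
  "cone n = (case n of 0 \<Rightarrow> prod_module (zero_module (P 0)) (B 0) | Suc m \<Rightarrow> prod_module (P m) (B (Suc m)))"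

text \<open>The sign of \<open>d\<close> makes the cross terms \<open>\<tau> d\<close> and
  \<open>\<delta> \<tau>\<close> cancel in the square.\<close>

definition cone_d :: "(nat \<Rightarrow> 'p \<Rightarrow> 'b) \<Rightarrow> nat \<Rightarrow> 'p \<times> 'b \<Rightarrow> 'p \<times> 'b" where
  "cone_d \<tau> n x = (case n of
       0 \<Rightarrow> x
     | Suc 0 \<Rightarrow> (\<zero>\<^bsub>P 0\<^esub>, \<tau> 0 (fst x) \<oplus>\<^bsub>B 0\<^esub> \<delta> (Suc 0) (snd x))
     | Suc (Suc m) \<Rightarrow> (\<ominus>\<^bsub>P m\<^esub> d (Suc m) (fst x),
         \<tau> (Suc m) (fst x) \<oplus>\<^bsub>B (Suc m)\<^esub> \<delta> (Suc (Suc m)) (snd x)))"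

lemma cone_simps [simp]:
  "cone 0 = prod_module (zero_module (P 0)) (B 0)"
  "cone (Suc n) = prod_module (P n) (B (Suc n))"
  "cone_d \<tau> (Suc 0) x = (\<zero>\<^bsub>P 0\<^esub>, \<tau> 0 (fst x) \<oplus>\<^bsub>B 0\<^esub> \<delta> (Suc 0) (snd x))"
  "cone_d \<tau> (Suc (Suc m)) x = (\<ominus>\<^bsub>P m\<^esub> d (Suc m) (fst x),
         \<tau> (Suc m) (fst x) \<oplus>\<^bsub>B (Suc m)\<^esub> \<delta> (Suc (Suc m)) (snd x))"
  by (simp_all add: cone_def cone_d_def)

lemma minus_eq_zeroD: "\<lbrakk>abelian_group G; x \<in> carrier G; \<ominus>\<^bsub>G\<^esub> x = \<zero>\<^bsub>G\<^esub>\<rbrakk> \<Longrightarrow> x = \<zero>\<^bsub>G\<^esub>" for G :: "('r, 'p) module" and x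
proof -
  assume G: "abelian_group G" and x: "x \<in> carrier G" "\<ominus>\<^bsub>G\<^esub> x = \<zero>\<^bsub>G\<^esub>"
  interpret G: abelian_group G by (rule G)
  show ?thesis using x G.r_neg[of x] by simp
qed

text \<open>Local projectivity passes to direct sums, and exactness combines that of
  \<open>P\<close> with that of \<open>B\<close>; the two augmentations decide the lowest
  degrees.\<close>

lemma cone_exact_complex:
  assumes \<tau>: "comparison \<tau>"
  shows "exact_complex R cone (cone_d \<tau>)"
proof -
  have \<tau>h: "\<tau> n \<in> lmod_hom R (P n) (B n)" for n
    using \<tau> by (auto simp: comparison_def)
  note \<tau>_in = lmod_homD[OF \<tau>h]
  have \<eta>\<tau>: "\<eta> (\<tau> 0 p) = \<epsilon> p" if "p \<in> carrier (P 0)" for p using \<tau> that by (simp add: comparison_def)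
  have \<delta>\<tau>: "\<delta> (Suc n) (\<tau> (Suc n) p) = \<tau> n (d (Suc n) p)" if "p \<in> carrier (P (Suc n))" for n p
    using \<tau> that by (simp add: comparison_def)
  have m: "lmod R (cone n)" for n
    by (cases n) (simp_all add: prod_module_lmod zero_module_lmod P_lmod B_lmod)
  have lp: "locally_projective R (cone n) (carrier (cone n))" for n
  proof (cases n)
    case 0
    then show ?thesis
      by (metis cone_simps(1) prod_module_locally_projective zero_module_lmod[OF P_lmod] B_lmod
          zero_module_locally_projective B_locally_projective)
  next
    case (Suc k)
    then show ?thesis
      by (metis cone_simps(2) prod_module_locally_projective P_lmod B_lmod
          projective_locally_projective P_projective B_locally_projective)
  qed
  have second: "(\<lambda>x. \<tau> n (fst x) \<oplus>\<^bsub>B n\<^esub> \<delta> (Suc n) (snd x)) \<in> lmod_hom R (prod_module (P n) (B (Suc n))) (B n)" for n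
    by (rule lmod_hom_add[OF lmod_hom_compose[OF _ \<tau>h] lmod_hom_compose[OF _ \<delta>_hom] B_lmod])
      (auto simp: lmod_hom_def)
  have hom: "cone_d \<tau> (Suc n) \<in> lmod_hom R (cone (Suc n)) (cone n)" for n
  proof (cases n)
    case 0
    have "cone_d \<tau> (Suc 0) \<in> lmod_hom R (prod_module (P 0) (B (Suc 0))) (prod_module (zero_module (P 0)) (B 0))"
      using lmod_homD[OF second[of 0], simplified] by (intro lmod_homI) (auto simp: P.smult_zero_right)
    then show ?thesis using 0 by simp
  next
    case (Suc m)
    have "(\<lambda>x. \<ominus>\<^bsub>P m\<^esub> d (Suc m) (fst x)) \<in> lmod_hom R (prod_module (P (Suc m)) (B (Suc (Suc m)))) (P m)"
      by (rule lmod_hom_uminus[OF lmod_hom_compose[OF _ d_hom] P_lmod]) (auto simp: lmod_hom_def)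
    note f_in = lmod_homD[OF this, simplified]
    have "cone_d \<tau> (Suc (Suc m)) \<in> lmod_hom R (prod_module (P (Suc m)) (B (Suc (Suc m)))) (prod_module (P m) (B (Suc m)))"
      using lmod_homD[OF second[of "Suc m"], simplified] f_in by (intro lmod_homI) auto
    then show ?thesis using Suc by simp
  qed
  have ex0: "cone_d \<tau> (Suc 0) ` carrier (cone (Suc 0)) = carrier (cone 0)"
  proof
    show "cone_d \<tau> (Suc 0) ` carrier (cone (Suc 0)) \<subseteq> carrier (cone 0)"
      using lmod_homD(1)[OF hom] by blast
    show "carrier (cone 0) \<subseteq> cone_d \<tau> (Suc 0) ` carrier (cone (Suc 0))"
    proof
      fix x assume "x \<in> carrier (cone 0)"
      then obtain b where b: "x = (\<zero>\<^bsub>P 0\<^esub>, b)" "b \<in> carrier (B 0)" by auto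
      \<comment> \<open>As \<open>\<epsilon>\<close> is onto, some \<open>p\<close> has the same
        augmentation as \<open>b\<close>; then \<open>b - \<tau> p\<close> is a boundary.\<close>
      then obtain p where p: "p \<in> carrier (P 0)" "\<epsilon> p = \<eta> b" using \<epsilon>_onto \<eta>_in(1) by (metis imageE)
      have "\<eta> (b \<ominus>\<^bsub>B 0\<^esub> \<tau> 0 p) = \<zero>\<^bsub>L\<^esub>"
        using b p \<tau>_in(1)[of p 0] lmod_hom_minus[OF \<eta>_hom B.abelian_group_axioms L.abelian_group_axioms]
        by (simp add: a_minus_def \<eta>_in \<eta>\<tau> L.r_neg)
      moreover have bm: "b \<ominus>\<^bsub>B 0\<^esub> \<tau> 0 p \<in> carrier (B 0)" using b p \<tau>_in(1)[of p 0] by simp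
      ultimately obtain b' where b': "b' \<in> carrier (B (Suc 0))" "\<delta> (Suc 0) b' = b \<ominus>\<^bsub>B 0\<^esub> \<tau> 0 p"
        using B_exact_0 by (metis (mono_tags, lifting) imageE mem_Collect_eq)
      have "\<tau> 0 p \<oplus>\<^bsub>B 0\<^esub> (b \<ominus>\<^bsub>B 0\<^esub> \<tau> 0 p) = b"
        using b p \<tau>_in(1)[of p 0] by (simp add: a_minus_def B.a_lcomm B.r_neg)
      then have "x = cone_d \<tau> (Suc 0) (p, b')" using b b' by simp
      moreover have "(p, b') \<in> carrier (cone (Suc 0))" using p b' by simp
      ultimately show "x \<in> cone_d \<tau> (Suc 0) ` carrier (cone (Suc 0))" by (rule image_eqI)
    qed
  qed
  have dd0: "cone_d \<tau> (Suc n) (cone_d \<tau> (Suc (Suc n)) x) = \<zero>\<^bsub>cone n\<^esub>" if "x \<in> carrier (cone (Suc (Suc n)))" for n x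
  proof -
    have x: "fst x \<in> carrier (P (Suc n))" "snd x \<in> carrier (B (Suc (Suc n)))" using that by auto
    have p: "d (Suc n) (fst x) \<in> carrier (P n)" using x d_in by simp
    have "\<tau> n (\<ominus>\<^bsub>P n\<^esub> d (Suc n) (fst x)) \<oplus>\<^bsub>B n\<^esub> \<delta> (Suc n) (\<tau> (Suc n) (fst x) \<oplus>\<^bsub>B (Suc n)\<^esub> \<delta> (Suc (Suc n)) (snd x))
      = \<zero>\<^bsub>B n\<^esub>"
      using x p by (simp add: lmod_hom_minus[OF \<tau>h P.abelian_group_axioms B.abelian_group_axioms] \<delta>_in \<tau>_in \<delta>\<delta> \<delta>\<tau> B.l_neg)
    moreover have "\<ominus>\<^bsub>P m\<^esub> d (Suc m) (\<ominus>\<^bsub>P n\<^esub> d (Suc n) (fst x)) = \<zero>\<^bsub>P m\<^esub>" if "n = Suc m" for m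
      using x p dd[of "fst x" m] that lmod_hom_minus[OF d_hom P.abelian_group_axioms P.abelian_group_axioms]
      by simp
    ultimately show ?thesis by (cases n) auto
  qed
  have ex: "cone_d \<tau> (Suc (Suc n)) ` carrier (cone (Suc (Suc n))) =
      {x \<in> carrier (cone (Suc n)). cone_d \<tau> (Suc n) x = \<zero>\<^bsub>cone n\<^esub>}" for n
  proof (intro subset_antisym subsetI)
    fix x assume "x \<in> cone_d \<tau> (Suc (Suc n)) ` carrier (cone (Suc (Suc n)))"
    then show "x \<in> {x \<in> carrier (cone (Suc n)). cone_d \<tau> (Suc n) x = \<zero>\<^bsub>cone n\<^esub>}"
      using dd0 lmod_homD(1)[OF hom] by blast
  next
    fix x assume "x \<in> {x \<in> carrier (cone (Suc n)). cone_d \<tau> (Suc n) x = \<zero>\<^bsub>cone n\<^esub>}"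
    then obtain p b where x: "x = (p, b)" "p \<in> carrier (P n)" "b \<in> carrier (B (Suc n))"
      and dx: "cone_d \<tau> (Suc n) (p, b) = \<zero>\<^bsub>cone n\<^esub>" by auto
    have sum0: "\<tau> n p \<oplus>\<^bsub>B n\<^esub> \<delta> (Suc n) b = \<zero>\<^bsub>B n\<^esub>" using dx by (cases n) auto
    \<comment> \<open>In degree 0 the first component of the cone boundary carries no information.
      The augmentation supplies it: \<open>\<epsilon> p = \<eta> (\<tau> p + \<delta> b)\<close>,
      which vanishes.\<close>
    have "p \<in> d (Suc n) ` carrier (P (Suc n))"
    proof (cases n)
      case 0
      have "\<epsilon> p = \<eta> (\<tau> 0 p \<oplus>\<^bsub>B 0\<^esub> \<delta> (Suc 0) b)" using x 0 by (simp add: \<eta>_in \<tau>_in \<delta>_in \<eta>\<tau> \<eta>\<delta> \<epsilon>_in)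
      then have "\<epsilon> p = \<zero>\<^bsub>L\<^esub>" using sum0 0 lmod_hom_zero[OF \<eta>_hom B.abelian_group_axioms L.abelian_group_axioms] by simp
      then show ?thesis using P_exact_0 x 0 by auto
    next
      case (Suc m)
      then have "\<ominus>\<^bsub>P m\<^esub> d (Suc m) p = \<zero>\<^bsub>P m\<^esub>" using dx by simp
      moreover have "d (Suc m) p \<in> carrier (P m)" using x Suc d_in by simp
      ultimately have "d (Suc m) p = \<zero>\<^bsub>P m\<^esub>" using minus_eq_zeroD[OF P.abelian_group_axioms] by blast
      then show ?thesis using P_exact[of m] x Suc by auto
    qed
    then obtain q where q: "q \<in> carrier (P (Suc n))" "p = d (Suc n) q" by auto
    \<comment> \<open>Negated because of the sign in \<open>cone_d\<close>.\<close>
    let ?q = "\<ominus>\<^bsub>P (Suc n)\<^esub> q"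
    have q': "?q \<in> carrier (P (Suc n))" using q by simp
    have dq': "\<ominus>\<^bsub>P n\<^esub> d (Suc n) ?q = p"
      using q x lmod_hom_minus[OF d_hom P.abelian_group_axioms P.abelian_group_axioms] by simp
    have \<tau>q: "\<tau> (Suc n) ?q \<in> carrier (B (Suc n))" using q' \<tau>_in by simp
    have "\<delta> (Suc n) (b \<ominus>\<^bsub>B (Suc n)\<^esub> \<tau> (Suc n) ?q) = \<delta> (Suc n) b \<oplus>\<^bsub>B n\<^esub> \<tau> n p"
    proof -
      have "\<ominus>\<^bsub>B n\<^esub> \<tau> n (d (Suc n) ?q) = \<tau> n p"
        using q q' d_in(1)[OF q'] dq' lmod_hom_minus[OF \<tau>h P.abelian_group_axioms B.abelian_group_axioms, of "d (Suc n) ?q" n] by simp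
      then show ?thesis
        using x \<tau>q q' by (simp add: a_minus_def \<delta>_in \<delta>\<tau> lmod_hom_minus[OF \<delta>_hom B.abelian_group_axioms B.abelian_group_axioms])
    qed
    also have "\<dots> = \<zero>\<^bsub>B n\<^esub>" using sum0 x \<tau>_in(1)[of p n] \<delta>_in(1)[of b n] by (simp add: B.a_comm)
    finally have "b \<ominus>\<^bsub>B (Suc n)\<^esub> \<tau> (Suc n) ?q \<in> \<delta> (Suc (Suc n)) ` carrier (B (Suc (Suc n)))"
      using B_exact[of n] x \<tau>q by auto
    then obtain b' where b': "b' \<in> carrier (B (Suc (Suc n)))" "\<delta> (Suc (Suc n)) b' = b \<ominus>\<^bsub>B (Suc n)\<^esub> \<tau> (Suc n) ?q"
      by auto
    have "\<tau> (Suc n) ?q \<oplus>\<^bsub>B (Suc n)\<^esub> (b \<ominus>\<^bsub>B (Suc n)\<^esub> \<tau> (Suc n) ?q) = b"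
      using x \<tau>q by (simp add: a_minus_def B.a_lcomm B.r_neg)
    then have "x = cone_d \<tau> (Suc (Suc n)) (?q, b')" using x b' dq' by simp
    moreover have "(?q, b') \<in> carrier (cone (Suc (Suc n)))" using q' b' by simp
    ultimately show "x \<in> cone_d \<tau> (Suc (Suc n)) ` carrier (cone (Suc (Suc n)))" by (rule image_eqI)
  qed
  show ?thesis
    by (intro exact_complex.intro exact_complex_axioms.intro ring_with_local_units_axioms m hom ex0 ex lp)
qed

section \<open>The comparison map modulo the ideal\<close>

text \<open>Degree 0 of the cone is \<open>B 0\<close> up to a zero summand, and every element of it
  is a boundary, so no error term from the ideal appears.\<close>

lemma comparison_surjective_0:
  assumes \<tau>: "comparison \<tau>" and b: "b \<in> carrier (B 0)"
  shows "\<exists>p\<in>carrier (P 0). \<exists>b'\<in>carrier (B (Suc 0)). b = \<tau> 0 p \<oplus>\<^bsub>B 0\<^esub> \<delta> (Suc 0) b'"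
proof -
  interpret C: exact_complex R cone "cone_d \<tau>" by (rule cone_exact_complex[OF \<tau>])
  have "(\<zero>\<^bsub>P 0\<^esub>, b) \<in> cone_d \<tau> (Suc 0) ` carrier (cone (Suc 0))" using C.exact_0 b by simp
  then obtain x where "x \<in> carrier (cone (Suc 0))" "(\<zero>\<^bsub>P 0\<^esub>, b) = cone_d \<tau> (Suc 0) x" by blast
  then have "fst x \<in> carrier (P 0)" "snd x \<in> carrier (B (Suc 0))"
    "b = \<tau> 0 (fst x) \<oplus>\<^bsub>B 0\<^esub> \<delta> (Suc 0) (snd x)" by auto
  then show ?thesis by blast
qed

text \<open>\<open>tensor_exact\<close> for the cone, applied to \<open>(0, b)\<close>. The second
  component of the resulting equation decomposes \<open>b\<close>; the first one says that
  \<open>d p\<close> lies in \<open>J P\<close>, so \<open>p\<close> is a cycle modulo the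
  ideal.\<close>

lemma comparison_surjective:
  assumes \<tau>: "comparison \<tau>" and b: "b \<in> carrier (B (Suc n))" and \<delta>b: "\<delta> (Suc n) b \<in> ideal_span J (B n)"
  shows "\<exists>p\<in>carrier (P (Suc n)). d (Suc n) p \<in> ideal_span J (P n) \<and>
    (\<exists>b'\<in>carrier (B (Suc (Suc n))). \<exists>w\<in>ideal_span J (B (Suc n)).
       b = \<tau> (Suc n) p \<oplus>\<^bsub>B (Suc n)\<^esub> \<delta> (Suc (Suc n)) b' \<oplus>\<^bsub>B (Suc n)\<^esub> w)"
proof -
  interpret C: exact_complex R cone "cone_d \<tau>" by (rule cone_exact_complex[OF \<tau>])
  have \<tau>h: "\<tau> n \<in> lmod_hom R (P n) (B n)" for n
    using \<tau> by (auto simp: comparison_def)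
  let ?x = "(\<zero>\<^bsub>P n\<^esub>, b)"
  have "?x \<in> carrier (cone (Suc n))" using b by simp
  moreover have "cone_d \<tau> (Suc n) ?x \<in> ideal_span J (cone n)"
  proof -
    have "\<tau> n \<zero>\<^bsub>P n\<^esub> \<oplus>\<^bsub>B n\<^esub> \<delta> (Suc n) b = \<delta> (Suc n) b"
      using b lmod_hom_zero[OF \<tau>h P.abelian_group_axioms B.abelian_group_axioms] by (simp add: \<delta>_in)
    moreover have "\<ominus>\<^bsub>P m\<^esub> d (Suc m) \<zero>\<^bsub>P (Suc m)\<^esub> = \<zero>\<^bsub>P m\<^esub>" for m
      using lmod_hom_zero[OF d_hom P.abelian_group_axioms P.abelian_group_axioms] by simp
    moreover have "\<zero>\<^bsub>P 0\<^esub> \<in> ideal_span J (zero_module (P 0))"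
      using lmod.ideal_spanD(2)[OF zero_module_lmod[OF P_lmod] J_subset, of 0] by simp
    ultimately show ?thesis using \<delta>b P.ideal_spanD(2)[OF J_subset]
      by (cases n) (simp_all add: ideal_span_prod_iff P_lmod B_lmod zero_module_lmod)
  qed
  ultimately obtain y w where y: "y \<in> carrier (cone (Suc (Suc n)))" and w: "w \<in> ideal_span J (cone (Suc n))"
    and eq: "?x = cone_d \<tau> (Suc (Suc n)) y \<oplus>\<^bsub>cone (Suc n)\<^esub> w"
    using C.tensor_exact[OF right_ideal_axioms] by blast
  from y have y': "fst y \<in> carrier (P (Suc n))" "snd y \<in> carrier (B (Suc (Suc n)))" by auto
  from w have w': "fst w \<in> ideal_span J (P n)" "snd w \<in> ideal_span J (B (Suc n))"
    by (simp_all add: ideal_span_prod_iff P_lmod B_lmod)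
  have "\<zero>\<^bsub>P n\<^esub> = \<ominus>\<^bsub>P n\<^esub> d (Suc n) (fst y) \<oplus>\<^bsub>P n\<^esub> fst w" using eq by simp
  then have "fst w = d (Suc n) (fst y)"
    using P.ideal_spanD(1)[OF J_subset w'(1)] d_in(1)[OF y'(1)] P.minus_equality
    by (metis P.a_comm P.a_inv_closed P.minus_minus)
  moreover have "b = \<tau> (Suc n) (fst y) \<oplus>\<^bsub>B (Suc n)\<^esub> \<delta> (Suc (Suc n)) (snd y) \<oplus>\<^bsub>B (Suc n)\<^esub> snd w"
    using eq by simp
  ultimately show ?thesis using y' w' by metis
qed

text \<open>\<open>tensor_exact\<close> for the cone, applied to \<open>(p, - b)\<close>: the second
  component of its boundary is \<open>\<tau> p - \<delta> b = w\<close>. The condition on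
  \<open>d p\<close> is empty in degree 0, where the first summand of the cone is zero.\<close>

lemma comparison_injective:
  assumes \<tau>: "comparison \<tau>" and p: "p \<in> carrier (P n)"
    and dp: "\<And>m. n = Suc m \<Longrightarrow> d n p \<in> ideal_span J (P m)"
    and b: "b \<in> carrier (B (Suc n))" and w: "w \<in> ideal_span J (B n)"
    and eq: "\<tau> n p = \<delta> (Suc n) b \<oplus>\<^bsub>B n\<^esub> w"
  shows "\<exists>q\<in>carrier (P (Suc n)). \<exists>v\<in>ideal_span J (P n). p = d (Suc n) q \<oplus>\<^bsub>P n\<^esub> v"
proof -
  interpret C: exact_complex R cone "cone_d \<tau>" by (rule cone_exact_complex[OF \<tau>])
  have \<tau>h: "\<tau> n \<in> lmod_hom R (P n) (B n)" for n
    using \<tau> by (auto simp: comparison_def)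
  have wB: "w \<in> carrier (B n)" by (rule B.ideal_spanD(1)[OF J_subset w])
  let ?x = "(p, \<ominus>\<^bsub>B (Suc n)\<^esub> b)"
  have "?x \<in> carrier (cone (Suc n))" using p b by simp
  moreover have "cone_d \<tau> (Suc n) ?x \<in> ideal_span J (cone n)"
  proof -
    have "\<tau> n p \<oplus>\<^bsub>B n\<^esub> \<delta> (Suc n) (\<ominus>\<^bsub>B (Suc n)\<^esub> b) = w"
      using b wB \<delta>_in(1)[OF b] unfolding eq
      by (simp add: lmod_hom_minus[OF \<delta>_hom B.abelian_group_axioms B.abelian_group_axioms] B.a_ac B.r_neg B.r_neg1 B.r_neg2)
    moreover have "\<zero>\<^bsub>P 0\<^esub> \<in> ideal_span J (zero_module (P 0))"
      using lmod.ideal_spanD(2)[OF zero_module_lmod[OF P_lmod] J_subset, of 0] by simp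
    moreover have "\<ominus>\<^bsub>P m\<^esub> d (Suc m) p \<in> ideal_span J (P m)" if "n = Suc m" for m
      using P.ideal_spanD(4)[OF J_subset dp[OF that]] that by simp
    ultimately show ?thesis using w
      by (cases n) (simp_all add: ideal_span_prod_iff P_lmod B_lmod zero_module_lmod)
  qed
  ultimately obtain y v where y: "y \<in> carrier (cone (Suc (Suc n)))" and v: "v \<in> ideal_span J (cone (Suc n))"
    and eq': "?x = cone_d \<tau> (Suc (Suc n)) y \<oplus>\<^bsub>cone (Suc n)\<^esub> v"
    using C.tensor_exact[OF right_ideal_axioms] by blast
  from y have y': "fst y \<in> carrier (P (Suc n))" by auto
  from v have v': "fst v \<in> ideal_span J (P n)"
    by (simp add: ideal_span_prod_iff P_lmod B_lmod)
  have "p = d (Suc n) (\<ominus>\<^bsub>P (Suc n)\<^esub> fst y) \<oplus>\<^bsub>P n\<^esub> fst v" "\<ominus>\<^bsub>P (Suc n)\<^esub> fst y \<in> carrier (P (Suc n))"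
    using eq' y' by (simp_all add: lmod_hom_minus[OF d_hom P.abelian_group_axioms P.abelian_group_axioms])
  then show ?thesis using v' by blast
qed

lemma comparison_unique:
  assumes \<tau>: "comparison \<tau>" and \<tau>': "comparison \<tau>'" and p: "p \<in> carrier (P n)"
    and dp: "\<And>m. n = Suc m \<Longrightarrow> d n p \<in> ideal_span J (P m)"
  shows "\<exists>b\<in>carrier (B (Suc n)). \<exists>w\<in>ideal_span J (B n). \<tau> n p = \<delta> (Suc n) b \<oplus>\<^bsub>B n\<^esub> w \<oplus>\<^bsub>B n\<^esub> \<tau>' n p"
proof -
  obtain h where h: "\<And>n. h n \<in> lmod_hom R (P n) (B (Suc n))"
    and h0: "\<forall>p\<in>carrier (P 0). \<tau> 0 p \<ominus>\<^bsub>B 0\<^esub> \<tau>' 0 p = \<delta> (Suc 0) (h 0 p)"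
    and hS: "\<And>n. \<forall>p\<in>carrier (P (Suc n)). \<tau> (Suc n) p \<ominus>\<^bsub>B (Suc n)\<^esub> \<tau>' (Suc n) p \<ominus>\<^bsub>B (Suc n)\<^esub> h n (d (Suc n) p) =
      \<delta> (Suc (Suc n)) (h (Suc n) p)"
    using comparison_homotopy[OF \<tau> \<tau>'] by blast
  have c: "\<tau> n p \<in> carrier (B n)" "\<tau>' n p \<in> carrier (B n)"
    using \<tau> \<tau>' p by (auto simp: comparison_def lmod_hom_def)
  have hc: "h n p \<in> carrier (B (Suc n))" by (rule lmod_homD(1)[OF h p])
  show ?thesis
  proof (cases n)
    case 0
    then have "\<delta> (Suc n) (h n p) \<oplus>\<^bsub>B n\<^esub> \<zero>\<^bsub>B n\<^esub> \<oplus>\<^bsub>B n\<^esub> \<tau>' n p = \<tau> n p"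
      using h0 p c by (simp add: a_minus_def B.a_assoc B.l_neg flip: h0[rule_format])
    then show ?thesis using hc B.ideal_spanD(2)[OF J_subset] by metis
  next
    case (Suc m)
    \<comment> \<open>A homotopy is linear and \<open>d p\<close> lies in \<open>J P\<close>, so the
      term \<open>h d\<close> of the homotopy identity lies in \<open>J B\<close>.\<close>
    let ?w = "h m (d n p)"
    have w: "?w \<in> ideal_span J (B n)"
      using P.ideal_span_hom[OF h B_lmod J_subset dp[OF Suc]] Suc by simp
    have wc: "?w \<in> carrier (B n)" by (rule B.ideal_spanD(1)[OF J_subset w])
    have "\<delta> (Suc n) (h n p) = \<tau> n p \<ominus>\<^bsub>B n\<^esub> \<tau>' n p \<ominus>\<^bsub>B n\<^esub> ?w" using hS p Suc by simp
    then have "\<delta> (Suc n) (h n p) \<oplus>\<^bsub>B n\<^esub> ?w \<oplus>\<^bsub>B n\<^esub> \<tau>' n p = \<tau> n p"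
      using c wc by (simp add: a_minus_def B.a_assoc B.l_neg B.r_neg1 B.r_neg2)
    then show ?thesis using hc w by metis
  qed
qed

end

section \<open>Sums of finitely supported families\<close>

text \<open>The common form of push-forwards, convolution products and module actions: a sum over a
  fibre, with value 0 when infinitely many terms are nonzero.\<close>

definition fsum :: "'a set \<Rightarrow> ('a \<Rightarrow> int) \<Rightarrow> int" where
  "fsum A g = sum g {x \<in> A. g x \<noteq> 0}"

lemma fsum_eq_sum:
  assumes "finite T" "T \<subseteq> A" "\<And>x. \<lbrakk>x \<in> A; g x \<noteq> 0\<rbrakk> \<Longrightarrow> x \<in> T"
  shows "fsum A g = sum g T"
  unfolding fsum_def using assms by (intro sum.mono_neutral_left) auto

lemma fsum_cong: "\<lbrakk>A = B; \<And>x. x \<in> B \<Longrightarrow> f x = g x\<rbrakk> \<Longrightarrow> fsum A f = fsum B g"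
  unfolding fsum_def by (rule sum.cong) auto

lemma fsum_reindex:
  assumes "bij_betw h A B"
  shows "fsum B g = fsum A (\<lambda>x. g (h x))"
proof -
  have "bij_betw h {x \<in> A. g (h x) \<noteq> 0} {x \<in> B. g x \<noteq> 0}"
    using assms by (auto simp: bij_betw_def inj_on_def)
  then show ?thesis unfolding fsum_def by (rule sum.reindex_bij_betw[symmetric])
qed

lemma fsum_single:
  assumes "a \<in> A" "\<And>x. \<lbrakk>x \<in> A; x \<noteq> a\<rbrakk> \<Longrightarrow> g x = 0"
  shows "fsum A g = g a"
proof -
  have "fsum A g = sum g {a}" by (rule fsum_eq_sum) (use assms in auto)
  then show ?thesis by simp
qed

lemma fsum_zero [simp]: "fsum A (\<lambda>x. 0) = 0"
  by (simp add: fsum_def)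

lemma fsum_empty [simp]: "fsum {} g = 0"
  by (simp add: fsum_def)

lemma fsum_add:
  assumes "finite {x \<in> A. f x \<noteq> 0}" "finite {x \<in> A. g x \<noteq> 0}"
  shows "fsum A (\<lambda>x. f x + g x) = fsum A f + fsum A g"
proof -
  let ?T = "{x \<in> A. f x \<noteq> 0} \<union> {x \<in> A. g x \<noteq> 0}"
  have "fsum A (\<lambda>x. f x + g x) = sum (\<lambda>x. f x + g x) ?T" using assms by (intro fsum_eq_sum) auto
  moreover have "fsum A f = sum f ?T" "fsum A g = sum g ?T" using assms by (auto intro!: fsum_eq_sum)
  ultimately show ?thesis by (simp add: sum.distrib)
qed

text \<open>Holds for infinite supports as well: for nonzero \<open>c\<close> both sums run over the
  same set.\<close>

lemma fsum_cmult: "fsum A (\<lambda>x. c * f x) = c * fsum A f"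
  by (cases "c = 0") (simp_all add: fsum_def sum_distrib_left)

lemma fsum_multc: "fsum A (\<lambda>x. f x * c) = fsum A f * c"
  using fsum_cmult[of A c f] by (simp add: mult.commute)

lemma fsum_uminus: "fsum A (\<lambda>x. - f x) = - fsum A f"
  using fsum_cmult[of A "-1" f] by simp

text \<open>Finiteness is asked of the set of pairs: with infinitely many nonzero terms the right
  side is 0, whereas cancellation in the inner sums may leave a nonzero iterated sum.\<close>

lemma fsum_Sigma:
  assumes fin: "finite {p \<in> Sigma A B. g (fst p) (snd p) \<noteq> 0}"
  shows "fsum A (\<lambda>x. fsum (B x) (g x)) = fsum (Sigma A B) (\<lambda>p. g (fst p) (snd p))"
proof -
  let ?S = "{p \<in> Sigma A B. g (fst p) (snd p) \<noteq> 0}"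
  let ?A = "fst ` ?S"
  let ?B = "\<lambda>x. {y \<in> B x. g x y \<noteq> 0}"
  have inn: "fsum (B x) (g x) = sum (g x) (?B x)" for x by (simp add: fsum_def)
  have "fsum A (\<lambda>x. fsum (B x) (g x)) = (\<Sum>x\<in>?A. sum (g x) (?B x))"
    unfolding inn
  proof (rule fsum_eq_sum)
    show "finite ?A" using fin by simp
    show "?A \<subseteq> A" by auto
    fix x assume x: "x \<in> A" "sum (g x) (?B x) \<noteq> 0"
    then obtain y where "y \<in> ?B x" by (metis (no_types, lifting) sum.not_neutral_contains_not_neutral)
    then have "(x, y) \<in> ?S" using x by simp
    then show "x \<in> ?A" by force
  qed
  also have "\<dots> = sum (\<lambda>(x, y). g x y) (Sigma ?A ?B)"
  proof (rule sum.Sigma)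
    show "finite ?A" using fin by simp
    show "\<forall>x\<in>?A. finite (?B x)"
    proof
      fix x assume "x \<in> ?A"
      then have "x \<in> A" by auto
      then have "?B x \<subseteq> snd ` ?S" by force
      then show "finite (?B x)" by (rule finite_subset) (use fin in simp)
    qed
  qed
  also have "Sigma ?A ?B = ?S" by force
  also have "sum (\<lambda>(x, y). g x y) ?S = fsum (Sigma A B) (\<lambda>p. g (fst p) (snd p))"
    by (simp add: fsum_def case_prod_unfold)
  finally show ?thesis .
qed

lemma fsum_swap:
  assumes "finite {p \<in> A \<times> B. g (fst p) (snd p) \<noteq> 0}"
  shows "fsum A (\<lambda>x. fsum B (g x)) = fsum B (\<lambda>y. fsum A (\<lambda>x. g x y))"
proof -
  have bij: "bij_betw prod.swap (B \<times> A) (A \<times> B)"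
    by (auto simp: bij_betw_def inj_on_def)
  have "{p \<in> B \<times> A. g (snd p) (fst p) \<noteq> 0} = prod.swap ` {p \<in> A \<times> B. g (fst p) (snd p) \<noteq> 0}" by force
  then have "finite {p \<in> B \<times> A. g (snd p) (fst p) \<noteq> 0}" using assms by simp
  then have "fsum B (\<lambda>y. fsum A (\<lambda>x. g x y)) = fsum (B \<times> A) (\<lambda>p. g (snd p) (fst p))"
    using fsum_Sigma[of B "\<lambda>_. A" "\<lambda>y x. g x y"] by simp
  also have "\<dots> = fsum (A \<times> B) (\<lambda>p. g (fst p) (snd p))"
    using fsum_reindex[OF bij, of "\<lambda>p. g (fst p) (snd p)"] by simp
  also have "\<dots> = fsum A (\<lambda>x. fsum B (g x))" using fsum_Sigma[OF assms] by simp
  finally show ?thesis by simp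
qed

lemma pushforward_fsum: "pushforward Y f a z = fsum {y \<in> topspace Y. f y = z} a"
  by (simp add: pushforward_def fsum_def)

section \<open>Totally disconnected spaces and etale maps\<close>

text \<open>The locally compact Hausdorff totally disconnected spaces, described by their basis of
  compact open sets.\<close>

definition ample_space :: "'a topology \<Rightarrow> bool" where
  "ample_space Y \<longleftrightarrow> Hausdorff_space Y \<and>
     (\<forall>W y. openin Y W \<and> y \<in> W \<longrightarrow> (\<exists>U. openin Y U \<and> compactin Y U \<and> y \<in> U \<and> U \<subseteq> W))"

text \<open>A local homeomorphism, split into three properties that are verified separately.\<close>

definition etale_map :: "'a topology \<Rightarrow> 'b topology \<Rightarrow> ('a \<Rightarrow> 'b) \<Rightarrow> bool" where
  "etale_map Y Z f \<longleftrightarrow> continuous_map Y Z f \<and> open_map Y Z f \<and>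
     (\<forall>y\<in>topspace Y. \<exists>U. openin Y U \<and> y \<in> U \<and> inj_on f U)"

lemma compact_open_closed: "\<lbrakk>ample_space Y; compactin Y U\<rbrakk> \<Longrightarrow> closedin Y U"
  by (simp add: ample_space_def compactin_imp_closedin)

lemma compact_open_Int_closed:
  assumes "compactin Y U" "closedin Y V" shows "compactin Y (U \<inter> V)"
proof -
  have "compactin Y (V \<inter> U)" using closed_Int_compactin[OF assms(2,1)] .
  then show ?thesis by (simp add: Int_commute)
qed

lemma compact_diff_open:
  assumes "compactin Y U" "openin Y V" shows "compactin Y (U - V)"
proof -
  have "U - V = U \<inter> (topspace Y - V)" using compactin_subset_topspace[OF assms(1)] by auto
  then show ?thesis using compact_open_Int_closed[OF assms(1), of "topspace Y - V"] assms(2) by auto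
qed

lemma compact_open_cover:
  assumes Y: "ample_space Y" and C: "compactin Y C"
    and cover: "\<And>y. y \<in> C \<Longrightarrow> \<exists>U. openin Y U \<and> y \<in> U \<and> Q U"
    and her: "\<And>U V. \<lbrakk>Q U; V \<subseteq> U\<rbrakk> \<Longrightarrow> Q V"
  obtains F where "finite F" "C \<subseteq> \<Union>F" "\<And>U. U \<in> F \<Longrightarrow> openin Y U \<and> compactin Y U \<and> Q U"
proof -
  let ?\<U> = "{U. openin Y U \<and> compactin Y U \<and> Q U}"
  have "C \<subseteq> \<Union>?\<U>"
  proof
    fix y assume "y \<in> C"
    then obtain U where U: "openin Y U" "y \<in> U" "Q U" using cover by blast
    then obtain V where "openin Y V" "compactin Y V" "y \<in> V" "V \<subseteq> U"
      using Y unfolding ample_space_def by blast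
    then show "y \<in> \<Union>?\<U>" using her[OF U(3)] by blast
  qed
  moreover have "\<forall>U\<in>?\<U>. openin Y U" by blast
  ultimately obtain F where "finite F" "F \<subseteq> ?\<U>" "C \<subseteq> \<Union>F"
    using C unfolding compactin_def by (metis (no_types, lifting))
  then show thesis using that by blast
qed

text \<open>Compact open sets are closed here, so subtracting the sets already chosen keeps a set
  compact and open, and \<open>Q\<close> passes to subsets.\<close>

lemma compact_open_disjoint_cover:
  assumes Y: "ample_space Y" and C: "compactin Y C"
    and cover: "\<And>y. y \<in> C \<Longrightarrow> \<exists>U. openin Y U \<and> y \<in> U \<and> Q U"
    and her: "\<And>U V. \<lbrakk>Q U; V \<subseteq> U\<rbrakk> \<Longrightarrow> Q V"
  obtains F where "finite F" "C \<subseteq> \<Union>F" "disjoint F" "\<And>U. U \<in> F \<Longrightarrow> openin Y U \<and> compactin Y U \<and> Q U"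
proof -
  obtain F where F: "finite F" "C \<subseteq> \<Union>F" "\<And>U. U \<in> F \<Longrightarrow> openin Y U \<and> compactin Y U \<and> Q U"
    using compact_open_cover[OF Y C, of Q] cover her by metis
  have "\<exists>F'. finite F' \<and> \<Union>F' = \<Union>F \<and> disjoint F' \<and> (\<forall>U\<in>F'. openin Y U \<and> compactin Y U \<and> Q U)"
    using F(1,3)
  proof (induction F)
    case empty
    then show ?case by (intro exI[of _ "{}"]) auto
  next
    case (insert U F)
    have "openin Y V \<and> compactin Y V \<and> Q V" if "V \<in> F" for V using insert.prems that by blast
    from insert.IH[OF this] obtain F' where "finite F' \<and> \<Union>F' = \<Union>F \<and> disjoint F' \<and>
      (\<forall>U\<in>F'. openin Y U \<and> compactin Y U \<and> Q U)" ..
    then have F': "finite F'" "\<Union>F' = \<Union>F" "disjoint F'"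
      and F'2: "\<forall>U\<in>F'. openin Y U \<and> compactin Y U \<and> Q U" by simp_all
    let ?V = "U - \<Union>F'"
    have "openin Y (\<Union>F')" by (rule openin_Union) (use F'2 in blast)
    moreover have "closedin Y (\<Union>F')"
      by (rule closedin_Union[OF F'(1)]) (use F'2 compact_open_closed[OF Y] in blast)
    ultimately have "openin Y ?V" "compactin Y ?V" "Q ?V"
      using insert.prems[of U] her[of U ?V] compact_diff_open[of Y U "\<Union>F'"] by auto
    moreover have "disjoint (insert ?V F')" using F'(3) by (auto simp: pairwise_def disjnt_def)
    ultimately show ?case using F' F'2 by (intro exI[of _ "insert ?V F'"]) auto
  qed
  then obtain F' where "finite F' \<and> \<Union>F' = \<Union>F \<and> disjoint F' \<and>
      (\<forall>U\<in>F'. openin Y U \<and> compactin Y U \<and> Q U)" ..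
  then show thesis using that[of F'] F(2) by simp
qed

lemma compact_open_superset:
  assumes "ample_space Y" "compactin Y C"
  obtains K where "openin Y K" "compactin Y K" "C \<subseteq> K"
proof -
  obtain F where "finite F" "C \<subseteq> \<Union>F" "\<And>U. U \<in> F \<Longrightarrow> openin Y U \<and> compactin Y U \<and> True"
    using compact_open_cover[OF assms, of "\<lambda>_. True"] compactin_subset_topspace[OF assms(2)] by blast
  then show thesis using that[of "\<Union>F"] by (auto intro!: compactin_Union)
qed

text \<open>An open injective map has a continuous inverse on its image, and this carries
  compactness back.\<close>

lemma compactin_inj_open:
  assumes f: "open_map Y X f" and N: "openin Y N" "inj_on f N" and K: "compactin X (f ` N)"
  shows "compactin Y N"
  unfolding compactin_def
proof (intro conjI allI impI)
  show "N \<subseteq> topspace Y" using N by (simp add: openin_subset)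
  fix \<U> assume \<U>: "(\<forall>U\<in>\<U>. openin Y U) \<and> N \<subseteq> \<Union>\<U>"
  let ?\<V> = "(\<lambda>U. f ` (U \<inter> N)) ` \<U>"
  have "\<forall>V\<in>?\<V>. openin X V" using \<U> N f by (auto simp: open_map_def)
  moreover have "f ` N \<subseteq> \<Union>?\<V>" using \<U> by blast
  ultimately obtain F where "finite F" "F \<subseteq> ?\<V>" "f ` N \<subseteq> \<Union>F"
    using K unfolding compactin_def by (metis (no_types, lifting))
  then obtain F' where F': "finite F'" "F' \<subseteq> \<U>" "f ` N \<subseteq> \<Union>((\<lambda>U. f ` (U \<inter> N)) ` F')"
    by (metis (no_types, lifting) finite_subset_image)
  have "N \<subseteq> \<Union>F'"
  proof
    fix y assume y: "y \<in> N"
    then obtain U y' where "U \<in> F'" "y' \<in> U \<inter> N" "f y = f y'" using F'(3) by blast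
    then show "y \<in> \<Union>F'" using inj_onD[OF N(2)] y by blast
  qed
  then show "\<exists>F. finite F \<and> F \<subseteq> \<U> \<and> N \<subseteq> \<Union>F" using F' by blast
qed

lemma ample_space_etale:
  assumes f: "etale_map Y X f" and X: "ample_space X" and Y: "Hausdorff_space Y"
  shows "ample_space Y"
  unfolding ample_space_def
proof (intro conjI Y allI impI, elim conjE)
  fix W y assume W: "openin Y W" "y \<in> W"
  then have "y \<in> topspace Y" using openin_subset by blast
  then obtain U where U: "openin Y U" "y \<in> U" "inj_on f U" using f unfolding etale_map_def by blast
  have om: "open_map Y X f" and cm: "continuous_map Y X f" using f by (auto simp: etale_map_def)
  have V: "openin Y (U \<inter> W)" using U W by auto
  then have "openin X (f ` (U \<inter> W))" using om by (auto simp: open_map_def)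
  then obtain K where K: "openin X K" "compactin X K" "f y \<in> K" "K \<subseteq> f ` (U \<inter> W)"
    using X W(2) U(2) unfolding ample_space_def by blast
  let ?N = "{z \<in> U \<inter> W. f z \<in> K}"
  have N: "openin Y ?N" by (rule openin_continuous_map_preimage_gen[OF cm V K(1)])
  have "f ` ?N = K" using K(4) by auto
  moreover have "inj_on f ?N" using U(3) by (rule inj_on_subset) auto
  ultimately have "compactin Y ?N" using compactin_inj_open[OF om N] K(2) by simp
  then show "\<exists>U. openin Y U \<and> compactin Y U \<and> y \<in> U \<and> U \<subseteq> W"
    using N K(3) U(2) W(2) by (intro exI[of _ ?N]) auto
qed

lemma etale_map_compose:
  assumes f: "etale_map Y X f" and g: "etale_map X Z g"
  shows "etale_map Y Z (\<lambda>y. g (f y))"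
  unfolding etale_map_def
proof (intro conjI ballI)
  show "continuous_map Y Z (\<lambda>y. g (f y))"
    using continuous_map_compose[of Y X f Z g] f g by (simp add: etale_map_def o_def)
  show "open_map Y Z (\<lambda>y. g (f y))"
    using open_map_compose[of Y X f Z g] f g by (simp add: etale_map_def o_def)
  fix y assume y: "y \<in> topspace Y"
  have cf: "continuous_map Y X f" using f by (simp add: etale_map_def)
  obtain U where U: "openin Y U" "y \<in> U" "inj_on f U" using f y unfolding etale_map_def by blast
  have "f y \<in> topspace X" using cf y by (auto simp: continuous_map_def)
  then obtain V where V: "openin X V" "f y \<in> V" "inj_on g V" using g unfolding etale_map_def by blast
  have "inj_on (\<lambda>y. g (f y)) {z \<in> U. f z \<in> V}"
    using U(3) V(3) by (auto simp: inj_on_def)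
  moreover have "openin Y {z \<in> U. f z \<in> V}" by (rule openin_continuous_map_preimage_gen[OF cf U(1) V(1)])
  ultimately show "\<exists>U. openin Y U \<and> y \<in> U \<and> inj_on (\<lambda>y. g (f y)) U"
    using U V by (intro exI[of _ "{z \<in> U. f z \<in> V}"]) auto
qed

text \<open>Locally, \<open>f\<close> is \<open>h\<close> followed by the inverse of
  \<open>g\<close> on an injectivity set. Taking for \<open>g\<close> the anchor of the nerve, whose
  values are units, reduces etaleness of maps between nerves that respect the anchors to
  continuity.\<close>

lemma etale_map_cancel:
  assumes f: "continuous_map Y X f" and g: "etale_map X Z g" and gf: "etale_map Y Z h"
    and h: "\<And>y. y \<in> topspace Y \<Longrightarrow> g (f y) = h y"
  shows "etale_map Y X f"
  unfolding etale_map_def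
proof (intro conjI ballI f)
  show "\<exists>U. openin Y U \<and> y \<in> U \<and> inj_on f U" if y: "y \<in> topspace Y" for y
  proof -
    obtain U where U: "openin Y U" "y \<in> U" "inj_on h U" using gf y unfolding etale_map_def by blast
    have "inj_on f U"
    proof (rule inj_onI)
      fix a b assume ab: "a \<in> U" "b \<in> U" "f a = f b"
      then have "h a = h b" using h openin_subset[OF U(1)] by (metis subsetD)
      then show "a = b" using inj_onD[OF U(3)] ab by blast
    qed
    then show ?thesis using U by blast
  qed
  show "open_map Y X f"
    unfolding open_map_def
  proof (intro allI impI)
    fix W assume W: "openin Y W"
    show "openin X (f ` W)"
    proof (subst openin_subopen, intro ballI)
      fix x assume "x \<in> f ` W"
      then obtain y where y: "y \<in> W" "x = f y" by blast
      have WY: "W \<subseteq> topspace Y" using W by (rule openin_subset)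
      have "f y \<in> topspace X" using f y WY by (auto simp: continuous_map_def)
      then obtain V where V: "openin X V" "f y \<in> V" "inj_on g V" using g unfolding etale_map_def by blast
      let ?W = "{z \<in> W. f z \<in> V}"
      have "openin Y ?W" by (rule openin_continuous_map_preimage_gen[OF f W V(1)])
      then have "openin Z (h ` ?W)" using gf by (auto simp: etale_map_def open_map_def)
      moreover have "continuous_map X Z g" using g by (simp add: etale_map_def)
      ultimately have "openin X {x \<in> V. g x \<in> h ` ?W}"
        using V(1) by (intro openin_continuous_map_preimage_gen)
      moreover have "f y \<in> {x \<in> V. g x \<in> h ` ?W}" using y V(2) h[of y] WY by auto
      moreover have "{x \<in> V. g x \<in> h ` ?W} \<subseteq> f ` W"
      proof
        fix x assume "x \<in> {x \<in> V. g x \<in> h ` ?W}"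
        then obtain w where w: "x \<in> V" "w \<in> W" "f w \<in> V" "g x = h w" by auto
        then have "g x = g (f w)" using h[of w] WY by auto
        then have "x = f w" using inj_onD[OF V(3)] w by blast
        then show "x \<in> f ` W" using w by blast
      qed
      ultimately show "\<exists>T. openin X T \<and> x \<in> T \<and> T \<subseteq> f ` W" using y by blast
    qed
  qed
qed

section \<open>Compactly supported integer-valued functions\<close>

lemma cc_funs_iff:
  "a \<in> cc_funs Y \<longleftrightarrow> (\<forall>c. openin Y {y \<in> topspace Y. a y = c}) \<and> (\<forall>y. y \<notin> topspace Y \<longrightarrow> a y = 0) \<and>
     compactin Y {y \<in> topspace Y. a y \<noteq> 0}"
proof -
  have "continuous_map Y (discrete_topology UNIV) a \<longleftrightarrow> (\<forall>c. openin Y {y \<in> topspace Y. a y = c})"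
  proof
    assume a: "continuous_map Y (discrete_topology UNIV) a"
    show "\<forall>c. openin Y {y \<in> topspace Y. a y = c}"
    proof
      fix c
      have "openin Y {y \<in> topspace Y. a y \<in> {c}}" by (rule openin_continuous_map_preimage[OF a]) simp
      then show "openin Y {y \<in> topspace Y. a y = c}" by simp
    qed
  next
    assume a: "\<forall>c. openin Y {y \<in> topspace Y. a y = c}"
    have "openin Y {y \<in> topspace Y. a y \<in> U}" for U
    proof -
      have "{y \<in> topspace Y. a y \<in> U} = (\<Union>c\<in>U. {y \<in> topspace Y. a y = c})" by auto
      then show ?thesis using a by auto
    qed
    then show "continuous_map Y (discrete_topology UNIV) a" by (simp add: continuous_map_def)
  qed
  then show ?thesis by (auto simp: cc_funs_def)
qed

lemma cc_funsD:
  assumes "a \<in> cc_funs Y"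
  shows "openin Y {y \<in> topspace Y. a y = c}"
    and "y \<notin> topspace Y \<Longrightarrow> a y = 0"
    and "a y \<noteq> 0 \<Longrightarrow> y \<in> topspace Y"
    and "compactin Y {y \<in> topspace Y. a y \<noteq> 0}"
  using assms by (auto simp: cc_funs_iff)

lemma cc_level_open:
  assumes "a \<in> cc_funs Y" shows "openin Y {y \<in> topspace Y. a y \<in> S}"
proof -
  have "{y \<in> topspace Y. a y \<in> S} = (\<Union>c\<in>S. {y \<in> topspace Y. a y = c})" by auto
  then show ?thesis using cc_funsD(1)[OF assms] by auto
qed

lemma cc_support_open: "a \<in> cc_funs Y \<Longrightarrow> openin Y {y \<in> topspace Y. a y \<noteq> 0}"
  using cc_level_open[of a Y "- {0}"] by simp

lemma cc_zero [simp]: "(\<lambda>y. 0) \<in> cc_funs Y"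
proof -
  have "openin Y {y \<in> topspace Y. 0 = c}" for c :: int by (cases "c = 0") auto
  then show ?thesis by (auto simp: cc_funs_iff)
qed

lemma cc_combine:
  fixes h :: "int \<Rightarrow> int \<Rightarrow> int"
  assumes a: "a \<in> cc_funs Y" and b: "\<And>c. openin Y {y \<in> topspace Y. b y = c}"
    and out: "\<And>y. y \<notin> topspace Y \<Longrightarrow> h (a y) (b y) = 0"
    and K: "compactin Y K" and sub: "\<And>y. y \<in> topspace Y \<Longrightarrow> h (a y) (b y) \<noteq> 0 \<Longrightarrow> y \<in> K"
  shows "(\<lambda>y. h (a y) (b y)) \<in> cc_funs Y"
proof -
  have op: "openin Y {y \<in> topspace Y. h (a y) (b y) \<in> S}" for S
  proof -
    have "{y \<in> topspace Y. h (a y) (b y) \<in> S} =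
      (\<Union>p\<in>{p. h (fst p) (snd p) \<in> S}. {y \<in> topspace Y. a y = fst p} \<inter> {y \<in> topspace Y. b y = snd p})"
      by auto
    moreover have "openin Y ({y \<in> topspace Y. a y = fst p} \<inter> {y \<in> topspace Y. b y = snd p})" for p
      by (rule openin_Int[OF cc_funsD(1)[OF a] b])
    ultimately show ?thesis by auto
  qed
  have "closedin Y {y \<in> topspace Y. h (a y) (b y) \<noteq> 0}"
  proof -
    have "topspace Y - {y \<in> topspace Y. h (a y) (b y) \<noteq> 0} = {y \<in> topspace Y. h (a y) (b y) \<in> {0}}" by auto
    then show ?thesis using op[of "{0}"] by (auto simp: closedin_def)
  qed
  then have "compactin Y {y \<in> topspace Y. h (a y) (b y) \<noteq> 0}"
    by (rule closed_compactin[OF K, rotated]) (use sub in auto)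
  then show ?thesis using op[of "{_}"] out by (auto simp: cc_funs_iff)
qed

lemma cc_add:
  assumes "a \<in> cc_funs Y" "b \<in> cc_funs Y" shows "(\<lambda>y. a y + b y) \<in> cc_funs Y"
proof (rule cc_combine[where h = "(+)", OF assms(1) cc_funsD(1)[OF assms(2)]])
  show "compactin Y ({y \<in> topspace Y. a y \<noteq> 0} \<union> {y \<in> topspace Y. b y \<noteq> 0})"
    by (rule compactin_Un[OF cc_funsD(4)[OF assms(1)] cc_funsD(4)[OF assms(2)]])
  show "a y + b y = 0" if "y \<notin> topspace Y" for y
    using cc_funsD(2)[OF assms(1) that] cc_funsD(2)[OF assms(2) that] by simp
qed auto

lemma cc_mult_locally_constant:
  assumes "a \<in> cc_funs Y" "\<And>c. openin Y {y \<in> topspace Y. b y = c}" shows "(\<lambda>y. b y * a y) \<in> cc_funs Y"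
proof (rule cc_combine[where h = "\<lambda>x y. y * x", OF assms(1)])
  show "b y * a y = 0" if "y \<notin> topspace Y" for y
    using cc_funsD(2)[OF assms(1) that] by simp
  show "compactin Y {y \<in> topspace Y. a y \<noteq> 0}" by (rule cc_funsD(4)[OF assms(1)])
qed (use assms(2) in auto)

lemma cc_cmult: "a \<in> cc_funs Y \<Longrightarrow> (\<lambda>y. c * a y) \<in> cc_funs Y"
proof (rule cc_mult_locally_constant)
  show "openin Y {y \<in> topspace Y. c = d}" for d by (cases "c = d") auto
qed

lemma cc_uminus: "a \<in> cc_funs Y \<Longrightarrow> (\<lambda>y. - a y) \<in> cc_funs Y"
  using cc_cmult[of a Y "-1"] by simp

lemma cc_diff: "\<lbrakk>a \<in> cc_funs Y; b \<in> cc_funs Y\<rbrakk> \<Longrightarrow> (\<lambda>y. a y - b y) \<in> cc_funs Y"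
  using cc_add[OF _ cc_uminus, of a Y b] by simp

lemma cc_restrict:
  assumes a: "a \<in> cc_funs Y" and U: "openin Y U" "closedin Y U"
  shows "(\<lambda>y. if y \<in> U then a y else 0) \<in> cc_funs Y"
proof -
  have "(\<lambda>y. (if y \<in> U then 1 else 0) * a y) \<in> cc_funs Y"
  proof (rule cc_mult_locally_constant[OF a])
    fix c :: int
    have "openin Y U" "openin Y (topspace Y - U)" using U by (auto simp: closedin_def)
    moreover have "topspace Y \<inter> U = U" using openin_subset[OF U(1)] by blast
    moreover have "{y \<in> topspace Y. (if y \<in> U then 1 else 0) = c} =
        (if c = 1 then topspace Y \<inter> U else if c = 0 then topspace Y - U else {})" by auto
    ultimately show "openin Y {y \<in> topspace Y. (if y \<in> U then 1 else 0) = c}" by simp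
  qed
  moreover have "(\<lambda>y. (if y \<in> U then 1 else 0) * a y) = (\<lambda>y. if y \<in> U then a y else 0)" by auto
  ultimately show ?thesis by simp
qed

lemma cc_indicator:
  assumes Y: "ample_space Y" and U: "openin Y U" "compactin Y U"
  shows "(\<lambda>y. if y \<in> U then c else 0) \<in> cc_funs Y"
proof -
  have cl: "openin Y (topspace Y - U)" using compact_open_closed[OF Y U(2)] by (simp add: closedin_def)
  have sub: "U \<subseteq> topspace Y" by (rule openin_subset[OF U(1)])
  show ?thesis
  proof (cases "c = 0")
    case False
    then have "{y \<in> topspace Y. (if y \<in> U then c else 0) = d} = (if d = c then U else if d = 0 then topspace Y - U else {})" for d
      using sub by auto
    moreover have "{y \<in> topspace Y. (if y \<in> U then c else 0) \<noteq> 0} = U" using False sub by auto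
    ultimately show ?thesis using U cl sub by (auto simp: cc_funs_iff)
  next
    case True
    then have "(\<lambda>y. if y \<in> U then c else 0) = (\<lambda>y. 0)" by auto
    then show ?thesis by simp
  qed
qed

lemma cc_sum: "(\<And>i. i \<in> I \<Longrightarrow> f i \<in> cc_funs Y) \<Longrightarrow> (\<lambda>y. \<Sum>i\<in>I. f i y) \<in> cc_funs Y"
  by (induction I rule: infinite_finite_induct) (auto intro: cc_add)

text \<open>
  Every element is an integer combination of indicators of compact open sets, which may be taken
  as small as desired.
\<close>

lemma cc_induct [consumes 2, case_names small hereditary zero step]:
  assumes Y: "ample_space Y" and a: "a \<in> cc_funs Y"
    and small: "\<And>y. y \<in> topspace Y \<Longrightarrow> \<exists>U. openin Y U \<and> y \<in> U \<and> Q U"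
    and her: "\<And>U V. \<lbrakk>Q U; V \<subseteq> U\<rbrakk> \<Longrightarrow> Q V"
    and zero: "A (\<lambda>y. 0)"
    and step: "\<And>a c U. \<lbrakk>a \<in> cc_funs Y; A a; openin Y U; compactin Y U; Q U\<rbrakk>
       \<Longrightarrow> A (\<lambda>y. a y + (if y \<in> U then c else 0))"
  shows "A a"
proof -
  \<comment> \<open>\<open>Q\<close> is sharpened so that \<open>a\<close> takes at most one nonzero
    value on each set of the cover.\<close>
  let ?Q = "\<lambda>U. Q U \<and> (\<exists>c. \<forall>y\<in>U. a y \<in> {0, c})"
  have 1: "\<exists>U. openin Y U \<and> y \<in> U \<and> ?Q U" if "y \<in> {y \<in> topspace Y. a y \<noteq> 0}" for y
  proof -
    have y: "y \<in> topspace Y" using that by simp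
    obtain U where U: "openin Y U \<and> y \<in> U \<and> Q U" using small[OF y] ..
    let ?V = "U \<inter> {z \<in> topspace Y. a z = a y}"
    have "openin Y ?V" using U cc_funsD(1)[OF a] by (intro openin_Int) simp_all
    moreover have "Q ?V" using her[of U ?V] U by simp
    moreover have "y \<in> ?V" using U y by simp
    moreover have "\<forall>z\<in>?V. a z \<in> {0, a y}" by simp
    ultimately show ?thesis by (intro exI[of _ ?V] conjI exI[of _ "a y"])
  qed
  have 2: "?Q V" if "?Q U" "V \<subseteq> U" for U V
  proof
    show "Q V" by (rule her[OF conjunct1[OF that(1)] that(2)])
    from conjunct2[OF that(1)] obtain c where "\<forall>y\<in>U. a y \<in> {0, c}" ..
    then have "\<forall>y\<in>V. a y \<in> {0, c}" using that(2) by (simp add: subset_iff)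
    then show "\<exists>c. \<forall>y\<in>V. a y \<in> {0, c}" ..
  qed
  obtain F where F: "finite F" "{y \<in> topspace Y. a y \<noteq> 0} \<subseteq> \<Union>F"
    "\<And>U. U \<in> F \<Longrightarrow> openin Y U \<and> compactin Y U \<and> ?Q U"
    by (rule compact_open_cover[OF Y cc_funsD(4)[OF a], of ?Q])
      (erule 1, erule (1) 2, rule that, assumption+)
  \<comment> \<open>The induction over the cover quantifies over \<open>a\<close>, since cutting off
    one set of the cover changes the function.\<close>
  have "\<forall>a\<in>cc_funs Y. {y \<in> topspace Y. a y \<noteq> 0} \<subseteq> \<Union>F \<longrightarrow>
    (\<forall>U\<in>F. openin Y U \<and> compactin Y U \<and> Q U \<and> (\<exists>c. \<forall>y\<in>U. a y \<in> {0, c})) \<longrightarrow> A a"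
    using F(1)
  proof (induction F)
    case empty
    have "a = (\<lambda>y. 0)" if "a \<in> cc_funs Y" "{y \<in> topspace Y. a y \<noteq> 0} \<subseteq> \<Union>{}" for a
    proof
      fix y show "a y = 0" using cc_funsD(2)[OF that(1), of y] that(2) by (cases "y \<in> topspace Y") auto
    qed
    then show ?case using zero by metis
  next
    case (insert U F)
    show ?case
    proof (intro ballI impI)
      fix a assume a: "a \<in> cc_funs Y" and sup: "{y \<in> topspace Y. a y \<noteq> 0} \<subseteq> \<Union>(insert U F)"
        and all: "\<forall>U\<in>insert U F. openin Y U \<and> compactin Y U \<and> Q U \<and> (\<exists>c. \<forall>y\<in>U. a y \<in> {0, c})"
      then obtain c where U: "openin Y U" "compactin Y U" "Q U" "\<forall>y\<in>U. a y \<in> {0, c}" by auto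
      let ?V = "topspace Y - U"
      have V: "openin Y ?V" "closedin Y ?V" using U compact_open_closed[OF Y U(2)] by (auto simp: closedin_def openin_subset double_diff)
      let ?b = "\<lambda>y. if y \<in> ?V then a y else 0"
      have b: "?b \<in> cc_funs Y" by (rule cc_restrict[OF a V])
      have "A ?b"
      proof (rule insert.IH[rule_format, OF b])
        show "{y \<in> topspace Y. ?b y \<noteq> 0} \<subseteq> \<Union>F" using sup by (auto split: if_splits)
        show "openin Y W \<and> compactin Y W \<and> Q W \<and> (\<exists>c. \<forall>y\<in>W. ?b y \<in> {0, c})" if "W \<in> F" for W
        proof -
          have "\<exists>c. \<forall>y\<in>W. a y \<in> {0, c}" using all that by simp
          then obtain c where "\<forall>y\<in>W. a y \<in> {0, c}" ..
          then have "\<forall>y\<in>W. ?b y \<in> {0, c}" by auto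
          then have "\<exists>c. \<forall>y\<in>W. ?b y \<in> {0, c}" ..
          then show ?thesis using all that by simp
        qed
      qed
      moreover let ?W = "{y \<in> U. a y \<noteq> 0}"
      have W: "?W = U \<inter> {y \<in> topspace Y. a y \<noteq> 0}" using openin_subset[OF U(1)] by auto
      have "openin Y ?W" "compactin Y ?W"
        unfolding W using U cc_support_open[OF a] compact_open_Int_closed[OF U(2)]
          compact_open_closed[OF Y cc_funsD(4)[OF a]] by auto
      ultimately have "A (\<lambda>y. ?b y + (if y \<in> ?W then c else 0))"
        using her[OF U(3), of ?W] b by (intro step) auto
      moreover have "(\<lambda>y. ?b y + (if y \<in> ?W then c else 0)) = a"
        using U(4) cc_funsD(2)[OF a] openin_subset[OF U(1)] by (auto simp: fun_eq_iff)
      ultimately show "A a" by simp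
    qed
  qed
  then show ?thesis using a F by blast
qed

section \<open>Push-forward along etale maps\<close>

text \<open>The compact support is covered by finitely many sets on which \<open>f\<close> is
  injective, and each of them meets the fibre in at most one point.\<close>

lemma finite_fibre_support:
  assumes f: "etale_map Y Z f" and a: "a \<in> cc_funs Y"
  shows "finite {y \<in> {y \<in> topspace Y. f y = z}. a y \<noteq> 0}"
proof -
  let ?C = "{y \<in> topspace Y. a y \<noteq> 0}"
  let ?\<U> = "{U. openin Y U \<and> inj_on f U}"
  have "?C \<subseteq> \<Union>?\<U>" using f unfolding etale_map_def by blast
  moreover have "\<forall>U\<in>?\<U>. openin Y U" by blast
  ultimately obtain F where F: "finite F" "F \<subseteq> ?\<U>" "?C \<subseteq> \<Union>F"
    using cc_funsD(4)[OF a] unfolding compactin_def by (metis (no_types, lifting))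
  have "finite {y \<in> U. f y = z}" if "inj_on f U" for U
  proof (rule finite_imageD[of f])
    show "finite (f ` {y \<in> U. f y = z})" by (rule finite_subset[of _ "{z}"]) auto
    show "inj_on f {y \<in> U. f y = z}" using that by (rule inj_on_subset) auto
  qed
  then have "finite (\<Union>U\<in>F. {y \<in> U. f y = z})" using F by blast
  moreover have "{y \<in> {y \<in> topspace Y. f y = z}. a y \<noteq> 0} \<subseteq> (\<Union>U\<in>F. {y \<in> U. f y = z})" using F(3) by blast
  ultimately show ?thesis by (rule finite_subset[rotated])
qed

lemma pushforward_add:
  assumes "etale_map Y Z f" "a \<in> cc_funs Y" "b \<in> cc_funs Y"
  shows "pushforward Y f (\<lambda>y. a y + b y) = (\<lambda>z. pushforward Y f a z + pushforward Y f b z)"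
  using finite_fibre_support[OF assms(1)] assms by (auto simp: pushforward_fsum fun_eq_iff intro!: fsum_add)

lemma pushforward_cmult: "pushforward Y f (\<lambda>y. c * a y) = (\<lambda>z. c * pushforward Y f a z)"
  by (rule ext) (simp add: pushforward_fsum fsum_cmult)

lemma pushforward_uminus: "pushforward Y f (\<lambda>y. - a y) = (\<lambda>z. - pushforward Y f a z)"
  by (rule ext) (simp add: pushforward_fsum fsum_uminus)

lemma pushforward_zero [simp]: "pushforward Y f (\<lambda>y. 0) = (\<lambda>z. 0)"
  by (rule ext) (simp add: pushforward_fsum)

lemma pushforward_indicator:
  assumes "inj_on f U" "U \<subseteq> topspace Y"
  shows "pushforward Y f (\<lambda>y. if y \<in> U then c else 0) z = (if z \<in> f ` U then c else 0)"
proof (cases "z \<in> f ` U")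
  case True
  then obtain u where u: "u \<in> U" "z = f u" by blast
  then show ?thesis unfolding pushforward_fsum
    using assms by (subst fsum_single[of u]) (auto simp: inj_on_def)
next
  case False
  then have "fsum {y \<in> topspace Y. f y = z} (\<lambda>y. if y \<in> U then c else 0) = fsum {y \<in> topspace Y. f y = z} (\<lambda>y. 0)"
    by (intro fsum_cong) auto
  then show ?thesis using False by (simp add: pushforward_fsum)
qed

text \<open>By additivity the claim reduces to a multiple of the indicator of a compact open set on
  which \<open>f\<close> is injective; its push-forward is the same multiple of the indicator of the
  image.\<close>

lemma pushforward_cc:
  assumes f: "etale_map Y Z f" and Y: "ample_space Y" and Z: "ample_space Z" and a: "a \<in> cc_funs Y"
  shows "pushforward Y f a \<in> cc_funs Z"
  using Y a
proof (induction a rule: cc_induct[where Q = "inj_on f"])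
  case (small y)
  then show ?case using f unfolding etale_map_def by blast
next
  case (hereditary U V)
  then show ?case using inj_on_subset by blast
next
  case zero
  then show ?case by simp
next
  case (step a c U)
  have "openin Z (f ` U)" "compactin Z (f ` U)"
    using f step image_compactin[of Y U Z f] by (auto simp: etale_map_def open_map_def)
  then have "(\<lambda>z. if z \<in> f ` U then c else 0) \<in> cc_funs Z" by (rule cc_indicator[OF Z])
  moreover have "pushforward Y f (\<lambda>y. if y \<in> U then c else 0) = (\<lambda>z. if z \<in> f ` U then c else 0)"
    by (rule ext) (rule pushforward_indicator[OF \<open>inj_on f U\<close> openin_subset[OF \<open>openin Y U\<close>]])
  ultimately show ?case
    using step cc_indicator[OF Y, of U c] by (subst pushforward_add[OF f]) (auto intro: cc_add)
qed

text \<open>Etaleness is asked of the composite: it makes the support of \<open>a\<close> finite on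
  each fibre of \<open>h\<close>, which justifies summing over the smaller fibres first.\<close>

lemma pushforward_compose:
  assumes gf: "etale_map Y Z h" and a: "a \<in> cc_funs Y"
    and f: "\<And>y. y \<in> topspace Y \<Longrightarrow> f y \<in> topspace X" and h: "\<And>y. y \<in> topspace Y \<Longrightarrow> h y = g (f y)"
  shows "pushforward X g (pushforward Y f a) = pushforward Y h a"
proof
  fix z
  let ?A = "{x \<in> topspace X. g x = z}" and ?B = "\<lambda>x. {y \<in> topspace Y. f y = x}"
  have bij: "bij_betw (\<lambda>y. (f y, y)) {y \<in> topspace Y. h y = z} (Sigma ?A ?B)"
    using f h by (auto simp: bij_betw_def inj_on_def)
  have "{p \<in> Sigma ?A ?B. a (snd p) \<noteq> 0} = (\<lambda>y. (f y, y)) ` {y \<in> {y \<in> topspace Y. h y = z}. a y \<noteq> 0}"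
    using f h by auto
  then have "finite {p \<in> Sigma ?A ?B. a (snd p) \<noteq> 0}" using finite_fibre_support[OF gf a] by simp
  then have "fsum ?A (\<lambda>x. fsum (?B x) a) = fsum (Sigma ?A ?B) (\<lambda>p. a (snd p))"
    using fsum_Sigma[of ?A ?B "\<lambda>x. a"] by simp
  also have "\<dots> = fsum {y \<in> topspace Y. h y = z} a"
    using fsum_reindex[OF bij, of "\<lambda>p. a (snd p)"] by simp
  finally have "fsum ?A (\<lambda>x. fsum (?B x) a) = fsum {y \<in> topspace Y. h y = z} a" .
  moreover have "pushforward Y f a = (\<lambda>x. fsum (?B x) a)" by (rule ext) (rule pushforward_fsum)
  ultimately show "pushforward X g (pushforward Y f a) z = pushforward Y h a z"
    by (simp add: pushforward_fsum[of X] pushforward_fsum[of Y h])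
qed

lemma pushforward_cong:
  assumes "\<And>y. y \<in> topspace Y \<Longrightarrow> f y = g y" shows "pushforward Y f a = pushforward Y g a"
  by (rule ext) (auto simp: pushforward_fsum assms intro!: fsum_cong)

lemma comm_group_cc: "comm_group (cc_group Y)"
proof (rule comm_groupI)
  fix a assume "a \<in> carrier (cc_group Y)"
  then show "\<exists>b\<in>carrier (cc_group Y). b \<otimes>\<^bsub>cc_group Y\<^esub> a = \<one>\<^bsub>cc_group Y\<^esub>"
    by (intro bexI[of _ "\<lambda>y. - a y"]) (auto simp: cc_group_def cc_uminus)
qed (auto simp: cc_group_def cc_add fun_eq_iff)

section \<open>Ample groupoids\<close>

context ample_groupoid
begin

lemma arrows_topspace: "topspace (gtop G) = arrows G"
  by (simp add: arrows_def)

lemma units_arrows: "x \<in> units G \<Longrightarrow> x \<in> arrows G"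
  by (auto simp: units_def src_closed)

lemma src_in_units: "g \<in> arrows G \<Longrightarrow> gsrc G g \<in> units G"
  by (auto simp: units_def)

lemma rng_in_units: "g \<in> arrows G \<Longrightarrow> grng G g \<in> units G"
  using src_rng rng_closed src_in_units by metis

lemma src_unit: "x \<in> units G \<Longrightarrow> gsrc G x = x"
  by (auto simp: units_def src_src)

lemma rng_unit: "x \<in> units G \<Longrightarrow> grng G x = x"
  by (auto simp: units_def rng_src)

lemma unit_topspace: "topspace (unit_top G) = units G"
  using units_arrows by (auto simp: unit_top_def arrows_topspace)

lemma unit_mul: "\<lbrakk>x \<in> units G; g \<in> arrows G; x = grng G g\<rbrakk> \<Longrightarrow> gmul G x g = g"
  using mul_rng by simp

lemma mul_unit: "\<lbrakk>x \<in> units G; g \<in> arrows G; gsrc G g = x\<rbrakk> \<Longrightarrow> gmul G g x = g"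
  using mul_src by blast

lemma inv_mul_cancel:
  assumes "g \<in> arrows G" "h \<in> arrows G" "gsrc G g = grng G h"
  shows "gmul G (ginv G g) (gmul G g h) = h"
proof -
  have "gmul G (ginv G g) (gmul G g h) = gmul G (gmul G (ginv G g) g) h"
    using assms by (simp add: mul_assoc inv_closed src_inv)
  then show ?thesis using assms mul_rng by (simp add: inv_mul)
qed

lemma mul_inv_cancel:
  assumes "g \<in> arrows G" "h \<in> arrows G" "grng G g = grng G h"
  shows "gmul G g (gmul G (ginv G g) h) = h"
proof -
  have "gmul G g (gmul G (ginv G g) h) = gmul G (gmul G g (ginv G g)) h"
    using assms by (simp add: mul_assoc inv_closed src_inv rng_inv)
  then show ?thesis using assms mul_rng by (simp add: mul_inv)
qed

lemma inv_inv: assumes g: "g \<in> arrows G" shows "ginv G (ginv G g) = g"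
proof -
  have "gmul G (ginv G (ginv G g)) (gmul G (ginv G g) g) = g"
    using g by (intro inv_mul_cancel) (auto simp: inv_closed src_inv rng_inv)
  moreover have "gmul G (ginv G (ginv G g)) (gsrc G g) = ginv G (ginv G g)"
    using g by (intro mul_unit) (auto simp: inv_closed src_inv rng_inv src_in_units)
  ultimately show ?thesis using g by (simp add: inv_mul)
qed

lemma inv_unit: assumes x: "x \<in> units G" shows "ginv G x = x"
proof -
  have xa: "x \<in> arrows G" using x units_arrows by blast
  then have "gmul G x (ginv G x) = ginv G x"
    using x by (intro unit_mul) (auto simp: inv_closed rng_inv src_unit)
  then show ?thesis using mul_inv[OF xa] rng_unit[OF x] by simp
qed

lemma inv_mul_distrib:
  assumes g: "g \<in> arrows G" and h: "h \<in> arrows G" and gh: "gsrc G g = grng G h"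
  shows "ginv G (gmul G g h) = gmul G (ginv G h) (ginv G g)"
proof -
  let ?p = "gmul G g h" and ?q = "gmul G (ginv G h) (ginv G g)"
  have p: "?p \<in> arrows G" "grng G ?p = grng G g" "gsrc G ?p = gsrc G h" using assms by (simp_all add: mul_closed rng_mul src_mul)
  have q: "?q \<in> arrows G" "grng G ?q = gsrc G h" "gsrc G ?q = grng G g"
    using assms by (simp_all add: mul_closed rng_mul src_mul inv_closed src_inv rng_inv)
  have "gmul G ?p ?q = gmul G g (gmul G h (gmul G (ginv G h) (ginv G g)))"
    using assms q by (intro mul_assoc) simp_all
  also have "gmul G h (gmul G (ginv G h) (ginv G g)) = ginv G g"
    using assms by (intro mul_inv_cancel) (auto simp: inv_closed rng_inv)
  finally have "gmul G ?p ?q = grng G g" using g by (simp add: mul_inv)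
  then have "gmul G (ginv G ?p) (gmul G ?p ?q) = gmul G (ginv G ?p) (grng G g)" by simp
  also have "\<dots> = ginv G ?p" using p g by (intro mul_unit) (auto simp: inv_closed src_inv rng_in_units)
  finally show ?thesis using inv_mul_cancel[OF p(1) q(1)] p q by simp
qed

section \<open>Bisections and the topology of the units\<close>

lemma bisection_inj:
  assumes "bisection G U" shows "inj_on (grng G) U" "inj_on (gsrc G) U"
proof -
  have "topspace (subtopology (gtop G) U) = U"
    using assms by (auto simp: bisection_def arrows_def)
  then show "inj_on (grng G) U" "inj_on (gsrc G) U"
    using assms homeomorphic_imp_injective_map unfolding bisection_def by metis+
qed

lemma etale_rng: "etale_map (gtop G) (unit_top G) (grng G)"
  and etale_src: "etale_map (gtop G) (unit_top G) (gsrc G)"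
proof -
  have "\<exists>U. openin (gtop G) U \<and> g \<in> U \<and> bisection G U" if "g \<in> topspace (gtop G)" for g
    using bisection_basis[of "topspace (gtop G)" g] that by blast
  then show "etale_map (gtop G) (unit_top G) (grng G)" "etale_map (gtop G) (unit_top G) (gsrc G)"
    unfolding etale_map_def using bisection_inj continuous_rng continuous_src open_rng open_src by meson+
qed

lemma ample_gtop: "ample_space (gtop G)"
  unfolding ample_space_def using Hausdorff compact_bisection_basis by blast

text \<open>If an open bisection around a unit contains both \<open>g\<close> and
  \<open>gsrc G g\<close>, these two have the same source and therefore agree, so \<open>g\<close>
  is a unit.\<close>

lemma units_open: "openin (gtop G) (units G)"
proof (subst openin_subopen, intro ballI)
  fix x assume x: "x \<in> units G"
  then have "x \<in> topspace (gtop G)" using units_arrows by (simp add: arrows_topspace)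
  then obtain U where U: "openin (gtop G) U" "bisection G U" "x \<in> U"
    using bisection_basis[of "topspace (gtop G)" x] by blast
  have c: "continuous_map (gtop G) (gtop G) (gsrc G)"
    using continuous_src continuous_map_into_fulltopology unfolding unit_top_def by blast
  have "openin (gtop G) {g \<in> U. gsrc G g \<in> U}" by (rule openin_continuous_map_preimage_gen[OF c U(1,1)])
  moreover have "x \<in> {g \<in> U. gsrc G g \<in> U}" using U x src_unit by simp
  moreover have "{g \<in> U. gsrc G g \<in> U} \<subseteq> units G"
  proof
    fix g assume g: "g \<in> {g \<in> U. gsrc G g \<in> U}"
    then have ga: "g \<in> arrows G" using openin_subset[OF U(1)] arrows_topspace by blast
    then have "gsrc G (gsrc G g) = gsrc G g" by (rule src_src)
    then have "gsrc G g = g" using inj_onD[OF bisection_inj(2)[OF U(2)]] g by blast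
    then show "g \<in> units G" using src_in_units[OF ga] by simp
  qed
  ultimately show "\<exists>T. openin (gtop G) T \<and> x \<in> T \<and> T \<subseteq> units G" by blast
qed

lemma openin_unit_top: "openin (unit_top G) U \<longleftrightarrow> openin (gtop G) U \<and> U \<subseteq> units G"
  unfolding unit_top_def by (rule openin_open_subtopology[OF units_open])

lemma compactin_unit_top: "compactin (unit_top G) K \<longleftrightarrow> compactin (gtop G) K \<and> K \<subseteq> units G"
  unfolding unit_top_def by (rule compactin_subtopology)

lemma Hausdorff_unit_top: "Hausdorff_space (unit_top G)"
  unfolding unit_top_def by (rule Hausdorff_space_subtopology[OF Hausdorff])

lemma ample_unit_top: "ample_space (unit_top G)"
  unfolding ample_space_def
proof (intro conjI Hausdorff_unit_top allI impI, elim conjE)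
  fix W x assume "openin (unit_top G) W" "x \<in> W"
  then have W: "openin (gtop G) W" "x \<in> W" "W \<subseteq> units G" by (simp_all add: openin_unit_top)
  then obtain U where "openin (gtop G) U" "compactin (gtop G) U" "x \<in> U" "U \<subseteq> W"
    using ample_gtop unfolding ample_space_def by metis
  then show "\<exists>U. openin (unit_top G) U \<and> compactin (unit_top G) U \<and> x \<in> U \<and> U \<subseteq> W"
    using W by (intro exI[of _ U]) (auto simp: openin_unit_top compactin_unit_top)
qed

lemma closedin_equal_units:
  assumes f: "continuous_map X (unit_top G) f" and g: "continuous_map X (unit_top G) g"
  shows "closedin X {x \<in> topspace X. f x = g x}"
proof -
  let ?D = "(\<lambda>x. (x, x)) ` topspace (unit_top G)"
  have "closedin (prod_topology (unit_top G) (unit_top G)) ?D"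
    using Hausdorff_unit_top Hausdorff_space_closedin_diagonal by blast
  then have "closedin X {x \<in> topspace X. (f x, g x) \<in> ?D}"
    by (rule closedin_continuous_map_preimage[OF continuous_map_pairedI[OF f g]])
  moreover have "{x \<in> topspace X. (f x, g x) \<in> ?D} = {x \<in> topspace X. f x = g x}"
    using f by (auto simp: continuous_map_def Pi_iff)
  ultimately show ?thesis by simp
qed

text \<open>The units are the fixed points of the source map, and the space is Hausdorff. Together
  with openness this allows extension by zero from the units to all arrows.\<close>

lemma units_closed: "closedin (gtop G) (units G)"
proof -
  have 1: "continuous_map (gtop G) (gtop G) (gsrc G)"
    using continuous_src continuous_map_into_fulltopology unfolding unit_top_def by blast
  have 2: "continuous_map (gtop G) (gtop G) (\<lambda>g. g)" using continuous_map_id[of "gtop G"] by (simp add: id_def)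
  have "closedin (prod_topology (gtop G) (gtop G)) ((\<lambda>x. (x, x)) ` topspace (gtop G))"
    using Hausdorff Hausdorff_space_closedin_diagonal by blast
  then have "closedin (gtop G) {g \<in> topspace (gtop G). (gsrc G g, g) \<in> (\<lambda>x. (x, x)) ` topspace (gtop G)}"
    by (rule closedin_continuous_map_preimage[OF continuous_map_pairedI[OF 1 2]])
  moreover have "{g \<in> topspace (gtop G). (gsrc G g, g) \<in> (\<lambda>x. (x, x)) ` topspace (gtop G)} = units G"
    using units_arrows src_unit src_in_units by (force simp: arrows_topspace)
  ultimately show ?thesis by simp
qed

text \<open>Functions on the base space become elements of the convolution ring without any change,
  as both are zero outside the units. In particular they provide the local units.\<close>

lemma cc_units_subset:
  assumes a: "a \<in> cc_funs (unit_top G)" shows "a \<in> cc_funs (gtop G)"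
  unfolding cc_funs_iff
proof (intro conjI allI impI)
  have out: "a g = 0" if "g \<notin> units G" for g using cc_funsD(2)[OF a] that by (simp add: unit_topspace)
  fix c
  show "openin (gtop G) {y \<in> topspace (gtop G). a y = c}"
  proof -
    have op: "openin (gtop G) {y \<in> units G. a y = c}"
      using cc_funsD(1)[OF a, of c] by (simp add: openin_unit_top unit_topspace)
    have "openin (gtop G) (arrows G - units G)" using units_closed by (simp add: closedin_def arrows_topspace)
    moreover have "{y \<in> topspace (gtop G). a y = c} =
        {y \<in> units G. a y = c} \<union> (if c = 0 then arrows G - units G else {})"
      using out units_arrows by (auto simp: arrows_topspace)
    ultimately show ?thesis using op by auto
  qed
next
  fix g assume "g \<notin> topspace (gtop G)"
  then show "a g = 0" using cc_funsD(2)[OF a] units_arrows by (auto simp: unit_topspace arrows_topspace)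
next
  have "{y \<in> topspace (gtop G). a y \<noteq> 0} = {y \<in> topspace (unit_top G). a y \<noteq> 0}"
    using cc_funsD(2)[OF a] units_arrows by (auto simp: unit_topspace arrows_topspace)
  then show "compactin (gtop G) {y \<in> topspace (gtop G). a y \<noteq> 0}"
    using cc_funsD(4)[OF a] by (simp add: compactin_unit_top)
qed

lemma fibre_finite:
  assumes "f \<in> cc_funs (gtop G)"
  shows "finite {h \<in> arrows G. grng G h = x \<and> f h \<noteq> 0}" "finite {h \<in> arrows G. gsrc G h = x \<and> f h \<noteq> 0}"
  using finite_fibre_support[OF etale_rng assms, of x] finite_fibre_support[OF etale_src assms, of x]
  by (simp_all add: arrows_topspace conj_assoc)

end

lemma openin_prod_box:
  assumes "openin (prod_topology X Y) S" "(x, y) \<in> S"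
  shows "\<exists>U V. openin X U \<and> openin Y V \<and> x \<in> U \<and> y \<in> V \<and> U \<times> V \<subseteq> S"
  using assms(1)[unfolded openin_prod_topology_alt, rule_format, OF assms(2)] .

section \<open>Spaces with a groupoid action\<close>

text \<open>The arrow \<open>g\<close> acts on \<open>z\<close> when \<open>gsrc G g = \<rho> z\<close>; other values of \<open>act\<close> are junk.\<close>

locale groupoid_space = ample_groupoid +
  fixes Z :: "'z topology" and \<rho> :: "'z \<Rightarrow> 'a" and act :: "'a \<Rightarrow> 'z \<Rightarrow> 'z"
  assumes ample_Z: "ample_space Z"
    and anchor_continuous: "continuous_map Z (unit_top G) \<rho>"
    and act_closed: "\<lbrakk>g \<in> arrows G; z \<in> topspace Z; gsrc G g = \<rho> z\<rbrakk> \<Longrightarrow> act g z \<in> topspace Z"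
    and anchor_act: "\<lbrakk>g \<in> arrows G; z \<in> topspace Z; gsrc G g = \<rho> z\<rbrakk> \<Longrightarrow> \<rho> (act g z) = grng G g"
    and act_mul: "\<lbrakk>g \<in> arrows G; h \<in> arrows G; z \<in> topspace Z; gsrc G g = grng G h; gsrc G h = \<rho> z\<rbrakk>
        \<Longrightarrow> act (gmul G g h) z = act g (act h z)"
    and act_unit: "z \<in> topspace Z \<Longrightarrow> act (\<rho> z) z = z"
    and act_continuous: "continuous_map
        (subtopology (prod_topology (gtop G) Z) {(g, z). gsrc G g = \<rho> z}) Z (\<lambda>(g, z). act g z)"
begin

text \<open>With arrows acting on arrows, on units and on tuples, this one formula becomes the ring
  product, the left module of functions on the base space and the bar modules.\<close>

definition conv :: "('a \<Rightarrow> int) \<Rightarrow> ('z \<Rightarrow> int) \<Rightarrow> 'z \<Rightarrow> int" where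
  "conv f b z = (if z \<in> topspace Z
     then fsum {h \<in> arrows G. grng G h = \<rho> z} (\<lambda>h. f h * b (act (ginv G h) z)) else 0)"

lemma anchor_in_units: "z \<in> topspace Z \<Longrightarrow> \<rho> z \<in> units G"
  using anchor_continuous by (auto simp: continuous_map_def unit_topspace Pi_iff)

lemma inv_act_closed:
  assumes "h \<in> arrows G" "z \<in> topspace Z" "grng G h = \<rho> z"
  shows "act (ginv G h) z \<in> topspace Z" "\<rho> (act (ginv G h) z) = gsrc G h"
    "act h (act (ginv G h) z) = z"
proof -
  show "act (ginv G h) z \<in> topspace Z" "\<rho> (act (ginv G h) z) = gsrc G h"
    using assms by (auto simp: act_closed anchor_act inv_closed src_inv rng_inv)
  have "act (gmul G h (ginv G h)) z = act h (act (ginv G h) z)"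
    using assms by (intro act_mul) (auto simp: inv_closed src_inv rng_inv)
  then show "act h (act (ginv G h) z) = z" using assms by (simp add: mul_inv act_unit)
qed

lemma act_inv_act:
  assumes "h \<in> arrows G" "z \<in> topspace Z" "gsrc G h = \<rho> z"
  shows "act (ginv G h) (act h z) = z"
proof -
  have "act (gmul G (ginv G h) h) z = act (ginv G h) (act h z)"
    using assms by (intro act_mul) (auto simp: inv_closed src_inv rng_inv)
  then show ?thesis using assms by (simp add: inv_mul act_unit)
qed

definition set_act :: "'a set \<Rightarrow> 'z set \<Rightarrow> 'z set" where
  "set_act U V = {act g z | g z. g \<in> U \<and> z \<in> V \<and> gsrc G g = \<rho> z}"

text \<open>A point \<open>y\<close> near \<open>z = act u v\<close> is \<open>ginv G g\<close>
  applied to \<open>act g y\<close>, for \<open>g\<close> near the inverse of \<open>u\<close>. Then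
  \<open>act g y\<close> is in \<open>V\<close> by continuity of the action, and a \<open>g\<close>
  with the source required by \<open>y\<close> exists because the source map is open.\<close>

lemma set_act_open:
  assumes U: "openin (gtop G) U" and V: "openin Z V"
  shows "openin Z (set_act U V)"
proof (subst openin_subopen, intro ballI)
  fix z assume "z \<in> set_act U V"
  then obtain u v where uv: "u \<in> U" "v \<in> V" "gsrc G u = \<rho> v" "z = act u v" by (auto simp: set_act_def)
  have ua: "u \<in> arrows G" using uv openin_subset[OF U] by (auto simp: arrows_topspace)
  have vZ: "v \<in> topspace Z" using uv openin_subset[OF V] by auto
  have zZ: "z \<in> topspace Z" using uv ua vZ by (simp add: act_closed)
  let ?S = "{(g, z). gsrc G g = \<rho> z}"
  let ?X = "subtopology (prod_topology (gtop G) Z) ?S"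
  have "openin ?X {p \<in> topspace ?X. (case p of (g, z) \<Rightarrow> act g z) \<in> V}"
    by (rule openin_continuous_map_preimage[OF act_continuous V])
  then obtain N where N: "openin (prod_topology (gtop G) Z) N"
    "{p \<in> topspace ?X. (case p of (g, z) \<Rightarrow> act g z) \<in> V} = N \<inter> ?S" by (auto simp: openin_subtopology)
  have iu: "ginv G u \<in> arrows G" "gsrc G (ginv G u) = \<rho> z" "act (ginv G u) z = v"
    using ua vZ uv by (auto simp: inv_closed src_inv anchor_act act_inv_act)
  then have "(ginv G u, z) \<in> N \<inter> ?S"
    using zZ uv N(2)[symmetric] by (auto simp: arrows_topspace)
  then obtain A C where AC: "openin (gtop G) A" "openin Z C" "ginv G u \<in> A" "z \<in> C" "A \<times> C \<subseteq> N"
    using openin_prod_box[OF N(1), of "ginv G u" z] by auto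
  let ?A = "{g \<in> A. ginv G g \<in> U}"
  have A: "openin (gtop G) ?A" by (rule openin_continuous_map_preimage_gen[OF continuous_inv AC(1) U])
  have "openin (unit_top G) (gsrc G ` ?A)" using open_src A by (simp add: open_map_def)
  then have "openin Z {y \<in> C. \<rho> y \<in> gsrc G ` ?A}"
    by (rule openin_continuous_map_preimage_gen[OF anchor_continuous AC(2)])
  moreover have "z \<in> {y \<in> C. \<rho> y \<in> gsrc G ` ?A}"
    using AC iu uv inv_inv[OF ua] by (auto intro!: image_eqI[of _ _ "ginv G u"])
  moreover have "{y \<in> C. \<rho> y \<in> gsrc G ` ?A} \<subseteq> set_act U V"
  proof
    fix y assume "y \<in> {y \<in> C. \<rho> y \<in> gsrc G ` ?A}"
    then obtain g where g: "y \<in> C" "g \<in> A" "ginv G g \<in> U" "\<rho> y = gsrc G g" by auto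
    have ga: "g \<in> arrows G" using g openin_subset[OF AC(1)] by (auto simp: arrows_topspace)
    have yZ: "y \<in> topspace Z" using g openin_subset[OF AC(2)] by auto
    have "(g, y) \<in> N \<inter> ?S" using g AC(5) by auto
    then have "act g y \<in> V" using N(2)[symmetric] by auto
    moreover have "act (ginv G g) (act g y) = y" using ga yZ g by (simp add: act_inv_act)
    moreover have "gsrc G (ginv G g) = \<rho> (act g y)" using ga yZ g by (simp add: src_inv anchor_act)
    ultimately show "y \<in> set_act U V" unfolding set_act_def using g(3) by (metis (mono_tags, lifting) mem_Collect_eq)
  qed
  ultimately show "\<exists>T. openin Z T \<and> z \<in> T \<and> T \<subseteq> set_act U V" by blast
qed

text \<open>The pairs on which the action is defined form a closed set, as the base space is
  Hausdorff; hence those in \<open>U \<times> V\<close> form a compact set, and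
  \<open>set_act U V\<close> is its image.\<close>

lemma set_act_compact:
  assumes U: "compactin (gtop G) U" and V: "compactin Z V"
  shows "compactin Z (set_act U V)"
proof -
  let ?S = "{(g, z). gsrc G g = \<rho> z}"
  let ?P = "prod_topology (gtop G) Z"
  have "continuous_map ?P (unit_top G) (\<lambda>p. gsrc G (fst p))" "continuous_map ?P (unit_top G) (\<lambda>p. \<rho> (snd p))"
    using continuous_map_compose[OF continuous_map_fst continuous_src]
      continuous_map_compose[OF continuous_map_snd anchor_continuous] by (simp_all add: o_def)
  then have cl: "closedin ?P {p \<in> topspace ?P. gsrc G (fst p) = \<rho> (snd p)}" by (rule closedin_equal_units)
  have "compactin ?P (U \<times> V)" using U V by (simp add: compactin_Times)
  then have "compactin ?P (U \<times> V \<inter> {p \<in> topspace ?P. gsrc G (fst p) = \<rho> (snd p)})"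
    by (rule compact_open_Int_closed[OF _ cl])
  moreover have "U \<times> V \<inter> {p \<in> topspace ?P. gsrc G (fst p) = \<rho> (snd p)} = U \<times> V \<inter> ?S"
    using compactin_subset_topspace[OF U] compactin_subset_topspace[OF V] by auto
  ultimately have "compactin (subtopology ?P ?S) (U \<times> V \<inter> ?S)" by (simp add: compactin_subtopology)
  from image_compactin[OF this act_continuous]
  have "compactin Z ((\<lambda>(g, z). act g z) ` (U \<times> V \<inter> ?S))" .
  moreover have "(\<lambda>(g, z). act g z) ` (U \<times> V \<inter> ?S) = set_act U V" by (auto simp: set_act_def)
  ultimately show ?thesis by simp
qed

lemma conv_support_finite:
  assumes "f \<in> cc_funs (gtop G)"
  shows "finite {h \<in> {h \<in> arrows G. grng G h = x}. f h * c h \<noteq> 0}"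
  by (rule finite_subset[OF _ fibre_finite(1)[OF assms, of x]]) auto

lemma conv_add_left:
  assumes "f \<in> cc_funs (gtop G)" "f' \<in> cc_funs (gtop G)"
  shows "conv (\<lambda>g. f g + f' g) b = (\<lambda>z. conv f b z + conv f' b z)"
  using fsum_add[OF conv_support_finite[OF assms(1)] conv_support_finite[OF assms(2)]]
  by (auto simp: conv_def fun_eq_iff distrib_right)

lemma conv_add_right:
  assumes "f \<in> cc_funs (gtop G)"
  shows "conv f (\<lambda>z. b z + b' z) = (\<lambda>z. conv f b z + conv f b' z)"
  using fsum_add[OF conv_support_finite[OF assms] conv_support_finite[OF assms]]
  by (auto simp: conv_def fun_eq_iff distrib_left)

lemma conv_zero [simp]: "conv (\<lambda>g. 0) b = (\<lambda>z. 0)" "conv f (\<lambda>z. 0) = (\<lambda>z. 0)"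
  by (auto simp: conv_def fun_eq_iff)

text \<open>At most one arrow contributes at \<open>z\<close>: the one in \<open>U\<close> with
  range \<open>\<rho> z\<close>.\<close>

lemma conv_indicator:
  assumes U: "U \<subseteq> arrows G" "inj_on (grng G) U" and V: "V \<subseteq> topspace Z"
  shows "conv (\<lambda>g. if g \<in> U then c else 0) (\<lambda>z. if z \<in> V then e else 0) = (\<lambda>z. if z \<in> set_act U V then c * e else 0)"
proof
  fix z
  show "conv (\<lambda>g. if g \<in> U then c else 0) (\<lambda>z. if z \<in> V then e else 0) z = (if z \<in> set_act U V then c * e else 0)"
  proof (cases "z \<in> set_act U V")
    case True
    then obtain u v where uv: "u \<in> U" "v \<in> V" "gsrc G u = \<rho> v" "z = act u v" by (auto simp: set_act_def)
    have ua: "u \<in> arrows G" and vZ: "v \<in> topspace Z" using uv U V by auto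
    have zZ: "z \<in> topspace Z" and \<rho>z: "\<rho> z = grng G u" and iz: "act (ginv G u) z = v"
      using uv ua vZ by (simp_all add: act_closed anchor_act act_inv_act)
    have "fsum {h \<in> arrows G. grng G h = \<rho> z}
      (\<lambda>h. (if h \<in> U then c else 0) * (if act (ginv G h) z \<in> V then e else 0)) = c * e"
      using ua \<rho>z uv iz inj_onD[OF U(2)] by (subst fsum_single[of u]) auto
    then show ?thesis using True zZ by (simp add: conv_def)
  next
    case False
    have "(if h \<in> U then c else 0) * (if act (ginv G h) z \<in> V then e else 0) = 0"
      if "z \<in> topspace Z" "h \<in> arrows G" "grng G h = \<rho> z" for h
    proof -
      have "h \<notin> U \<or> act (ginv G h) z \<notin> V"
        using False inv_act_closed[OF that(2,1,3)] unfolding set_act_def by (metis (mono_tags, lifting) mem_Collect_eq)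
      then show ?thesis by auto
    qed
    then have "fsum {h \<in> arrows G. grng G h = \<rho> z}
      (\<lambda>h. (if h \<in> U then c else 0) * (if act (ginv G h) z \<in> V then e else 0)) = fsum {h \<in> arrows G. grng G h = \<rho> z} (\<lambda>h. 0)"
      if "z \<in> topspace Z" using that by (intro fsum_cong) auto
    then show ?thesis using False by (simp add: conv_def)
  qed
qed

text \<open>Additivity in both arguments reduces the claim to multiples of indicators, for which the
  result is a multiple of the indicator of the compact open set \<open>set_act U V\<close>.\<close>

lemma conv_closed:
  assumes f: "f \<in> cc_funs (gtop G)" and b: "b \<in> cc_funs Z"
  shows "conv f b \<in> cc_funs Z"
  using ample_gtop f
proof (induction f rule: cc_induct[where Q = "inj_on (grng G)"])
  case (small y)
  then show ?case using etale_rng unfolding etale_map_def by blast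
next
  case (hereditary U V)
  then show ?case using inj_on_subset by blast
next
  case zero
  then show ?case by simp
next
  case (step f c U)
  have U: "openin (gtop G) U" "compactin (gtop G) U" "inj_on (grng G) U" "U \<subseteq> arrows G"
    using step openin_subset[of "gtop G" U] by (auto simp: arrows_topspace)
  have Uc: "(\<lambda>g. if g \<in> U then c else 0) \<in> cc_funs (gtop G)" by (rule cc_indicator[OF ample_gtop U(1,2)])
  have "conv (\<lambda>g. if g \<in> U then c else 0) b \<in> cc_funs Z"
    using ample_Z b
  proof (induction b rule: cc_induct[where Q = "\<lambda>_. True"])
    case (small y)
    then show ?case by blast
  next
    case zero
    then show ?case by simp
  next
    case (step b e V)
    have "(\<lambda>z. if z \<in> set_act U V then c * e else 0) \<in> cc_funs Z"
      by (rule cc_indicator[OF ample_Z set_act_open set_act_compact]) (use U step in auto)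
    then show ?case
      using step openin_subset[of Z V] conv_indicator[OF U(4,3), of V c e]
      by (simp add: conv_add_right[OF Uc] cc_add)
  qed simp
  then show ?case using step by (simp add: conv_add_left[OF _ Uc] cc_add)
qed

text \<open>Among the arrows with range \<open>\<rho> z\<close>, the only unit is
  \<open>\<rho> z\<close> itself.\<close>

lemma conv_units:
  assumes "\<And>g. g \<notin> units G \<Longrightarrow> a g = 0" and "z \<in> topspace Z"
  shows "conv a b z = a (\<rho> z) * b z"
proof -
  have u: "\<rho> z \<in> units G" by (rule anchor_in_units[OF assms(2)])
  have "fsum {h \<in> arrows G. grng G h = \<rho> z} (\<lambda>h. a h * b (act (ginv G h) z)) = a (\<rho> z) * b (act (ginv G (\<rho> z)) z)"
  proof (rule fsum_single)
    show "\<rho> z \<in> {h \<in> arrows G. grng G h = \<rho> z}" using u units_arrows rng_unit by simp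
    fix h assume h: "h \<in> {h \<in> arrows G. grng G h = \<rho> z}" "h \<noteq> \<rho> z"
    then have "h \<notin> units G" using rng_unit[of h] by auto
    then show "a h * b (act (ginv G h) z) = 0" using assms(1) by simp
  qed
  then show ?thesis using assms(2) u by (simp add: conv_def inv_unit act_unit)
qed

lemma unit_for_compact:
  assumes "compactin Z C"
  shows "\<exists>K. openin (unit_top G) K \<and> compactin (unit_top G) K \<and> \<rho> ` C \<subseteq> K"
  using compact_open_superset[OF ample_unit_top image_compactin[OF assms anchor_continuous]] by metis

lemma conv_local_unit:
  assumes K: "K \<subseteq> units G" and b: "b \<in> cc_funs Z" and sub: "\<rho> ` {z \<in> topspace Z. b z \<noteq> 0} \<subseteq> K"
  shows "conv (\<lambda>g. if g \<in> K then 1 else 0) b = b"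
proof
  fix z
  show "conv (\<lambda>g. if g \<in> K then 1 else 0) b z = b z"
  proof (cases "z \<in> topspace Z")
    case True
    then have "conv (\<lambda>g. if g \<in> K then 1 else 0) b z = (if \<rho> z \<in> K then 1 else 0) * b z"
      using K by (intro conv_units) auto
    then show ?thesis using sub True by auto
  next
    case False
    then show ?thesis using cc_funsD(2)[OF b] by (simp add: conv_def)
  qed
qed

lemma ex_local_unit:
  assumes "b \<in> cc_funs Z"
  shows "\<exists>e\<in>cc_funs (gtop G). conv e b = b"
proof -
  obtain K where K: "openin (unit_top G) K" "compactin (unit_top G) K" "\<rho> ` {z \<in> topspace Z. b z \<noteq> 0} \<subseteq> K"
    using unit_for_compact[OF cc_funsD(4)[OF assms]] by blast
  have "(\<lambda>g. if g \<in> K then 1 else 0) \<in> cc_funs (gtop G)"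
    by (rule cc_units_subset[OF cc_indicator[OF ample_unit_top K(1,2)]])
  moreover have "K \<subseteq> units G" using openin_subset[OF K(1)] by (simp add: unit_topspace)
  ultimately show ?thesis using conv_local_unit[OF _ assms K(3)] by blast
qed

end

sublocale ample_groupoid \<subseteq> arrow: groupoid_space G "gtop G" "grng G" "gmul G"
proof (intro groupoid_space.intro groupoid_space_axioms.intro ample_groupoid_axioms)
  show "ample_space (gtop G)" by (rule ample_gtop)
  show "continuous_map (gtop G) (unit_top G) (grng G)" by (rule continuous_rng)
  show "continuous_map (subtopology (prod_topology (gtop G) (gtop G)) {(g, z). gsrc G g = grng G z})
     (gtop G) (\<lambda>(g, z). gmul G g z)" by (rule continuous_mul)
qed (auto simp: arrows_topspace mul_closed rng_mul mul_assoc mul_rng)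

text \<open>An arrow with source \<open>x\<close> moves \<open>x\<close> to its range.\<close>

sublocale ample_groupoid \<subseteq> unit: groupoid_space G "unit_top G" "\<lambda>x. x" "\<lambda>g x. grng G g"
proof (intro groupoid_space.intro groupoid_space_axioms.intro ample_groupoid_axioms)
  show "ample_space (unit_top G)" by (rule ample_unit_top)
  show "continuous_map (subtopology (prod_topology (gtop G) (unit_top G)) {(g, z). gsrc G g = z})
     (unit_top G) (\<lambda>(g, z). grng G g)"
    using continuous_map_from_subtopology[OF continuous_map_compose[OF continuous_map_fst continuous_rng]]
    by (simp add: o_def case_prod_unfold)
qed (auto simp: unit_topspace rng_in_units rng_mul rng_unit)

context groupoid_space
begin

text \<open>The double sum runs over pairs \<open>h\<close>, \<open>k\<close> of arrows with range
  \<open>\<rho> z\<close>, and the substitution \<open>h = k l\<close> separates it. For arrows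
  acting on themselves this is associativity of the ring.\<close>

lemma conv_assoc:
  assumes f: "f \<in> cc_funs (gtop G)" and f': "f' \<in> cc_funs (gtop G)"
  shows "conv (arrow.conv f f') b = conv f (conv f' b)"
proof
  fix z
  show "conv (arrow.conv f f') b z = conv f (conv f' b) z"
  proof (cases "z \<in> topspace Z")
    case z: True
    let ?x = "\<rho> z"
    let ?A = "{h \<in> arrows G. grng G h = ?x}"
    let ?F = "\<lambda>h k. f k * f' (gmul G (ginv G k) h) * b (act (ginv G h) z)"
    have bij: "bij_betw (gmul G k) {l \<in> arrows G. grng G l = gsrc G k} ?A" if k: "k \<in> ?A" for k
    proof (rule bij_betw_byWitness[where f' = "\<lambda>h. gmul G (ginv G k) h"])
      show "\<forall>l\<in>{l \<in> arrows G. grng G l = gsrc G k}. gmul G (ginv G k) (gmul G k l) = l"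
        using k by (auto simp: inv_mul_cancel)
      show "\<forall>h\<in>?A. gmul G k (gmul G (ginv G k) h) = h" using k by (auto simp: mul_inv_cancel)
      show "gmul G k ` {l \<in> arrows G. grng G l = gsrc G k} \<subseteq> ?A" using k by (auto simp: mul_closed rng_mul)
      show "gmul G (ginv G k) ` ?A \<subseteq> {l \<in> arrows G. grng G l = gsrc G k}"
        using k by (auto simp: mul_closed rng_mul inv_closed src_inv rng_inv)
    qed
    \<comment> \<open>A nonzero term comes from \<open>k\<close> in the support of \<open>f\<close>
      and \<open>l\<close> in the support of \<open>f'\<close>, each confined to one range fibre,
      where the support is finite.\<close>
    have fin: "finite {p \<in> ?A \<times> ?A. ?F (fst p) (snd p) \<noteq> 0}"
    proof (rule finite_subset)
      let ?K = "{k \<in> arrows G. grng G k = ?x \<and> f k \<noteq> 0}"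
      let ?L = "\<lambda>k. {l \<in> arrows G. grng G l = gsrc G k \<and> f' l \<noteq> 0}"
      show "finite ((\<lambda>(k, l). (gmul G k l, k)) ` (Sigma ?K ?L))"
        using fibre_finite(1)[OF f] fibre_finite(1)[OF f'] by auto
      show "{p \<in> ?A \<times> ?A. ?F (fst p) (snd p) \<noteq> 0} \<subseteq> (\<lambda>(k, l). (gmul G k l, k)) ` (Sigma ?K ?L)"
      proof
        fix p assume "p \<in> {p \<in> ?A \<times> ?A. ?F (fst p) (snd p) \<noteq> 0}"
        then obtain h k where p: "p = (h, k)" "h \<in> ?A" "k \<in> ?A" "?F h k \<noteq> 0" by auto
        let ?l = "gmul G (ginv G k) h"
        have "?l \<in> arrows G" "grng G ?l = gsrc G k" "gmul G k ?l = h"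
          using p by (auto simp: mul_closed rng_mul inv_closed src_inv rng_inv mul_inv_cancel)
        then have "(k, ?l) \<in> Sigma ?K ?L" "p = (\<lambda>(k, l). (gmul G k l, k)) (k, ?l)" using p by auto
        then show "p \<in> (\<lambda>(k, l). (gmul G k l, k)) ` (Sigma ?K ?L)" by blast
      qed
    qed
    have "conv (arrow.conv f f') b z = fsum ?A (\<lambda>h. arrow.conv f f' h * b (act (ginv G h) z))"
      using z by (simp add: conv_def)
    also have "\<dots> = fsum ?A (\<lambda>h. fsum ?A (?F h))"
    proof (rule fsum_cong)
      fix h assume h: "h \<in> ?A"
      then have "arrow.conv f f' h = fsum ?A (\<lambda>k. f k * f' (gmul G (ginv G k) h))"
        by (simp add: arrow.conv_def arrows_topspace)
      then show "arrow.conv f f' h * b (act (ginv G h) z) = fsum ?A (?F h)" by (simp add: fsum_multc)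
    qed simp
    also have "\<dots> = fsum ?A (\<lambda>k. fsum ?A (\<lambda>h. ?F h k))" by (rule fsum_swap[OF fin])
    also have "\<dots> = fsum ?A (\<lambda>k. f k * conv f' b (act (ginv G k) z))"
    proof (rule fsum_cong)
      fix k assume k: "k \<in> ?A"
      have "fsum ?A (\<lambda>h. ?F h k) = fsum {l \<in> arrows G. grng G l = gsrc G k} (\<lambda>l. ?F (gmul G k l) k)"
        by (rule fsum_reindex[OF bij[OF k]])
      also have "\<dots> = fsum {l \<in> arrows G. grng G l = gsrc G k} (\<lambda>l. f k * (f' l * b (act (ginv G l) (act (ginv G k) z))))"
      proof (rule fsum_cong)
        fix l assume l: "l \<in> {l \<in> arrows G. grng G l = gsrc G k}"
        have "act (ginv G (gmul G k l)) z = act (ginv G l) (act (ginv G k) z)"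
          using k l z by (simp add: inv_mul_distrib act_mul inv_closed src_inv rng_inv)
        then show "?F (gmul G k l) k = f k * (f' l * b (act (ginv G l) (act (ginv G k) z)))"
          using k l by (simp add: inv_mul_cancel)
      qed simp
      also have "\<dots> = f k * conv f' b (act (ginv G k) z)"
        using k z inv_act_closed[of k z] by (simp add: fsum_cmult conv_def)
      finally show "fsum ?A (\<lambda>h. ?F h k) = f k * conv f' b (act (ginv G k) z)" .
    qed simp
    also have "\<dots> = conv f (conv f' b) z" using z by (simp add: conv_def)
    finally show ?thesis .
  qed (simp add: conv_def)
qed

text \<open>The action of \<open>ginv G h\<close> maps the fibre of \<open>\<phi>\<close> over
  \<open>w\<close> bijectively onto the fibre over the translate of \<open>w\<close>. Linearity of
  the augmentation, the bar boundary and the coordinates all come from here.\<close>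

lemma pushforward_conv:
  assumes Y: "groupoid_space G Y \<sigma> act'" and \<phi>: "etale_map Z Y \<phi>"
    and anchor: "\<And>z. z \<in> topspace Z \<Longrightarrow> \<sigma> (\<phi> z) = \<rho> z"
    and equi: "\<And>g z. \<lbrakk>g \<in> arrows G; z \<in> topspace Z; gsrc G g = \<rho> z\<rbrakk> \<Longrightarrow> \<phi> (act g z) = act' g (\<phi> z)"
    and f: "f \<in> cc_funs (gtop G)" and b: "b \<in> cc_funs Z"
  shows "pushforward Z \<phi> (conv f b) = groupoid_space.conv G Y \<sigma> act' f (pushforward Z \<phi> b)"
proof
  interpret Y: groupoid_space G Y \<sigma> act' by (rule Y)
  have \<phi>Y: "\<phi> z \<in> topspace Y" if "z \<in> topspace Z" for z
    using \<phi> that by (auto simp: etale_map_def continuous_map_def)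
  fix w
  show "pushforward Z \<phi> (conv f b) w = Y.conv f (pushforward Z \<phi> b) w"
  proof (cases "w \<in> topspace Y")
    case False
    then have "{z \<in> topspace Z. \<phi> z = w} = {}" using \<phi>Y by auto
    then show ?thesis using False by (simp only: pushforward_fsum Y.conv_def if_False fsum_empty)
  next
    case w: True
    let ?Z = "\<lambda>w. {z \<in> topspace Z. \<phi> z = w}"
    let ?A = "{h \<in> arrows G. grng G h = \<sigma> w}"
    have bij: "bij_betw (act (ginv G h)) (?Z w) (?Z (act' (ginv G h) w))" if h: "h \<in> ?A" for h
    proof (rule bij_betw_byWitness[where f' = "act h"])
      show "\<forall>z\<in>?Z w. act h (act (ginv G h) z) = z" using h anchor inv_act_closed(3) by auto
      show "\<forall>z\<in>?Z (act' (ginv G h) w). act (ginv G h) (act h z) = z"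
      proof
        fix z assume z: "z \<in> ?Z (act' (ginv G h) w)"
        then have "\<rho> z = gsrc G h" using anchor[of z] h w Y.inv_act_closed(2)[of h w] by simp
        then show "act (ginv G h) (act h z) = z" using z h by (intro act_inv_act) auto
      qed
      show "act (ginv G h) ` ?Z w \<subseteq> ?Z (act' (ginv G h) w)"
        using h anchor inv_act_closed(1) by (auto simp: equi inv_closed src_inv)
      show "act h ` ?Z (act' (ginv G h) w) \<subseteq> ?Z w"
      proof clarify
        fix z assume z: "z \<in> topspace Z" "\<phi> z = act' (ginv G h) w"
        then have "\<rho> z = gsrc G h" using anchor[of z] h w Y.inv_act_closed(2)[of h w] by simp
        then show "act h z \<in> topspace Z \<and> \<phi> (act h z) = w"
          using z h w equi[of h z] Y.inv_act_closed(3)[of h w] by (simp add: act_closed)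
      qed
    qed
    have fin: "finite {p \<in> ?Z w \<times> ?A. f (snd p) * b (act (ginv G (snd p)) (fst p)) \<noteq> 0}"
    proof (rule finite_subset)
      let ?K = "{k \<in> arrows G. grng G k = \<sigma> w \<and> f k \<noteq> 0}"
      let ?L = "\<lambda>k. {z \<in> ?Z (act' (ginv G k) w). b z \<noteq> 0}"
      show "finite ((\<lambda>(k, z). (act k z, k)) ` (Sigma ?K ?L))"
        using fibre_finite(1)[OF f] finite_fibre_support[OF \<phi> b] by auto
      show "{p \<in> ?Z w \<times> ?A. f (snd p) * b (act (ginv G (snd p)) (fst p)) \<noteq> 0} \<subseteq> (\<lambda>(k, z). (act k z, k)) ` (Sigma ?K ?L)"
      proof
        fix p assume "p \<in> {p \<in> ?Z w \<times> ?A. f (snd p) * b (act (ginv G (snd p)) (fst p)) \<noteq> 0}"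
        then obtain z k where p: "p = (z, k)" "z \<in> ?Z w" "k \<in> ?A" "f k \<noteq> 0" "b (act (ginv G k) z) \<noteq> 0" by auto
        have "act (ginv G k) z \<in> ?Z (act' (ginv G k) w)" using bij_betwE[OF bij[OF p(3)]] p(2) by blast
        moreover have "act k (act (ginv G k) z) = z" using p anchor inv_act_closed(3) by auto
        ultimately have "(k, act (ginv G k) z) \<in> Sigma ?K ?L" "p = (\<lambda>(k, z). (act k z, k)) (k, act (ginv G k) z)"
          using p by auto
        then show "p \<in> (\<lambda>(k, z). (act k z, k)) ` (Sigma ?K ?L)" by blast
      qed
    qed
    have "pushforward Z \<phi> (conv f b) w = fsum (?Z w) (\<lambda>z. fsum ?A (\<lambda>h. f h * b (act (ginv G h) z)))"
      unfolding pushforward_fsum by (rule fsum_cong) (auto simp: conv_def anchor)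
    also have "\<dots> = fsum ?A (\<lambda>h. fsum (?Z w) (\<lambda>z. f h * b (act (ginv G h) z)))"
      by (rule fsum_swap[OF fin])
    also have "\<dots> = fsum ?A (\<lambda>h. f h * pushforward Z \<phi> b (act' (ginv G h) w))"
    proof (rule fsum_cong)
      fix h assume h: "h \<in> ?A"
      have "fsum (?Z w) (\<lambda>z. f h * b (act (ginv G h) z)) = f h * fsum (?Z w) (\<lambda>z. b (act (ginv G h) z))"
        by (rule fsum_cmult)
      also have "fsum (?Z w) (\<lambda>z. b (act (ginv G h) z)) = pushforward Z \<phi> b (act' (ginv G h) w)"
        unfolding pushforward_fsum by (rule fsum_reindex[OF bij[OF h], symmetric])
      finally show "fsum (?Z w) (\<lambda>z. f h * b (act (ginv G h) z)) = f h * pushforward Z \<phi> b (act' (ginv G h) w)" .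
    qed simp
    also have "\<dots> = Y.conv f (pushforward Z \<phi> b) w" using w by (simp add: Y.conv_def)
    finally show ?thesis .
  qed
qed

end

lemma abelian_group_cc:
  assumes "carrier M = cc_funs Y" "\<zero>\<^bsub>M\<^esub> = (\<lambda>y. 0)" "add M = (\<lambda>a b y. a y + b y)"
  shows "abelian_group M"
proof (rule abelian_groupI)
  fix a assume "a \<in> carrier M"
  then show "\<exists>b\<in>carrier M. b \<oplus>\<^bsub>M\<^esub> a = \<zero>\<^bsub>M\<^esub>"
    by (intro bexI[of _ "\<lambda>y. - a y"]) (auto simp: assms cc_uminus)
qed (auto simp: assms cc_add fun_eq_iff)

lemma a_inv_cc:
  assumes "carrier M = cc_funs Y" "\<zero>\<^bsub>M\<^esub> = (\<lambda>y. 0)" "add M = (\<lambda>a b y. a y + b y)" "a \<in> cc_funs Y"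
  shows "\<ominus>\<^bsub>M\<^esub> a = (\<lambda>y. - a y)"
proof -
  interpret abelian_group M by (rule abelian_group_cc[OF assms(1-3)])
  show ?thesis by (rule minus_equality) (use assms in \<open>auto simp: cc_uminus\<close>)
qed

section \<open>The convolution ring\<close>

context ample_groupoid
begin

lemma conv_ring_simps:
  "carrier (conv_ring G) = cc_funs (gtop G)"
  "\<zero>\<^bsub>conv_ring G\<^esub> = (\<lambda>g. 0)"
  "add (conv_ring G) = (\<lambda>f f' g. f g + f' g)"
  by (simp_all add: conv_ring_def)

lemma conv_sum_eq:
  assumes "f \<in> cc_funs (gtop G)"
  shows "(\<Sum>h | h \<in> arrows G \<and> grng G h = x \<and> f h \<noteq> 0. f h * c h) = fsum {h \<in> arrows G. grng G h = x} (\<lambda>h. f h * c h)"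
  by (rule fsum_eq_sum[symmetric]) (use fibre_finite(1)[OF assms] in auto)

lemma conv_ring_mult:
  assumes "f \<in> cc_funs (gtop G)" shows "f \<otimes>\<^bsub>conv_ring G\<^esub> f' = arrow.conv f f'"
  by (simp add: conv_ring_def arrow.conv_def arrows_topspace conv_sum_eq[OF assms] fun_eq_iff)

end

context groupoid_space
begin

lemma lmod_conv:
  assumes M: "carrier M = cc_funs Z" "\<zero>\<^bsub>M\<^esub> = (\<lambda>y. 0)" "add M = (\<lambda>a b y. a y + b y)"
    and smult: "\<And>f b. \<lbrakk>f \<in> cc_funs (gtop G); b \<in> cc_funs Z\<rbrakk> \<Longrightarrow> f \<odot>\<^bsub>M\<^esub> b = conv f b"
  shows "lmod (conv_ring G) M"
proof (rule lmodI_left_units)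
  show "abelian_group M" by (rule abelian_group_cc[OF M])
  show "\<exists>e\<in>carrier (conv_ring G). e \<odot>\<^bsub>M\<^esub> m = m" if "m \<in> carrier M" for m
    using ex_local_unit[of m] that by (auto simp: M smult conv_ring_simps)
qed (auto simp: M conv_ring_simps smult conv_closed conv_add_left conv_add_right cc_add
     conv_ring_mult conv_assoc arrow.conv_closed)

end

context ample_groupoid
begin

text \<open>The local units are indicators of compact open sets of units containing the ranges of
  all the supports.\<close>

sublocale conv_ring: ring_with_local_units "conv_ring G"
proof (rule ring_with_local_units.intro)
  show "lmod (conv_ring G) (regular_module (conv_ring G))"
    by (rule arrow.lmod_conv) (simp_all add: conv_ring_simps conv_ring_mult)
  fix F assume F: "finite F" "F \<subseteq> carrier (conv_ring G)"
  have "compactin (gtop G) (\<Union>f\<in>F. {g \<in> topspace (gtop G). f g \<noteq> 0})"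
    using F by (intro compactin_Union) (auto simp: conv_ring_simps cc_funsD(4) subset_iff)
  from arrow.unit_for_compact[OF this] obtain K where "openin (unit_top G) K \<and> compactin (unit_top G) K \<and>
    grng G ` (\<Union>f\<in>F. {g \<in> topspace (gtop G). f g \<noteq> 0}) \<subseteq> K" ..
  then have K: "openin (unit_top G) K" "compactin (unit_top G) K"
    "grng G ` (\<Union>f\<in>F. {g \<in> topspace (gtop G). f g \<noteq> 0}) \<subseteq> K" by simp_all
  let ?e = "\<lambda>g. if g \<in> K then 1 else 0"
  have e: "?e \<in> cc_funs (gtop G)"
    by (rule cc_units_subset[OF cc_indicator[OF ample_unit_top K(1,2)]])
  have "K \<subseteq> units G" using openin_subset[OF K(1)] by (simp add: unit_topspace)
  moreover have "grng G ` {g \<in> topspace (gtop G). f g \<noteq> 0} \<subseteq> K" if "f \<in> F" for f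
    using that by (intro subset_trans[OF image_mono K(3)]) blast
  ultimately have "arrow.conv ?e f = f" if "f \<in> F" for f
    using that F by (intro arrow.conv_local_unit) (auto simp: conv_ring_simps)
  then show "\<exists>e\<in>carrier (conv_ring G). \<forall>f\<in>F. e \<otimes>\<^bsub>conv_ring G\<^esub> f = f"
    using e by (intro bexI[of _ ?e]) (auto simp: conv_ring_mult conv_ring_simps)
qed

end

section \<open>The nerve\<close>

text \<open>In degree 0 a tuple is a single unit, which for a composable pair is the source of the
  added arrow; the result is then the 1-tuple of \<open>g\<close>. In positive degrees the entries
  shift by one.\<close>

definition tuple_cons :: "nat \<Rightarrow> 'a \<Rightarrow> (nat \<Rightarrow> 'a) \<Rightarrow> nat \<Rightarrow> 'a" where
  "tuple_cons n g w = (if n = 0 then (\<lambda>j\<in>{..<1}. g)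
     else (\<lambda>j\<in>{..<Suc n}. if j = 0 then g else w (j - 1)))"

context ample_groupoid
begin

abbreviation anchor :: "(nat \<Rightarrow> 'a) \<Rightarrow> 'a" where
  "anchor y \<equiv> grng G (y 0)"

abbreviation tail :: "nat \<Rightarrow> (nat \<Rightarrow> 'a) \<Rightarrow> nat \<Rightarrow> 'a" where
  "tail n \<equiv> face G (Suc n) 0"

lemma nerve_setD:
  assumes "y \<in> nerve_set G n"
  shows "k < max 1 n \<Longrightarrow> y k \<in> arrows G"
    and "n \<noteq> 0 \<Longrightarrow> k < n \<Longrightarrow> y k \<in> arrows G"
    and "Suc k < n \<Longrightarrow> gsrc G (y k) = grng G (y (Suc k))"
    and "\<not> k < max 1 n \<Longrightarrow> y k = undefined"
    and "n = 0 \<Longrightarrow> y 0 \<in> units G"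
  using assms by (auto simp: nerve_set_def PiE_def extensional_def split: if_splits)

lemma nerve_setI:
  assumes "\<And>k. k < max 1 n \<Longrightarrow> y k \<in> arrows G" "\<And>k. Suc k < n \<Longrightarrow> gsrc G (y k) = grng G (y (Suc k))"
    "\<And>k. \<not> k < max 1 n \<Longrightarrow> y k = undefined" "n = 0 \<Longrightarrow> y 0 \<in> units G"
  shows "y \<in> nerve_set G n"
  using assms by (auto simp: nerve_set_def PiE_def extensional_def)

lemma nerve_topspace: "topspace (nerve G n) = nerve_set G n"
proof -
  have "nerve_set G n \<subseteq> (\<Pi>\<^sub>E i\<in>{..<max 1 n}. arrows G)"
    by (auto simp: nerve_set_def max_def split: if_splits)
  then show ?thesis by (auto simp: nerve_def arrows_topspace)
qed

lemma anchor_unit: "w \<in> nerve_set G n \<Longrightarrow> anchor w \<in> units G"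
  by (rule rng_in_units) (rule nerve_setD(1), auto)

lemma head_arrow: "w \<in> nerve_set G n \<Longrightarrow> w 0 \<in> arrows G"
  by (rule nerve_setD(1)) auto

lemma tuple_cons_in:
  assumes "g \<in> arrows G" "w \<in> nerve_set G n" "gsrc G g = anchor w"
  shows "tuple_cons n g w \<in> nerve_set G (Suc n)"
proof (cases n)
  case 0
  then show ?thesis using assms by (intro nerve_setI) (auto simp: tuple_cons_def)
next
  case (Suc m)
  show ?thesis
  proof (rule nerve_setI)
    fix k assume k: "Suc k < Suc n"
    then show "gsrc G (tuple_cons n g w k) = grng G (tuple_cons n g w (Suc k))"
      using assms nerve_setD(3)[OF assms(2), of "k - 1"] Suc by (cases k) (auto simp: tuple_cons_def)
  qed (use assms Suc nerve_setD(1)[OF assms(2)] in \<open>auto simp: tuple_cons_def\<close>)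
qed

lemma head_tuple_cons [simp]: "tuple_cons n g w 0 = g"
  by (simp add: tuple_cons_def)

lemma tail_tuple_cons:
  assumes "g \<in> arrows G" "w \<in> nerve_set G n" "gsrc G g = anchor w"
  shows "tail n (tuple_cons n g w) = w"
proof
  fix k show "tail n (tuple_cons n g w) k = w k"
    using assms nerve_setD(4,5)[OF assms(2)] rng_unit by (auto simp: face_def tuple_cons_def)
qed

lemma tail_in:
  assumes "y \<in> nerve_set G (Suc n)" shows "tail n y \<in> nerve_set G n"
  using nerve_setD[OF assms] by (intro nerve_setI) (auto simp: face_def src_closed src_in_units)

lemma anchor_tail:
  assumes "y \<in> nerve_set G (Suc n)" shows "anchor (tail n y) = gsrc G (y 0)"
  using nerve_setD(1)[OF assms] nerve_setD(3)[OF assms, of 0] by (cases n) (auto simp: face_def rng_src)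

lemma tuple_cons_head_tail:
  assumes "y \<in> nerve_set G (Suc n)" shows "tuple_cons n (y 0) (tail n y) = y"
proof
  fix k show "tuple_cons n (y 0) (tail n y) k = y k"
    using nerve_setD(4)[OF assms, of k] by (auto simp: face_def tuple_cons_def)
qed

lemma nerve_eqI:
  assumes "y \<in> nerve_set G (Suc n)" "y' \<in> nerve_set G (Suc n)" "y 0 = y' 0" "tail n y = tail n y'"
  shows "y = y'"
  by (metis tuple_cons_head_tail assms)

lemma continuous_component:
  assumes "k < max 1 n" shows "continuous_map (nerve G n) (gtop G) (\<lambda>y. y k)"
  unfolding nerve_def
  by (rule continuous_map_from_subtopology[OF continuous_map_product_projection]) (use assms in auto)

lemma continuous_into_nerve:
  assumes "\<And>x. x \<in> topspace X \<Longrightarrow> f x \<in> nerve_set G n"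
    and "\<And>k. k < max 1 n \<Longrightarrow> continuous_map X (gtop G) (\<lambda>x. f x k)"
  shows "continuous_map X (nerve G n) f"
  unfolding nerve_def
proof (rule continuous_map_into_subtopology)
  show "continuous_map X (product_topology (\<lambda>_. gtop G) {..<max 1 n}) f"
    unfolding continuous_map_componentwise
  proof (intro conjI ballI image_subsetI)
    show "f x \<in> extensional {..<max 1 n}" if "x \<in> topspace X" for x
      using nerve_setD(4)[OF assms(1)[OF that]] by (auto simp: extensional_def)
  qed (use assms(2) in auto)
  show "f \<in> topspace X \<rightarrow> nerve_set G n" using assms(1) by blast
qed

lemma continuous_src_arrows: "continuous_map (gtop G) (gtop G) (gsrc G)"
  and continuous_rng_arrows: "continuous_map (gtop G) (gtop G) (grng G)"
  using continuous_src continuous_rng continuous_map_into_fulltopology unfolding unit_top_def by blast+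

lemma continuous_anchor: "continuous_map (nerve G n) (unit_top G) anchor"
  using continuous_map_compose[OF continuous_component[of 0 n] continuous_rng] by (simp add: o_def)

lemma continuous_mul_compose:
  assumes "continuous_map X (gtop G) f" "continuous_map X (gtop G) h"
    "\<And>x. x \<in> topspace X \<Longrightarrow> gsrc G (f x) = grng G (h x)"
  shows "continuous_map X (gtop G) (\<lambda>x. gmul G (f x) (h x))"
proof -
  have "continuous_map X (subtopology (prod_topology (gtop G) (gtop G)) {(g, h). gsrc G g = grng G h}) (\<lambda>x. (f x, h x))"
    by (rule continuous_map_into_subtopology[OF continuous_map_pairedI[OF assms(1,2)]]) (use assms(3) in auto)
  from continuous_map_compose[OF this continuous_mul] show ?thesis by (simp add: o_def)
qed

lemma continuous_tail: "continuous_map (nerve G (Suc n)) (nerve G n) (tail n)"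
proof (rule continuous_into_nerve)
  show "tail n y \<in> nerve_set G n" if "y \<in> topspace (nerve G (Suc n))" for y
    using that tail_in by (simp add: nerve_topspace)
  fix k assume k: "k < max 1 n"
  show "continuous_map (nerve G (Suc n)) (gtop G) (\<lambda>y. tail n y k)"
  proof (cases "n = 0")
    case True
    then show ?thesis
      using k continuous_map_compose[OF continuous_component[of 0 "Suc n"] continuous_src_arrows]
      by (simp add: face_def o_def)
  next
    case False
    then show ?thesis using k continuous_component[of "Suc k" "Suc n"] by (simp add: face_def)
  qed
qed

lemma continuous_tuple_cons:
  "continuous_map (subtopology (prod_topology (gtop G) (nerve G n)) {(g, w). gsrc G g = anchor w})
     (nerve G (Suc n)) (\<lambda>(g, w). tuple_cons n g w)"
proof (rule continuous_into_nerve)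
  let ?X = "subtopology (prod_topology (gtop G) (nerve G n)) {(g, w). gsrc G g = anchor w}"
  show "(case p of (g, w) \<Rightarrow> tuple_cons n g w) \<in> nerve_set G (Suc n)" if "p \<in> topspace ?X" for p
    using that by (auto simp: arrows_topspace nerve_topspace tuple_cons_in)
  fix k assume k: "k < max 1 (Suc n)"
  have f: "continuous_map ?X (gtop G) fst" and s: "continuous_map ?X (nerve G n) snd"
    by (rule continuous_map_from_subtopology, rule continuous_map_fst continuous_map_snd)+
  show "continuous_map ?X (gtop G) (\<lambda>p. (case p of (g, w) \<Rightarrow> tuple_cons n g w) k)"
  proof (cases k)
    case 0
    then show ?thesis using f by (simp add: case_prod_unfold)
  next
    case (Suc m)
    then have "continuous_map ?X (gtop G) (\<lambda>p. snd p m)"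
      using k continuous_map_compose[OF s continuous_component[of m n]] by (simp add: o_def)
    then show ?thesis using k Suc by (simp add: case_prod_unfold tuple_cons_def)
  qed
qed

text \<open>Tuples of length \<open>Suc n\<close> are the fibre product of arrows and
  \<open>n\<close>-tuples over the units. By continuity of \<open>tuple_cons\<close>, boxes in the
  product describe the neighbourhoods of \<open>y\<close>.\<close>

lemma nerve_box:
  assumes W: "openin (nerve G (Suc n)) W" and y: "y \<in> W"
  obtains A C where "openin (gtop G) A" "openin (nerve G n) C" "y 0 \<in> A" "tail n y \<in> C"
    "\<And>g c. \<lbrakk>g \<in> A; c \<in> C; gsrc G g = anchor c\<rbrakk> \<Longrightarrow> tuple_cons n g c \<in> W"
proof -
  let ?S = "{(g, w). gsrc G g = anchor w}"
  let ?X = "subtopology (prod_topology (gtop G) (nerve G n)) ?S"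
  have yn: "y \<in> nerve_set G (Suc n)" using y openin_subset[OF W] by (auto simp: nerve_topspace)
  have "openin ?X {p \<in> topspace ?X. (case p of (g, w) \<Rightarrow> tuple_cons n g w) \<in> W}"
    by (rule openin_continuous_map_preimage[OF continuous_tuple_cons W])
  then obtain N where N: "openin (prod_topology (gtop G) (nerve G n)) N"
    "{p \<in> topspace ?X. (case p of (g, w) \<Rightarrow> tuple_cons n g w) \<in> W} = N \<inter> ?S" by (auto simp: openin_subtopology)
  have "(y 0, tail n y) \<in> {p \<in> topspace ?X. (case p of (g, w) \<Rightarrow> tuple_cons n g w) \<in> W}"
    using yn y head_arrow[OF yn] tail_in[OF yn] anchor_tail[OF yn] tuple_cons_head_tail[OF yn]
    by (simp add: nerve_topspace arrows_topspace)
  then have "(y 0, tail n y) \<in> N" using N(2) by blast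
  from openin_prod_box[OF N(1) this] obtain A C where
    AC: "openin (gtop G) A \<and> openin (nerve G n) C \<and> y 0 \<in> A \<and> tail n y \<in> C \<and> A \<times> C \<subseteq> N" by (elim exE)
  have "tuple_cons n g c \<in> W" if "g \<in> A" "c \<in> C" "gsrc G g = anchor c" for g c
  proof -
    have "(g, c) \<in> N \<inter> ?S" using that AC by auto
    then have "(g, c) \<in> {p \<in> topspace ?X. (case p of (g, w) \<Rightarrow> tuple_cons n g w) \<in> W}" using N(2) by blast
    then show ?thesis by simp
  qed
  then show thesis using that[of A C] AC by blast
qed

lemma Hausdorff_nerve: "Hausdorff_space (nerve G n)"
  unfolding nerve_def
  by (rule Hausdorff_space_subtopology) (simp add: Hausdorff_space_product_topology Hausdorff)

text \<open>\<open>tail n\<close> is the base change of the source map along the anchor, and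
  inherits openness and local injectivity from it.\<close>

lemma etale_tail: "etale_map (nerve G (Suc n)) (nerve G n) (tail n)"
  unfolding etale_map_def
proof (intro conjI ballI continuous_tail)
  show "open_map (nerve G (Suc n)) (nerve G n) (tail n)"
    unfolding open_map_def
  proof (intro allI impI, subst openin_subopen, intro ballI)
    fix W w assume W: "openin (nerve G (Suc n)) W" and "w \<in> tail n ` W"
    then obtain y where y: "y \<in> W" "w = tail n y" by blast
    have yn: "y \<in> nerve_set G (Suc n)" using y openin_subset[OF W] by (auto simp: nerve_topspace)
    obtain A C where AC: "openin (gtop G) A" "openin (nerve G n) C" "y 0 \<in> A" "tail n y \<in> C"
      "\<And>g c. \<lbrakk>g \<in> A; c \<in> C; gsrc G g = anchor c\<rbrakk> \<Longrightarrow> tuple_cons n g c \<in> W"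
      by (rule nerve_box[OF W y(1)]) (rule that)
    have "openin (unit_top G) (gsrc G ` A)" using open_src AC(1) by (simp add: open_map_def)
    then have "openin (nerve G n) {c \<in> C. anchor c \<in> gsrc G ` A}"
      by (rule openin_continuous_map_preimage_gen[OF continuous_anchor AC(2)])
    moreover have "w \<in> {c \<in> C. anchor c \<in> gsrc G ` A}" using y AC anchor_tail[OF yn] by simp
    moreover have "{c \<in> C. anchor c \<in> gsrc G ` A} \<subseteq> tail n ` W"
    proof
      fix c assume "c \<in> {c \<in> C. anchor c \<in> gsrc G ` A}"
      then obtain g where g: "c \<in> C" "g \<in> A" "gsrc G g = anchor c" by auto
      then have "g \<in> arrows G" "c \<in> nerve_set G n"
        using openin_subset[OF AC(1)] openin_subset[OF AC(2)] by (auto simp: arrows_topspace nerve_topspace)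
      then have "tail n (tuple_cons n g c) = c" using g by (intro tail_tuple_cons)
      then show "c \<in> tail n ` W" using AC(5)[OF g(2,1,3)] by (metis image_eqI)
    qed
    ultimately show "\<exists>T. openin (nerve G n) T \<and> w \<in> T \<and> T \<subseteq> tail n ` W" by blast
  qed
  fix y assume "y \<in> topspace (nerve G (Suc n))"
  then have y: "y \<in> nerve_set G (Suc n)" by (simp add: nerve_topspace)
  have "y 0 \<in> topspace (gtop G)" using head_arrow[OF y] by (simp add: arrows_topspace)
  then obtain A where A: "openin (gtop G) A" "y 0 \<in> A" "inj_on (gsrc G) A" using etale_src unfolding etale_map_def by blast
  let ?U = "{y \<in> topspace (nerve G (Suc n)). y 0 \<in> A}"
  have "openin (nerve G (Suc n)) ?U"
    by (rule openin_continuous_map_preimage[OF continuous_component A(1)]) simp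
  moreover have "inj_on (tail n) ?U"
  proof (rule inj_onI)
    fix a b assume a: "a \<in> ?U" and b: "b \<in> ?U" and eq: "tail n a = tail n b"
    have ab: "a \<in> nerve_set G (Suc n)" "b \<in> nerve_set G (Suc n)" using a b by (simp_all add: nerve_topspace)
    then have "gsrc G (a 0) = gsrc G (b 0)" using anchor_tail[OF ab(1)] anchor_tail[OF ab(2)] eq by simp
    then have "a 0 = b 0" using inj_onD[OF A(3)] a b by blast
    then show "a = b" using nerve_eqI[OF ab] eq by simp
  qed
  ultimately show "\<exists>U. openin (nerve G (Suc n)) U \<and> y \<in> U \<and> inj_on (tail n) U"
    using A y by (intro exI[of _ ?U]) (simp add: nerve_topspace)
qed

text \<open>The first entry is the base change of the anchor along the source map. The hypothesis is
  the induction hypothesis of \<open>etale_anchor\<close>.\<close>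

lemma etale_head_if:
  assumes \<rho>: "etale_map (nerve G n) (unit_top G) anchor"
  shows "etale_map (nerve G (Suc n)) (gtop G) (\<lambda>y. y 0)"
  unfolding etale_map_def
proof (intro conjI ballI)
  show "continuous_map (nerve G (Suc n)) (gtop G) (\<lambda>y. y 0)" by (rule continuous_component) simp
  show "open_map (nerve G (Suc n)) (gtop G) (\<lambda>y. y 0)"
    unfolding open_map_def
  proof (intro allI impI, subst openin_subopen, intro ballI)
    fix W h assume W: "openin (nerve G (Suc n)) W" and "h \<in> (\<lambda>y. y 0) ` W"
    then obtain y where y: "y \<in> W" "h = y 0" by blast
    have yn: "y \<in> nerve_set G (Suc n)" using y openin_subset[OF W] by (auto simp: nerve_topspace)
    obtain A C where AC: "openin (gtop G) A" "openin (nerve G n) C" "y 0 \<in> A" "tail n y \<in> C"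
      "\<And>g c. \<lbrakk>g \<in> A; c \<in> C; gsrc G g = anchor c\<rbrakk> \<Longrightarrow> tuple_cons n g c \<in> W"
      by (rule nerve_box[OF W y(1)]) (rule that)
    have "openin (unit_top G) (anchor ` C)" using \<rho> AC(2) by (simp add: open_map_def etale_map_def)
    then have "openin (gtop G) {g \<in> A. gsrc G g \<in> anchor ` C}"
      by (rule openin_continuous_map_preimage_gen[OF continuous_src AC(1)])
    moreover have "h \<in> {g \<in> A. gsrc G g \<in> anchor ` C}"
      using y AC anchor_tail[OF yn] by (auto intro!: image_eqI[of _ _ "tail n y"])
    moreover have "{g \<in> A. gsrc G g \<in> anchor ` C} \<subseteq> (\<lambda>y. y 0) ` W"
    proof
      fix g assume "g \<in> {g \<in> A. gsrc G g \<in> anchor ` C}"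
      then obtain c where "c \<in> C" "g \<in> A" "gsrc G g = anchor c" by auto
      then have "tuple_cons n g c \<in> W" by (intro AC(5))
      then show "g \<in> (\<lambda>y. y 0) ` W" by (metis head_tuple_cons image_eqI)
    qed
    ultimately show "\<exists>T. openin (gtop G) T \<and> h \<in> T \<and> T \<subseteq> (\<lambda>y. y 0) ` W" by blast
  qed
  fix y assume "y \<in> topspace (nerve G (Suc n))"
  then have y: "y \<in> nerve_set G (Suc n)" by (simp add: nerve_topspace)
  have "tail n y \<in> topspace (nerve G n)" using tail_in[OF y] by (simp add: nerve_topspace)
  then obtain V where V: "openin (nerve G n) V" "tail n y \<in> V" "inj_on anchor V"
    using \<rho> unfolding etale_map_def by blast
  let ?U = "{y \<in> topspace (nerve G (Suc n)). tail n y \<in> V}"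
  have "openin (nerve G (Suc n)) ?U"
    by (rule openin_continuous_map_preimage[OF continuous_tail V(1)])
  moreover have "inj_on (\<lambda>y. y 0) ?U"
  proof (rule inj_onI)
    fix a b assume a: "a \<in> ?U" and b: "b \<in> ?U" and eq: "a 0 = b 0"
    have ab: "a \<in> nerve_set G (Suc n)" "b \<in> nerve_set G (Suc n)" using a b by (simp_all add: nerve_topspace)
    then have "anchor (tail n a) = anchor (tail n b)" using anchor_tail[OF ab(1)] anchor_tail[OF ab(2)] eq by simp
    then have "tail n a = tail n b" using inj_onD[OF V(3)] a b by blast
    then show "a = b" using nerve_eqI[OF ab] eq by simp
  qed
  ultimately show "\<exists>U. openin (nerve G (Suc n)) U \<and> y \<in> U \<and> inj_on (\<lambda>y. y 0) U"
    using V y by (intro exI[of _ ?U]) (simp add: nerve_topspace)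
qed

text \<open>In degree 0 the anchor identifies the 1-tuples of units with the base space; in higher
  degrees it is the first entry followed by the range map.\<close>

lemma etale_anchor: "etale_map (nerve G n) (unit_top G) anchor"
proof (induction n)
  case 0
  have c: "continuous_map (unit_top G) (nerve G 0) (\<lambda>x. \<lambda>j\<in>{..<1}. x)"
  proof (rule continuous_into_nerve)
    show "(\<lambda>j\<in>{..<1}. x) \<in> nerve_set G 0" if "x \<in> topspace (unit_top G)" for x
      using that units_arrows by (intro nerve_setI) (auto simp: unit_topspace)
    show "continuous_map (unit_top G) (gtop G) (\<lambda>x. (\<lambda>j\<in>{..<1::nat}. x) k)" if "k < max 1 0" for k
      using that continuous_map_from_subtopology[OF continuous_map_id[of "gtop G"]]
      by (simp add: unit_top_def id_def)
  qed
  have an: "anchor y = y 0" "(\<lambda>j\<in>{..<1}. y 0) = y" if "y \<in> nerve_set G 0" for y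
    using nerve_setD[OF that] by (auto simp: rng_unit fun_eq_iff)
  show ?case
    unfolding etale_map_def
  proof (intro conjI ballI continuous_anchor)
    show "open_map (nerve G 0) (unit_top G) anchor"
      unfolding open_map_def
    proof (intro allI impI)
      fix W assume W: "openin (nerve G 0) W"
      have Wn: "W \<subseteq> nerve_set G 0" using openin_subset[OF W] by (simp add: nerve_topspace)
      have "anchor ` W = {x \<in> topspace (unit_top G). (\<lambda>j\<in>{..<1}. x) \<in> W}"
      proof (intro subset_antisym subsetI)
        fix x assume "x \<in> anchor ` W"
        then obtain y where "y \<in> W" "x = anchor y" by blast
        then show "x \<in> {x \<in> topspace (unit_top G). (\<lambda>j\<in>{..<1}. x) \<in> W}"
          using an[of y] Wn anchor_unit[of y 0] by (auto simp: unit_topspace)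
      next
        fix x assume x: "x \<in> {x \<in> topspace (unit_top G). (\<lambda>j\<in>{..<1}. x) \<in> W}"
        then have "anchor (\<lambda>j\<in>{..<1}. x) = x" by (simp add: unit_topspace rng_unit)
        then show "x \<in> anchor ` W" using x by (metis (mono_tags, lifting) image_eqI mem_Collect_eq)
      qed
      then show "openin (unit_top G) (anchor ` W)" using openin_continuous_map_preimage[OF c W] by simp
    qed
    have "inj_on anchor (nerve_set G 0)"
    proof (rule inj_onI)
      fix a b assume a: "a \<in> nerve_set G 0" and b: "b \<in> nerve_set G 0" and eq: "anchor a = anchor b"
      have "a 0 = b 0" using eq unfolding an(1)[OF a] an(1)[OF b] .
      then have "(\<lambda>j\<in>{..<1}. a 0) = (\<lambda>j\<in>{..<1::nat}. b 0)" by (rule arg_cong)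
      then show "a = b" unfolding an(2)[OF a] an(2)[OF b] .
    qed
    then show "\<exists>U. openin (nerve G 0) U \<and> y \<in> U \<and> inj_on anchor U" if "y \<in> topspace (nerve G 0)" for y
      using that by (intro exI[of _ "topspace (nerve G 0)"] conjI openin_topspace) (simp_all add: nerve_topspace)
  qed
next
  case (Suc n)
  from etale_map_compose[OF etale_head_if[OF Suc] etale_rng] show ?case .
qed

lemmas etale_head = etale_head_if[OF etale_anchor]

lemma ample_nerve: "ample_space (nerve G n)"
  by (rule ample_space_etale[OF etale_anchor ample_unit_top Hausdorff_nerve])

lemma face_entry:
  assumes "j < n" "n \<noteq> 0" "0 < i"
  shows "face G (Suc n) i y j = (if Suc j < i then y j else if i = Suc n then y j
     else if Suc j = i then gmul G (y j) (y (Suc j)) else y (Suc j))"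
  using assms by (auto simp: face_def)

lemma face_in:
  assumes y: "y \<in> nerve_set G (Suc n)" and i: "0 < i" "i \<le> Suc n"
  shows "face G (Suc n) i y \<in> nerve_set G n" and "anchor (face G (Suc n) i y) = anchor y"
proof -
  have ya: "y k \<in> arrows G" if "k < Suc n" for k using nerve_setD(1)[OF y] that by simp
  have comp: "gsrc G (y k) = grng G (y (Suc k))" if "k < n" for k using nerve_setD(3)[OF y] that by simp
  show "face G (Suc n) i y \<in> nerve_set G n"
  proof (cases "n = 0")
    case True
    then show ?thesis
      using ya[of 0] i rng_in_units[of "y 0"] by (intro nerve_setI) (auto simp: face_def rng_closed)
  next
    case False
    show ?thesis
    proof (rule nerve_setI)
      show "face G (Suc n) i y k \<in> arrows G" if "k < max 1 n" for k
        using False that i ya comp[of k] by (auto simp: face_entry mul_closed)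
      show "gsrc G (face G (Suc n) i y k) = grng G (face G (Suc n) i y (Suc k))" if "Suc k < n" for k
        using that i ya[of k] ya[of "Suc k"] ya[of "Suc (Suc k)"] comp[of k] comp[of "Suc k"]
        by (auto simp: face_entry src_mul rng_mul)
      show "face G (Suc n) i y k = undefined" if "\<not> k < max 1 n" for k
        using False that i by (auto simp: face_def)
    qed (use False in simp)
  qed
  show "anchor (face G (Suc n) i y) = anchor y"
    using i ya[of 0] ya[of 1] comp[of 0] by (cases "n = 0") (auto simp: face_entry rng_mul face_def rng_rng)
qed

text \<open>Faces of positive index preserve the anchor, so \<open>etale_map_cancel\<close> leaves
  continuity to be shown; the face of index 0 is \<open>tail\<close>.\<close>

lemma etale_face:
  assumes i: "i \<le> Suc n" shows "etale_map (nerve G (Suc n)) (nerve G n) (face G (Suc n) i)"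
proof (cases "i = 0")
  case True
  then show ?thesis using etale_tail by simp
next
  case False
  have "continuous_map (nerve G (Suc n)) (nerve G n) (face G (Suc n) i)"
  proof (rule continuous_into_nerve)
    show "face G (Suc n) i y \<in> nerve_set G n" if "y \<in> topspace (nerve G (Suc n))" for y
      using that False i face_in by (simp add: nerve_topspace)
    fix k assume k: "k < max 1 n"
    have c: "continuous_map (nerve G (Suc n)) (gtop G) (\<lambda>y. y l)" if "l < Suc n" for l
      using that by (intro continuous_component) simp
    show "continuous_map (nerve G (Suc n)) (gtop G) (\<lambda>y. face G (Suc n) i y k)"
    proof (cases "n = 0")
      case True
      then show ?thesis
        using k False continuous_map_compose[OF c[of 0] continuous_rng_arrows] by (simp add: face_def o_def)
    next
      case n: False
      have "continuous_map (nerve G (Suc n)) (gtop G) (\<lambda>y. gmul G (y k) (y (Suc k)))"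
        using k n by (intro continuous_mul_compose c) (auto simp: nerve_topspace dest: nerve_setD(3))
      then show ?thesis using k n False c by (auto simp: face_entry)
    qed
  qed
  then show ?thesis
    by (rule etale_map_cancel[OF _ etale_anchor etale_anchor])
      (use False i face_in in \<open>simp add: nerve_topspace\<close>)
qed

section \<open>Sections, the action on tuples, and simplicial identities\<close>

text \<open>The extra degeneracy of the bar construction. As a section of \<open>tail\<close> it
  yields the basis elements of the bar modules and preimages under \<open>coinv\<close>; it also
  gives the contracting homotopy.\<close>

definition section_map :: "nat \<Rightarrow> (nat \<Rightarrow> 'a) \<Rightarrow> nat \<Rightarrow> 'a" where
  "section_map n w = tuple_cons n (anchor w) w"

lemma section_map_in:
  assumes "w \<in> nerve_set G n"
  shows "section_map n w \<in> nerve_set G (Suc n)" "tail n (section_map n w) = w" "anchor (section_map n w) = anchor w"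
  unfolding section_map_def using assms anchor_unit[OF assms]
  by (auto intro!: tuple_cons_in tail_tuple_cons simp: units_arrows src_unit rng_unit)

lemma etale_section_map: "etale_map (nerve G n) (nerve G (Suc n)) (section_map n)"
proof (rule etale_map_cancel[OF _ etale_anchor etale_anchor])
  show "anchor (section_map n w) = anchor w" if "w \<in> topspace (nerve G n)" for w
    using that section_map_in by (simp add: nerve_topspace)
  have c: "continuous_map (nerve G n) (gtop G) anchor"
    using continuous_anchor continuous_map_into_fulltopology unfolding unit_top_def by blast
  have "continuous_map (nerve G n) (nerve G n) (\<lambda>w. w)" using continuous_map_id[of "nerve G n"] by (simp add: id_def)
  then have "continuous_map (nerve G n) (subtopology (prod_topology (gtop G) (nerve G n)) {(g, w). gsrc G g = anchor w}) (\<lambda>w. (anchor w, w))"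
    by (intro continuous_map_into_subtopology continuous_map_pairedI c)
      (auto simp: nerve_topspace src_unit anchor_unit)
  from continuous_map_compose[OF this continuous_tuple_cons]
  show "continuous_map (nerve G n) (nerve G (Suc n)) (section_map n)"
    by (simp add: o_def section_map_def[abs_def])
qed

text \<open>The unit as an entry in degree 1 of the nerve, not in degree 0: this is a section of the
  augmentation of the bar complex, and the lowest part of its contraction.\<close>

definition base_section :: "'a \<Rightarrow> nat \<Rightarrow> 'a" where
  "base_section x = (\<lambda>j\<in>{..<1}. x)"

lemma base_section_in:
  assumes "x \<in> units G" shows "base_section x \<in> nerve_set G (Suc 0)" "anchor (base_section x) = x"
  using assms by (auto intro!: nerve_setI simp: base_section_def units_arrows rng_unit)

lemma etale_base_section: "etale_map (unit_top G) (nerve G (Suc 0)) base_section"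
proof (rule etale_map_cancel[OF _ etale_anchor])
  have i: "continuous_map (unit_top G) (unit_top G) (\<lambda>x. x)" using continuous_map_id[of "unit_top G"] by (simp add: id_def)
  show "etale_map (unit_top G) (unit_top G) (\<lambda>x. x)"
    unfolding etale_map_def open_map_def using i by (auto intro!: exI[of _ "topspace (unit_top G)"])
  show "anchor (base_section x) = x" if "x \<in> topspace (unit_top G)" for x
    using that base_section_in by (simp add: unit_topspace)
  have i: "continuous_map (unit_top G) (gtop G) (\<lambda>x. x)"
    using i continuous_map_into_fulltopology unfolding unit_top_def by blast
  show "continuous_map (unit_top G) (nerve G (Suc 0)) base_section"
  proof (rule continuous_into_nerve)
    show "continuous_map (unit_top G) (gtop G) (\<lambda>x. base_section x k)" if "k < max 1 (Suc 0)" for k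
      using that i by (simp add: base_section_def)
  qed (simp add: base_section_in unit_topspace)
qed

definition nerve_act :: "'a \<Rightarrow> (nat \<Rightarrow> 'a) \<Rightarrow> nat \<Rightarrow> 'a" where
  "nerve_act g y = y(0 := gmul G g (y 0))"

lemma nerve_act_in:
  assumes "g \<in> arrows G" "y \<in> nerve_set G (Suc n)" "gsrc G g = anchor y"
  shows "nerve_act g y \<in> nerve_set G (Suc n)" "tail n (nerve_act g y) = tail n y"
    "anchor (nerve_act g y) = grng G g"
proof -
  have h: "y 0 \<in> arrows G" by (rule head_arrow[OF assms(2)])
  show "nerve_act g y \<in> nerve_set G (Suc n)"
    unfolding nerve_act_def
  proof (rule nerve_setI)
    fix k assume "Suc k < Suc n"
    then show "gsrc G ((y(0 := gmul G g (y 0))) k) = grng G ((y(0 := gmul G g (y 0))) (Suc k))"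
      using nerve_setD(3)[OF assms(2), of k] assms h by (auto simp: src_mul)
  qed (use nerve_setD(1,4)[OF assms(2)] assms h in \<open>auto simp: mul_closed\<close>)
  show "tail n (nerve_act g y) = tail n y"
    using assms h by (auto simp: face_def nerve_act_def src_mul fun_eq_iff)
  show "anchor (nerve_act g y) = grng G g"
    using assms h by (simp add: nerve_act_def rng_mul)
qed

lemma nerve_groupoid_space: "groupoid_space G (nerve G (Suc n)) anchor nerve_act"
proof (intro groupoid_space.intro groupoid_space_axioms.intro ample_groupoid_axioms ample_nerve continuous_anchor)
  let ?X = "subtopology (prod_topology (gtop G) (nerve G (Suc n))) {(g, z). gsrc G g = anchor z}"
  show "continuous_map ?X (nerve G (Suc n)) (\<lambda>(g, z). nerve_act g z)"
  proof (rule continuous_into_nerve)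
    show "(case p of (g, z) \<Rightarrow> nerve_act g z) \<in> nerve_set G (Suc n)" if "p \<in> topspace ?X" for p
      using that nerve_act_in(1) by (auto simp: arrows_topspace nerve_topspace)
    fix k assume k: "k < max 1 (Suc n)"
    have f: "continuous_map ?X (gtop G) fst" and s: "continuous_map ?X (nerve G (Suc n)) snd"
      by (rule continuous_map_from_subtopology, rule continuous_map_fst continuous_map_snd)+
    have c: "continuous_map ?X (gtop G) (\<lambda>p. snd p l)" if "l < Suc n" for l
      using that continuous_map_compose[OF s continuous_component[of l "Suc n"]] by (simp add: o_def)
    have "continuous_map ?X (gtop G) (\<lambda>p. gmul G (fst p) (snd p 0))"
      by (rule continuous_mul_compose[OF f c]) auto
    then show "continuous_map ?X (gtop G) (\<lambda>p. (case p of (g, z) \<Rightarrow> nerve_act g z) k)"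
      using k c by (cases "k = 0") (simp_all add: nerve_act_def case_prod_unfold)
  qed
next
  fix z assume z: "z \<in> topspace (nerve G (Suc n))"
  then show "nerve_act (anchor z) z = z"
    using head_arrow[of z "Suc n"] by (simp add: nerve_act_def mul_rng nerve_topspace)
  fix g assume g: "g \<in> arrows G" "gsrc G g = anchor z"
  show "nerve_act g z \<in> topspace (nerve G (Suc n))" "anchor (nerve_act g z) = grng G g"
    using nerve_act_in[of g z n] g z by (simp_all add: nerve_topspace)
next
  fix g h z assume "g \<in> arrows G" "h \<in> arrows G" "z \<in> topspace (nerve G (Suc n))"
    "gsrc G g = grng G h" "gsrc G h = anchor z"
  then show "nerve_act (gmul G g h) z = nerve_act g (nerve_act h z)"
    using head_arrow[of z "Suc n"] by (simp add: nerve_act_def mul_assoc nerve_topspace)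
qed

text \<open>The action changes the first entry only. The one face here that multiplies this entry by
  the next, \<open>i = 0\<close>, commutes with the action by associativity.\<close>

lemma face_nerve_act:
  assumes g: "g \<in> arrows G" and y: "y \<in> nerve_set G (Suc (Suc n))" and gy: "gsrc G g = anchor y"
    and i: "i \<le> Suc n"
  shows "face G (Suc (Suc n)) (Suc i) (nerve_act g y) = nerve_act g (face G (Suc (Suc n)) (Suc i) y)"
proof
  have "y 0 \<in> arrows G" "y 1 \<in> arrows G" "gsrc G (y 0) = grng G (y 1)"
    using nerve_setD(1)[OF y] nerve_setD(3)[OF y, of 0] by auto
  then have "gmul G (gmul G g (y 0)) (y 1) = gmul G g (gmul G (y 0) (y 1))"
    using g gy by (intro mul_assoc) auto
  then show "face G (Suc (Suc n)) (Suc i) (nerve_act g y) k = nerve_act g (face G (Suc (Suc n)) (Suc i) y) k" for k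
    using i by (auto simp: face_def nerve_act_def)
qed

text \<open>With the next two lemmas, these are the identities of an extra degeneracy: one face
  undoes it, the others commute with it, and in the lowest degree it meets the augmentation.\<close>

lemma face_section_map:
  assumes y: "y \<in> nerve_set G (Suc n)"
  shows "face G (Suc (Suc n)) (Suc 0) (section_map (Suc n) y) = y"
proof
  fix k
  have "gmul G (anchor y) (y 0) = y 0" using head_arrow[OF y] by (rule mul_rng)
  then show "face G (Suc (Suc n)) (Suc 0) (section_map (Suc n) y) k = y k"
    using nerve_setD(4)[OF y, of k] by (auto simp: face_def section_map_def tuple_cons_def)
qed

lemma face_section_map_Suc:
  assumes y: "y \<in> nerve_set G (Suc (Suc n))" and i: "i \<le> Suc n"
  shows "face G (Suc (Suc (Suc n))) (Suc (Suc i)) (section_map (Suc (Suc n)) y) =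
    section_map (Suc n) (face G (Suc (Suc n)) (Suc i) y)"
proof
  fix k
  have "anchor (face G (Suc (Suc n)) (Suc i) y) = anchor y" using face_in(2)[OF y] i by simp
  then show "face G (Suc (Suc (Suc n))) (Suc (Suc i)) (section_map (Suc (Suc n)) y) k =
    section_map (Suc n) (face G (Suc (Suc n)) (Suc i) y) k"
    using i by (cases k) (auto simp: face_def section_map_def tuple_cons_def)
qed

lemma face_section_map_base:
  "face G (Suc (Suc 0)) (Suc (Suc 0)) (section_map (Suc 0) y) = base_section (anchor y)"
  by (auto simp: face_def section_map_def tuple_cons_def base_section_def fun_eq_iff)

text \<open>Forgetting the first entry turns the bar faces, whose indices start at 1, into all faces
  of the nerve. This is why the coinvariants of the bar complex form the nerve complex.\<close>

lemma face_tail: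
  assumes y: "y \<in> nerve_set G (Suc (Suc n))" and i: "i \<le> Suc n"
  shows "face G (Suc n) i (tail (Suc n) y) = tail n (face G (Suc (Suc n)) (Suc i) y)"
proof
  fix k
  have "y 0 \<in> arrows G" "y 1 \<in> arrows G" "gsrc G (y 0) = grng G (y 1)"
    using nerve_setD(1)[OF y] nerve_setD(3)[OF y, of 0] by auto
  then show "face G (Suc n) i (tail (Suc n) y) k = tail n (face G (Suc (Suc n)) (Suc i) y) k"
    using i by (cases "n = 0") (auto simp: face_def src_mul le_Suc_eq)
qed

end

section \<open>Coinvariants of the convolution action\<close>

context groupoid_space
begin

lemma conv_cmult_right: "conv f (\<lambda>z. c * b z) = (\<lambda>z. c * conv f b z)"
proof
  fix z
  have "(\<lambda>h. f h * (c * b (act (ginv G h) z))) = (\<lambda>h. c * (f h * b (act (ginv G h) z)))" by auto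
  then show "conv f (\<lambda>z. c * b z) z = c * conv f b z" by (simp add: conv_def fsum_cmult)
qed

lemma conv_sum_right:
  assumes "f \<in> cc_funs (gtop G)"
  shows "conv f (\<lambda>z. \<Sum>i\<in>I. b i z) = (\<lambda>z. \<Sum>i\<in>I. conv f (b i) z)"
  by (induction I rule: infinite_finite_induct) (simp_all add: conv_add_right[OF assms])

text \<open>
  Substituting \<open>z = h z'\<close> turns the sum over \<open>h\<close> with range \<open>\<rho> z\<close> into a sum over \<open>h\<close> with source
  \<open>\<rho> z'\<close>.
\<close>

lemma pushforward_conv_invariant:
  assumes t: "etale_map Z X t" and inv: "\<And>g z. \<lbrakk>g \<in> arrows G; z \<in> topspace Z; gsrc G g = \<rho> z\<rbrakk> \<Longrightarrow> t (act g z) = t z"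
    and f: "f \<in> cc_funs (gtop G)" and b: "b \<in> cc_funs Z"
  shows "pushforward Z t (conv f b) = pushforward Z t (\<lambda>z. pushforward (gtop G) (gsrc G) f (\<rho> z) * b z)"
proof
  fix w
  let ?Z = "{z \<in> topspace Z. t z = w}"
  let ?A = "\<lambda>z. {h \<in> arrows G. grng G h = \<rho> z}" and ?B = "\<lambda>z. {h \<in> arrows G. gsrc G h = \<rho> z}"
  let ?F = "\<lambda>p. f (snd p) * b (fst p)"
  let ?k = "\<lambda>(z, h). (act (ginv G h) z, h)" and ?k' = "\<lambda>(z, h). (act h z, h)"
  have bij: "bij_betw ?k (Sigma ?Z ?A) (Sigma ?Z ?B)"
  proof (rule bij_betw_byWitness[where f' = ?k'])
    show "\<forall>p\<in>Sigma ?Z ?A. ?k' (?k p) = p" using inv_act_closed(3) by auto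
    show "\<forall>p\<in>Sigma ?Z ?B. ?k (?k' p) = p" using act_inv_act by auto
    show "?k ` Sigma ?Z ?A \<subseteq> Sigma ?Z ?B"
      using inv_act_closed by (auto simp: inv inv_closed src_inv)
    show "?k' ` Sigma ?Z ?B \<subseteq> Sigma ?Z ?A" by (auto simp: act_closed anchor_act inv)
  qed
  have fin: "finite {p \<in> Sigma ?Z ?B. ?F p \<noteq> 0}"
  proof (rule finite_subset)
    show "finite (Sigma {z \<in> ?Z. b z \<noteq> 0} (\<lambda>z. {h \<in> arrows G. gsrc G h = \<rho> z \<and> f h \<noteq> 0}))"
      using finite_fibre_support[OF t b] fibre_finite(2)[OF f] by auto
  qed auto
  have "{p \<in> Sigma ?Z ?A. ?F (?k p) \<noteq> 0} \<subseteq> ?k' ` {p \<in> Sigma ?Z ?B. ?F p \<noteq> 0}"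
  proof
    fix p assume p: "p \<in> {p \<in> Sigma ?Z ?A. ?F (?k p) \<noteq> 0}"
    then have "?k p \<in> {p \<in> Sigma ?Z ?B. ?F p \<noteq> 0}" using bij_betwE[OF bij] by blast
    moreover have "p = ?k' (?k p)" using p inv_act_closed(3) by auto
    ultimately show "p \<in> ?k' ` {p \<in> Sigma ?Z ?B. ?F p \<noteq> 0}" by (rule rev_image_eqI)
  qed
  then have fin': "finite {p \<in> Sigma ?Z ?A. ?F (?k p) \<noteq> 0}" by (rule finite_subset[OF _ finite_imageI[OF fin]])
  have "pushforward Z t (conv f b) w = fsum ?Z (\<lambda>z. fsum (?A z) (\<lambda>h. ?F (?k (z, h))))"
    unfolding pushforward_fsum by (rule fsum_cong) (auto simp: conv_def)
  also have "\<dots> = fsum (Sigma ?Z ?A) (\<lambda>p. ?F (?k p))"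
    using fsum_Sigma[of ?Z ?A "\<lambda>z h. ?F (?k (z, h))"] fin' by simp
  also have "\<dots> = fsum (Sigma ?Z ?B) ?F" by (rule fsum_reindex[OF bij, symmetric])
  also have "\<dots> = fsum ?Z (\<lambda>z. fsum (?B z) (\<lambda>h. f h * b z))"
    using fsum_Sigma[of ?Z ?B "\<lambda>z h. f h * b z"] fin by simp
  also have "\<dots> = fsum ?Z (\<lambda>z. pushforward (gtop G) (gsrc G) f (\<rho> z) * b z)"
    by (simp add: fsum_multc pushforward_fsum arrows_topspace)
  finally show "pushforward Z t (conv f b) w = pushforward Z t (\<lambda>z. pushforward (gtop G) (gsrc G) f (\<rho> z) * b z) w"
    by (simp add: pushforward_fsum[of Z])
qed

end

lemma pushforward_id: "a \<in> cc_funs Y \<Longrightarrow> pushforward Y (\<lambda>y. y) a = a"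
proof
  fix z assume a: "a \<in> cc_funs Y"
  show "pushforward Y (\<lambda>y. y) a z = a z"
  proof (cases "z \<in> topspace Y")
    case True
    then show ?thesis unfolding pushforward_fsum by (subst fsum_single[of z]) auto
  next
    case False
    then have "{y \<in> topspace Y. y = z} = {}" by auto
    then show ?thesis using cc_funsD(2)[OF a False] by (simp only: pushforward_fsum fsum_empty)
  qed
qed

lemma pushforward_sum:
  assumes f: "etale_map Y Z f" and "finite I" "\<And>i. i \<in> I \<Longrightarrow> a i \<in> cc_funs Y"
  shows "pushforward Y f (\<lambda>y. \<Sum>i\<in>I. c i * a i y) = (\<lambda>z. \<Sum>i\<in>I. c i * pushforward Y f (a i) z)"
  using assms(2,3)
proof (induction I)
  case empty
  then show ?case by simp
next
  case (insert i I)
  have "pushforward Y f (\<lambda>y. c i * a i y + (\<Sum>i\<in>I. c i * a i y)) =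
    (\<lambda>z. pushforward Y f (\<lambda>y. c i * a i y) z + pushforward Y f (\<lambda>y. \<Sum>i\<in>I. c i * a i y) z)"
    by (rule pushforward_add[OF f]) (use insert in \<open>auto intro!: cc_sum cc_cmult\<close>)
  then show ?case using insert by (simp add: pushforward_cmult)
qed

section \<open>The bar resolution\<close>

context ample_groupoid
begin

sublocale nerve: groupoid_space G "nerve G (Suc n)" anchor nerve_act for n
  by (rule nerve_groupoid_space)

abbreviation "R \<equiv> conv_ring G"

lemma bar_module_simps:
  "carrier (bar_module G n) = cc_funs (nerve G (Suc n))"
  "\<zero>\<^bsub>bar_module G n\<^esub> = (\<lambda>y. 0)"
  "add (bar_module G n) = (\<lambda>a b y. a y + b y)"
  by (simp_all add: bar_module_def)

lemma bar_module_smult: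
  assumes "f \<in> cc_funs (gtop G)"
  shows "f \<odot>\<^bsub>bar_module G n\<^esub> b = nerve.conv n f b"
  by (simp add: bar_module_def nerve.conv_def nerve_topspace nerve_act_def conv_sum_eq[OF assms] fun_eq_iff)

lemma bar_lmod: "lmod R (bar_module G n)"
  by (rule nerve.lmod_conv) (simp_all add: bar_module_simps bar_module_smult)

sublocale bar: lmod "conv_ring G" "bar_module G n" for n
  by (rule bar_lmod)

lemma unit_left_module_simps:
  "carrier (unit_left_module G) = cc_funs (unit_top G)"
  "\<zero>\<^bsub>unit_left_module G\<^esub> = (\<lambda>y. 0)"
  "add (unit_left_module G) = (\<lambda>a b y. a y + b y)"
  by (simp_all add: unit_left_module_def)

lemma unit_left_module_smult:
  assumes "f \<in> cc_funs (gtop G)"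
  shows "f \<odot>\<^bsub>unit_left_module G\<^esub> a = unit.conv f a"
proof
  fix x
  have "(\<Sum>g | g \<in> arrows G \<and> grng G g = x \<and> f g \<noteq> 0. f g * a (gsrc G g)) =
    fsum {h \<in> arrows G. grng G h = x} (\<lambda>h. f h * a (gsrc G h))"
    by (rule conv_sum_eq[OF assms])
  also have "\<dots> = fsum {h \<in> arrows G. grng G h = x} (\<lambda>h. f h * a (grng G (ginv G h)))"
    by (rule fsum_cong) (auto simp: rng_inv)
  also have "\<dots> = unit.conv f a x"
  proof (cases "x \<in> units G")
    case False
    then have "{h \<in> arrows G. grng G h = x} = {}" using rng_in_units by auto
    then show ?thesis using False by (simp only: unit.conv_def unit_topspace if_False fsum_empty)
  qed (simp add: unit.conv_def unit_topspace)
  finally show "(f \<odot>\<^bsub>unit_left_module G\<^esub> a) x = unit.conv f a x" by (simp add: unit_left_module_def)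
qed

lemma abelian_group_unit_left_module: "abelian_group (unit_left_module G)"
  by (rule abelian_group_cc) (rule unit_left_module_simps)+

lemma augmentation_hom: "bar_augmentation G \<in> lmod_hom R (bar_module G 0) (unit_left_module G)"
proof (rule lmod_homI)
  have e: "etale_map (nerve G (Suc 0)) (unit_top G) anchor" by (rule etale_anchor)
  fix x assume "x \<in> carrier (bar_module G 0)"
  then have x: "x \<in> cc_funs (nerve G (Suc 0))" by (simp add: bar_module_simps)
  then show "bar_augmentation G x \<in> carrier (unit_left_module G)"
    using pushforward_cc[OF e ample_nerve ample_unit_top] by (simp add: bar_augmentation_def unit_left_module_simps)
  show "bar_augmentation G (x \<oplus>\<^bsub>bar_module G 0\<^esub> y) = bar_augmentation G x \<oplus>\<^bsub>unit_left_module G\<^esub> bar_augmentation G y"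
    if "y \<in> carrier (bar_module G 0)" for y
    using that x pushforward_add[OF e] by (simp add: bar_augmentation_def unit_left_module_simps bar_module_simps)
  fix f assume f: "f \<in> carrier R"
  then have "pushforward (nerve G (Suc 0)) anchor (nerve.conv 0 f x) = unit.conv f (pushforward (nerve G (Suc 0)) anchor x)"
    using x by (intro nerve.pushforward_conv unit.groupoid_space_axioms e)
      (auto simp: conv_ring_simps nerve_topspace nerve_act_in)
  then show "bar_augmentation G (f \<odot>\<^bsub>bar_module G 0\<^esub> x) = f \<odot>\<^bsub>unit_left_module G\<^esub> bar_augmentation G x"
    using f by (simp add: bar_augmentation_def bar_module_smult unit_left_module_smult conv_ring_simps)
qed

lemma bar_boundary_eq:
  "bar_boundary G (Suc n) b =
    (\<lambda>y. \<Sum>i\<le>Suc n. (-1) ^ i * pushforward (nerve G (Suc (Suc n))) (face G (Suc (Suc n)) (Suc i)) b y)"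
  by (rule ext) (simp only: bar_boundary_def)

lemma bar_boundary_hom: "bar_boundary G (Suc n) \<in> lmod_hom R (bar_module G (Suc n)) (bar_module G n)"
proof (rule lmod_homI)
  let ?p = "\<lambda>i. pushforward (nerve G (Suc (Suc n))) (face G (Suc (Suc n)) (Suc i))"
  have e: "etale_map (nerve G (Suc (Suc n))) (nerve G (Suc n)) (face G (Suc (Suc n)) (Suc i))" if "i \<le> Suc n" for i
    by (rule etale_face) (use that in simp)
  fix b assume "b \<in> carrier (bar_module G (Suc n))"
  then have b: "b \<in> cc_funs (nerve G (Suc (Suc n)))" by (simp add: bar_module_simps)
  have pb: "?p i b \<in> cc_funs (nerve G (Suc n))" if "i \<le> Suc n" for i
    by (rule pushforward_cc[OF e[OF that] ample_nerve ample_nerve b])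
  then show "bar_boundary G (Suc n) b \<in> carrier (bar_module G n)"
    unfolding bar_boundary_eq bar_module_simps by (intro cc_sum cc_cmult) auto
  show "bar_boundary G (Suc n) (b \<oplus>\<^bsub>bar_module G (Suc n)\<^esub> b') =
    bar_boundary G (Suc n) b \<oplus>\<^bsub>bar_module G n\<^esub> bar_boundary G (Suc n) b'" if "b' \<in> carrier (bar_module G (Suc n))" for b'
  proof -
    have b': "b' \<in> cc_funs (nerve G (Suc (Suc n)))" using that by (simp add: bar_module_simps)
    have "(\<Sum>i\<le>Suc n. (-1) ^ i * ?p i (\<lambda>y. b y + b' y) y) =
      (\<Sum>i\<le>Suc n. (-1) ^ i * ?p i b y + (-1) ^ i * ?p i b' y)" for y
      by (rule sum.cong) (simp_all add: pushforward_add[OF e b b'] distrib_left)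
    then show ?thesis unfolding bar_boundary_eq bar_module_simps sum.distrib by blast
  qed
  fix f assume "f \<in> carrier R"
  then have f: "f \<in> cc_funs (gtop G)" by (simp add: conv_ring_simps)
  have lin: "?p i (nerve.conv (Suc n) f b) = nerve.conv n f (?p i b)" if i: "i \<le> Suc n" for i
  proof (rule nerve.pushforward_conv[OF nerve_groupoid_space e[OF i] _ _ f b])
    show "anchor (face G (Suc (Suc n)) (Suc i) z) = anchor z" if "z \<in> topspace (nerve G (Suc (Suc n)))" for z
      using that i by (intro face_in(2)) (auto simp: nerve_topspace)
    show "face G (Suc (Suc n)) (Suc i) (nerve_act g z) = nerve_act g (face G (Suc (Suc n)) (Suc i) z)"
      if "g \<in> arrows G" "z \<in> topspace (nerve G (Suc (Suc n)))" "gsrc G g = anchor z" for g z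
      using that i by (intro face_nerve_act) (auto simp: nerve_topspace)
  qed
  have "bar_boundary G (Suc n) (nerve.conv (Suc n) f b) = (\<lambda>y. \<Sum>i\<le>Suc n. (-1) ^ i * nerve.conv n f (?p i b) y)"
    unfolding bar_boundary_eq by (intro ext sum.cong) (simp_all add: lin)
  also have "\<dots> = nerve.conv n f (bar_boundary G (Suc n) b)"
    unfolding bar_boundary_eq nerve.conv_sum_right[OF f] nerve.conv_cmult_right ..
  finally show "bar_boundary G (Suc n) (f \<odot>\<^bsub>bar_module G (Suc n)\<^esub> b) = f \<odot>\<^bsub>bar_module G n\<^esub> bar_boundary G (Suc n) b"
    by (simp add: bar_module_smult[OF f])
qed

subsection \<open>Local dual bases\<close>

text \<open>Over a set \<open>U\<close> on which the anchor is injective, a tuple is determined by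
  its first entry, since \<open>gsrc G (y 0)\<close> is the anchor of its tail. The first entry
  therefore identifies the part of the bar module over \<open>U\<close> with a left ideal of the
  ring.\<close>

definition coordinate :: "nat \<Rightarrow> (nat \<Rightarrow> 'a) set \<Rightarrow> ((nat \<Rightarrow> 'a) \<Rightarrow> int) \<Rightarrow> 'a \<Rightarrow> int" where
  "coordinate n U b = pushforward (nerve G (Suc n)) (\<lambda>y. y 0) (\<lambda>y. if tail n y \<in> U then b y else 0)"

text \<open>The vector dual to \<open>coordinate n U\<close>, supported on the tuples that consist
  of a unit followed by an element of \<open>U\<close>.\<close>

definition basis_element :: "nat \<Rightarrow> (nat \<Rightarrow> 'a) set \<Rightarrow> (nat \<Rightarrow> 'a) \<Rightarrow> int" where
  "basis_element n U = (\<lambda>y. if y \<in> section_map n ` U then 1 else 0)"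

text \<open>The fibres of \<open>tail n\<close> are the orbits of the action on tuples, so this is
  the passage to coinvariants.\<close>

definition coinv :: "nat \<Rightarrow> ((nat \<Rightarrow> 'a) \<Rightarrow> int) \<Rightarrow> (nat \<Rightarrow> 'a) \<Rightarrow> int" where
  "coinv n = pushforward (nerve G (Suc n)) (tail n)"

text \<open>For a discrete group, with its single unit, this is the usual augmentation ideal of the
  group ring.\<close>

definition aug_ideal :: "('a \<Rightarrow> int) set" where
  "aug_ideal = {f \<in> cc_funs (gtop G). pushforward (gtop G) (gsrc G) f = (\<lambda>x. 0)}"

lemma restrict_tail:
  assumes U: "openin (nerve G n) U" "compactin (nerve G n) U" and b: "b \<in> cc_funs (nerve G (Suc n))"
  shows "(\<lambda>y. if tail n y \<in> U then b y else 0) \<in> cc_funs (nerve G (Suc n))"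
proof -
  let ?T = "{y \<in> topspace (nerve G (Suc n)). tail n y \<in> U}"
  have "openin (nerve G (Suc n)) ?T" "closedin (nerve G (Suc n)) ?T"
    using openin_continuous_map_preimage[OF continuous_tail U(1)]
      closedin_continuous_map_preimage[OF continuous_tail compact_open_closed[OF ample_nerve U(2)]] by auto
  then have "(\<lambda>y. if y \<in> ?T then b y else 0) \<in> cc_funs (nerve G (Suc n))" by (rule cc_restrict[OF b])
  moreover have "(\<lambda>y. if y \<in> ?T then b y else 0) = (\<lambda>y. if tail n y \<in> U then b y else 0)"
    using cc_funsD(2)[OF b] by (auto simp: fun_eq_iff)
  ultimately show ?thesis by simp
qed

text \<open>Restriction to tails in \<open>U\<close> is linear because the action leaves the tail
  unchanged, and taking the first entry is equivariant.\<close>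

lemma coordinate_hom:
  assumes U: "openin (nerve G n) U" "compactin (nerve G n) U"
  shows "coordinate n U \<in> lmod_hom R (bar_module G n) (regular_module R)"
proof (rule lmod_homI)
  fix b assume "b \<in> carrier (bar_module G n)"
  then have b: "b \<in> cc_funs (nerve G (Suc n))" by (simp add: bar_module_simps)
  note bU = restrict_tail[OF U b]
  show "coordinate n U b \<in> carrier (regular_module R)"
    unfolding coordinate_def using pushforward_cc[OF etale_head ample_nerve ample_gtop bU]
    by (simp add: conv_ring_simps)
  show "coordinate n U (b \<oplus>\<^bsub>bar_module G n\<^esub> b') = coordinate n U b \<oplus>\<^bsub>regular_module R\<^esub> coordinate n U b'"
    if "b' \<in> carrier (bar_module G n)" for b'
  proof -
    have b': "b' \<in> cc_funs (nerve G (Suc n))" using that by (simp add: bar_module_simps)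
    have "(\<lambda>y. if tail n y \<in> U then b y + b' y else 0) =
      (\<lambda>y. (if tail n y \<in> U then b y else 0) + (if tail n y \<in> U then b' y else 0))" by auto
    then show ?thesis
      using pushforward_add[OF etale_head bU restrict_tail[OF U b']]
      by (simp add: coordinate_def conv_ring_simps bar_module_simps)
  qed
  fix f assume "f \<in> carrier R"
  then have f: "f \<in> cc_funs (gtop G)" by (simp add: conv_ring_simps)
  have "(\<lambda>y. if tail n y \<in> U then nerve.conv n f b y else 0) = nerve.conv n f (\<lambda>y. if tail n y \<in> U then b y else 0)"
  proof
    fix y
    show "(if tail n y \<in> U then nerve.conv n f b y else 0) = nerve.conv n f (\<lambda>y. if tail n y \<in> U then b y else 0) y"
    proof (cases "y \<in> nerve_set G (Suc n)")
      case True
      have "nerve.conv n f (\<lambda>y. if tail n y \<in> U then b y else 0) y =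
        fsum {h \<in> arrows G. grng G h = anchor y} (\<lambda>h. (if tail n y \<in> U then f h * b (nerve_act (ginv G h) y) else 0))"
        using True by (simp only: nerve.conv_def nerve_topspace if_True)
          (rule fsum_cong, auto simp: nerve_act_in inv_closed src_inv)
      also have "\<dots> = (if tail n y \<in> U then nerve.conv n f b y else 0)"
        using True by (simp add: nerve.conv_def nerve_topspace)
      finally show ?thesis by simp
    qed (simp add: nerve.conv_def nerve_topspace)
  qed
  moreover have "pushforward (nerve G (Suc n)) (\<lambda>y. y 0) (nerve.conv n f (\<lambda>y. if tail n y \<in> U then b y else 0)) =
      arrow.conv f (pushforward (nerve G (Suc n)) (\<lambda>y. y 0) (\<lambda>y. if tail n y \<in> U then b y else 0))"
    by (rule nerve.pushforward_conv[OF arrow.groupoid_space_axioms etale_head _ _ f bU]) (simp_all add: nerve_act_def)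
  ultimately show "coordinate n U (f \<odot>\<^bsub>bar_module G n\<^esub> b) = f \<odot>\<^bsub>regular_module R\<^esub> coordinate n U b"
    by (simp add: coordinate_def bar_module_smult[OF f] conv_ring_mult[OF f])
qed

lemma section_open_compact:
  assumes U: "openin (nerve G n) U" "compactin (nerve G n) U"
  shows "openin (nerve G (Suc n)) (section_map n ` U)" "compactin (nerve G (Suc n)) (section_map n ` U)"
  using etale_section_map[of n] U image_compactin[OF U(2), of _ "section_map n"]
  by (auto simp: etale_map_def open_map_def)

lemma basis_element_cc:
  assumes U: "openin (nerve G n) U" "compactin (nerve G n) U"
  shows "basis_element n U \<in> cc_funs (nerve G (Suc n))"
  unfolding basis_element_def by (rule cc_indicator[OF ample_nerve section_open_compact[OF U]])

lemma basis_element_pushforward: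
  assumes U: "openin (nerve G n) U"
  shows "basis_element n U = pushforward (nerve G n) (section_map n) (\<lambda>w. if w \<in> U then 1 else 0)"
proof -
  have s: "U \<subseteq> nerve_set G n" using openin_subset[OF U] by (simp add: nerve_topspace)
  have "inj_on (section_map n) U" by (rule inj_on_inverseI[where g = "tail n"]) (use s section_map_in in auto)
  then show ?thesis using s
    by (intro ext) (simp add: basis_element_def pushforward_indicator nerve_topspace)
qed

text \<open>Among the arrows \<open>h\<close> with range \<open>anchor y\<close>, only
  \<open>h = y 0\<close> moves \<open>y\<close> to a tuple beginning with a unit, so the product
  reads off the coordinate at \<open>y 0\<close>. As the anchor is injective on \<open>U\<close>,
  this coordinate is the single value \<open>b y\<close>.\<close>

lemma coordinate_basis:
  assumes U: "openin (nerve G n) U" "compactin (nerve G n) U" "inj_on anchor U" and b: "b \<in> cc_funs (nerve G (Suc n))"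
  shows "coordinate n U b \<odot>\<^bsub>bar_module G n\<^esub> basis_element n U = (\<lambda>y. if tail n y \<in> U then b y else 0)"
proof -
  have c: "coordinate n U b \<in> cc_funs (gtop G)"
    using lmod_homD(1)[OF coordinate_hom[OF U(1,2)], of b] b by (simp add: bar_module_simps conv_ring_simps)
  have "nerve.conv n (coordinate n U b) (basis_element n U) y = (if tail n y \<in> U then b y else 0)" for y
  proof (cases "y \<in> nerve_set G (Suc n)")
    case y: True
    have ya: "y 0 \<in> arrows G" by (rule head_arrow[OF y])
    have bz: "basis_element n U (nerve_act (ginv G h) y) = (if h = y 0 \<and> tail n y \<in> U then 1 else 0)"
      if h: "h \<in> arrows G" "grng G h = anchor y" for h
    proof -
      let ?z = "nerve_act (ginv G h) y"
      have z: "?z \<in> nerve_set G (Suc n)" "tail n ?z = tail n y"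
        using nerve_act_in[of "ginv G h" y n] h y by (simp_all add: inv_closed src_inv)
      have "?z \<in> section_map n ` U \<longleftrightarrow> h = y 0 \<and> tail n y \<in> U"
      proof
        assume "?z \<in> section_map n ` U"
        then obtain w where w: "w \<in> U" "?z = section_map n w" by blast
        have wn: "w \<in> nerve_set G n" using w(1) openin_subset[OF U(1)] by (auto simp: nerve_topspace)
        have "tail n y = w" using section_map_in(2)[OF wn] z(2) w(2) by simp
        moreover have "gmul G (ginv G h) (y 0) = anchor w"
          using arg_cong[OF w(2), of "\<lambda>z. z 0"] by (simp add: nerve_act_def section_map_def)
        then have "gmul G h (gmul G (ginv G h) (y 0)) = gmul G h (anchor w)" by simp
        then have "y 0 = gmul G h (anchor w)" using mul_inv_cancel[OF h(1) ya] h by simp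
        moreover have "gsrc G h = anchor w"
        proof -
          have "grng G (gmul G (ginv G h) (y 0)) = gsrc G h" using h ya by (simp add: rng_mul inv_closed src_inv rng_inv)
          then show ?thesis using \<open>gmul G (ginv G h) (y 0) = anchor w\<close> rng_unit[OF anchor_unit[OF wn]] by simp
        qed
        ultimately show "h = y 0 \<and> tail n y \<in> U" using w(1) h mul_unit[OF anchor_unit[OF wn] h(1)] by simp
      next
        assume a: "h = y 0 \<and> tail n y \<in> U"
        have "?z 0 = gsrc G (y 0)" using a ya by (simp add: nerve_act_def inv_mul)
        then have "?z 0 = section_map n (tail n y) 0" using anchor_tail[OF y] by (simp add: section_map_def)
        moreover have "tail n ?z = tail n (section_map n (tail n y))" using z section_map_in(2)[OF tail_in[OF y]] by simp
        ultimately have "?z = section_map n (tail n y)"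
          by (intro nerve_eqI[OF z(1) section_map_in(1)[OF tail_in[OF y]]])
        then show "?z \<in> section_map n ` U" using a by blast
      qed
      then show ?thesis by (simp add: basis_element_def)
    qed
    have "nerve.conv n (coordinate n U b) (basis_element n U) y =
      fsum {h \<in> arrows G. grng G h = anchor y} (\<lambda>h. coordinate n U b h * (if h = y 0 \<and> tail n y \<in> U then 1 else 0))"
      using y by (simp only: nerve.conv_def nerve_topspace if_True) (rule fsum_cong, auto simp: bz)
    also have "\<dots> = coordinate n U b (y 0) * (if tail n y \<in> U then 1 else 0)"
      by (subst fsum_single[of "y 0"]) (use ya in auto)
    also have "\<dots> = (if tail n y \<in> U then b y else 0)"
    proof (cases "tail n y \<in> U")
      case True
      have "coordinate n U b (y 0) = (if tail n y \<in> U then b y else 0)"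
        unfolding coordinate_def pushforward_fsum
      proof (rule fsum_single)
        show "y \<in> {z \<in> topspace (nerve G (Suc n)). z 0 = y 0}" using y by (simp add: nerve_topspace)
        fix z assume "z \<in> {z \<in> topspace (nerve G (Suc n)). z 0 = y 0}" and ne: "z \<noteq> y"
        then have z: "z \<in> nerve_set G (Suc n)" "z 0 = y 0" by (simp_all add: nerve_topspace)
        have "anchor (tail n z) = anchor (tail n y)" using anchor_tail[OF z(1)] anchor_tail[OF y] z(2) by simp
        then have "tail n z \<notin> U" using inj_onD[OF U(3)] True ne nerve_eqI[OF z(1) y z(2)] by blast
        then show "(if tail n z \<in> U then b z else 0) = 0" by simp
      qed
      then show ?thesis using True by simp
    qed simp
    finally show ?thesis .
  next
    case False
    then show ?thesis using cc_funsD(2)[OF b] by (simp add: nerve.conv_def nerve_topspace)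
  qed
  then show ?thesis by (simp add: bar_module_smult[OF c] fun_eq_iff)
qed

text \<open>The source of the first entry is the anchor of the tail. So the push-forward of the
  coordinate along the source map can be computed through the tail, where it becomes the restriction
  of \<open>coinv n b\<close> to \<open>U\<close>.\<close>

lemma coordinate_aug_ideal:
  assumes U: "openin (nerve G n) U" "compactin (nerve G n) U" and b: "b \<in> cc_funs (nerve G (Suc n))"
    and 0: "coinv n b = (\<lambda>w. 0)"
  shows "coordinate n U b \<in> aug_ideal"
proof -
  let ?b = "\<lambda>y. if tail n y \<in> U then b y else 0"
  note bU = restrict_tail[OF U b]
  have e: "etale_map (nerve G (Suc n)) (unit_top G) (\<lambda>y. gsrc G (y 0))"
    by (rule etale_map_compose[OF etale_head etale_src])
  have "pushforward (gtop G) (gsrc G) (coordinate n U b) = pushforward (nerve G (Suc n)) (\<lambda>y. gsrc G (y 0)) ?b"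
    unfolding coordinate_def by (rule pushforward_compose[OF e bU]) (auto simp: nerve_topspace arrows_topspace head_arrow)
  also have "\<dots> = pushforward (nerve G n) anchor (pushforward (nerve G (Suc n)) (tail n) ?b)"
    by (rule pushforward_compose[OF e bU, symmetric]) (auto simp: nerve_topspace tail_in anchor_tail)
  also have "pushforward (nerve G (Suc n)) (tail n) ?b = (\<lambda>w. 0)"
  proof
    fix w
    have "pushforward (nerve G (Suc n)) (tail n) ?b w =
      fsum {y \<in> topspace (nerve G (Suc n)). tail n y = w} (\<lambda>y. (if w \<in> U then 1 else 0) * b y)"
      unfolding pushforward_fsum by (rule fsum_cong) auto
    also have "\<dots> = (if w \<in> U then 1 else 0) * coinv n b w" by (simp only: fsum_cmult coinv_def pushforward_fsum)
    finally show "pushforward (nerve G (Suc n)) (tail n) ?b w = 0" by (simp add: 0)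
  qed
  finally have "pushforward (gtop G) (gsrc G) (coordinate n U b) = (\<lambda>x. 0)" by simp
  moreover have "coordinate n U b \<in> cc_funs (gtop G)"
    using lmod_homD(1)[OF coordinate_hom[OF U(1,2)], of b] b by (simp add: bar_module_simps conv_ring_simps)
  ultimately show ?thesis by (simp add: aug_ideal_def)
qed

text \<open>The tails of the supports form a compact set, which finitely many disjoint compact open
  sets with injective anchor cover. Disjointness makes the pieces of \<open>b\<close> add up to
  \<open>b\<close>.\<close>

lemma bar_dual_basis:
  assumes Y: "finite Y" "Y \<subseteq> carrier (bar_module G n)"
  obtains F where "set F \<subseteq> {U. openin (nerve G n) U \<and> compactin (nerve G n) U \<and> inj_on anchor U}"
    "\<And>b. b \<in> Y \<Longrightarrow> lincomb (bar_module G n) (map (\<lambda>U. (coordinate n U, basis_element n U)) F) b = b"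
proof -
  have Yc: "b \<in> cc_funs (nerve G (Suc n))" if "b \<in> Y" for b using that Y by (auto simp: bar_module_simps)
  let ?C = "\<Union>b\<in>Y. tail n ` {y \<in> topspace (nerve G (Suc n)). b y \<noteq> 0}"
  have C: "compactin (nerve G n) ?C"
    using Y(1) by (intro compactin_Union finite_imageI) (auto intro!: image_compactin[OF cc_funsD(4)[OF Yc] continuous_tail])
  have "\<exists>U. openin (nerve G n) U \<and> y \<in> U \<and> inj_on anchor U" if "y \<in> ?C" for y
    using etale_anchor[of n] compactin_subset_topspace[OF C] that unfolding etale_map_def by blast
  then obtain F0 where F0: "finite F0" "?C \<subseteq> \<Union>F0" "disjoint F0"
    "\<And>U. U \<in> F0 \<Longrightarrow> openin (nerve G n) U \<and> compactin (nerve G n) U \<and> inj_on anchor U"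
    by (rule compact_open_disjoint_cover[OF ample_nerve C, of "inj_on anchor"]) (assumption, blast intro: inj_on_subset, blast)
  obtain F where F: "set F = F0" "distinct F" using finite_distinct_list[OF F0(1)] by blast
  have good: "set F \<subseteq> {U. openin (nerve G n) U \<and> compactin (nerve G n) U \<and> inj_on anchor U}"
    using F0(4) F(1) by blast
  have "lincomb (bar_module G n) (map (\<lambda>U. (coordinate n U, basis_element n U)) F) b = b" if b: "b \<in> Y" for b
  proof -
    have "lincomb (bar_module G n) (map (\<lambda>U. (coordinate n U, basis_element n U)) F) b =
      (\<lambda>y. \<Sum>U\<in>set F. if tail n y \<in> U then b y else 0)"
      using good F(2)
    proof (induction F)
      case Nil
      then show ?case by (simp add: bar_module_simps)
    next
      case (Cons U F)
      then have "coordinate n U b \<odot>\<^bsub>bar_module G n\<^esub> basis_element n U = (\<lambda>y. if tail n y \<in> U then b y else 0)"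
        by (intro coordinate_basis Yc[OF b]) auto
      then show ?case using Cons by (simp add: bar_module_simps)
    qed
    also have "\<dots> = b"
    proof
      fix y
      show "(\<Sum>U\<in>set F. if tail n y \<in> U then b y else 0) = b y"
      proof (cases "b y = 0")
        case True
        then show ?thesis by (intro trans[OF sum.neutral]) auto
      next
        case False
        then have "y \<in> topspace (nerve G (Suc n))" using cc_funsD(3)[OF Yc[OF b]] by blast
        then have "tail n y \<in> ?C" using False b by blast
        then obtain U where U: "U \<in> F0" "tail n y \<in> U" using F0(2) by blast
        have "(\<Sum>V\<in>set F. if tail n y \<in> V then b y else 0) = (\<Sum>V\<in>{U}. if tail n y \<in> V then b y else 0)"
        proof (rule sum.mono_neutral_right)
          show "\<forall>V\<in>set F - {U}. (if tail n y \<in> V then b y else 0) = 0"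
          proof
            fix V assume "V \<in> set F - {U}"
            then have "disjnt U V" using F0(3) U F(1) by (auto simp: pairwise_def)
            then show "(if tail n y \<in> V then b y else 0) = 0" using U by (auto simp: disjnt_iff)
          qed
        qed (use U F in auto)
        then show ?thesis using U by simp
      qed
    qed
    finally show ?thesis .
  qed
  then show thesis using that good by blast
qed

lemma bar_locally_projective: "locally_projective R (bar_module G n) (carrier (bar_module G n))"
  unfolding locally_projective_def
proof (intro allI impI, elim conjE)
  fix Y assume Y: "finite Y" "Y \<subseteq> carrier (bar_module G n)"
  obtain F where F: "set F \<subseteq> {U. openin (nerve G n) U \<and> compactin (nerve G n) U \<and> inj_on anchor U}"
    "\<And>b. b \<in> Y \<Longrightarrow> lincomb (bar_module G n) (map (\<lambda>U. (coordinate n U, basis_element n U)) F) b = b"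
    by (rule bar_dual_basis[OF Y]) (rule that)
  show "\<exists>cs. (\<forall>c\<in>set cs. fst c \<in> lmod_hom R (bar_module G n) (regular_module R) \<and> snd c \<in> carrier (bar_module G n)) \<and>
           (\<forall>y\<in>Y. lincomb (bar_module G n) cs y = y)"
    using F by (intro exI[of _ "map (\<lambda>U. (coordinate n U, basis_element n U)) F"])
      (auto simp: coordinate_hom basis_element_cc bar_module_simps)
qed

end

lemma (in lmod) lincomb_eq_zero:
  assumes "\<And>c. c \<in> set cs \<Longrightarrow> fst c y \<in> carrier R \<and> snd c = \<zero>\<^bsub>M\<^esub>"
  shows "lincomb M cs y = \<zero>\<^bsub>M\<^esub>"
  using assms by (induction cs) (auto simp: smult_zero_right)

context ample_groupoid
begin

section \<open>The augmentation ideal and the coinvariants of the bar modules\<close>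

text \<open>A product of arrows has the source of its right factor. By
  \<open>pushforward_conv_invariant\<close> the push-forward of \<open>j r\<close> is therefore
  expressed through that of \<open>j\<close>, which is zero.\<close>

lemma aug_right_ideal: "right_ideal R aug_ideal"
proof (intro right_ideal.intro right_ideal_axioms.intro conv_ring.ring_with_local_units_axioms)
  show "subgroup aug_ideal (add_monoid (regular_module R))"
  proof (rule subgroup.intro)
    show "aug_ideal \<subseteq> carrier (add_monoid (regular_module R))" by (auto simp: aug_ideal_def conv_ring_simps)
    show "x \<otimes>\<^bsub>add_monoid (regular_module R)\<^esub> y \<in> aug_ideal" if "x \<in> aug_ideal" "y \<in> aug_ideal" for x y
      using that pushforward_add[OF etale_src] by (auto simp: aug_ideal_def conv_ring_simps cc_add)
    show "\<one>\<^bsub>add_monoid (regular_module R)\<^esub> \<in> aug_ideal" by (simp add: aug_ideal_def conv_ring_simps)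
    show "inv\<^bsub>add_monoid (regular_module R)\<^esub> x \<in> aug_ideal" if "x \<in> aug_ideal" for x
    proof -
      have "\<ominus>\<^bsub>regular_module R\<^esub> x = (\<lambda>y. - x y)"
        by (rule a_inv_cc[where Y = "gtop G"]) (use that in \<open>auto simp: conv_ring_simps aug_ideal_def\<close>)
      then show ?thesis using that by (simp add: a_inv_def aug_ideal_def cc_uminus pushforward_uminus)
    qed
  qed
  show "j \<otimes>\<^bsub>R\<^esub> r \<in> aug_ideal" if "j \<in> aug_ideal" "r \<in> carrier R" for j r
  proof -
    have j: "j \<in> cc_funs (gtop G)" "pushforward (gtop G) (gsrc G) j = (\<lambda>x. 0)" and r: "r \<in> cc_funs (gtop G)"
      using that by (auto simp: aug_ideal_def conv_ring_simps)
    have "pushforward (gtop G) (gsrc G) (arrow.conv j r) =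
      pushforward (gtop G) (gsrc G) (\<lambda>z. pushforward (gtop G) (gsrc G) j (grng G z) * r z)"
      by (rule arrow.pushforward_conv_invariant[OF etale_src _ j(1) r]) (auto simp: arrows_topspace src_mul)
    then show ?thesis using j r by (simp add: aug_ideal_def arrow.conv_closed conv_ring_mult)
  qed
qed

lemma aug_ideal_subset: "aug_ideal \<subseteq> carrier R"
  by (auto simp: aug_ideal_def conv_ring_simps)

lemma coinv_closed: "b \<in> cc_funs (nerve G (Suc n)) \<Longrightarrow> coinv n b \<in> cc_funs (nerve G n)"
  unfolding coinv_def by (rule pushforward_cc[OF etale_tail ample_nerve ample_nerve])

lemma coinv_add:
  "\<lbrakk>b \<in> cc_funs (nerve G (Suc n)); b' \<in> cc_funs (nerve G (Suc n))\<rbrakk>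
    \<Longrightarrow> coinv n (\<lambda>y. b y + b' y) = (\<lambda>w. coinv n b w + coinv n b' w)"
  unfolding coinv_def by (rule pushforward_add[OF etale_tail])

lemma coinv_uminus: "coinv n (\<lambda>y. - b y) = (\<lambda>w. - coinv n b w)"
  unfolding coinv_def by (rule pushforward_uminus)

lemma coinv_zero [simp]: "coinv n (\<lambda>y. 0) = (\<lambda>w. 0)"
  by (simp add: coinv_def)

lemma bar_a_inv: "b \<in> cc_funs (nerve G (Suc n)) \<Longrightarrow> \<ominus>\<^bsub>bar_module G n\<^esub> b = (\<lambda>y. - b y)"
  by (rule a_inv_cc[OF bar_module_simps])

text \<open>Products with elements of the ideal die because \<open>tail n\<close> is invariant under
  the action. Conversely, if \<open>coinv n b\<close> is zero then all coordinates of
  \<open>b\<close> lie in the ideal, and the dual basis writes \<open>b\<close> as an element of its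
  span. With \<open>coinv_surjective\<close> this identifies \<open>B / J B\<close> with the chains
  on the nerve.\<close>

lemma coinv_eq_zero_iff:
  assumes b: "b \<in> cc_funs (nerve G (Suc n))"
  shows "coinv n b = (\<lambda>w. 0) \<longleftrightarrow> b \<in> ideal_span aug_ideal (bar_module G n)"
proof
  assume 0: "coinv n b = (\<lambda>w. 0)"
  have Y: "finite {b}" "{b} \<subseteq> carrier (bar_module G n)" using b by (auto simp: bar_module_simps)
  obtain F where F: "set F \<subseteq> {U. openin (nerve G n) U \<and> compactin (nerve G n) U \<and> inj_on anchor U}"
    "\<And>b'. b' \<in> {b} \<Longrightarrow> lincomb (bar_module G n) (map (\<lambda>U. (coordinate n U, basis_element n U)) F) b' = b'"
    by (rule bar_dual_basis[OF Y]) (rule that)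
  have "lincomb (bar_module G n) (map (\<lambda>U. (coordinate n U, basis_element n U)) F) b \<in> ideal_span aug_ideal (bar_module G n)"
  proof (rule bar.lincomb_ideal_span[OF aug_ideal_subset])
    fix c assume "c \<in> set (map (\<lambda>U. (coordinate n U, basis_element n U)) F)"
    then obtain U where "U \<in> set F" "c = (coordinate n U, basis_element n U)" by auto
    then show "fst c b \<in> aug_ideal \<and> snd c \<in> carrier (bar_module G n)"
      using F(1) coordinate_aug_ideal[OF _ _ b 0] basis_element_cc by (auto simp: bar_module_simps)
  qed
  then show "b \<in> ideal_span aug_ideal (bar_module G n)" using F(2) by simp
next
  let ?K = "{b \<in> cc_funs (nerve G (Suc n)). coinv n b = (\<lambda>w. 0)}"
  assume "b \<in> ideal_span aug_ideal (bar_module G n)"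
  then have bg: "b \<in> generate (add_monoid (bar_module G n))
      {j \<odot>\<^bsub>bar_module G n\<^esub> m | j m. j \<in> aug_ideal \<and> m \<in> carrier (bar_module G n)}"
    by (simp add: ideal_span_def)
  have K: "subgroup ?K (add_monoid (bar_module G n))"
  proof (rule subgroup.intro)
    show "inv\<^bsub>add_monoid (bar_module G n)\<^esub> x \<in> ?K" if "x \<in> ?K" for x
      using that bar_a_inv[of x n] by (simp add: a_inv_def cc_uminus coinv_uminus)
  qed (auto simp: bar_module_simps cc_add coinv_add)
  have "j \<odot>\<^bsub>bar_module G n\<^esub> m \<in> ?K" if "j \<in> aug_ideal" "m \<in> carrier (bar_module G n)" for j m
  proof -
    have j: "j \<in> cc_funs (gtop G)" "pushforward (gtop G) (gsrc G) j = (\<lambda>x. 0)"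
      and m: "m \<in> cc_funs (nerve G (Suc n))"
      using that by (auto simp: aug_ideal_def bar_module_simps)
    have "coinv n (nerve.conv n j m) = pushforward (nerve G (Suc n)) (tail n)
        (\<lambda>z. pushforward (gtop G) (gsrc G) j (anchor z) * m z)"
      unfolding coinv_def
      by (rule nerve.pushforward_conv_invariant[OF etale_tail _ j(1) m]) (simp add: nerve_topspace nerve_act_in)
    then show ?thesis using j m by (simp add: bar_module_smult nerve.conv_closed)
  qed
  then have gen: "{j \<odot>\<^bsub>bar_module G n\<^esub> m | j m. j \<in> aug_ideal \<and> m \<in> carrier (bar_module G n)} \<subseteq> ?K"
    by blast
  have "b \<in> ?K" by (rule subsetD[OF group.generate_subgroup_incl[OF bar.a_group gen K] bg])
  then show "coinv n b = (\<lambda>w. 0)" by simp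
qed

lemma coinv_surjective:
  assumes a: "a \<in> cc_funs (nerve G n)"
  shows "\<exists>b\<in>cc_funs (nerve G (Suc n)). coinv n b = a"
proof (intro bexI)
  show "pushforward (nerve G n) (section_map n) a \<in> cc_funs (nerve G (Suc n))"
    by (rule pushforward_cc[OF etale_section_map ample_nerve ample_nerve a])
  have "etale_map (nerve G n) (nerve G n) (\<lambda>w. tail n (section_map n w))"
    by (rule etale_map_compose[OF etale_section_map etale_tail])
  then have "coinv n (pushforward (nerve G n) (section_map n) a) = pushforward (nerve G n) (\<lambda>w. tail n (section_map n w)) a"
    unfolding coinv_def by (rule pushforward_compose[OF _ a]) (auto simp: nerve_topspace section_map_in)
  also have "\<dots> = pushforward (nerve G n) (\<lambda>w. w) a"
    by (rule pushforward_cong) (simp add: nerve_topspace section_map_in)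
  also have "\<dots> = a" by (rule pushforward_id[OF a])
  finally show "coinv n (pushforward (nerve G n) (section_map n) a) = a" .
qed

lemma nerve_boundary_coinv:
  assumes b: "b \<in> cc_funs (nerve G (Suc (Suc n)))"
  shows "nerve_boundary G (Suc n) (coinv (Suc n) b) = coinv n (bar_boundary G (Suc n) b)"
proof -
  have "pushforward (nerve G (Suc n)) (face G (Suc n) i) (coinv (Suc n) b) =
     coinv n (pushforward (nerve G (Suc (Suc n))) (face G (Suc (Suc n)) (Suc i)) b)" if i: "i \<le> Suc n" for i
  proof -
    have e: "etale_map (nerve G (Suc (Suc n))) (nerve G n) (\<lambda>y. face G (Suc n) i (tail (Suc n) y))"
      by (rule etale_map_compose[OF etale_tail etale_face[OF i]])
    have "pushforward (nerve G (Suc n)) (face G (Suc n) i) (coinv (Suc n) b) =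
      pushforward (nerve G (Suc (Suc n))) (\<lambda>y. face G (Suc n) i (tail (Suc n) y)) b"
      unfolding coinv_def by (rule pushforward_compose[OF e b]) (auto simp: nerve_topspace tail_in)
    also have "\<dots> = coinv n (pushforward (nerve G (Suc (Suc n))) (face G (Suc (Suc n)) (Suc i)) b)"
      unfolding coinv_def
      by (rule pushforward_compose[OF e b, symmetric]) (use i in \<open>auto simp: nerve_topspace face_in face_tail\<close>)
    finally show ?thesis .
  qed
  then have "nerve_boundary G (Suc n) (coinv (Suc n) b) =
    (\<lambda>y. \<Sum>i\<le>Suc n. (-1) ^ i * coinv n (pushforward (nerve G (Suc (Suc n))) (face G (Suc (Suc n)) (Suc i)) b) y)"
    by (intro ext) (simp add: nerve_boundary_def)
  also have "\<dots> = coinv n (bar_boundary G (Suc n) b)"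
    unfolding bar_boundary_eq coinv_def
    by (rule pushforward_sum[OF etale_tail, symmetric])
      (auto intro!: pushforward_cc[OF etale_face ample_nerve ample_nerve b])
  finally show ?thesis .
qed

subsection \<open>The contracting homotopy\<close>

text \<open>Additive but in general not linear over the ring, since prepending a unit does not
  commute with the action.\<close>

definition contraction :: "nat \<Rightarrow> ((nat \<Rightarrow> 'a) \<Rightarrow> int) \<Rightarrow> (nat \<Rightarrow> 'a) \<Rightarrow> int" where
  "contraction n = pushforward (nerve G (Suc n)) (section_map (Suc n))"

lemma contraction_cc: "b \<in> cc_funs (nerve G (Suc n)) \<Longrightarrow> contraction n b \<in> cc_funs (nerve G (Suc (Suc n)))"
  unfolding contraction_def by (rule pushforward_cc[OF etale_section_map ample_nerve ample_nerve])

lemma contraction_zero [simp]: "contraction n (\<lambda>y. 0) = (\<lambda>y. 0)"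
  by (simp add: contraction_def)

lemma face_contraction:
  assumes b: "b \<in> cc_funs (nerve G (Suc n))" and i: "i \<le> Suc n"
  shows "pushforward (nerve G (Suc (Suc n))) (face G (Suc (Suc n)) (Suc i)) (contraction n b) =
    pushforward (nerve G (Suc n)) (\<lambda>y. face G (Suc (Suc n)) (Suc i) (section_map (Suc n) y)) b"
proof -
  have "etale_map (nerve G (Suc n)) (nerve G (Suc n)) (\<lambda>y. face G (Suc (Suc n)) (Suc i) (section_map (Suc n) y))"
    by (rule etale_map_compose[OF etale_section_map etale_face]) (use i in simp)
  then show ?thesis
    unfolding contraction_def by (rule pushforward_compose[OF _ b]) (auto simp: nerve_topspace section_map_in)
qed

lemma face_contraction_0:
  assumes b: "b \<in> cc_funs (nerve G (Suc n))"
  shows "pushforward (nerve G (Suc (Suc n))) (face G (Suc (Suc n)) (Suc 0)) (contraction n b) = b"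
proof -
  have "pushforward (nerve G (Suc n)) (\<lambda>y. face G (Suc (Suc n)) (Suc 0) (section_map (Suc n) y)) b =
    pushforward (nerve G (Suc n)) (\<lambda>y. y) b"
    by (rule pushforward_cong) (simp add: nerve_topspace face_section_map)
  then show ?thesis using face_contraction[OF b, of 0] pushforward_id[OF b] by simp
qed

lemma augmentation_cc: "b \<in> cc_funs (nerve G (Suc 0)) \<Longrightarrow> bar_augmentation G b \<in> cc_funs (unit_top G)"
  using lmod_homD(1)[OF augmentation_hom] by (simp add: bar_module_simps unit_left_module_simps)

lemma base_section_cc: "a \<in> cc_funs (unit_top G) \<Longrightarrow> pushforward (unit_top G) base_section a \<in> cc_funs (nerve G (Suc 0))"
  by (rule pushforward_cc[OF etale_base_section ample_unit_top ample_nerve])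

lemma augmentation_base_section:
  assumes a: "a \<in> cc_funs (unit_top G)"
  shows "bar_augmentation G (pushforward (unit_top G) base_section a) = a"
proof -
  have "etale_map (unit_top G) (unit_top G) (\<lambda>x. anchor (base_section x))"
    by (rule etale_map_compose[OF etale_base_section etale_anchor])
  then have "bar_augmentation G (pushforward (unit_top G) base_section a) =
    pushforward (unit_top G) (\<lambda>x. anchor (base_section x)) a"
    unfolding bar_augmentation_def One_nat_def
    by (rule pushforward_compose[OF _ a]) (auto simp: nerve_topspace unit_topspace base_section_in)
  also have "\<dots> = pushforward (unit_top G) (\<lambda>x. x) a"
    by (rule pushforward_cong) (simp add: unit_topspace base_section_in)
  also have "\<dots> = a" by (rule pushforward_id[OF a])
  finally show ?thesis .
qed

lemma boundary_contraction_0: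
  assumes b: "b \<in> cc_funs (nerve G (Suc 0))"
  shows "bar_boundary G (Suc 0) (contraction 0 b) =
    (\<lambda>y. b y - pushforward (unit_top G) base_section (bar_augmentation G b) y)"
proof -
  have "pushforward (nerve G (Suc (Suc 0))) (face G (Suc (Suc 0)) (Suc (Suc 0))) (contraction 0 b) =
    pushforward (nerve G (Suc 0)) (\<lambda>y. base_section (anchor y)) b"
    unfolding face_contraction[OF b, of "Suc 0", simplified] face_section_map_base ..
  also have "\<dots> = pushforward (unit_top G) base_section (bar_augmentation G b)"
    unfolding bar_augmentation_def One_nat_def
    by (rule pushforward_compose[OF etale_map_compose[OF etale_anchor etale_base_section] b, symmetric])
      (auto simp: unit_topspace nerve_topspace anchor_unit)
  finally show ?thesis
    unfolding bar_boundary_eq by (simp add: face_contraction_0[OF b])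
qed

text \<open>The face of index 1 undoes the extra degeneracy. The others commute with it after a
  shift of the index by one, which produces the minus sign.\<close>

lemma boundary_contraction_Suc:
  assumes b: "b \<in> cc_funs (nerve G (Suc (Suc n)))"
  shows "bar_boundary G (Suc (Suc n)) (contraction (Suc n) b) =
    (\<lambda>y. b y - contraction n (bar_boundary G (Suc n) b) y)"
proof -
  let ?p = "\<lambda>i. pushforward (nerve G (Suc (Suc n))) (face G (Suc (Suc n)) (Suc i)) b"
  have "pushforward (nerve G (Suc (Suc (Suc n)))) (face G (Suc (Suc (Suc n))) (Suc (Suc i))) (contraction (Suc n) b)
    = contraction n (?p i)" if i: "i \<le> Suc n" for i
  proof -
    have "pushforward (nerve G (Suc (Suc (Suc n)))) (face G (Suc (Suc (Suc n))) (Suc (Suc i))) (contraction (Suc n) b)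
      = pushforward (nerve G (Suc (Suc n))) (\<lambda>y. face G (Suc (Suc (Suc n))) (Suc (Suc i)) (section_map (Suc (Suc n)) y)) b"
      by (rule face_contraction[OF b]) (use i in simp)
    also have "\<dots> = pushforward (nerve G (Suc (Suc n))) (\<lambda>y. section_map (Suc n) (face G (Suc (Suc n)) (Suc i) y)) b"
      by (rule pushforward_cong) (use i in \<open>simp add: nerve_topspace face_section_map_Suc\<close>)
    also have "\<dots> = contraction n (?p i)"
      unfolding contraction_def
      by (rule pushforward_compose[OF etale_map_compose[OF etale_face etale_section_map] b, symmetric])
        (use i in \<open>auto simp: nerve_topspace face_in\<close>)
    finally show ?thesis .
  qed
  then have "bar_boundary G (Suc (Suc n)) (contraction (Suc n) b) =
    (\<lambda>y. b y + (\<Sum>i\<le>Suc n. (-1) ^ Suc i * contraction n (?p i) y))"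
    unfolding bar_boundary_eq sum.atMost_Suc_shift[of _ "Suc n"] by (simp add: face_contraction_0[OF b])
  also have "\<dots> = (\<lambda>y. b y - (\<Sum>i\<le>Suc n. (-1) ^ i * contraction n (?p i) y))"
    by (intro ext) (simp add: sum_negf del: sum.atMost_Suc)
  also have "(\<lambda>y. \<Sum>i\<le>Suc n. (-1) ^ i * contraction n (?p i) y) = contraction n (bar_boundary G (Suc n) b)"
    unfolding bar_boundary_eq contraction_def
    by (rule pushforward_sum[OF etale_section_map, symmetric])
      (auto intro!: pushforward_cc[OF etale_face ample_nerve ample_nerve b])
  then have "(\<lambda>y. b y - (\<Sum>i\<le>Suc n. (-1) ^ i * contraction n (?p i) y)) =
     (\<lambda>y. b y - contraction n (bar_boundary G (Suc n) b) y)" by (metis (no_types, lifting))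
  finally show ?thesis .
qed

text \<open>The image of the contraction generates the bar module.\<close>

lemma hom_zero_on_contraction:
  assumes h: "h \<in> lmod_hom R (bar_module G (Suc n)) N" and N: "lmod R N"
    and 0: "\<And>c. c \<in> cc_funs (nerve G (Suc n)) \<Longrightarrow> h (contraction n c) = \<zero>\<^bsub>N\<^esub>"
    and b: "b \<in> cc_funs (nerve G (Suc (Suc n)))"
  shows "h b = \<zero>\<^bsub>N\<^esub>"
proof -
  interpret N: lmod R N by (rule N)
  have Y: "finite {b}" "{b} \<subseteq> carrier (bar_module G (Suc n))" using b by (auto simp: bar_module_simps)
  obtain F where F: "set F \<subseteq> {U. openin (nerve G (Suc n)) U \<and> compactin (nerve G (Suc n)) U \<and> inj_on anchor U}"
    "\<And>b'. b' \<in> {b} \<Longrightarrow> lincomb (bar_module G (Suc n)) (map (\<lambda>U. (coordinate (Suc n) U, basis_element (Suc n) U)) F) b' = b'"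
    by (rule bar_dual_basis[OF Y]) (rule that)
  let ?cs = "map (\<lambda>U. (coordinate (Suc n) U, basis_element (Suc n) U)) F"
  have cs: "fst c b \<in> carrier R \<and> snd c \<in> carrier (bar_module G (Suc n)) \<and> h (snd c) = \<zero>\<^bsub>N\<^esub>" if "c \<in> set ?cs" for c
  proof -
    obtain U where U: "U \<in> set F" "c = (coordinate (Suc n) U, basis_element (Suc n) U)" using \<open>c \<in> set ?cs\<close> by auto
    have U': "openin (nerve G (Suc n)) U" "compactin (nerve G (Suc n)) U" using F(1) U(1) by auto
    have "h (basis_element (Suc n) U) = \<zero>\<^bsub>N\<^esub>"
      using 0[OF cc_indicator[OF ample_nerve U', of 1]] basis_element_pushforward[OF U'(1)]
      by (simp add: contraction_def)
    then show ?thesis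
      using U lmod_homD(1)[OF coordinate_hom[OF U'], of b] basis_element_cc[OF U'] b
      by (simp add: bar_module_simps)
  qed
  have "h (lincomb (bar_module G (Suc n)) ?cs b) = lincomb N (map (apsnd h) ?cs) b"
    by (rule bar.hom_lincomb[OF h N.abelian_group_axioms]) (use cs in blast)
  also have "\<dots> = \<zero>\<^bsub>N\<^esub>"
  proof (rule N.lincomb_eq_zero)
    fix c assume "c \<in> set (map (apsnd h) ?cs)"
    then have "c \<in> apsnd h ` set ?cs" by (simp only: set_map)
    then obtain c' where c': "c = apsnd h c'" "c' \<in> set ?cs" by (rule imageE)
    then show "fst c b \<in> carrier R \<and> snd c = \<zero>\<^bsub>N\<^esub>" using cs[OF c'(2)] by simp
  qed
  finally show ?thesis using F(2) by simp
qed

lemma unit_left_module_lmod: "lmod R (unit_left_module G)"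
  by (rule unit.lmod_conv) (simp_all add: unit_left_module_simps unit_left_module_smult)

lemma boundary_diff:
  assumes "b \<in> cc_funs (nerve G (Suc (Suc n)))" "c \<in> cc_funs (nerve G (Suc (Suc n)))"
  shows "bar_boundary G (Suc n) (\<lambda>y. b y - c y) = (\<lambda>y. bar_boundary G (Suc n) b y - bar_boundary G (Suc n) c y)"
proof -
  note h = bar_boundary_hom[of n]
  have "bar_boundary G (Suc n) (\<lambda>y. - c y) = (\<lambda>y. - bar_boundary G (Suc n) c y)"
    using lmod_hom_minus[OF h bar.abelian_group_axioms bar.abelian_group_axioms, of c] assms lmod_homD(1)[OF h, of c]
    by (simp add: bar_a_inv bar_module_simps)
  then show ?thesis
    using lmod_homD(2)[OF h, of b "\<lambda>y. - c y"] assms by (simp add: bar_module_simps cc_uminus)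
qed

lemma augmentation_diff:
  assumes "b \<in> cc_funs (nerve G (Suc 0))" "c \<in> cc_funs (nerve G (Suc 0))"
  shows "bar_augmentation G (\<lambda>y. b y - c y) = (\<lambda>x. bar_augmentation G b x - bar_augmentation G c x)"
proof -
  have "(\<lambda>y. b y - c y) = (\<lambda>y. b y + - c y)" by simp
  then show ?thesis
    using pushforward_add[OF etale_anchor assms(1) cc_uminus[OF assms(2)]]
    by (simp add: bar_augmentation_def pushforward_uminus)
qed

lemma boundary_cc: "b \<in> cc_funs (nerve G (Suc (Suc n))) \<Longrightarrow> bar_boundary G (Suc n) b \<in> cc_funs (nerve G (Suc n))"
  using lmod_homD(1)[OF bar_boundary_hom] by (simp add: bar_module_simps)

section \<open>Exactness of the bar complex\<close>

lemma augmentation_boundary: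
  assumes "b \<in> cc_funs (nerve G (Suc (Suc 0)))"
  shows "bar_augmentation G (bar_boundary G (Suc 0) b) = (\<lambda>x. 0)"
proof -
  have "(\<lambda>b. bar_augmentation G (bar_boundary G (Suc 0) b)) b = \<zero>\<^bsub>unit_left_module G\<^esub>"
  proof (rule hom_zero_on_contraction[OF lmod_hom_compose[OF bar_boundary_hom augmentation_hom] unit_left_module_lmod _ assms])
    fix c assume c: "c \<in> cc_funs (nerve G (Suc 0))"
    then show "bar_augmentation G (bar_boundary G (Suc 0) (contraction 0 c)) = \<zero>\<^bsub>unit_left_module G\<^esub>"
      using augmentation_cc[OF c]
      by (simp add: boundary_contraction_0 augmentation_diff base_section_cc augmentation_base_section unit_left_module_simps)
  qed
  then show ?thesis by (simp add: unit_left_module_simps)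
qed

text \<open>Deduced from the contraction \<open>h\<close>: the composite \<open>d d\<close> is
  linear, so it may be tested on chains \<open>h c\<close>, where
  \<open>d d h c = d (c - h d c) = h d d c\<close> vanishes by the previous degree. In the lowest
  degree the augmentation takes over the role of \<open>d\<close>.\<close>

lemma boundary_boundary:
  assumes "b \<in> cc_funs (nerve G (Suc (Suc (Suc n))))"
  shows "bar_boundary G (Suc n) (bar_boundary G (Suc (Suc n)) b) = (\<lambda>y. 0)"
  using assms
proof (induction n arbitrary: b)
  case 0
  have "(\<lambda>b. bar_boundary G (Suc 0) (bar_boundary G (Suc (Suc 0)) b)) b = \<zero>\<^bsub>bar_module G 0\<^esub>"
  proof (rule hom_zero_on_contraction[OF lmod_hom_compose[OF bar_boundary_hom bar_boundary_hom] bar_lmod _ 0])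
    fix c assume c: "c \<in> cc_funs (nerve G (Suc (Suc 0)))"
    have "bar_boundary G (Suc 0) (contraction 0 (bar_boundary G (Suc 0) c)) = bar_boundary G (Suc 0) c"
      by (simp add: boundary_contraction_0[OF boundary_cc[OF c]] augmentation_boundary[OF c])
    then show "bar_boundary G (Suc 0) (bar_boundary G (Suc (Suc 0)) (contraction (Suc 0) c)) = \<zero>\<^bsub>bar_module G 0\<^esub>"
      using c by (simp add: boundary_contraction_Suc boundary_diff contraction_cc boundary_cc bar_module_simps)
  qed
  then show ?case by (simp add: bar_module_simps)
next
  case (Suc n)
  have "(\<lambda>b. bar_boundary G (Suc (Suc n)) (bar_boundary G (Suc (Suc (Suc n))) b)) b = \<zero>\<^bsub>bar_module G (Suc n)\<^esub>"
  proof (rule hom_zero_on_contraction[OF lmod_hom_compose[OF bar_boundary_hom bar_boundary_hom] bar_lmod _ Suc.prems])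
    fix c assume c: "c \<in> cc_funs (nerve G (Suc (Suc (Suc n))))"
    have "bar_boundary G (Suc (Suc n)) (contraction (Suc n) (bar_boundary G (Suc (Suc n)) c)) = bar_boundary G (Suc (Suc n)) c"
      by (simp add: boundary_contraction_Suc[OF boundary_cc[OF c]] Suc.IH[OF c])
    then show "bar_boundary G (Suc (Suc n)) (bar_boundary G (Suc (Suc (Suc n))) (contraction (Suc (Suc n)) c)) = \<zero>\<^bsub>bar_module G (Suc n)\<^esub>"
      using c by (simp add: boundary_contraction_Suc boundary_diff contraction_cc boundary_cc bar_module_simps)
  qed
  then show ?case by (simp add: bar_module_simps)
qed

lemma bar_exact_0:
  "bar_boundary G (Suc 0) ` carrier (bar_module G (Suc 0)) =
    {b \<in> carrier (bar_module G 0). bar_augmentation G b = \<zero>\<^bsub>unit_left_module G\<^esub>}"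
  unfolding bar_module_simps unit_left_module_simps
proof (intro subset_antisym subsetI)
  fix b assume "b \<in> {b \<in> cc_funs (nerve G (Suc 0)). bar_augmentation G b = (\<lambda>y. 0)}"
  then have "b = bar_boundary G (Suc 0) (contraction 0 b)" "contraction 0 b \<in> cc_funs (nerve G (Suc (Suc 0)))"
    by (simp_all add: boundary_contraction_0 contraction_cc)
  then show "b \<in> bar_boundary G (Suc 0) ` cc_funs (nerve G (Suc (Suc 0)))" by (rule image_eqI)
qed (auto simp: boundary_cc augmentation_boundary)

lemma bar_exact:
  "bar_boundary G (Suc (Suc n)) ` carrier (bar_module G (Suc (Suc n))) =
    {b \<in> carrier (bar_module G (Suc n)). bar_boundary G (Suc n) b = \<zero>\<^bsub>bar_module G n\<^esub>}"
  unfolding bar_module_simps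
proof (intro subset_antisym subsetI)
  fix b assume "b \<in> {b \<in> cc_funs (nerve G (Suc (Suc n))). bar_boundary G (Suc n) b = (\<lambda>y. 0)}"
  then have "b = bar_boundary G (Suc (Suc n)) (contraction (Suc n) b)"
    "contraction (Suc n) b \<in> cc_funs (nerve G (Suc (Suc (Suc n))))"
    by (simp_all add: boundary_contraction_Suc contraction_cc)
  then show "b \<in> bar_boundary G (Suc (Suc n)) ` cc_funs (nerve G (Suc (Suc (Suc n))))" by (rule image_eqI)
qed (auto simp: boundary_cc boundary_boundary)

lemma augmentation_onto: "bar_augmentation G ` carrier (bar_module G 0) = carrier (unit_left_module G)"
  unfolding bar_module_simps unit_left_module_simps
proof (intro subset_antisym subsetI)
  fix a assume a: "a \<in> cc_funs (unit_top G)"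
  show "a \<in> bar_augmentation G ` cc_funs (nerve G (Suc 0))"
    using augmentation_base_section[OF a] base_section_cc[OF a] by (metis image_eqI)
qed (auto simp: augmentation_cc)

lemma bar_resolution_pair:
  assumes "projective_resolution R (unit_left_module G) P d \<epsilon>"
  shows "resolution_pair R aug_ideal (unit_left_module G) P d \<epsilon> (bar_module G) (bar_boundary G) (bar_augmentation G)"
  by (intro resolution_pair.intro resolution_pair_axioms.intro aug_right_ideal abelian_group_unit_left_module
      assms bar_lmod bar_locally_projective bar_boundary_hom augmentation_hom augmentation_onto bar_exact_0 bar_exact)

end

section \<open>Balanced tensor products\<close>

text \<open>The homomorphism on the free abelian group that extends \<open>\<beta>\<close>;
  \<open>tensor_lift\<close> takes this value on any representative of a coset.\<close>

definition frag_eval :: "('b, 'w) monoid_scheme \<Rightarrow> ('k \<Rightarrow> 'b) \<Rightarrow> ('k \<Rightarrow>\<^sub>0 int) \<Rightarrow> 'b" where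
  "frag_eval A \<beta> c = finprod A (\<lambda>k. \<beta> k [^]\<^bsub>A\<^esub> Poly_Mapping.lookup c k) (Poly_Mapping.keys c)"

context comm_group
begin

lemma frag_eval_superset:
  assumes "finite T" "Poly_Mapping.keys c \<subseteq> T" "\<And>k. k \<in> T \<Longrightarrow> \<beta> k \<in> carrier G"
  shows "frag_eval G \<beta> c = finprod G (\<lambda>k. \<beta> k [^] Poly_Mapping.lookup c k) T"
  unfolding frag_eval_def
  by (rule finprod_mono_neutral_cong_left) (use assms in \<open>auto simp: in_keys_iff\<close>)

lemma frag_eval_hom:
  assumes \<beta>: "\<And>k. k \<in> S \<Longrightarrow> \<beta> k \<in> carrier G"
  shows "frag_eval G \<beta> \<in> hom (free_Abelian_group S) G"
proof (rule homI)
  fix x assume x: "x \<in> carrier (free_Abelian_group S)"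
  then show "frag_eval G \<beta> x \<in> carrier G"
    unfolding frag_eval_def using \<beta> by (auto intro!: finprod_closed)
  fix y assume y: "y \<in> carrier (free_Abelian_group S)"
  let ?T = "Poly_Mapping.keys x \<union> Poly_Mapping.keys y"
  have T: "finite ?T" "\<And>k. k \<in> ?T \<Longrightarrow> \<beta> k \<in> carrier G" using x y \<beta> by auto
  have "frag_eval G \<beta> (x + y) = finprod G (\<lambda>k. \<beta> k [^] Poly_Mapping.lookup (x + y) k) ?T"
    by (rule frag_eval_superset[OF T(1) Poly_Mapping.keys_add T(2)])
  also have "\<dots> = finprod G (\<lambda>k. \<beta> k [^] Poly_Mapping.lookup x k \<otimes> \<beta> k [^] Poly_Mapping.lookup y k) ?T"
    using T(2) by (intro finprod_cong') (auto simp: lookup_add int_pow_mult)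
  also have "\<dots> = finprod G (\<lambda>k. \<beta> k [^] Poly_Mapping.lookup x k) ?T \<otimes> finprod G (\<lambda>k. \<beta> k [^] Poly_Mapping.lookup y k) ?T"
    using T(2) by (intro finprod_multf) auto
  also have "\<dots> = frag_eval G \<beta> x \<otimes> frag_eval G \<beta> y"
    using frag_eval_superset[OF T(1) _ T(2), of x] frag_eval_superset[OF T(1) _ T(2), of y] by simp
  finally show "frag_eval G \<beta> (x \<otimes>\<^bsub>free_Abelian_group S\<^esub> y) = frag_eval G \<beta> x \<otimes> frag_eval G \<beta> y" by simp
qed

lemma frag_eval_frag_of: "\<beta> k \<in> carrier G \<Longrightarrow> frag_eval G \<beta> (frag_of k) = \<beta> k"
  by (simp add: frag_eval_def finprod_singleton int_pow_1)

lemma mult_inv_eq_one: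
  assumes "x \<in> carrier G" "y \<in> carrier G" "x \<otimes> inv y = \<one>" shows "x = y"
proof -
  have "x = x \<otimes> inv y \<otimes> y" using assms(1,2) by (simp add: m_assoc)
  also have "\<dots> = y" unfolding assms(3) using assms(2) by simp
  finally show ?thesis .
qed

lemma mult_inv_inv_eq_one:
  assumes "x \<in> carrier G" "y \<in> carrier G" "z \<in> carrier G" "x \<otimes> inv y \<otimes> inv z = \<one>" shows "x = y \<otimes> z"
proof (rule mult_inv_eq_one)
  show "x \<otimes> inv (y \<otimes> z) = \<one>" using assms by (simp add: inv_mult m_assoc)
qed (use assms in auto)

end

locale tensor_product =
  fixes R :: "('r, 'x) ring_scheme" and M :: "('r, 'm) module" and P :: "('r, 'p) module"
  assumes M_group: "abelian_group M"
    and M_smult: "\<lbrakk>r \<in> carrier R; m \<in> carrier M\<rbrakk> \<Longrightarrow> r \<odot>\<^bsub>M\<^esub> m \<in> carrier M"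
    and P_lmod: "lmod R P"
begin

sublocale M: abelian_group M by (rule M_group)
sublocale P: lmod R P by (rule P_lmod)

abbreviation "F \<equiv> free_Abelian_group (carrier M \<times> carrier P)"
abbreviation "N \<equiv> tensor_null R M P"

sublocale F: comm_group F by (rule abelian_free_Abelian_group)

lemma frag_of_in: "\<lbrakk>m \<in> carrier M; p \<in> carrier P\<rbrakk> \<Longrightarrow> frag_of (m, p) \<in> carrier F"
  by simp

lemma F_diff: "\<lbrakk>x \<in> carrier F; y \<in> carrier F\<rbrakk> \<Longrightarrow> x - y \<in> carrier F \<and> x - y = x \<otimes>\<^bsub>F\<^esub> inv\<^bsub>F\<^esub> y"
  using keys_diff[of x y] by auto

lemma rels_subset: "tensor_rels R M P \<subseteq> carrier F"
proof
  fix x assume "x \<in> tensor_rels R M P"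
  then consider m m' p where "x = frag_of (m \<oplus>\<^bsub>M\<^esub> m', p) - frag_of (m, p) - frag_of (m', p)"
      "m \<in> carrier M" "m' \<in> carrier M" "p \<in> carrier P"
    | m p p' where "x = frag_of (m, p \<oplus>\<^bsub>P\<^esub> p') - frag_of (m, p) - frag_of (m, p')"
      "m \<in> carrier M" "p \<in> carrier P" "p' \<in> carrier P"
    | r m p where "x = frag_of (r \<odot>\<^bsub>M\<^esub> m, p) - frag_of (m, r \<odot>\<^bsub>P\<^esub> p)"
      "r \<in> carrier R" "m \<in> carrier M" "p \<in> carrier P"
    unfolding tensor_rels_def by blast
  then show "x \<in> carrier F"
  proof cases
    case 1
    show ?thesis unfolding 1(1) by (intro conjunct1[OF F_diff] frag_of_in M.a_closed 1)
  next
    case 2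
    show ?thesis unfolding 2(1) by (intro conjunct1[OF F_diff] frag_of_in P.a_closed 2)
  next
    case 3
    show ?thesis unfolding 3(1) by (intro conjunct1[OF F_diff] frag_of_in M_smult P.smult_closed 3)
  qed
qed

lemma null_subgroup: "subgroup N F"
  unfolding tensor_null_def by (rule F.generate_is_subgroup[OF rels_subset])

lemma null_normal: "N \<lhd> F"
  using null_subgroup F.normal_iff_subgroup by blast

lemma tensor_comm_group: "comm_group (tensor R M P)"
  unfolding tensor_def by (rule F.abelian_FactGroup[OF null_subgroup])

sublocale T: comm_group "tensor R M P" by (rule tensor_comm_group)

lemma coset_hom: "(\<lambda>c. N #>\<^bsub>F\<^esub> c) \<in> hom F (tensor R M P)"
  unfolding tensor_def by (rule normal.r_coset_hom_Mod[OF null_normal])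

lemma coset_carrier: "carrier (tensor R M P) = (\<lambda>c. N #>\<^bsub>F\<^esub> c) ` carrier F"
  by (simp only: tensor_def carrier_FactGroup)

lemma coset_one: "c \<in> N \<Longrightarrow> N #>\<^bsub>F\<^esub> c = \<one>\<^bsub>tensor R M P\<^esub>"
  using F.coset_join2[OF _ null_subgroup] subgroup.subset[OF null_subgroup]
  by (auto simp: tensor_def)

lemma coset_diff:
  assumes "x \<in> carrier F" "y \<in> carrier F"
  shows "N #>\<^bsub>F\<^esub> (x - y) = (N #>\<^bsub>F\<^esub> x) \<otimes>\<^bsub>tensor R M P\<^esub> inv\<^bsub>tensor R M P\<^esub> (N #>\<^bsub>F\<^esub> y)"
proof -
  interpret h: group_hom F "tensor R M P" "\<lambda>c. N #>\<^bsub>F\<^esub> c"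
    by (intro group_hom.intro group_hom_axioms.intro coset_hom F.is_group T.is_group)
  show ?thesis using F_diff[OF assms] assms by (simp only: h.hom_mult F.inv_closed h.hom_inv)
qed

lemma tensor_elt_closed: "\<lbrakk>m \<in> carrier M; p \<in> carrier P\<rbrakk> \<Longrightarrow> tensor_elt R M P m p \<in> carrier (tensor R M P)"
  unfolding tensor_elt_def coset_carrier using frag_of_in by blast

lemma rel_null: "x \<in> tensor_rels R M P \<Longrightarrow> N #>\<^bsub>F\<^esub> x = \<one>\<^bsub>tensor R M P\<^esub>"
  by (rule coset_one) (simp add: tensor_null_def generate.incl)

lemma tensor_elt_add_left:
  assumes "m \<in> carrier M" "m' \<in> carrier M" "p \<in> carrier P"
  shows "tensor_elt R M P (m \<oplus>\<^bsub>M\<^esub> m') p = tensor_elt R M P m p \<otimes>\<^bsub>tensor R M P\<^esub> tensor_elt R M P m' p"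
proof -
  note in1 = frag_of_in[OF assms(1,3)] and in2 = frag_of_in[OF assms(2,3)]
    and in3 = frag_of_in[OF M.a_closed[OF assms(1,2)] assms(3)]
  have "N #>\<^bsub>F\<^esub> (frag_of (m \<oplus>\<^bsub>M\<^esub> m', p) - frag_of (m, p) - frag_of (m', p)) = \<one>\<^bsub>tensor R M P\<^esub>"
    by (rule rel_null) (use assms in \<open>unfold tensor_rels_def, blast\<close>)
  then have "tensor_elt R M P (m \<oplus>\<^bsub>M\<^esub> m') p \<otimes>\<^bsub>tensor R M P\<^esub> inv\<^bsub>tensor R M P\<^esub> tensor_elt R M P m p
    \<otimes>\<^bsub>tensor R M P\<^esub> inv\<^bsub>tensor R M P\<^esub> tensor_elt R M P m' p = \<one>\<^bsub>tensor R M P\<^esub>"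
    using coset_diff[OF conjunct1[OF F_diff[OF in3 in1]] in2] coset_diff[OF in3 in1]
    unfolding tensor_elt_def by simp
  then show ?thesis
    using tensor_elt_closed assms M.a_closed
    by (intro T.mult_inv_inv_eq_one) auto
qed

lemma tensor_elt_add_right:
  assumes "m \<in> carrier M" "p \<in> carrier P" "p' \<in> carrier P"
  shows "tensor_elt R M P m (p \<oplus>\<^bsub>P\<^esub> p') = tensor_elt R M P m p \<otimes>\<^bsub>tensor R M P\<^esub> tensor_elt R M P m p'"
proof -
  note in1 = frag_of_in[OF assms(1,2)] and in2 = frag_of_in[OF assms(1,3)]
    and in3 = frag_of_in[OF assms(1) P.a_closed[OF assms(2,3)]]
  have "N #>\<^bsub>F\<^esub> (frag_of (m, p \<oplus>\<^bsub>P\<^esub> p') - frag_of (m, p) - frag_of (m, p')) = \<one>\<^bsub>tensor R M P\<^esub>"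
    by (rule rel_null) (use assms in \<open>unfold tensor_rels_def, blast\<close>)
  then have "tensor_elt R M P m (p \<oplus>\<^bsub>P\<^esub> p') \<otimes>\<^bsub>tensor R M P\<^esub> inv\<^bsub>tensor R M P\<^esub> tensor_elt R M P m p
    \<otimes>\<^bsub>tensor R M P\<^esub> inv\<^bsub>tensor R M P\<^esub> tensor_elt R M P m p' = \<one>\<^bsub>tensor R M P\<^esub>"
    using coset_diff[OF conjunct1[OF F_diff[OF in3 in1]] in2] coset_diff[OF in3 in1]
    unfolding tensor_elt_def by simp
  then show ?thesis
    using tensor_elt_closed assms P.a_closed
    by (intro T.mult_inv_inv_eq_one) auto
qed

lemma tensor_elt_balanced:
  assumes "r \<in> carrier R" "m \<in> carrier M" "p \<in> carrier P"
  shows "tensor_elt R M P (r \<odot>\<^bsub>M\<^esub> m) p = tensor_elt R M P m (r \<odot>\<^bsub>P\<^esub> p)"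
proof -
  note in1 = frag_of_in[OF M_smult[OF assms(1,2)] assms(3)]
    and in2 = frag_of_in[OF assms(2) P.smult_closed[OF assms(1,3)]]
  have "N #>\<^bsub>F\<^esub> (frag_of (r \<odot>\<^bsub>M\<^esub> m, p) - frag_of (m, r \<odot>\<^bsub>P\<^esub> p)) = \<one>\<^bsub>tensor R M P\<^esub>"
    by (rule rel_null) (use assms in \<open>unfold tensor_rels_def, blast\<close>)
  then have "tensor_elt R M P (r \<odot>\<^bsub>M\<^esub> m) p \<otimes>\<^bsub>tensor R M P\<^esub> inv\<^bsub>tensor R M P\<^esub> tensor_elt R M P m (r \<odot>\<^bsub>P\<^esub> p) = \<one>\<^bsub>tensor R M P\<^esub>"
    using coset_diff[OF in1 in2] unfolding tensor_elt_def by simp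
  then show ?thesis
    by (rule T.mult_inv_eq_one[OF tensor_elt_closed[OF M_smult[OF assms(1,2)] assms(3)]
          tensor_elt_closed[OF assms(2) P.smult_closed[OF assms(1,3)]]])
qed

lemma tensor_elt_zero:
  assumes "p \<in> carrier P" shows "tensor_elt R M P \<zero>\<^bsub>M\<^esub> p = \<one>\<^bsub>tensor R M P\<^esub>"
  using tensor_elt_add_left[OF M.zero_closed M.zero_closed assms] tensor_elt_closed[OF M.zero_closed assms]
  by (simp add: T.l_cancel_one')

lemma tensor_generated:
  assumes S: "subgroup S (tensor R M P)"
    and elt: "\<And>m p. \<lbrakk>m \<in> carrier M; p \<in> carrier P\<rbrakk> \<Longrightarrow> tensor_elt R M P m p \<in> S"
  shows "carrier (tensor R M P) \<subseteq> S"
proof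
  fix X assume "X \<in> carrier (tensor R M P)"
  then obtain c where c: "c \<in> carrier F" "X = N #>\<^bsub>F\<^esub> c" unfolding coset_carrier by blast
  from c(1) have k: "Poly_Mapping.keys c \<subseteq> carrier M \<times> carrier P" by simp
  have "N #>\<^bsub>F\<^esub> c \<in> S"
  proof (rule free_Abelian_group_induct[OF k])
    have "N #>\<^bsub>F\<^esub> 0 = \<one>\<^bsub>tensor R M P\<^esub>"
      by (rule coset_one) (use subgroup.one_closed[OF null_subgroup] in simp)
    then show "N #>\<^bsub>F\<^esub> 0 \<in> S" using subgroup.one_closed[OF S] by simp
  next
    fix x y assume "Poly_Mapping.keys x \<subseteq> carrier M \<times> carrier P" "Poly_Mapping.keys y \<subseteq> carrier M \<times> carrier P"
      and S': "N #>\<^bsub>F\<^esub> x \<in> S" "N #>\<^bsub>F\<^esub> y \<in> S"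
    then have "N #>\<^bsub>F\<^esub> (x - y) = (N #>\<^bsub>F\<^esub> x) \<otimes>\<^bsub>tensor R M P\<^esub> inv\<^bsub>tensor R M P\<^esub> (N #>\<^bsub>F\<^esub> y)"
      by (intro coset_diff) simp_all
    then show "N #>\<^bsub>F\<^esub> (x - y) \<in> S"
      using subgroup.m_closed[OF S S'(1) subgroup.m_inv_closed[OF S S'(2)]] by simp
  next
    fix a assume "a \<in> carrier M \<times> carrier P"
    then show "N #>\<^bsub>F\<^esub> frag_of a \<in> S" using elt[of "fst a" "snd a"] by (auto simp: tensor_elt_def)
  qed
  then show "X \<in> S" using c by simp
qed

text \<open>The universal property: all relations lie in the kernel of the extension of
  \<open>\<beta>\<close> to the free abelian group. The extension is thus constant on cosets, and
  \<open>the_elem\<close> picks that constant.\<close>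

lemma tensor_lift_elt:
  assumes A: "comm_group A" and \<beta>: "\<And>m p. \<lbrakk>m \<in> carrier M; p \<in> carrier P\<rbrakk> \<Longrightarrow> \<beta> m p \<in> carrier A"
    and add1: "\<And>m m' p. \<lbrakk>m \<in> carrier M; m' \<in> carrier M; p \<in> carrier P\<rbrakk> \<Longrightarrow> \<beta> (m \<oplus>\<^bsub>M\<^esub> m') p = \<beta> m p \<otimes>\<^bsub>A\<^esub> \<beta> m' p"
    and add2: "\<And>m p p'. \<lbrakk>m \<in> carrier M; p \<in> carrier P; p' \<in> carrier P\<rbrakk> \<Longrightarrow> \<beta> m (p \<oplus>\<^bsub>P\<^esub> p') = \<beta> m p \<otimes>\<^bsub>A\<^esub> \<beta> m p'"
    and bal: "\<And>r m p. \<lbrakk>r \<in> carrier R; m \<in> carrier M; p \<in> carrier P\<rbrakk> \<Longrightarrow> \<beta> (r \<odot>\<^bsub>M\<^esub> m) p = \<beta> m (r \<odot>\<^bsub>P\<^esub> p)"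
  shows "tensor_lift A \<beta> \<in> hom (tensor R M P) A"
    and "\<lbrakk>m \<in> carrier M; p \<in> carrier P\<rbrakk> \<Longrightarrow> tensor_lift A \<beta> (tensor_elt R M P m p) = \<beta> m p"
proof -
  interpret A: comm_group A by (rule A)
  let ?\<beta> = "\<lambda>k. \<beta> (fst k) (snd k)"
  let ?E = "frag_eval A ?\<beta>"
  have \<beta>': "\<And>k. k \<in> carrier M \<times> carrier P \<Longrightarrow> ?\<beta> k \<in> carrier A" using \<beta> by auto
  have E: "?E \<in> hom F A" by (rule A.frag_eval_hom[OF \<beta>'])
  interpret E: group_hom F A ?E
    by (intro group_hom.intro group_hom_axioms.intro E F.is_group A.is_group)
  have E_of: "?E (frag_of (m, p)) = \<beta> m p" if "m \<in> carrier M" "p \<in> carrier P" for m p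
    using A.frag_eval_frag_of[of ?\<beta> "(m, p)"] \<beta> that by simp
  have E_diff: "?E (x - y) = ?E x \<otimes>\<^bsub>A\<^esub> inv\<^bsub>A\<^esub> ?E y" if "x \<in> carrier F" "y \<in> carrier F" for x y
    using F_diff[OF that] that by (simp only: E.hom_mult F.inv_closed E.hom_inv)
  have ker: "subgroup (kernel F A ?E) F" by (rule E.subgroup_kernel)
  have "tensor_rels R M P \<subseteq> kernel F A ?E"
  proof
    fix x assume x: "x \<in> tensor_rels R M P"
    then have xF: "x \<in> carrier F" using rels_subset by blast
    from x consider m m' p where "x = frag_of (m \<oplus>\<^bsub>M\<^esub> m', p) - frag_of (m, p) - frag_of (m', p)"
        "m \<in> carrier M" "m' \<in> carrier M" "p \<in> carrier P"
      | m p p' where "x = frag_of (m, p \<oplus>\<^bsub>P\<^esub> p') - frag_of (m, p) - frag_of (m, p')"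
        "m \<in> carrier M" "p \<in> carrier P" "p' \<in> carrier P"
      | r m p where "x = frag_of (r \<odot>\<^bsub>M\<^esub> m, p) - frag_of (m, r \<odot>\<^bsub>P\<^esub> p)"
        "r \<in> carrier R" "m \<in> carrier M" "p \<in> carrier P"
      unfolding tensor_rels_def by blast
    then have "?E x = \<one>\<^bsub>A\<^esub>"
    proof cases
      case 1
      note in1 = frag_of_in[OF 1(2,4)] and in2 = frag_of_in[OF 1(3,4)]
        and in3 = frag_of_in[OF M.a_closed[OF 1(2,3)] 1(4)]
      have "?E x = \<beta> (m \<oplus>\<^bsub>M\<^esub> m') p \<otimes>\<^bsub>A\<^esub> inv\<^bsub>A\<^esub> \<beta> m p \<otimes>\<^bsub>A\<^esub> inv\<^bsub>A\<^esub> \<beta> m' p"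
        unfolding 1(1) using E_diff[OF conjunct1[OF F_diff[OF in3 in1]] in2] E_diff[OF in3 in1] 1
        by (simp only: E_of M.a_closed)
      also have "\<beta> (m \<oplus>\<^bsub>M\<^esub> m') p = \<beta> m' p \<otimes>\<^bsub>A\<^esub> \<beta> m p" using 1 add1 \<beta> by (simp add: A.m_comm)
      finally show ?thesis using 1 \<beta> by (simp add: A.m_assoc)
    next
      case 2
      note in1 = frag_of_in[OF 2(2,3)] and in2 = frag_of_in[OF 2(2,4)]
        and in3 = frag_of_in[OF 2(2) P.a_closed[OF 2(3,4)]]
      have "?E x = \<beta> m (p \<oplus>\<^bsub>P\<^esub> p') \<otimes>\<^bsub>A\<^esub> inv\<^bsub>A\<^esub> \<beta> m p \<otimes>\<^bsub>A\<^esub> inv\<^bsub>A\<^esub> \<beta> m p'"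
        unfolding 2(1) using E_diff[OF conjunct1[OF F_diff[OF in3 in1]] in2] E_diff[OF in3 in1] 2
        by (simp only: E_of P.a_closed)
      also have "\<beta> m (p \<oplus>\<^bsub>P\<^esub> p') = \<beta> m p' \<otimes>\<^bsub>A\<^esub> \<beta> m p" using 2 add2 \<beta> by (simp add: A.m_comm)
      finally show ?thesis using 2 \<beta> by (simp add: A.m_assoc)
    next
      case 3
      note in1 = frag_of_in[OF M_smult[OF 3(2,3)] 3(4)] and in2 = frag_of_in[OF 3(3) P.smult_closed[OF 3(2,4)]]
      have "?E x = \<beta> (r \<odot>\<^bsub>M\<^esub> m) p \<otimes>\<^bsub>A\<^esub> inv\<^bsub>A\<^esub> \<beta> m (r \<odot>\<^bsub>P\<^esub> p)"
        unfolding 3(1) using E_diff[OF in1 in2] 3 by (simp only: E_of M_smult P.smult_closed)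
      then show ?thesis using 3 bal \<beta> P.smult_closed by simp
    qed
    then show "x \<in> kernel F A ?E" using xF by (simp add: kernel_def del: carrier_free_Abelian_group_iff)
  qed
  then have null: "N \<subseteq> kernel F A ?E"
    unfolding tensor_null_def by (rule F.generate_subgroup_incl[OF _ ker])
  have lift: "tensor_lift A \<beta> (N #>\<^bsub>F\<^esub> c) = ?E c" if c: "c \<in> carrier F" for c
  proof -
    have "?E ` (N #>\<^bsub>F\<^esub> c) = {?E c}"
    proof -
      have "?E x = ?E c" if xc: "x \<in> N #>\<^bsub>F\<^esub> c" for x
      proof -
        obtain z where "z \<in> N" "x = z \<otimes>\<^bsub>F\<^esub> c" using xc unfolding r_coset_def by blast
        moreover have "z \<in> carrier F" "?E z = \<one>\<^bsub>A\<^esub>" using null \<open>z \<in> N\<close> unfolding kernel_def by blast+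
        ultimately show ?thesis using c by (simp only: E.hom_mult E.hom_closed A.l_one)
      qed
      moreover have "c \<in> N #>\<^bsub>F\<^esub> c" by (rule F.rcos_self[OF c null_subgroup])
      ultimately show ?thesis by blast
    qed
    then show ?thesis by (simp add: tensor_lift_def frag_eval_def[abs_def])
  qed
  show "tensor_lift A \<beta> \<in> hom (tensor R M P) A"
  proof (rule homI)
    fix X assume "X \<in> carrier (tensor R M P)"
    then obtain c where c: "c \<in> carrier F" "X = N #>\<^bsub>F\<^esub> c" unfolding coset_carrier by blast
    then show "tensor_lift A \<beta> X \<in> carrier A" using lift[OF c(1)] E.hom_closed[OF c(1)] by simp
    fix Y assume "Y \<in> carrier (tensor R M P)"
    then obtain e where e: "e \<in> carrier F" "Y = N #>\<^bsub>F\<^esub> e" unfolding coset_carrier by blast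
    have "X \<otimes>\<^bsub>tensor R M P\<^esub> Y = N #>\<^bsub>F\<^esub> (c \<otimes>\<^bsub>F\<^esub> e)"
      using hom_mult[OF coset_hom c(1) e(1)] c e by simp
    then show "tensor_lift A \<beta> (X \<otimes>\<^bsub>tensor R M P\<^esub> Y) = tensor_lift A \<beta> X \<otimes>\<^bsub>A\<^esub> tensor_lift A \<beta> Y"
      using lift[OF F.m_closed[OF c(1) e(1)]] lift[OF c(1)] lift[OF e(1)] c(2) e(2) E.hom_mult[OF c(1) e(1)] by simp
  qed
  show "tensor_lift A \<beta> (tensor_elt R M P m p) = \<beta> m p" if "m \<in> carrier M" "p \<in> carrier P"
    unfolding tensor_elt_def using lift[OF frag_of_in[OF that]] E_of[OF that] by simp
qed

end

section \<open>Tensoring with the functions on the base space\<close>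

context ample_groupoid
begin

abbreviation "ind K \<equiv> (\<lambda>x. if x \<in> K then 1 else 0 :: int)"

abbreviation "src_push \<equiv> pushforward (gtop G) (gsrc G)"

lemma unit_right_module_simps:
  "carrier (unit_right_module G) = cc_funs (unit_top G)"
  "\<zero>\<^bsub>unit_right_module G\<^esub> = (\<lambda>y. 0)"
  "add (unit_right_module G) = (\<lambda>a b y. a y + b y)"
  by (simp_all add: unit_right_module_def)

lemma abelian_group_unit_right_module: "abelian_group (unit_right_module G)"
  by (rule abelian_group_cc[OF unit_right_module_simps])

lemma cc_unit_zero: "\<lbrakk>a \<in> cc_funs (unit_top G); g \<notin> units G\<rbrakk> \<Longrightarrow> a g = 0"
  using cc_funsD(2)[of a "unit_top G"] by (simp add: unit_topspace)

text \<open>The right action is multiplication in the ring followed by push-forward along the source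
  map, which exhibits the right module as the ring modulo \<open>aug_ideal\<close>.\<close>

lemma unit_right_module_smult:
  assumes f: "f \<in> cc_funs (gtop G)" and a: "a \<in> cc_funs (unit_top G)"
  shows "f \<odot>\<^bsub>unit_right_module G\<^esub> a = src_push (arrow.conv a f)"
proof
  fix x
  have "(\<Sum>g | g \<in> arrows G \<and> gsrc G g = x \<and> f g \<noteq> 0. a (grng G g) * f g) =
    fsum {g \<in> arrows G. gsrc G g = x} (\<lambda>g. a (grng G g) * f g)"
    by (rule fsum_eq_sum[symmetric]) (use fibre_finite(2)[OF f] in auto)
  also have "\<dots> = src_push (arrow.conv a f) x"
    unfolding pushforward_fsum
    by (rule fsum_cong) (auto simp: arrows_topspace arrow.conv_units[OF cc_unit_zero[OF a]])
  finally show "(f \<odot>\<^bsub>unit_right_module G\<^esub> a) x = src_push (arrow.conv a f) x"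
    by (simp add: unit_right_module_def)
qed

lemma src_push_cc: "f \<in> cc_funs (gtop G) \<Longrightarrow> src_push f \<in> cc_funs (unit_top G)"
  by (rule pushforward_cc[OF etale_src ample_gtop ample_unit_top])

lemma src_push_unit:
  assumes a: "a \<in> cc_funs (unit_top G)" shows "src_push a = a"
proof
  fix x
  show "src_push a x = a x"
  proof (cases "x \<in> units G")
    case True
    show ?thesis unfolding pushforward_fsum
    proof (rule fsum_single)
      show "x \<in> {g \<in> topspace (gtop G). gsrc G g = x}" using True by (simp add: arrows_topspace units_arrows src_unit)
      fix g assume "g \<in> {g \<in> topspace (gtop G). gsrc G g = x}" "g \<noteq> x"
      then have "g \<notin> units G" using src_unit[of g] by auto
      then show "a g = 0" by (rule cc_unit_zero[OF a])
    qed
  next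
    case False
    then have "{g \<in> topspace (gtop G). gsrc G g = x} = {}" using src_in_units by (auto simp: arrows_topspace)
    then show ?thesis using cc_unit_zero[OF a False] by (simp only: pushforward_fsum fsum_empty)
  qed
qed

lemma arrow_conv_unit_unit:
  assumes a: "a \<in> cc_funs (unit_top G)" and c: "c \<in> cc_funs (unit_top G)"
  shows "arrow.conv a c = (\<lambda>x. a x * c x)"
proof
  fix g
  have conv: "arrow.conv a c g = a (grng G g) * c g" if "g \<in> arrows G"
    by (rule arrow.conv_units) (use that cc_unit_zero[OF a] in \<open>simp_all add: arrows_topspace\<close>)
  show "arrow.conv a c g = a g * c g"
  proof (cases "g \<in> units G")
    case True
    then show ?thesis using conv units_arrows rng_unit by simp
  next
    case False
    then have "c g = 0" by (rule cc_unit_zero[OF c])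
    then show ?thesis using conv by (cases "g \<in> arrows G") (simp_all add: arrows_topspace arrow.conv_def)
  qed
qed

text \<open>\<open>src_push\<close> fixes the functions on the units, so it is an idempotent with
  kernel \<open>aug_ideal\<close>: every ring element is congruent to a function on the
  units.\<close>

lemma src_push_diff_aug_ideal:
  assumes f: "f \<in> cc_funs (gtop G)"
  shows "(\<lambda>g. src_push f g - f g) \<in> aug_ideal"
proof -
  have s: "src_push f \<in> cc_funs (gtop G)" by (rule cc_units_subset[OF src_push_cc[OF f]])
  have "(\<lambda>g. src_push f g - f g) = (\<lambda>g. src_push f g + - f g)" by simp
  then have "src_push (\<lambda>g. src_push f g - f g) = (\<lambda>x. src_push (src_push f) x - src_push f x)"
    using pushforward_add[OF etale_src s cc_uminus[OF f]] by (simp add: pushforward_uminus)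
  also have "\<dots> = (\<lambda>x. 0)" by (simp add: src_push_unit[OF src_push_cc[OF f]])
  finally show ?thesis using cc_diff[OF s f] by (simp add: aug_ideal_def)
qed

end

locale groupoid_module = ample_groupoid +
  fixes P :: "('a \<Rightarrow> int, 'p) module"
  assumes P_lmod: "lmod (conv_ring G) P"
begin

sublocale tensor_product "conv_ring G" "unit_right_module G" P
proof (intro tensor_product.intro abelian_group_unit_right_module P_lmod)
  show "r \<odot>\<^bsub>unit_right_module G\<^esub> m \<in> carrier (unit_right_module G)"
    if "r \<in> carrier R" "m \<in> carrier (unit_right_module G)" for r m
    using that by (simp add: unit_right_module_simps conv_ring_simps unit_right_module_smult src_push_cc
        arrow.conv_closed cc_units_subset)
qed

text \<open>Such a set of units replaces the identity of the ring as far as \<open>p\<close> is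
  concerned.\<close>

definition good :: "'a set \<Rightarrow> 'p \<Rightarrow> bool" where
  "good K p \<longleftrightarrow> openin (unit_top G) K \<and> compactin (unit_top G) K \<and> ind K \<odot>\<^bsub>P\<^esub> p = p"

text \<open>Plays the part of \<open>1 \<otimes> p\<close>. Every admissible \<open>K\<close> gives
  the same tensor, by \<open>unit_tensor_eq\<close>.\<close>

definition unit_tensor :: "'p \<Rightarrow> (('a \<Rightarrow> int) \<times> 'p \<Rightarrow>\<^sub>0 int) set" where
  "unit_tensor p = tensor_elt R (unit_right_module G) P (ind (SOME K. good K p)) p"

lemma ind_cc: "\<lbrakk>openin (unit_top G) K; compactin (unit_top G) K\<rbrakk> \<Longrightarrow> ind K \<in> cc_funs (unit_top G)"
  by (rule cc_indicator[OF ample_unit_top])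

lemma smult_R: "\<lbrakk>a \<in> cc_funs (gtop G); f \<in> cc_funs (gtop G); p \<in> carrier P\<rbrakk>
    \<Longrightarrow> a \<odot>\<^bsub>P\<^esub> (f \<odot>\<^bsub>P\<^esub> p) = arrow.conv a f \<odot>\<^bsub>P\<^esub> p"
  using P.smult_assoc[of a f p] by (simp add: conv_ring_simps conv_ring_mult)

lemma smult_in: "\<lbrakk>f \<in> cc_funs (gtop G); p \<in> carrier P\<rbrakk> \<Longrightarrow> f \<odot>\<^bsub>P\<^esub> p \<in> carrier P"
  using P.smult_closed[of f p] by (simp add: conv_ring_simps)

lemma good_ind: "good K p \<Longrightarrow> ind K \<in> cc_funs (unit_top G)"
  by (simp add: good_def ind_cc)

lemma good_mono:
  assumes "good K p" "p \<in> carrier P" "openin (unit_top G) K'" "compactin (unit_top G) K'" "K \<subseteq> K'"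
  shows "good K' p"
proof -
  have K: "ind K \<in> cc_funs (unit_top G)" "ind K' \<in> cc_funs (unit_top G)" "ind K \<odot>\<^bsub>P\<^esub> p = p"
    using assms by (simp_all add: good_def ind_cc)
  have "ind K' \<odot>\<^bsub>P\<^esub> (ind K \<odot>\<^bsub>P\<^esub> p) = (\<lambda>x. ind K' x * ind K x) \<odot>\<^bsub>P\<^esub> p"
    by (simp only: smult_R[OF cc_units_subset[OF K(2)] cc_units_subset[OF K(1)] assms(2)] arrow_conv_unit_unit[OF K(2,1)])
  also have "(\<lambda>x. ind K' x * ind K x) = ind K" using assms(5) by (auto simp: fun_eq_iff)
  finally have "ind K' \<odot>\<^bsub>P\<^esub> p = p" unfolding K(3) .
  then show ?thesis using assms by (simp add: good_def)
qed

lemma good_smult: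
  assumes f: "f \<in> cc_funs (gtop G)" and p: "p \<in> carrier P"
  shows "\<exists>K. good K (f \<odot>\<^bsub>P\<^esub> p) \<and> arrow.conv (ind K) f = f"
proof -
  from arrow.unit_for_compact[OF cc_funsD(4)[OF f]] obtain K where
    K: "openin (unit_top G) K \<and> compactin (unit_top G) K \<and> grng G ` {g \<in> topspace (gtop G). f g \<noteq> 0} \<subseteq> K" ..
  have "K \<subseteq> units G" using K openin_subset[of "unit_top G" K] by (simp add: unit_topspace)
  then have c: "arrow.conv (ind K) f = f" using K by (intro arrow.conv_local_unit[OF _ f]) simp_all
  have "ind K \<odot>\<^bsub>P\<^esub> (f \<odot>\<^bsub>P\<^esub> p) = f \<odot>\<^bsub>P\<^esub> p"
    using K by (simp only: smult_R[OF cc_units_subset[OF ind_cc] f p] c)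
  then show ?thesis using K c unfolding good_def by blast
qed

lemma ex_good: assumes p: "p \<in> carrier P" shows "\<exists>K. good K p"
proof -
  obtain e where "e \<in> carrier R" "e \<odot>\<^bsub>P\<^esub> p = p" using conv_ring.left_unit[OF P_lmod p] by blast
  then show ?thesis using good_smult[of e p] p by (auto simp: conv_ring_simps)
qed

lemma good_Un:
  assumes "good K p" "p \<in> carrier P" "good K' q" "q \<in> carrier P"
  shows "good (K \<union> K') p" "good (K \<union> K') q"
proof -
  have "openin (unit_top G) (K \<union> K')" "compactin (unit_top G) (K \<union> K')"
    using assms by (auto simp: good_def intro: compactin_Un)
  then show "good (K \<union> K') p" "good (K \<union> K') q" using assms good_mono by blast+
qed

lemma tensor_move:
  assumes f: "f \<in> cc_funs (gtop G)" and a: "a \<in> cc_funs (unit_top G)" and p: "p \<in> carrier P"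
  shows "tensor_elt R (unit_right_module G) P a (f \<odot>\<^bsub>P\<^esub> p) =
    tensor_elt R (unit_right_module G) P (src_push (arrow.conv a f)) p"
  using tensor_elt_balanced[of f a p] assms
  by (simp add: conv_ring_simps unit_right_module_simps unit_right_module_smult)

text \<open>Write \<open>p\<close> as \<open>ind K\<close> times \<open>p\<close> and move
  \<open>ind K\<close> across the tensor sign.\<close>

lemma tensor_good_mono:
  assumes K: "good K p" and p: "p \<in> carrier P" and K': "openin (unit_top G) K'" "compactin (unit_top G) K'" "K \<subseteq> K'"
  shows "tensor_elt R (unit_right_module G) P (ind K') p = tensor_elt R (unit_right_module G) P (ind K) p"
proof -
  have i: "ind K \<in> cc_funs (unit_top G)" "ind K' \<in> cc_funs (unit_top G)" using K K' by (simp_all add: good_def ind_cc)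
  have "tensor_elt R (unit_right_module G) P (ind K') p = tensor_elt R (unit_right_module G) P (ind K') (ind K \<odot>\<^bsub>P\<^esub> p)"
    using K by (simp add: good_def)
  also have "\<dots> = tensor_elt R (unit_right_module G) P (src_push (\<lambda>x. ind K' x * ind K x)) p"
    using tensor_move[OF cc_units_subset[OF i(1)] i(2) p] by (simp only: arrow_conv_unit_unit[OF i(2,1)])
  also have "(\<lambda>x. ind K' x * ind K x) = ind K" using K'(3) by (auto simp: fun_eq_iff)
  finally show ?thesis by (simp only: src_push_unit[OF i(1)])
qed

lemma unit_tensor_eq:
  assumes K: "good K p" and p: "p \<in> carrier P"
  shows "unit_tensor p = tensor_elt R (unit_right_module G) P (ind K) p"
proof -
  define K' where "K' = (SOME K. good K p)"
  have K': "good K' p" unfolding K'_def by (rule someI[of "\<lambda>K. good K p", OF K])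
  have U: "openin (unit_top G) (K \<union> K')" "compactin (unit_top G) (K \<union> K')"
    using K K' by (auto simp: good_def intro: compactin_Un)
  show ?thesis
    unfolding unit_tensor_def K'_def[symmetric]
    using tensor_good_mono[OF K p U] tensor_good_mono[OF K' p U] by simp
qed

lemma unit_tensor_closed: "p \<in> carrier P \<Longrightarrow> unit_tensor p \<in> carrier (tensor R (unit_right_module G) P)"
proof -
  assume p: "p \<in> carrier P"
  obtain K where K: "good K p" using ex_good[OF p] ..
  show ?thesis
    unfolding unit_tensor_eq[OF K p]
    by (rule tensor_elt_closed) (use p good_ind[OF K] in \<open>simp_all add: unit_right_module_simps\<close>)
qed

lemma unit_tensor_add:
  assumes p: "p \<in> carrier P" and q: "q \<in> carrier P"
  shows "unit_tensor (p \<oplus>\<^bsub>P\<^esub> q) = unit_tensor p \<otimes>\<^bsub>tensor R (unit_right_module G) P\<^esub> unit_tensor q"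
proof -
  obtain K K' where "good K p" "good K' q" using ex_good p q by blast
  from good_Un[OF this(1) p this(2) q] have g: "good (K \<union> K') p" "good (K \<union> K') q" .
  have i: "ind (K \<union> K') \<in> cc_funs (unit_top G)" by (rule good_ind[OF g(1)])
  have "good (K \<union> K') (p \<oplus>\<^bsub>P\<^esub> q)"
    using g p q P.smult_r_distr[of "ind (K \<union> K')" p q] cc_units_subset[OF i] by (simp add: good_def conv_ring_simps)
  then show ?thesis
    using unit_tensor_eq[OF g(1) p] unit_tensor_eq[OF g(2) q] unit_tensor_eq[of _ "p \<oplus>\<^bsub>P\<^esub> q"] p q i
      tensor_elt_add_right[of "ind (K \<union> K')" p q] by (simp add: unit_right_module_simps)
qed

lemma unit_tensor_hom: "unit_tensor \<in> hom (add_monoid P) (tensor R (unit_right_module G) P)"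
  by (rule homI) (simp_all add: unit_tensor_closed unit_tensor_add)

text \<open>With \<open>K\<close> large enough that \<open>ind K\<close> is a left unit of
  \<open>a\<close>, moving \<open>a\<close> across turns \<open>ind K \<otimes> a p\<close> into
  \<open>a \<otimes> p\<close>. So every elementary tensor is a value of \<open>unit_tensor\<close>,
  which gives surjectivity.\<close>

lemma tensor_elt_unit_tensor:
  assumes a: "a \<in> cc_funs (unit_top G)" and p: "p \<in> carrier P"
  shows "tensor_elt R (unit_right_module G) P a p = unit_tensor (a \<odot>\<^bsub>P\<^esub> p)"
proof -
  have a': "a \<in> cc_funs (gtop G)" by (rule cc_units_subset[OF a])
  obtain K where K: "good K (a \<odot>\<^bsub>P\<^esub> p)" "arrow.conv (ind K) a = a" using good_smult[OF a' p] by blast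
  show ?thesis
    using unit_tensor_eq[OF K(1) smult_in[OF a' p]] tensor_move[OF a' good_ind[OF K(1)] p] K(2)
    by (simp add: src_push_unit[OF a])
qed

lemma unit_tensor_onto: "unit_tensor ` carrier P = carrier (tensor R (unit_right_module G) P)"
proof
  show "unit_tensor ` carrier P \<subseteq> carrier (tensor R (unit_right_module G) P)" using unit_tensor_closed by blast
  interpret h: group_hom "add_monoid P" "tensor R (unit_right_module G) P" unit_tensor
    by (intro group_hom.intro group_hom_axioms.intro unit_tensor_hom P.a_group T.is_group)
  have "subgroup (unit_tensor ` carrier P) (tensor R (unit_right_module G) P)" using h.img_is_subgroup by simp
  then show "carrier (tensor R (unit_right_module G) P) \<subseteq> unit_tensor ` carrier P"
  proof (rule tensor_generated)
    fix a p assume "a \<in> carrier (unit_right_module G)" "p \<in> carrier P"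
    then show "tensor_elt R (unit_right_module G) P a p \<in> unit_tensor ` carrier P"
      using tensor_elt_unit_tensor[of a p] smult_in[of a p] cc_units_subset by (auto simp: unit_right_module_simps)
  qed
qed

text \<open>For suitable \<open>K\<close>, moving \<open>j\<close> across turns
  \<open>ind K \<otimes> j p\<close> into \<open>src_push j \<otimes> p\<close>, and
  \<open>src_push j\<close> is zero.\<close>

lemma unit_tensor_ideal:
  assumes j: "j \<in> aug_ideal" and p: "p \<in> carrier P"
  shows "unit_tensor (j \<odot>\<^bsub>P\<^esub> p) = \<one>\<^bsub>tensor R (unit_right_module G) P\<^esub>"
proof -
  have j': "j \<in> cc_funs (gtop G)" "src_push j = (\<lambda>x. 0)" using j by (simp_all add: aug_ideal_def)
  obtain K where K: "good K (j \<odot>\<^bsub>P\<^esub> p)" "arrow.conv (ind K) j = j" using good_smult[OF j'(1) p] by blast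
  have "unit_tensor (j \<odot>\<^bsub>P\<^esub> p) = tensor_elt R (unit_right_module G) P (\<lambda>x. 0) p"
    using unit_tensor_eq[OF K(1) smult_in[OF j'(1) p]] tensor_move[OF j'(1) good_ind[OF K(1)] p] K(2) j'(2) by simp
  then show ?thesis using tensor_elt_zero[OF p] by (simp add: unit_right_module_simps)
qed

text \<open>Additive maps on \<open>P\<close> that kill the multiples by the ideal extend to the
  tensor product. The point is that \<open>\<beta>\<close> is balanced: with \<open>g\<close> the
  ring product of \<open>a\<close> and \<open>f\<close>, one side is \<open>\<psi>\<close> of
  \<open>src_push g\<close> times \<open>p\<close> and the other is \<open>\<psi>\<close> of
  \<open>g\<close> times \<open>p\<close>, and \<open>src_push g - g\<close> lies in the
  ideal.\<close>

lemma tensor_lift_unit_tensor: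
  assumes A: "comm_group A" and \<psi>: "\<psi> \<in> hom (add_monoid P) A"
    and ideal: "\<And>j p. \<lbrakk>j \<in> aug_ideal; p \<in> carrier P\<rbrakk> \<Longrightarrow> \<psi> (j \<odot>\<^bsub>P\<^esub> p) = \<one>\<^bsub>A\<^esub>"
    and \<beta>: "\<And>a p. \<lbrakk>a \<in> cc_funs (unit_top G); p \<in> carrier P\<rbrakk> \<Longrightarrow> \<beta> a p = \<psi> (a \<odot>\<^bsub>P\<^esub> p)"
  shows "tensor_lift A \<beta> \<in> hom (tensor R (unit_right_module G) P) A"
    and "p \<in> carrier P \<Longrightarrow> tensor_lift A \<beta> (unit_tensor p) = \<psi> p"
proof -
  interpret A: comm_group A by (rule A)
  interpret \<psi>: group_hom "add_monoid P" A \<psi>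
    by (intro group_hom.intro group_hom_axioms.intro \<psi> P.a_group A.is_group)
  have in_R: "a \<in> carrier R" if "a \<in> cc_funs (unit_top G)" for a using cc_units_subset[OF that] by (simp add: conv_ring_simps)
  have closed: "\<beta> a p \<in> carrier A" if "a \<in> carrier (unit_right_module G)" "p \<in> carrier P" for a p
    using that \<psi>.hom_closed P.smult_closed[OF in_R, of a p] by (simp add: unit_right_module_simps \<beta>)
  have add1: "\<beta> (a \<oplus>\<^bsub>unit_right_module G\<^esub> a') p = \<beta> a p \<otimes>\<^bsub>A\<^esub> \<beta> a' p"
    if "a \<in> carrier (unit_right_module G)" "a' \<in> carrier (unit_right_module G)" "p \<in> carrier P" for a a' p
  proof -
    have a: "a \<in> cc_funs (unit_top G)" "a' \<in> cc_funs (unit_top G)" using that by (simp_all add: unit_right_module_simps)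
    have "(\<lambda>y. a y + a' y) \<odot>\<^bsub>P\<^esub> p = a \<odot>\<^bsub>P\<^esub> p \<oplus>\<^bsub>P\<^esub> a' \<odot>\<^bsub>P\<^esub> p"
      using P.smult_l_distr[OF in_R[OF a(1)] in_R[OF a(2)] that(3)] by (simp add: conv_ring_simps)
    then show ?thesis
      using \<psi>.hom_mult[of "a \<odot>\<^bsub>P\<^esub> p" "a' \<odot>\<^bsub>P\<^esub> p"] P.smult_closed[OF in_R _ ] a that
      by (simp add: unit_right_module_simps \<beta> cc_add)
  qed
  have add2: "\<beta> a (p \<oplus>\<^bsub>P\<^esub> p') = \<beta> a p \<otimes>\<^bsub>A\<^esub> \<beta> a p'"
    if "a \<in> carrier (unit_right_module G)" "p \<in> carrier P" "p' \<in> carrier P" for a p p'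
  proof -
    have a: "a \<in> cc_funs (unit_top G)" using that by (simp add: unit_right_module_simps)
    show ?thesis
      using \<psi>.hom_mult[of "a \<odot>\<^bsub>P\<^esub> p" "a \<odot>\<^bsub>P\<^esub> p'"] P.smult_closed[OF in_R[OF a]] P.smult_r_distr[OF in_R[OF a]] a that
      by (simp add: \<beta>)
  qed
  have bal: "\<beta> (f \<odot>\<^bsub>unit_right_module G\<^esub> a) p = \<beta> a (f \<odot>\<^bsub>P\<^esub> p)"
    if "f \<in> carrier R" "a \<in> carrier (unit_right_module G)" "p \<in> carrier P" for f a p
  proof -
    have f: "f \<in> cc_funs (gtop G)" and a: "a \<in> cc_funs (unit_top G)"
      using that by (simp_all add: unit_right_module_simps conv_ring_simps)
    let ?g = "arrow.conv a f"
    have g: "?g \<in> cc_funs (gtop G)" by (rule arrow.conv_closed[OF cc_units_subset[OF a] f])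
    let ?j = "\<lambda>x. src_push ?g x - ?g x"
    have j: "?j \<in> aug_ideal" by (rule src_push_diff_aug_ideal[OF g])
    have jR: "?j \<in> carrier R" using j by (simp add: aug_ideal_def conv_ring_simps)
    have gR: "?g \<in> carrier R" using g by (simp add: conv_ring_simps)
    have "src_push ?g = (\<lambda>x. ?j x + ?g x)" by simp
    then have "src_push ?g \<odot>\<^bsub>P\<^esub> p = ?j \<odot>\<^bsub>P\<^esub> p \<oplus>\<^bsub>P\<^esub> ?g \<odot>\<^bsub>P\<^esub> p"
      using P.smult_l_distr[OF jR gR that(3)] by (simp add: conv_ring_simps)
    then have "\<psi> (src_push ?g \<odot>\<^bsub>P\<^esub> p) = \<psi> (?j \<odot>\<^bsub>P\<^esub> p) \<otimes>\<^bsub>A\<^esub> \<psi> (?g \<odot>\<^bsub>P\<^esub> p)"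
      using \<psi>.hom_mult[of "?j \<odot>\<^bsub>P\<^esub> p" "?g \<odot>\<^bsub>P\<^esub> p"] P.smult_closed[OF jR that(3)] P.smult_closed[OF gR that(3)] by simp
    also have "\<dots> = \<psi> (?g \<odot>\<^bsub>P\<^esub> p)" using ideal[OF j that(3)] \<psi>.hom_closed[of "?g \<odot>\<^bsub>P\<^esub> p"] P.smult_closed[OF gR that(3)] by simp
    finally have "\<psi> (src_push ?g \<odot>\<^bsub>P\<^esub> p) = \<psi> (a \<odot>\<^bsub>P\<^esub> (f \<odot>\<^bsub>P\<^esub> p))" by (simp only: smult_R[OF cc_units_subset[OF a] f that(3)])
    then show ?thesis
      using smult_in[OF f that(3)] that(3) by (simp add: unit_right_module_smult[OF f a] \<beta> a src_push_cc[OF g])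
  qed
  note lift = tensor_lift_elt[of A \<beta>, OF A closed add1 add2 bal]
  show "tensor_lift A \<beta> \<in> hom (tensor R (unit_right_module G) P) A" by (rule lift(1))
  assume p: "p \<in> carrier P"
  obtain K where K: "good K p" using ex_good[OF p] ..
  have "tensor_lift A \<beta> (unit_tensor p) = \<beta> (ind K) p"
    unfolding unit_tensor_eq[OF K p] by (rule lift(2)) (use p good_ind[OF K] in \<open>simp_all add: unit_right_module_simps\<close>)
  also have "\<dots> = \<psi> p" using K p good_ind[OF K] by (simp add: \<beta> good_def)
  finally show "tensor_lift A \<beta> (unit_tensor p) = \<psi> p" .
qed

text \<open>The projection of \<open>P\<close> onto \<open>P / J P\<close> extends to the tensor
  product by \<open>tensor_lift_unit_tensor\<close>, and this extension detects \<open>J P\<close>.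
  The converse is \<open>unit_tensor_ideal\<close>.\<close>

lemma unit_tensor_eq_one_iff:
  assumes p: "p \<in> carrier P"
  shows "unit_tensor p = \<one>\<^bsub>tensor R (unit_right_module G) P\<^esub> \<longleftrightarrow> p \<in> ideal_span aug_ideal P"
proof
  let ?J = "ideal_span aug_ideal P" and ?A = "add_monoid P"
  have sub: "subgroup ?J ?A" by (rule P.ideal_span_subgroup[OF aug_ideal_subset])
  have nor: "?J \<lhd> ?A" using P.add.normal_iff_subgroup sub by blast
  interpret A: comm_group "?A Mod ?J" by (rule comm_group.abelian_FactGroup[OF P.a_comm_group sub])
  assume one: "unit_tensor p = \<one>\<^bsub>tensor R (unit_right_module G) P\<^esub>"
  let ?\<psi> = "\<lambda>p. ?J #>\<^bsub>?A\<^esub> p"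
  let ?\<beta> = "\<lambda>a p. ?\<psi> (a \<odot>\<^bsub>P\<^esub> p)"
  have \<psi>: "?\<psi> \<in> hom ?A (?A Mod ?J)" by (rule normal.r_coset_hom_Mod[OF nor])
  have k: "?\<psi> (j \<odot>\<^bsub>P\<^esub> q) = \<one>\<^bsub>?A Mod ?J\<^esub>" if "j \<in> aug_ideal" "q \<in> carrier P" for j q
    using group.coset_join2[OF P.a_group _ sub ideal_span_gen[OF that]] P.ideal_spanD(1)[OF aug_ideal_subset ideal_span_gen[OF that]]
    by simp
  have "?\<psi> p = tensor_lift (?A Mod ?J) ?\<beta> (unit_tensor p)"
    by (rule tensor_lift_unit_tensor(2)[OF A.comm_group_axioms \<psi> k _ p, symmetric]) simp_all
  also have "\<dots> = \<one>\<^bsub>?A Mod ?J\<^esub>"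
    unfolding one by (rule hom_one[OF tensor_lift_unit_tensor(1)[OF A.comm_group_axioms \<psi> k] T.is_group A.is_group]) simp_all
  finally have "?J #>\<^bsub>?A\<^esub> p = ?J" by simp
  then show "p \<in> ?J" using group.coset_join1[OF P.a_group _ _ sub, of p] p P.ideal_spanD(1)[OF aug_ideal_subset] by auto
next
  assume "p \<in> ideal_span aug_ideal P"
  then have pg: "p \<in> generate (add_monoid P) {j \<odot>\<^bsub>P\<^esub> m | j m. j \<in> aug_ideal \<and> m \<in> carrier P}"
    by (simp add: ideal_span_def)
  interpret h: group_hom "add_monoid P" "tensor R (unit_right_module G) P" unit_tensor
    by (intro group_hom.intro group_hom_axioms.intro unit_tensor_hom P.a_group T.is_group)
  have "j \<odot>\<^bsub>P\<^esub> m \<in> kernel (add_monoid P) (tensor R (unit_right_module G) P) unit_tensor"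
    if "j \<in> aug_ideal" "m \<in> carrier P" for j m
    using unit_tensor_ideal[OF that] smult_in[of j m] that by (simp add: kernel_def aug_ideal_def)
  then have "{j \<odot>\<^bsub>P\<^esub> m | j m. j \<in> aug_ideal \<and> m \<in> carrier P} \<subseteq> kernel (add_monoid P) (tensor R (unit_right_module G) P) unit_tensor"
    by blast
  from subsetD[OF group.generate_subgroup_incl[OF P.a_group this h.subgroup_kernel] pg]
  show "unit_tensor p = \<one>\<^bsub>tensor R (unit_right_module G) P\<^esub>" by (simp add: kernel_def)
qed

end

section \<open>Comparing the two homologies\<close>

text \<open>The given map \<open>t\<close> runs from \<open>A\<close> to \<open>A'\<close>, while
  the isomorphism runs back, as the inverse of the map that \<open>t\<close> induces on the
  quotients. Surjectivity is asked only modulo \<open>B'\<close>.\<close>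

lemma quotient_iso:
  assumes A: "comm_group A" and A': "comm_group A'"
    and Z: "subgroup Z A" and B: "subgroup B A" and BZ: "B \<subseteq> Z"
    and Z': "subgroup Z' A'" and B': "subgroup B' A'" and BZ': "B' \<subseteq> Z'"
    and t: "t \<in> hom A A'" and tZ: "\<And>z. z \<in> Z \<Longrightarrow> t z \<in> Z'"
    and ker: "\<And>z. z \<in> Z \<Longrightarrow> t z \<in> B' \<longleftrightarrow> z \<in> B"
    and onto: "\<And>z'. z' \<in> Z' \<Longrightarrow> \<exists>z\<in>Z. \<exists>b\<in>B'. z' = b \<otimes>\<^bsub>A'\<^esub> t z"
  shows "\<exists>\<Phi>\<in>iso (A'\<lparr>carrier := Z'\<rparr> Mod B') (A\<lparr>carrier := Z\<rparr> Mod B). \<forall>z\<in>Z. \<Phi> (B' #>\<^bsub>A'\<^esub> t z) = B #>\<^bsub>A\<^esub> z"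
proof -
  interpret A: comm_group A by (rule A)
  interpret A': comm_group A' by (rule A')
  let ?AZ = "A\<lparr>carrier := Z\<rparr>" and ?AZ' = "A'\<lparr>carrier := Z'\<rparr>"
  interpret AZ: comm_group ?AZ
    by (rule group.group_comm_groupI[OF subgroup.subgroup_is_group[OF Z A.is_group]])
      (use subgroup.subset[OF Z] A.m_comm in auto)
  interpret AZ': comm_group ?AZ'
    by (rule group.group_comm_groupI[OF subgroup.subgroup_is_group[OF Z' A'.is_group]])
      (use subgroup.subset[OF Z'] A'.m_comm in auto)
  have BZs: "subgroup B ?AZ" by (rule A.subgroup_incl[OF B Z BZ])
  have BZs': "subgroup B' ?AZ'" by (rule A'.subgroup_incl[OF B' Z' BZ'])
  have nor: "B' \<lhd> ?AZ'" using AZ'.normal_iff_subgroup BZs' by blast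
  interpret Q': comm_group "?AZ' Mod B'" by (rule AZ'.abelian_FactGroup[OF BZs'])
  have cos: "B #>\<^bsub>?AZ\<^esub> x = B #>\<^bsub>A\<^esub> x" "B' #>\<^bsub>?AZ'\<^esub> y = B' #>\<^bsub>A'\<^esub> y" for x y
    by (simp_all add: r_coset_def)
  let ?h = "\<lambda>z. B' #>\<^bsub>?AZ'\<^esub> t z"
  have "t \<in> hom ?AZ ?AZ'"
    using hom_mult[OF t] subgroup.subset[OF Z] by (intro homI) (auto simp: tZ subset_iff)
  from hom_compose[OF this normal.r_coset_hom_Mod[OF nor]]
  have h: "?h \<in> hom ?AZ (?AZ' Mod B')" by (simp add: o_def)
  interpret h: group_hom ?AZ "?AZ' Mod B'" ?h
    by (intro group_hom.intro group_hom_axioms.intro h AZ.is_group Q'.is_group)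
  have kernel: "kernel ?AZ (?AZ' Mod B') ?h = B"
  proof -
    have "?h z = B' \<longleftrightarrow> t z \<in> B'" if "z \<in> Z" for z
      using AZ'.coset_join1[OF _ _ BZs', of "t z"] AZ'.coset_join2[OF _ BZs', of "t z"] tZ[OF that]
        subgroup.subset[OF BZs'] by auto
    then show ?thesis using ker BZ by (auto simp: kernel_def)
  qed
  have "?h ` carrier ?AZ = carrier (?AZ' Mod B')"
  proof
    show "?h ` carrier ?AZ \<subseteq> carrier (?AZ' Mod B')" using h.hom_closed by blast
    show "carrier (?AZ' Mod B') \<subseteq> ?h ` carrier ?AZ"
    proof
      fix X assume "X \<in> carrier (?AZ' Mod B')"
      then obtain z' where z': "z' \<in> Z'" "X = B' #>\<^bsub>?AZ'\<^esub> z'" by (auto simp: carrier_FactGroup)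
      then obtain z b where z: "z \<in> Z" "b \<in> B'" "z' = b \<otimes>\<^bsub>A'\<^esub> t z" using onto by blast
      then have "z' \<in> B' #>\<^bsub>?AZ'\<^esub> t z" by (auto simp: r_coset_def)
      then have "B' #>\<^bsub>?AZ'\<^esub> t z = B' #>\<^bsub>?AZ'\<^esub> z'"
        using AZ'.repr_independence[OF _ _ BZs', of z' "t z"] tZ[OF z(1)] by simp
      then show "X \<in> ?h ` carrier ?AZ" using z' z(1) by (simp add: image_iff) metis
    qed
  qed
  from h.FactGroup_iso_set[OF this]
  have f: "(\<lambda>X. the_elem (?h ` X)) \<in> iso (?AZ Mod B) (?AZ' Mod B')" by (simp only: kernel)
  let ?f = "\<lambda>X. the_elem (?h ` X)"
  let ?\<Phi> = "inv_into (carrier (?AZ Mod B)) ?f"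
  interpret Q: comm_group "?AZ Mod B" by (rule AZ.abelian_FactGroup[OF BZs])
  have iso: "?\<Phi> \<in> iso (?AZ' Mod B') (?AZ Mod B)" by (rule Q.iso_set_sym[OF f])
  have "?\<Phi> (B' #>\<^bsub>A'\<^esub> t z) = B #>\<^bsub>A\<^esub> z" if z: "z \<in> Z" for z
  proof -
    have X: "B #>\<^bsub>A\<^esub> z \<in> carrier (?AZ Mod B)" using z by (simp add: carrier_FactGroup cos)
    have "?h x = ?h z" if "x \<in> B #>\<^bsub>A\<^esub> z" for x
    proof -
      obtain b where b: "b \<in> B" "x = b \<otimes>\<^bsub>?AZ\<^esub> z" using \<open>x \<in> B #>\<^bsub>A\<^esub> z\<close> by (auto simp: r_coset_def)
      then have "?h x = ?h b \<otimes>\<^bsub>?AZ' Mod B'\<^esub> ?h z" using h.hom_mult[of b z] BZ z by auto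
      moreover have "?h b = \<one>\<^bsub>?AZ' Mod B'\<^esub>" using b(1) unfolding kernel[symmetric] kernel_def by blast
      moreover have "?h z \<in> carrier (?AZ' Mod B')" by (rule h.hom_closed) (use z in simp)
      ultimately show ?thesis by (simp only: Q'.l_one)
    qed
    moreover have "z \<in> B #>\<^bsub>A\<^esub> z" by (rule A.rcos_self[OF _ B]) (use z subgroup.subset[OF Z] in blast)
    ultimately have "?h ` (B #>\<^bsub>A\<^esub> z) = {?h z}" by blast
    then have "?f (B #>\<^bsub>A\<^esub> z) = B' #>\<^bsub>A'\<^esub> t z" by (simp add: cos)
    moreover have "inj_on ?f (carrier (?AZ Mod B))" using f by (simp add: iso_def bij_betw_def)
    ultimately show ?thesis using inv_into_f_f[OF _ X, of ?f] by simp
  qed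
  then show ?thesis using iso by blast
qed

lemma (in group) coset_absorb:
  assumes "subgroup H G" "b \<in> H" "y \<in> carrier G"
  shows "H #> (b \<otimes> y) = H #> y"
  using repr_independence[OF _ assms(3,1), of "b \<otimes> y"] assms(2) by (auto simp: r_coset_def)

locale resolved_groupoid = ample_groupoid +
  fixes P :: "nat \<Rightarrow> ('a \<Rightarrow> int, 'p) module" and d :: "nat \<Rightarrow> 'p \<Rightarrow> 'p" and \<epsilon> :: "'p \<Rightarrow> 'a \<Rightarrow> int"
  assumes resolution: "projective_resolution (conv_ring G) (unit_left_module G) P d \<epsilon>"
begin

sublocale res: resolution_pair "conv_ring G" aug_ideal "unit_left_module G" P d \<epsilon>
    "bar_module G" "bar_boundary G" "bar_augmentation G"
  by (rule bar_resolution_pair[OF resolution])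

sublocale gm: groupoid_module G "P n" for n
  by (intro groupoid_module.intro groupoid_module_axioms.intro ample_groupoid_axioms res.P_lmod)

abbreviation "Mr \<equiv> unit_right_module G"
abbreviation "TC \<equiv> tensor_complex R Mr P"
abbreviation "TB \<equiv> tensor_boundary R Mr P d"

lemma comparison_iff: "bar_comparison G P d \<epsilon> \<tau> \<longleftrightarrow> res.comparison \<tau>"
  by (simp only: bar_comparison_def res.comparison_def)

lemma TC_carrier: "carrier (TC n) = gm.unit_tensor n ` carrier (P n)"
  by (simp only: tensor_complex_def gm.unit_tensor_onto)

lemma TC_comm_group: "comm_group (TC n)"
  unfolding tensor_complex_def by (rule gm.tensor_comm_group)

lemma unit_tensor_hom: "gm.unit_tensor n \<in> hom (add_monoid (P n)) (TC n)"
  unfolding tensor_complex_def by (rule gm.unit_tensor_hom)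

lemma unit_tensor_eq_one_iff:
  "p \<in> carrier (P n) \<Longrightarrow> gm.unit_tensor n p = \<one>\<^bsub>TC n\<^esub> \<longleftrightarrow> p \<in> ideal_span aug_ideal (P n)"
  unfolding tensor_complex_def by (rule gm.unit_tensor_eq_one_iff)

lemma unit_R: "a \<in> cc_funs (unit_top G) \<Longrightarrow> a \<in> carrier R"
  by (simp add: conv_ring_simps cc_units_subset)

text \<open>By \<open>tensor_elt_unit_tensor\<close> the boundary of the tensor complex has the form
  to which \<open>tensor_lift_unit_tensor\<close> applies, with \<open>\<psi>\<close> the composite
  of \<open>d\<close> and \<open>unit_tensor\<close>.\<close>

lemma TB_Suc:
  shows "TB (Suc n) \<in> hom (TC (Suc n)) (TC n)"
    and "p \<in> carrier (P (Suc n)) \<Longrightarrow> TB (Suc n) (gm.unit_tensor (Suc n) p) = gm.unit_tensor n (d (Suc n) p)"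
proof -
  let ?\<psi> = "\<lambda>p. gm.unit_tensor n (d (Suc n) p)"
  have dh: "d (Suc n) \<in> hom (add_monoid (P (Suc n))) (add_monoid (P n))"
    using res.d_in by (intro homI) simp_all
  have \<psi>: "?\<psi> \<in> hom (add_monoid (P (Suc n))) (TC n)"
    using hom_compose[OF dh unit_tensor_hom] by (simp add: o_def)
  have ideal: "?\<psi> (j \<odot>\<^bsub>P (Suc n)\<^esub> p) = \<one>\<^bsub>TC n\<^esub>" if "j \<in> aug_ideal" "p \<in> carrier (P (Suc n))" for j p
  proof -
    have j: "j \<in> carrier R" using that(1) aug_ideal_subset by blast
    have "d (Suc n) (j \<odot>\<^bsub>P (Suc n)\<^esub> p) = j \<odot>\<^bsub>P n\<^esub> d (Suc n) p" using j that(2) by (simp add: res.d_in)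
    then show ?thesis
      using ideal_span_gen[OF that(1) res.d_in(1)[OF that(2)]] res.P.smult_closed[OF j res.d_in(1)[OF that(2)]]
      by (simp add: unit_tensor_eq_one_iff)
  qed
  have \<beta>: "tensor_elt R Mr (P n) a (d (Suc n) p) = ?\<psi> (a \<odot>\<^bsub>P (Suc n)\<^esub> p)"
    if "a \<in> cc_funs (unit_top G)" "p \<in> carrier (P (Suc n))" for a p
    using gm.tensor_elt_unit_tensor[OF that(1) res.d_in(1)[OF that(2)]] unit_R[OF that(1)] that(2) by (simp add: res.d_in)
  note lift = gm.tensor_lift_unit_tensor[OF TC_comm_group \<psi> ideal \<beta>]
  have TB: "TB (Suc n) = tensor_lift (TC n) (\<lambda>a p. tensor_elt R Mr (P n) a (d (Suc n) p))"
    by (simp add: tensor_boundary_def tensor_map_def tensor_complex_def)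
  show "TB (Suc n) \<in> hom (TC (Suc n)) (TC n)"
    unfolding TB using lift(1) by (simp add: tensor_complex_def)
  show "TB (Suc n) (gm.unit_tensor (Suc n) p) = ?\<psi> p" if "p \<in> carrier (P (Suc n))"
    unfolding TB using lift(2) that by simp
qed

text \<open>Multiplying a bar chain by \<open>a\<close> at its anchor is the ring action of
  \<open>a\<close>, so \<open>bar_coinvariants\<close> has the form to which
  \<open>tensor_lift_unit_tensor\<close> applies. Under \<open>unit_tensor\<close>, the map to the
  nerve is then \<open>\<tau>\<close> followed by \<open>coinv\<close>.\<close>

lemma tensor_to_nerve_unit_tensor:
  assumes \<tau>: "\<tau> n \<in> lmod_hom R (P n) (bar_module G n)"
  shows "tensor_to_nerve G \<tau> n \<in> hom (TC n) (nerve_chains G n)"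
    and "p \<in> carrier (P n) \<Longrightarrow> tensor_to_nerve G \<tau> n (gm.unit_tensor n p) = coinv n (\<tau> n p)"
proof -
  note \<tau>_in = lmod_homD[OF \<tau>]
  have A: "comm_group (nerve_chains G n)" unfolding nerve_chains_def by (rule comm_group_cc)
  have \<tau>cc: "\<tau> n p \<in> cc_funs (nerve G (Suc n))" if "p \<in> carrier (P n)" for p
    using \<tau>_in(1)[OF that] by (simp add: bar_module_simps)
  have \<psi>: "(\<lambda>p. coinv n (\<tau> n p)) \<in> hom (add_monoid (P n)) (nerve_chains G n)"
    using \<tau>cc by (intro homI) (simp_all add: nerve_chains_def cc_group_def coinv_closed \<tau>_in bar_module_simps coinv_add)
  have ideal: "coinv n (\<tau> n (j \<odot>\<^bsub>P n\<^esub> p)) = \<one>\<^bsub>nerve_chains G n\<^esub>" if "j \<in> aug_ideal" "p \<in> carrier (P n)" for j p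
  proof -
    have j: "j \<in> carrier R" using that(1) aug_ideal_subset by blast
    have "\<tau> n (j \<odot>\<^bsub>P n\<^esub> p) = j \<odot>\<^bsub>bar_module G n\<^esub> \<tau> n p" using j that(2) by (simp add: \<tau>_in)
    moreover have "j \<odot>\<^bsub>bar_module G n\<^esub> \<tau> n p \<in> ideal_span aug_ideal (bar_module G n)"
      by (rule ideal_span_gen[OF that(1) \<tau>_in(1)[OF that(2)]])
    moreover have "j \<odot>\<^bsub>bar_module G n\<^esub> \<tau> n p \<in> cc_funs (nerve G (Suc n))"
      using bar.smult_closed[OF j \<tau>_in(1)[OF that(2)]] by (simp add: bar_module_simps)
    ultimately show ?thesis using coinv_eq_zero_iff by (simp add: nerve_chains_def cc_group_def)
  qed
  have \<beta>: "bar_coinvariants G n a (\<tau> n p) = coinv n (\<tau> n (a \<odot>\<^bsub>P n\<^esub> p))"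
    if a: "a \<in> cc_funs (unit_top G)" and p: "p \<in> carrier (P n)" for a p
  proof -
    have "(\<lambda>y. a (grng G (y 0)) * \<tau> n p y) = nerve.conv n a (\<tau> n p)"
    proof
      fix y
      show "a (grng G (y 0)) * \<tau> n p y = nerve.conv n a (\<tau> n p) y"
      proof (cases "y \<in> topspace (nerve G (Suc n))")
        case True
        show ?thesis by (rule nerve.conv_units[OF cc_unit_zero[OF a] True, symmetric])
      next
        case False
        then show ?thesis using cc_funsD(2)[OF \<tau>cc[OF p]] by (simp add: nerve.conv_def)
      qed
    qed
    then show ?thesis using unit_R[OF a] p
      by (simp add: bar_coinvariants_def coinv_def \<tau>_in bar_module_smult[OF cc_units_subset[OF a]])
  qed
  note lift = gm.tensor_lift_unit_tensor[OF A \<psi> ideal \<beta>]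
  show "tensor_to_nerve G \<tau> n \<in> hom (TC n) (nerve_chains G n)"
    unfolding tensor_to_nerve_def tensor_complex_def by (rule lift(1))
  show "tensor_to_nerve G \<tau> n (gm.unit_tensor n p) = coinv n (\<tau> n p)" if "p \<in> carrier (P n)"
    unfolding tensor_to_nerve_def by (rule lift(2)) (use that in simp_all)
qed

section \<open>Cycles and boundaries of the two complexes\<close>

abbreviation "NC \<equiv> nerve_chains G"
abbreviation "NB \<equiv> nerve_boundary G"

lemma NC_simps: "carrier (NC n) = cc_funs (nerve G n)" "a \<otimes>\<^bsub>NC n\<^esub> a' = (\<lambda>y. a y + a' y)" "\<one>\<^bsub>NC n\<^esub> = (\<lambda>y. 0)"
  by (simp_all add: nerve_chains_def cc_group_def)

lemma NC_comm_group: "comm_group (NC n)"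
  unfolding nerve_chains_def by (rule comm_group_cc)

text \<open>Chains are lifted along the surjection \<open>coinv\<close>, and additivity is inherited
  from the bar boundary.\<close>

lemma NB_hom: "NB (Suc n) \<in> hom (NC (Suc n)) (NC n)"
proof (rule homI)
  fix a assume "a \<in> carrier (NC (Suc n))"
  then obtain b where b: "b \<in> cc_funs (nerve G (Suc (Suc n)))" "a = coinv (Suc n) b"
    using coinv_surjective unfolding NC_simps by metis
  then show "NB (Suc n) a \<in> carrier (NC n)"
    by (simp add: nerve_boundary_coinv NC_simps coinv_closed boundary_cc)
  fix a' assume "a' \<in> carrier (NC (Suc n))"
  then obtain b' where b': "b' \<in> cc_funs (nerve G (Suc (Suc n)))" "a' = coinv (Suc n) b'"
    using coinv_surjective unfolding NC_simps by metis
  have "(\<lambda>y. a y + a' y) = coinv (Suc n) (\<lambda>y. b y + b' y)" using b b' by (simp add: coinv_add)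
  moreover have "bar_boundary G (Suc n) (\<lambda>y. b y + b' y) = (\<lambda>y. bar_boundary G (Suc n) b y + bar_boundary G (Suc n) b' y)"
    using lmod_homD(2)[OF bar_boundary_hom, of b n b'] b b' by (simp add: bar_module_simps)
  ultimately have "NB (Suc n) (\<lambda>y. a y + a' y) = coinv n (\<lambda>y. bar_boundary G (Suc n) b y + bar_boundary G (Suc n) b' y)"
    using b(1) b'(1) by (simp only: nerve_boundary_coinv cc_add)
  then show "NB (Suc n) (a \<otimes>\<^bsub>NC (Suc n)\<^esub> a') = NB (Suc n) a \<otimes>\<^bsub>NC n\<^esub> NB (Suc n) a'"
    using b b' by (simp add: nerve_boundary_coinv NC_simps coinv_add boundary_cc)
qed

lemma cycles_subgroup:
  assumes "\<And>n. comm_group (C n)" "\<And>n. D (Suc n) \<in> hom (C (Suc n)) (C n)"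
  shows "subgroup (cycles C D n) (C n)"
proof (cases n)
  case 0
  then show ?thesis using group.subgroup_self[OF comm_group.axioms(2)[OF assms(1)]] by (simp add: cycles_def)
next
  case (Suc m)
  interpret h: group_hom "C (Suc m)" "C m" "D (Suc m)"
    by (intro group_hom.intro group_hom_axioms.intro comm_group.axioms(2) assms)
  show ?thesis using h.subgroup_kernel Suc by (simp add: cycles_def)
qed

lemma boundaries_subgroup:
  assumes "\<And>n. comm_group (C n)" "\<And>n. D (Suc n) \<in> hom (C (Suc n)) (C n)"
  shows "subgroup (boundaries C D n) (C n)"
proof -
  interpret h: group_hom "C (Suc n)" "C n" "D (Suc n)"
    by (intro group_hom.intro group_hom_axioms.intro comm_group.axioms(2) assms)
  show ?thesis using h.img_is_subgroup by (simp add: boundaries_def)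
qed

text \<open>Cycles of the tensor complex are represented by elements whose boundary lies in
  \<open>J P\<close>. The quantifier over \<open>m\<close> makes the condition empty in degree
  0.\<close>

lemma unit_tensor_cycle_iff:
  assumes p: "p \<in> carrier (P n)"
  shows "gm.unit_tensor n p \<in> cycles TC TB n \<longleftrightarrow> (\<forall>m. n = Suc m \<longrightarrow> d n p \<in> ideal_span aug_ideal (P m))"
proof (cases n)
  case 0
  then show ?thesis using p by (simp add: cycles_def TC_carrier)
next
  case (Suc m)
  then have "gm.unit_tensor n p \<in> carrier (TC (Suc m))" using p TC_carrier by blast
  then show ?thesis
    using p Suc TB_Suc(2)[of p m] unit_tensor_eq_one_iff[OF res.d_in(1), of p m]
    by (simp add: cycles_def kernel_def)
qed

lemma TC_boundaries: "boundaries TC TB n = gm.unit_tensor n ` d (Suc n) ` carrier (P (Suc n))"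
  unfolding boundaries_def TC_carrier image_image by (rule image_cong) (simp_all add: TB_Suc)

lemma coinv_cycle_iff:
  assumes b: "b \<in> cc_funs (nerve G (Suc n))"
  shows "coinv n b \<in> cycles NC NB n \<longleftrightarrow> (\<forall>m. n = Suc m \<longrightarrow> bar_boundary G n b \<in> ideal_span aug_ideal (bar_module G m))"
proof (cases n)
  case 0
  then show ?thesis using coinv_closed[OF b] by (simp add: cycles_def NC_simps)
next
  case (Suc m)
  then show ?thesis
    using b coinv_closed[OF b] coinv_eq_zero_iff[OF boundary_cc, of b m]
    by (simp add: cycles_def kernel_def NC_simps nerve_boundary_coinv)
qed

lemma NC_boundaries: "boundaries NC NB n = coinv n ` bar_boundary G (Suc n) ` cc_funs (nerve G (Suc (Suc n)))"
proof -
  have "cc_funs (nerve G (Suc n)) = coinv (Suc n) ` cc_funs (nerve G (Suc (Suc n)))"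
    using coinv_surjective coinv_closed by blast
  then show ?thesis
    unfolding boundaries_def NC_simps image_image by (simp add: image_image nerve_boundary_coinv)
qed

lemma coinv_eq_iff:
  assumes "b \<in> cc_funs (nerve G (Suc n))" "c \<in> cc_funs (nerve G (Suc n))" "coinv n b = coinv n c"
  shows "\<exists>w\<in>ideal_span aug_ideal (bar_module G n). b = (\<lambda>y. c y + w y)"
proof (intro bexI)
  have "(\<lambda>y. b y - c y) = (\<lambda>y. b y + - c y)" by simp
  then have "coinv n (\<lambda>y. b y - c y) = (\<lambda>w. 0)"
    using coinv_add[OF assms(1) cc_uminus[OF assms(2)]] assms(3) by (simp add: coinv_uminus)
  then show "(\<lambda>y. b y - c y) \<in> ideal_span aug_ideal (bar_module G n)"
    using coinv_eq_zero_iff[OF cc_diff[OF assms(1,2)]] by simp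
qed simp

lemma ideal_span_coinv:
  assumes "w \<in> ideal_span aug_ideal (bar_module G n)"
  shows "w \<in> cc_funs (nerve G (Suc n))" "coinv n w = (\<lambda>y. 0)"
proof -
  show w: "w \<in> cc_funs (nerve G (Suc n))"
    using bar.ideal_spanD(1)[OF aug_ideal_subset assms] by (simp add: bar_module_simps)
  show "coinv n w = (\<lambda>y. 0)" using coinv_eq_zero_iff[OF w] assms by simp
qed

lemma cycle_to_cycle:
  assumes \<tau>: "res.comparison \<tau>" and X: "X \<in> cycles TC TB n"
  obtains p where "p \<in> carrier (P n)" "X = gm.unit_tensor n p"
    "\<And>m. n = Suc m \<Longrightarrow> d n p \<in> ideal_span aug_ideal (P m)" "tensor_to_nerve G \<tau> n X = coinv n (\<tau> n p)"
    "tensor_to_nerve G \<tau> n X \<in> cycles NC NB n" "\<tau> n p \<in> cc_funs (nerve G (Suc n))"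
proof -
  have \<tau>h: "\<tau> n \<in> lmod_hom R (P n) (bar_module G n)" for n using \<tau> by (simp add: res.comparison_def)
  have "X \<in> carrier (TC n)" using X by (auto simp: cycles_def kernel_def split: if_splits)
  then obtain p where p: "p \<in> carrier (P n)" "X = gm.unit_tensor n p" unfolding TC_carrier by blast
  have dp: "d n p \<in> ideal_span aug_ideal (P m)" if "n = Suc m" for m
    using X p that unit_tensor_cycle_iff[OF p(1)] by blast
  have \<tau>p: "\<tau> n p \<in> cc_funs (nerve G (Suc n))" using lmod_homD(1)[OF \<tau>h p(1)] by (simp add: bar_module_simps)
  have t: "tensor_to_nerve G \<tau> n X = coinv n (\<tau> n p)" using tensor_to_nerve_unit_tensor(2)[of \<tau> n, OF \<tau>h p(1)] p(2) by simp
  have "bar_boundary G n (\<tau> n p) \<in> ideal_span aug_ideal (bar_module G m)" if "n = Suc m" for m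
  proof -
    have "bar_boundary G n (\<tau> n p) = \<tau> m (d n p)" using \<tau> p(1) that by (simp add: res.comparison_def)
    then show ?thesis using res.P.ideal_span_hom[OF \<tau>h bar_lmod aug_ideal_subset dp[OF that]] by simp
  qed
  then have "tensor_to_nerve G \<tau> n X \<in> cycles NC NB n" using t coinv_cycle_iff[OF \<tau>p] by simp
  then show thesis using that[OF p dp t _ \<tau>p] by blast
qed

text \<open>\<open>quotient_iso\<close> for the map from the tensor complex to the nerve. Its kernel
  and surjectivity conditions are \<open>res.comparison_injective\<close> and
  \<open>res.comparison_surjective\<close>, which speak of bar chains modulo the ideal, translated
  by \<open>coinv\<close> and \<open>unit_tensor\<close>.\<close>

lemma comparison_iso:
  assumes \<tau>: "res.comparison \<tau>"
  shows "\<exists>\<Phi>\<in>iso (groupoid_homology G n) (Tor R Mr P d n). \<forall>X\<in>cycles TC TB n.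
    \<Phi> (homology_class NC NB n (tensor_to_nerve G \<tau> n X)) = homology_class TC TB n X"
  unfolding groupoid_homology_def Tor_def chain_homology_def homology_class_def
proof (rule quotient_iso)
  have \<tau>h: "\<tau> n \<in> lmod_hom R (P n) (bar_module G n)" for n using \<tau> by (simp add: res.comparison_def)
  note \<tau>_in = lmod_homD[OF \<tau>h]
  have \<tau>cc: "\<tau> n p \<in> cc_funs (nerve G (Suc n))" if "p \<in> carrier (P n)" for p n
    using \<tau>_in(1)[OF that] by (simp add: bar_module_simps)
  have \<delta>\<tau>: "bar_boundary G (Suc n) (\<tau> (Suc n) p) = \<tau> n (d (Suc n) p)" if "p \<in> carrier (P (Suc n))" for n p
    using \<tau> that by (simp add: res.comparison_def)
  have cc_bar: "b \<in> carrier (bar_module G n)" if "b \<in> cc_funs (nerve G (Suc n))" for b n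
    using that by (simp add: bar_module_simps)
  show "comm_group (TC n)" by (rule TC_comm_group)
  show "comm_group (NC n)" by (rule NC_comm_group)
  show "subgroup (cycles TC TB n) (TC n)" by (rule cycles_subgroup[of TC TB, OF TC_comm_group TB_Suc(1)])
  show "subgroup (boundaries TC TB n) (TC n)" by (rule boundaries_subgroup[of TC TB, OF TC_comm_group TB_Suc(1)])
  show "subgroup (cycles NC NB n) (NC n)" by (rule cycles_subgroup[of NC NB, OF NC_comm_group NB_hom])
  show "subgroup (boundaries NC NB n) (NC n)" by (rule boundaries_subgroup[of NC NB, OF NC_comm_group NB_hom])
  show "boundaries TC TB n \<subseteq> cycles TC TB n"
  proof
    fix X assume "X \<in> boundaries TC TB n"
    then obtain q where q: "q \<in> carrier (P (Suc n))" "X = gm.unit_tensor n (d (Suc n) q)" unfolding TC_boundaries by blast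
    have "d n (d (Suc n) q) \<in> ideal_span aug_ideal (P m)" if "n = Suc m" for m
      using res.dd[of q m] q(1) that res.P.ideal_spanD(2)[OF aug_ideal_subset] by simp
    then show "X \<in> cycles TC TB n" using unit_tensor_cycle_iff[OF res.d_in(1)[OF q(1)]] q(2) by simp
  qed
  show "boundaries NC NB n \<subseteq> cycles NC NB n"
  proof
    fix a assume "a \<in> boundaries NC NB n"
    then obtain c where c: "c \<in> cc_funs (nerve G (Suc (Suc n)))" "a = coinv n (bar_boundary G (Suc n) c)" unfolding NC_boundaries by blast
    have "bar_boundary G n (bar_boundary G (Suc n) c) \<in> ideal_span aug_ideal (bar_module G m)" if "n = Suc m" for m
      using boundary_boundary[of c m] c(1) that bar.ideal_spanD(2)[OF aug_ideal_subset, of m] by (simp add: bar_module_simps)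
    then show "a \<in> cycles NC NB n" using coinv_cycle_iff[OF boundary_cc[OF c(1)]] c(2) by simp
  qed
  show "tensor_to_nerve G \<tau> n \<in> hom (TC n) (NC n)" by (rule tensor_to_nerve_unit_tensor(1)[of \<tau> n, OF \<tau>h])
  show "tensor_to_nerve G \<tau> n X \<in> cycles NC NB n" if "X \<in> cycles TC TB n" for X
    by (rule cycle_to_cycle[OF \<tau> that])
  show "tensor_to_nerve G \<tau> n X \<in> boundaries NC NB n \<longleftrightarrow> X \<in> boundaries TC TB n" if X: "X \<in> cycles TC TB n" for X
  proof
    assume "X \<in> boundaries TC TB n"
    then obtain q where q: "q \<in> carrier (P (Suc n))" "X = gm.unit_tensor n (d (Suc n) q)" unfolding TC_boundaries by blast
    have "tensor_to_nerve G \<tau> n X = coinv n (bar_boundary G (Suc n) (\<tau> (Suc n) q))"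
      using tensor_to_nerve_unit_tensor(2)[of \<tau> n, OF \<tau>h res.d_in(1)[OF q(1)]] q \<delta>\<tau> by simp
    then show "tensor_to_nerve G \<tau> n X \<in> boundaries NC NB n" unfolding NC_boundaries using \<tau>cc[OF q(1)] by blast
  next
    assume "tensor_to_nerve G \<tau> n X \<in> boundaries NC NB n"
    then obtain c where c: "c \<in> cc_funs (nerve G (Suc (Suc n)))"
      "tensor_to_nerve G \<tau> n X = coinv n (bar_boundary G (Suc n) c)" unfolding NC_boundaries by blast
    obtain p where p: "p \<in> carrier (P n)" "X = gm.unit_tensor n p"
      and dp: "\<And>m. n = Suc m \<Longrightarrow> d n p \<in> ideal_span aug_ideal (P m)"
      and t: "tensor_to_nerve G \<tau> n X = coinv n (\<tau> n p)"
      by (rule cycle_to_cycle[OF \<tau> X]) (rule that, assumption+)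
    \<comment> \<open>Equal coinvariants mean equality up to an element \<open>w\<close> of
      \<open>J B\<close>, which is the error term that \<open>res.comparison_injective\<close>
      admits.\<close>
    have "coinv n (\<tau> n p) = coinv n (bar_boundary G (Suc n) c)" using c(2) t by simp
    from coinv_eq_iff[OF \<tau>cc[OF p(1)] boundary_cc[OF c(1)] this]
    obtain w where w: "w \<in> ideal_span aug_ideal (bar_module G n)" "\<tau> n p = (\<lambda>y. bar_boundary G (Suc n) c y + w y)" ..
    have "\<exists>q\<in>carrier (P (Suc n)). \<exists>v\<in>ideal_span aug_ideal (P n). p = d (Suc n) q \<oplus>\<^bsub>P n\<^esub> v"
      by (rule res.comparison_injective[OF \<tau> p(1) dp cc_bar[OF c(1)] w(1)]) (simp_all add: w(2) bar_module_simps)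
    then obtain q v where q: "q \<in> carrier (P (Suc n))" and v: "v \<in> ideal_span aug_ideal (P n)"
      and eq: "p = d (Suc n) q \<oplus>\<^bsub>P n\<^esub> v" by blast
    have vP: "v \<in> carrier (P n)" by (rule res.P.ideal_spanD(1)[OF aug_ideal_subset v])
    have "gm.unit_tensor n p = gm.unit_tensor n (d (Suc n) q) \<otimes>\<^bsub>TC n\<^esub> gm.unit_tensor n v"
      unfolding eq using hom_mult[OF unit_tensor_hom, of "d (Suc n) q" n v] vP res.d_in(1)[OF q] by simp
    also have "\<dots> = gm.unit_tensor n (d (Suc n) q)"
    proof -
      interpret T: comm_group "TC n" by (rule TC_comm_group)
      have "gm.unit_tensor n (d (Suc n) q) \<in> carrier (TC n)" unfolding TC_carrier using res.d_in(1)[OF q] by blast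
      then show ?thesis using unit_tensor_eq_one_iff[OF vP] v by simp
    qed
    finally show "X \<in> boundaries TC TB n" unfolding TC_boundaries p(2) using q by blast
  qed
  show "\<exists>X\<in>cycles TC TB n. \<exists>b\<in>boundaries NC NB n. a = b \<otimes>\<^bsub>NC n\<^esub> tensor_to_nerve G \<tau> n X"
    if a: "a \<in> cycles NC NB n" for a
  proof -
    have "a \<in> cc_funs (nerve G n)" using a by (auto simp: cycles_def kernel_def NC_simps split: if_splits)
    \<comment> \<open>The chain \<open>a\<close> is lifted to a bar chain; in positive degrees the
      boundary of the lift lies in \<open>J B\<close> because \<open>a\<close> is a cycle.\<close>
    then obtain b where b: "b \<in> cc_funs (nerve G (Suc n))" "coinv n b = a" using coinv_surjective by blast
    have "\<exists>p\<in>carrier (P n). (\<forall>m. n = Suc m \<longrightarrow> d n p \<in> ideal_span aug_ideal (P m)) \<and>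
      (\<exists>c\<in>cc_funs (nerve G (Suc (Suc n))). \<exists>w\<in>ideal_span aug_ideal (bar_module G n).
         b = (\<lambda>y. \<tau> n p y + bar_boundary G (Suc n) c y + w y))"
    proof (cases n)
      case 0
      have b0: "b \<in> carrier (bar_module G 0)" using b(1) 0 by (simp add: bar_module_simps)
      obtain p c where p: "p \<in> carrier (P 0)" and c: "c \<in> carrier (bar_module G (Suc 0))"
        and eq: "b = \<tau> 0 p \<oplus>\<^bsub>bar_module G 0\<^esub> bar_boundary G (Suc 0) c"
        using res.comparison_surjective_0[OF \<tau> b0] by blast
      have c': "c \<in> cc_funs (nerve G (Suc (Suc 0)))" using c by (simp add: bar_module_simps)
      have z: "(\<lambda>y. 0) \<in> ideal_span aug_ideal (bar_module G 0)"
        using bar.ideal_spanD(2)[OF aug_ideal_subset, of 0] by (simp only: bar_module_simps)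
      have "b = (\<lambda>y. \<tau> 0 p y + bar_boundary G (Suc 0) c y + 0)" using eq by (simp add: bar_module_simps)
      then have "\<exists>w\<in>ideal_span aug_ideal (bar_module G 0). b = (\<lambda>y. \<tau> 0 p y + bar_boundary G (Suc 0) c y + w y)"
        by (rule bexI[OF _ z])
      then show ?thesis unfolding 0 using p c' by blast
    next
      case (Suc m)
      have b': "b \<in> carrier (bar_module G (Suc m))" using b(1) Suc by (simp add: bar_module_simps)
      have "bar_boundary G (Suc m) b \<in> ideal_span aug_ideal (bar_module G m)"
        using coinv_cycle_iff[OF b(1)] a b(2) Suc by blast
      from res.comparison_surjective[OF \<tau> b' this]
      show ?thesis unfolding Suc bar_module_simps by blast
    qed
    then obtain p c w where p: "p \<in> carrier (P n)" "\<forall>m. n = Suc m \<longrightarrow> d n p \<in> ideal_span aug_ideal (P m)"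
      and c: "c \<in> cc_funs (nerve G (Suc (Suc n)))" and w: "w \<in> ideal_span aug_ideal (bar_module G n)"
      and eq: "b = (\<lambda>y. \<tau> n p y + bar_boundary G (Suc n) c y + w y)" by blast
    let ?X = "gm.unit_tensor n p" and ?b = "coinv n (bar_boundary G (Suc n) c)"
    have "?X \<in> cycles TC TB n" using unit_tensor_cycle_iff[OF p(1)] p(2) by simp
    moreover have "?b \<in> boundaries NC NB n" unfolding NC_boundaries using c by blast
    moreover have "a = ?b \<otimes>\<^bsub>NC n\<^esub> tensor_to_nerve G \<tau> n ?X"
    proof -
      have "a = coinv n (\<lambda>y. \<tau> n p y + bar_boundary G (Suc n) c y + w y)" using b(2) eq by simp
      also have "\<dots> = (\<lambda>y. coinv n (\<tau> n p) y + ?b y)"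
        using ideal_span_coinv[OF w] \<tau>cc[OF p(1)] boundary_cc[OF c] by (simp add: coinv_add cc_add)
      finally show ?thesis
        by (simp add: NC_simps tensor_to_nerve_unit_tensor(2)[of \<tau> n, OF \<tau>h p(1)] add.commute)
    qed
    ultimately show ?thesis by blast
  qed
qed

text \<open>The homotopy between two comparisons changes the image of a cycle by a boundary and an
  element of \<open>J B\<close>; the coinvariants of the latter vanish.\<close>

lemma comparison_independent:
  assumes \<tau>: "res.comparison \<tau>" and \<tau>': "res.comparison \<tau>'" and X: "X \<in> cycles TC TB n"
  shows "homology_class NC NB n (tensor_to_nerve G \<tau> n X) = homology_class NC NB n (tensor_to_nerve G \<tau>' n X)"
proof -
  have h: "\<tau> n \<in> lmod_hom R (P n) (bar_module G n)" "\<tau>' n \<in> lmod_hom R (P n) (bar_module G n)"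
    using \<tau> \<tau>' by (auto simp: res.comparison_def)
  obtain p where p: "p \<in> carrier (P n)" "X = gm.unit_tensor n p"
    and dp: "\<And>m. n = Suc m \<Longrightarrow> d n p \<in> ideal_span aug_ideal (P m)"
    by (rule cycle_to_cycle[OF \<tau> X]) (rule that, assumption+)
  have cc: "\<tau> n p \<in> cc_funs (nerve G (Suc n))" "\<tau>' n p \<in> cc_funs (nerve G (Suc n))"
    using lmod_homD(1)[OF h(1) p(1)] lmod_homD(1)[OF h(2) p(1)] by (simp_all add: bar_module_simps)
  obtain b w where b: "b \<in> carrier (bar_module G (Suc n))" and w: "w \<in> ideal_span aug_ideal (bar_module G n)"
    and eq: "\<tau> n p = bar_boundary G (Suc n) b \<oplus>\<^bsub>bar_module G n\<^esub> w \<oplus>\<^bsub>bar_module G n\<^esub> \<tau>' n p"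
    using res.comparison_unique[OF \<tau> \<tau>' p(1) dp] by blast
  have bc: "b \<in> cc_funs (nerve G (Suc (Suc n)))" using b by (simp add: bar_module_simps)
  let ?b = "coinv n (bar_boundary G (Suc n) b)"
  have "coinv n (\<tau> n p) = coinv n (\<lambda>y. bar_boundary G (Suc n) b y + w y + \<tau>' n p y)"
    using eq by (simp add: bar_module_simps)
  also have "\<dots> = (\<lambda>y. ?b y + coinv n (\<tau>' n p) y)"
    using ideal_span_coinv[OF w] cc boundary_cc[OF bc] by (simp add: coinv_add cc_add)
  finally have "tensor_to_nerve G \<tau> n X = ?b \<otimes>\<^bsub>NC n\<^esub> tensor_to_nerve G \<tau>' n X"
    using tensor_to_nerve_unit_tensor(2)[of \<tau> n, OF h(1) p(1)] tensor_to_nerve_unit_tensor(2)[of \<tau>' n, OF h(2) p(1)]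
    by (simp add: NC_simps p(2))
  moreover have "?b \<in> boundaries NC NB n" unfolding NC_boundaries using bc by blast
  moreover have "tensor_to_nerve G \<tau>' n X \<in> carrier (NC n)"
    using tensor_to_nerve_unit_tensor(2)[of \<tau>' n, OF h(2) p(1)] coinv_closed[OF cc(2)] by (simp add: NC_simps p(2))
  ultimately show ?thesis
    unfolding homology_class_def
    using group.coset_absorb[OF comm_group.axioms(2)[OF NC_comm_group] boundaries_subgroup[of NC NB, OF NC_comm_group NB_hom]] by simp
qed

end

theorem theoremB:
  fixes G :: "'a tgroupoid"
    and P :: "nat \<Rightarrow> ('a \<Rightarrow> int, 'p) module"
    and d :: "nat \<Rightarrow> 'p \<Rightarrow> 'p"
    and \<epsilon> :: "'p \<Rightarrow> 'a \<Rightarrow> int"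
  assumes "ample_groupoid G"
    and "sigma_compact_space (unit_top G)"
    and "projective_resolution (conv_ring G) (unit_left_module G) P d \<epsilon>"
  shows "\<exists>\<Phi>. (\<forall>n. \<Phi> n \<in> iso (groupoid_homology G n)
                           (Tor (conv_ring G) (unit_right_module G) P d n)) \<and>
              canonical_to_Tor G P d \<epsilon> \<Phi>"
proof -
  interpret resolved_groupoid G P d \<epsilon>
    using assms(1,3) by (intro resolved_groupoid.intro resolved_groupoid_axioms.intro)
  obtain \<tau> where \<tau>: "res.comparison \<tau>" using res.comparison_exists ..
  have "\<forall>n. \<exists>\<Phi>. \<Phi> \<in> iso (groupoid_homology G n) (Tor (conv_ring G) (unit_right_module G) P d n) \<and>
    (\<forall>X\<in>cycles TC TB n. \<Phi> (homology_class NC NB n (tensor_to_nerve G \<tau> n X)) = homology_class TC TB n X)"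
    using comparison_iso[OF \<tau>] by blast
  then obtain \<Phi> where \<Phi>: "\<forall>n. \<Phi> n \<in> iso (groupoid_homology G n) (Tor (conv_ring G) (unit_right_module G) P d n) \<and>
    (\<forall>X\<in>cycles TC TB n. \<Phi> n (homology_class NC NB n (tensor_to_nerve G \<tau> n X)) = homology_class TC TB n X)"
    by (rule choice[THEN exE])
  \<comment> \<open>\<open>\<Phi>\<close> was built from one comparison; the formula for any other
    comparison follows from \<open>comparison_independent\<close>.\<close>
  have "canonical_to_Tor G P d \<epsilon> \<Phi>"
    unfolding canonical_to_Tor_def comparison_iff
  proof (intro conjI allI impI ballI)
    show "\<exists>\<tau>. res.comparison \<tau>" by (rule exI[of _ \<tau>]) (rule \<tau>)
    fix \<tau>' n X assume "res.comparison \<tau>'" and X: "X \<in> cycles TC TB n"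
    then show "\<Phi> n (homology_class NC NB n (tensor_to_nerve G \<tau>' n X)) = homology_class TC TB n X"
      using \<Phi> comparison_independent[OF \<tau> _ X] by metis
  qed
  then show ?thesis using \<Phi> by blast
qed

end
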